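(* Let $(\mathfrak A,\alpha,\omega)$ be a $C^*$-dynamical system with $\mathfrak A$ separable and $s(\omega)\in Z(\mathfrak A^{**})$. Fix $k\in\mathbb Z\setminus\{-1,0\}$ and $l\in\mathbb Z\setminus\{0\}$. Suppose that $\pi_\omega(\mathfrak A)'\cap\{U_\omega^l\}'\subset\mathfrak Z_\omega$, where $\mathfrak Z_\omega=\pi_\omega(\mathfrak A)''\cap\pi_\omega(\mathfrak A)'$. Then for all $A_0,A_1,A_2\in\mathfrak A$, $$\lim_{N\to+\infty}\frac1N\sum_{n=0}^{N-1}\omega\left(A_0\alpha^{nkl}(A_1)\alpha^{n(k+1)l}(A_2)\right)=\left\langle V_{\pi_\omega(A_1)}\pi_\omega(A_2)\Omega,\pi_\omega(A_0^* )\Omega\right\rangle,$$ where $V_{\pi_\omega(A_1)}$ is the bounded linear operator $V_X$ with $X=\pi_\omega(A_1)$, corresponding to the unitary $U_\omega^l$ and the pair $(k,k+1)$, defined in the context.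
   Context: A (discrete) $C^*$-dynamical system $(\mathfrak A,\alpha,\omega)$ consists of a unital $C^*$-algebra $\mathfrak A$, a $*$-automorphism $\alpha$, and a state $\omega$ with $\omega\circ\alpha=\omega$. $s(\omega)$ is the support of $\omega$ in the bidual $\mathfrak A^{**}$ and $Z(\cdot)$ denotes the centre; $s(\omega)\in Z(\mathfrak A^{**})$ is equivalent to the GNS vector being separating for $\pi_\omega(\mathfrak A)''$. Inner products are linear in the first variable. $(\mathcal H_\omega,\pi_\omega,U_\omega,\Omega)$ is the covariant GNS representation: $\omega(A)=\langle\pi_\omega(A)\Omega,\Omega\rangle$, $U_\omega\Omega=\Omega$, $U_\omega\pi_\omega(A)U_\omega^*=\pi_\omega(\alpha(A))$. Decomposition. Put $\beta=\alpha^l$ and let $\partial\mathcal E$ be the set of extreme points of the set of $\beta$-invariant states of $\mathfrak A$. Let $\mathfrak Z=\pi_\omega(\mathfrak A)'\cap\{U_\omega^l\}'$ (Abelian by hypothesis), and let $\nu$ be the orthogonal measure on the state space $\mathcal S(\mathfrak A)$ associated to $\mathfrak Z$, i.e. the probability measure with barycentre $\omega$ determined by $$\int \psi(A_1)\cdots\psi(A_m)\,d\nu(\psi)=\langle\pi_\omega(A_1)P\pi_\omega(A_2)P\cdots P\pi_\omega(A_m)\Omega,\Omega\rangle,$$ $P$ being the projection onto $\overline{\mathfrak Z\Omega}$. It is supported on $\partial\mathcal E$. For $\psi\in\partial\mathcal E$ let $(\mathcal H_\psi,\pi_\psi,U_\psi,\Psi)$ be the covariant GNS representation of $(\mathfrak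 A,\beta,\psi)$. Then $\mathcal H_\omega$ is identified with $\int^\oplus_{\partial\mathcal E}\mathcal H_\psi\,d\nu(\psi)$ (measurable structure generated by the fields $\psi\mapsto\pi_\psi(A)\Psi$, $A\in\mathfrak A$), with $\pi_\omega=\int^\oplus\pi_\psi\,d\nu(\psi)$, $U_\omega^l=\int^\oplus U_\psi\,d\nu(\psi)$, $\Omega=\int^\oplus\Psi\,d\nu(\psi)$, and $\mathfrak Z$ identified with the diagonalisable operators. For $\psi$ in a measurable set $F\subset\partial\mathcal E$ of full measure, $s(\psi)\in Z(\mathfrak A^{**})$. Operators $V(\psi)$. Write $\sigma_{\rm pp}(U_\psi)$ for the set of eigenvalues of $U_\psi$. For $\psi\in F$ and $v\in\sigma_{\rm pp}(U_\psi)$ the eigenspace is one-dimensional, equal to $\mathbb CV_v\Psi=\mathbb CW_v\Psi$ with unitaries $V_v\in\pi_\psi(\mathfrak A)''$, $W_v\in\pi_\psi(\mathfrak A)'$, unique up to a phase, such that $U_\psi V_vU_\psi^*=vV_v$, $U_\psi W_vU_\psi^*=vW_v$. Define the partial isometry $V(\psi):\mathcal H_\psi\otimes\mathcal H_\psi\to\mathcal H_\psi$ by $$V(\psi)(\eta\otimes\xi)=\sum_{(v,w)\in\sigma_{\rm pp}(U_\psi)^2,\;v^{k}w^{k+1}=1}\langle\eta\otimes\xi,V_v\Psi\otimes W_w\Psi\rangle\,V_vW_w\Psi,$$ and $V(\psi)=0$ for $\psi\notin F$. The field $V(\psi)$ is measurable; put $V=\int^\oplus_{\partial\mathcal E}V(\psi)\,d\nu(\psi):\int^\oplus\mathcal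 H_\psi\otimes\mathcal H_\psi\,d\nu(\psi)\to\mathcal H_\omega$. Operator $V_X$. For $X$ in the norm closure of $\pi_\omega(\mathfrak A)''+\pi_\omega(\mathfrak A)'$ (so that $X$ is decomposable and the field $\psi\mapsto(X\Omega)(\psi)$ is essentially bounded), $$V_X\xi=V\int^\oplus_{\partial\mathcal E}(X\Omega)(\psi)\otimes\xi(\psi)\,d\nu(\psi),\qquad\xi\in\mathcal H_\omega.$$ *)

theory Defs
  imports "HOL-Probability.Probability"
begin

section \<open>Complex Hilbert spaces and unital C*-algebras\<close>

class complex_vector = real_vector +
  fixes scaleC :: "complex \<Rightarrow> 'a \<Rightarrow> 'a"  (infixr \<open>*\<^sub>C\<close> 75)
  assumes scaleC_add_right: "c *\<^sub>C (x + y) = c *\<^sub>C x + c *\<^sub>C y"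
    and scaleC_add_left: "(c + d) *\<^sub>C x = c *\<^sub>C x + d *\<^sub>C x"
    and scaleC_scaleC: "c *\<^sub>C d *\<^sub>C x = (c * d) *\<^sub>C x"
    and scaleC_one: "1 *\<^sub>C x = x"
    and scaleR_scaleC: "r *\<^sub>R x = complex_of_real r *\<^sub>C x"

text \<open>The inner product is linear in the first variable. Definiteness and the norm come from
  \<^class>\<open>real_inner\<close>, whose inner product is the real part of \<open>cinner\<close>.\<close>

class chilbert_space = complex_vector + real_inner + complete_space +
  fixes cinner :: "'a \<Rightarrow> 'a \<Rightarrow> complex"
  assumes cinner_add_left: "cinner (x + y) z = cinner x z + cinner y z"
    and cinner_scaleC_left: "cinner (c *\<^sub>C x) y = c * cinner x y"
    and cinner_commute: "cinner x y = cnj (cinner y x)"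
    and inner_eq_Re_cinner: "inner x y = Re (cinner x y)"

class cstar_algebra = complex_vector + real_normed_algebra_1 + banach +
  fixes star :: "'a \<Rightarrow> 'a"
  assumes mult_scaleC_left: "(c *\<^sub>C x) * y = c *\<^sub>C (x * y)"
    and mult_scaleC_right: "x * (c *\<^sub>C y) = c *\<^sub>C (x * y)"
    and norm_scaleC: "norm (c *\<^sub>C x) = cmod c * norm x"
    and star_add: "star (x + y) = star x + star y"
    and star_scaleC: "star (c *\<^sub>C x) = cnj c *\<^sub>C star x"
    and star_mult: "star (x * y) = star y * star x"
    and star_star: "star (star x) = x"
    and cstar_identity: "norm (star x * x) = (norm x)\<^sup>2"


section \<open>C*-dynamical systems\<close>

definition states :: "('a::cstar_algebra \<Rightarrow> complex) set" where
  "states = {\<phi>. (\<forall>a b. \<phi> (a + b) = \<phi> a + \<phi> b) \<and> (\<forall>c a. \<phi> (c *\<^sub>C a) = c * \<phi> a) \<and>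
     (\<forall>a. \<phi> (star a * a) \<in> \<real>\<^sub>\<ge>\<^sub>0) \<and> \<phi> 1 = 1}"

definition star_automorphism :: "('a::cstar_algebra \<Rightarrow> 'a) \<Rightarrow> bool" where
  "star_automorphism \<alpha> \<longleftrightarrow> bij \<alpha> \<and>
     (\<forall>a b. \<alpha> (a + b) = \<alpha> a + \<alpha> b) \<and> (\<forall>c a. \<alpha> (c *\<^sub>C a) = c *\<^sub>C \<alpha> a) \<and>
     (\<forall>a b. \<alpha> (a * b) = \<alpha> a * \<alpha> b) \<and> (\<forall>a. \<alpha> (star a) = star (\<alpha> a))"

definition invariant_states :: "('a::cstar_algebra \<Rightarrow> 'a) \<Rightarrow> ('a \<Rightarrow> complex) set" where
  "invariant_states \<beta> = {\<phi> \<in> states. \<phi> \<circ> \<beta> = \<phi>}"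

definition cstar_dynamical_system ::
    "('a::cstar_algebra \<Rightarrow> 'a) \<Rightarrow> ('a \<Rightarrow> complex) \<Rightarrow> bool" where
  "cstar_dynamical_system \<alpha> \<omega> \<longleftrightarrow> star_automorphism \<alpha> \<and> \<omega> \<in> invariant_states \<alpha>"

definition extreme_invariant_states ::
    "('a::cstar_algebra \<Rightarrow> 'a) \<Rightarrow> ('a \<Rightarrow> complex) set" where
  "extreme_invariant_states \<beta> = {\<psi> \<in> invariant_states \<beta>.
     \<forall>\<phi>\<^sub>1 \<in> invariant_states \<beta>. \<forall>\<phi>\<^sub>2 \<in> invariant_states \<beta>. \<forall>t::real.
       0 < t \<and> t < 1 \<and> (\<forall>a. \<psi> a = of_real t * \<phi>\<^sub>1 a + of_real (1 - t) * \<phi>\<^sub>2 a) \<longrightarrow>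
       \<phi>\<^sub>1 = \<psi> \<and> \<phi>\<^sub>2 = \<psi>}"

text \<open>Integer powers of a bijection of \<open>S\<close>.\<close>

definition int_iter :: "'b set \<Rightarrow> ('b \<Rightarrow> 'b) \<Rightarrow> int \<Rightarrow> 'b \<Rightarrow> 'b" where
  "int_iter S f n = (if 0 \<le> n then f ^^ nat n else inv_into S f ^^ nat (- n))"


section \<open>The bidual and supports of states\<close>

definition dual :: "('a::cstar_algebra \<Rightarrow> complex) set" where
  "dual = {f. bounded_linear f \<and> (\<forall>c a. f (c *\<^sub>C a) = c * f a)}"

definition bidual :: "(('a::cstar_algebra \<Rightarrow> complex) \<Rightarrow> complex) set" where
  "bidual = {F \<in> extensional dual.
     (\<forall>f\<in>dual. \<forall>g\<in>dual. F (\<lambda>a. f a + g a) = F f + F g) \<and>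
     (\<forall>c. \<forall>f\<in>dual. F (\<lambda>a. c * f a) = c * F f) \<and>
     (\<exists>K. \<forall>f\<in>dual. cmod (F f) \<le> K * onorm f)}"

text \<open>The W*-algebra structure of the bidual: the (first) Arens product, and the extension of the
  involution. The embedding of the algebra is \<open>a \<mapsto> (f \<mapsto> f a)\<close>.\<close>

definition bidual_mult ::
    "(('a::cstar_algebra \<Rightarrow> complex) \<Rightarrow> complex) \<Rightarrow> (('a \<Rightarrow> complex) \<Rightarrow> complex) \<Rightarrow>
     ('a \<Rightarrow> complex) \<Rightarrow> complex" where
  "bidual_mult F G = (\<lambda>f\<in>dual. F (\<lambda>a. G (\<lambda>b. f (a * b))))"

definition bidual_star ::
    "(('a::cstar_algebra \<Rightarrow> complex) \<Rightarrow> complex) \<Rightarrow> ('a \<Rightarrow> complex) \<Rightarrow> complex" where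
  "bidual_star F = (\<lambda>f\<in>dual. cnj (F (\<lambda>a. cnj (f (star a)))))"

definition bidual_centre :: "(('a::cstar_algebra \<Rightarrow> complex) \<Rightarrow> complex) set" where
  "bidual_centre = {Z \<in> bidual. \<forall>F\<in>bidual. bidual_mult Z F = bidual_mult F Z}"

definition bidual_projections :: "(('a::cstar_algebra \<Rightarrow> complex) \<Rightarrow> complex) set" where
  "bidual_projections = {p \<in> bidual. bidual_mult p p = p \<and> bidual_star p = p}"

text \<open>The support of \<open>\<phi>\<close> is the smallest projection \<open>p\<close> of the bidual on which the normal extension
  \<open>F \<mapsto> F \<phi>\<close> of \<open>\<phi>\<close> takes the value 1; \<open>p \<le> q\<close> for projections means \<open>p q = p\<close>.\<close>

definition is_support ::
    "('a::cstar_algebra \<Rightarrow> complex) \<Rightarrow> (('a \<Rightarrow> complex) \<Rightarrow> complex) \<Rightarrow> bool" where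
  "is_support \<phi> p \<longleftrightarrow> p \<in> bidual_projections \<and> p \<phi> = 1 \<and>
     (\<forall>q\<in>bidual_projections. q \<phi> = 1 \<longrightarrow> bidual_mult p q = p)"

definition central_support :: "('a::cstar_algebra \<Rightarrow> complex) \<Rightarrow> bool" where
  "central_support \<phi> \<longleftrightarrow> (\<exists>p\<in>bidual_centre. is_support \<phi> p)"


section \<open>Operators on closed subspaces, commutants\<close>

text \<open>A Hilbert space is given as a closed subspace \<open>H\<close> of an ambient one, so that the spaces of a
  field can share a type. Only the values on \<open>H\<close> of an operator on \<open>H\<close> matter.\<close>

definition closed_csubspace :: "'h::chilbert_space set \<Rightarrow> bool" where
  "closed_csubspace H \<longleftrightarrow> closed H \<and> 0 \<in> H \<and>
     (\<forall>x\<in>H. \<forall>y\<in>H. x + y \<in> H) \<and> (\<forall>c. \<forall>x\<in>H. c *\<^sub>C x \<in> H)"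

definition bounded_op :: "'h::chilbert_space set \<Rightarrow> ('h \<Rightarrow> 'h) \<Rightarrow> bool" where
  "bounded_op H T \<longleftrightarrow> T ` H \<subseteq> H \<and>
     (\<forall>x\<in>H. \<forall>y\<in>H. T (x + y) = T x + T y) \<and> (\<forall>c. \<forall>x\<in>H. T (c *\<^sub>C x) = c *\<^sub>C T x) \<and>
     (\<exists>K. \<forall>x\<in>H. norm (T x) \<le> K * norm x)"

definition unitary_op :: "'h::chilbert_space set \<Rightarrow> ('h \<Rightarrow> 'h) \<Rightarrow> bool" where
  "unitary_op H T \<longleftrightarrow> bounded_op H T \<and> T ` H = H \<and>
     (\<forall>x\<in>H. \<forall>y\<in>H. cinner (T x) (T y) = cinner x y)"

definition commutant :: "'h::chilbert_space set \<Rightarrow> ('h \<Rightarrow> 'h) set \<Rightarrow> ('h \<Rightarrow> 'h) set" where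
  "commutant H S = {T. bounded_op H T \<and> (\<forall>A\<in>S. \<forall>x\<in>H. T (A x) = A (T x))}"

definition point_spectrum :: "'h::chilbert_space set \<Rightarrow> ('h \<Rightarrow> 'h) \<Rightarrow> complex set" where
  "point_spectrum H T = {v. \<exists>x\<in>H. x \<noteq> 0 \<and> T x = v *\<^sub>C x}"

definition proj_onto :: "'h::chilbert_space set \<Rightarrow> 'h \<Rightarrow> 'h" where
  "proj_onto K x = (THE y. y \<in> K \<and> (\<forall>z\<in>K. cinner (x - y) z = 0))"


section \<open>Covariant GNS representations\<close>

record ('a, 'h) covariant_rep =
  hilb :: "'h set"
  rep :: "'a \<Rightarrow> 'h \<Rightarrow> 'h"
  evol :: "'h \<Rightarrow> 'h"
  cyc :: "'h"

definition covariant_gns ::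
    "('a::cstar_algebra \<Rightarrow> 'a) \<Rightarrow> ('a \<Rightarrow> complex) \<Rightarrow> ('a, 'h::chilbert_space) covariant_rep \<Rightarrow> bool"
  where
  "covariant_gns \<alpha> \<phi> R \<longleftrightarrow>
     closed_csubspace (hilb R) \<and>
     (\<forall>a. bounded_op (hilb R) (rep R a)) \<and>
     (\<forall>x\<in>hilb R.
        (\<forall>a b. rep R (a + b) x = rep R a x + rep R b x) \<and>
        (\<forall>c a. rep R (c *\<^sub>C a) x = c *\<^sub>C rep R a x) \<and>
        (\<forall>a b. rep R (a * b) x = rep R a (rep R b x)) \<and>
        rep R 1 x = x \<and>
        (\<forall>a. \<forall>y\<in>hilb R. cinner (rep R a x) y = cinner x (rep R (star a) y))) \<and>
     cyc R \<in> hilb R \<and>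
     closure (range (\<lambda>a. rep R a (cyc R))) = hilb R \<and>
     (\<forall>a. \<phi> a = cinner (rep R a (cyc R)) (cyc R)) \<and>
     unitary_op (hilb R) (evol R) \<and>
     evol R (cyc R) = cyc R \<and>
     (\<forall>a. \<forall>x\<in>hilb R. evol R (rep R a (inv_into (hilb R) (evol R) x)) = rep R (\<alpha> a) x)"

definition rep_commutant ::
    "('a, 'h::chilbert_space) covariant_rep \<Rightarrow> ('h \<Rightarrow> 'h) set" where
  "rep_commutant R = commutant (hilb R) (range (rep R))"

definition rep_bicommutant ::
    "('a, 'h::chilbert_space) covariant_rep \<Rightarrow> ('h \<Rightarrow> 'h) set" where
  "rep_bicommutant R = commutant (hilb R) (rep_commutant R)"

definition rep_centre ::
    "('a, 'h::chilbert_space) covariant_rep \<Rightarrow> ('h \<Rightarrow> 'h) set" where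
  "rep_centre R = rep_bicommutant R \<inter> rep_commutant R"

definition invariant_commutant ::
    "int \<Rightarrow> ('a, 'h::chilbert_space) covariant_rep \<Rightarrow> ('h \<Rightarrow> 'h) set" where
  "invariant_commutant l R =
     rep_commutant R \<inter> commutant (hilb R) {int_iter (hilb R) (evol R) l}"


section \<open>The orthogonal measure and the direct integral\<close>

text \<open>The topology of \<^typ>\<open>'a \<Rightarrow> complex\<close> is that of pointwise convergence, so the \<open>\<sigma>\<close>-algebra below is
  the Borel algebra of the weak* topology of the state space. With \<open>Z = invariant_commutant l R\<close>
  and \<open>P\<close> the projection onto the closure of \<open>Z \<Omega>\<close>, the right-hand side for \<open>as = [a\<^sub>1, ..., a\<^sub>m]\<close> is
  \<open>\<langle>\<pi>(a\<^sub>1) P \<pi>(a\<^sub>2) P ... P \<pi>(a\<^sub>m) \<Omega>, \<Omega>\<rangle>\<close>, as \<open>P \<Omega> = \<Omega>\<close>. Lists of length one give the barycentre.\<close>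

definition orthogonal_measure ::
    "int \<Rightarrow> ('a::cstar_algebra, 'h::chilbert_space) covariant_rep \<Rightarrow> ('a \<Rightarrow> complex) measure \<Rightarrow> bool"
  where
  "orthogonal_measure l R \<nu> \<longleftrightarrow>
     prob_space \<nu> \<and> sets \<nu> = sets (restrict_space borel states) \<and>
     (\<forall>as. (\<integral>\<psi>. prod_list (map \<psi> as) \<partial>\<nu>) =
        cinner (foldr (\<lambda>a x. rep R a
                   (proj_onto (closure ((\<lambda>T. T (cyc R)) ` invariant_commutant l R)) x))
                 as (cyc R))
               (cyc R))"

text \<open>Square-integrable \<open>\<nu>\<close>-measurable vector fields of a field \<open>G\<close> of representations, for the
  measurable structure generated by the fields \<open>\<psi> \<mapsto> \<pi>\<^sub>\<psi>(a) \<Psi>\<close>. The direct integral consists of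
  these up to \<open>\<nu>\<close>-null sets. \<open>\<nu>\<close> is a measure on all states; the fibres over the null set outside
  the extreme invariant states play no role.\<close>

definition square_integrable_field ::
    "('a \<Rightarrow> complex) measure \<Rightarrow> (('a \<Rightarrow> complex) \<Rightarrow> ('a, 'k::chilbert_space) covariant_rep) \<Rightarrow>
     (('a \<Rightarrow> complex) \<Rightarrow> 'k) \<Rightarrow> bool" where
  "square_integrable_field \<nu> G f \<longleftrightarrow>
     (AE \<psi> in \<nu>. f \<psi> \<in> hilb (G \<psi>)) \<and>
     (\<forall>a. (\<lambda>\<psi>. cinner (f \<psi>) (rep (G \<psi>) a (cyc (G \<psi>)))) \<in> borel_measurable (completion \<nu>)) \<and>
     integrable (completion \<nu>) (\<lambda>\<psi>. (norm (f \<psi>))\<^sup>2)"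

text \<open>\<open>\<xi> = \<integral>\<^sup>\<oplus> f(\<psi>) d\<nu>(\<psi>)\<close> under the identification of \<open>hilb R\<close> with the direct integral, which is
  the continuous extension of the isometry taking \<open>\<pi>(a) \<Omega>\<close> to \<open>\<psi> \<mapsto> \<pi>\<^sub>\<psi>(a) \<Psi>\<close>.\<close>

definition decomposes ::
    "('a, 'h::chilbert_space) covariant_rep \<Rightarrow> ('a \<Rightarrow> complex) measure \<Rightarrow>
     (('a \<Rightarrow> complex) \<Rightarrow> ('a, 'k::chilbert_space) covariant_rep) \<Rightarrow>
     'h \<Rightarrow> (('a \<Rightarrow> complex) \<Rightarrow> 'k) \<Rightarrow> bool" where
  "decomposes R \<nu> G \<xi> f \<longleftrightarrow>
     \<xi> \<in> hilb R \<and> square_integrable_field \<nu> G f \<and>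
     (\<exists>a :: nat \<Rightarrow> 'a.
        (\<lambda>n. rep R (a n) (cyc R)) \<longlonglongrightarrow> \<xi> \<and>
        (\<lambda>n. \<integral>\<^sup>+\<psi>. ennreal ((norm (f \<psi> - rep (G \<psi>) (a n) (cyc (G \<psi>))))\<^sup>2) \<partial>completion \<nu>)
          \<longlonglongrightarrow> 0)"

text \<open>A choice of \<open>\<psi> \<mapsto> \<xi>(\<psi>)\<close>, which is unique up to \<open>\<nu>\<close>-null sets.\<close>

definition field_of ::
    "('a, 'h::chilbert_space) covariant_rep \<Rightarrow> ('a \<Rightarrow> complex) measure \<Rightarrow>
     (('a \<Rightarrow> complex) \<Rightarrow> ('a, 'k::chilbert_space) covariant_rep) \<Rightarrow>
     'h \<Rightarrow> ('a \<Rightarrow> complex) \<Rightarrow> 'k" where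
  "field_of R \<nu> G \<xi> = (SOME f. decomposes R \<nu> G \<xi> f)"

definition vector_of ::
    "('a, 'h::chilbert_space) covariant_rep \<Rightarrow> ('a \<Rightarrow> complex) measure \<Rightarrow>
     (('a \<Rightarrow> complex) \<Rightarrow> ('a, 'k::chilbert_space) covariant_rep) \<Rightarrow>
     (('a \<Rightarrow> complex) \<Rightarrow> 'k) \<Rightarrow> 'h" where
  "vector_of R \<nu> G f = (THE \<xi>. decomposes R \<nu> G \<xi> f)"


section \<open>The operators \<open>V(\<psi>)\<close>, \<open>V\<close> and \<open>V\<^sub>X\<close>\<close>

text \<open>Phase choices of \<open>V\<^sub>v\<close> and \<open>W\<^sub>v\<close>; \<open>V(\<psi>)\<close> does not depend on them.\<close>

definition eigen_unitary :: "('a, 'k::chilbert_space) covariant_rep \<Rightarrow> complex \<Rightarrow> 'k \<Rightarrow> 'k" where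
  "eigen_unitary R v = (SOME T. T \<in> rep_bicommutant R \<and> unitary_op (hilb R) T \<and>
     (\<forall>x\<in>hilb R. evol R (T (inv_into (hilb R) (evol R) x)) = v *\<^sub>C T x))"

definition eigen_unitary' :: "('a, 'k::chilbert_space) covariant_rep \<Rightarrow> complex \<Rightarrow> 'k \<Rightarrow> 'k" where
  "eigen_unitary' R v = (SOME T. T \<in> rep_commutant R \<and> unitary_op (hilb R) T \<and>
     (\<forall>x\<in>hilb R. evol R (T (inv_into (hilb R) (evol R) x)) = v *\<^sub>C T x))"

text \<open>Elements \<open>t\<close> of the Hilbert space tensor product \<open>H \<otimes> H\<close> are represented by the forms
  \<open>(x, y) \<mapsto> \<langle>t, x \<otimes> y\<rangle>\<close>, which determine them; the following is \<open>\<eta> \<otimes> \<xi>\<close>.\<close>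

definition tensor :: "'k::chilbert_space \<Rightarrow> 'k \<Rightarrow> 'k \<Rightarrow> 'k \<Rightarrow> complex" where
  "tensor \<eta> \<xi> = (\<lambda>x y. cinner \<eta> x * cinner \<xi> y)"

definition V_fibre ::
    "int \<Rightarrow> ('a, 'k::chilbert_space) covariant_rep \<Rightarrow> ('k \<Rightarrow> 'k \<Rightarrow> complex) \<Rightarrow> 'k" where
  "V_fibre k R t =
     (\<Sum>\<^sub>\<infinity>(v, w) \<in> {(v, w). v \<in> point_spectrum (hilb R) (evol R) \<and>
                         w \<in> point_spectrum (hilb R) (evol R) \<and> v powi k * w powi (k + 1) = 1}.
        t (eigen_unitary R v (cyc R)) (eigen_unitary' R w (cyc R)) *\<^sub>C
          eigen_unitary R v (eigen_unitary' R w (cyc R)))"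

definition V_field ::
    "int \<Rightarrow> ('a \<Rightarrow> complex) set \<Rightarrow> (('a \<Rightarrow> complex) \<Rightarrow> ('a, 'k::chilbert_space) covariant_rep) \<Rightarrow>
     ('a \<Rightarrow> complex) \<Rightarrow> ('k \<Rightarrow> 'k \<Rightarrow> complex) \<Rightarrow> 'k" where
  "V_field k F G \<psi> t = (if \<psi> \<in> F then V_fibre k (G \<psi>) t else 0)"

definition V_int ::
    "int \<Rightarrow> ('a, 'h::chilbert_space) covariant_rep \<Rightarrow> ('a \<Rightarrow> complex) measure \<Rightarrow>
     ('a \<Rightarrow> complex) set \<Rightarrow> (('a \<Rightarrow> complex) \<Rightarrow> ('a, 'k::chilbert_space) covariant_rep) \<Rightarrow>
     (('a \<Rightarrow> complex) \<Rightarrow> 'k \<Rightarrow> 'k \<Rightarrow> complex) \<Rightarrow> 'h" where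
  "V_int k R \<nu> F G t = vector_of R \<nu> G (\<lambda>\<psi>. V_field k F G \<psi> (t \<psi>))"

definition V_op ::
    "int \<Rightarrow> ('a, 'h::chilbert_space) covariant_rep \<Rightarrow> ('a \<Rightarrow> complex) measure \<Rightarrow>
     ('a \<Rightarrow> complex) set \<Rightarrow> (('a \<Rightarrow> complex) \<Rightarrow> ('a, 'k::chilbert_space) covariant_rep) \<Rightarrow>
     ('h \<Rightarrow> 'h) \<Rightarrow> 'h \<Rightarrow> 'h" where
  "V_op k R \<nu> F G X \<xi> =
     V_int k R \<nu> F G (\<lambda>\<psi>. tensor (field_of R \<nu> G (X (cyc R)) \<psi>) (field_of R \<nu> G \<xi> \<psi>))"

end

theory Submission
  imports Defs
begin

text \<open>
  Put \<open>\<beta> = \<alpha>\<^sup>l\<close> and let \<open>s\<^sub>N\<close> be the average over \<open>n < N\<close> of \<open>\<beta>^(nk)(A\<^sub>1) \<beta>^(n(k+1))(A\<^sub>2)\<close>. For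
  \<open>\<psi> \<in> F\<close> the vectors \<open>\<pi>\<^sub>\<psi>(s\<^sub>N) \<Psi>\<close> converge in norm to \<open>V(\<psi>)(\<pi>\<^sub>\<psi>(A\<^sub>1) \<Psi> \<otimes> \<pi>\<^sub>\<psi>(A\<^sub>2) \<Psi>)\<close>. As \<open>\<nu>\<close> has
  barycentre \<open>\<omega>\<close>, dominated convergence makes \<open>\<pi>\<^sub>\<omega>(s\<^sub>N) \<Omega>\<close> Cauchy, with limit \<open>V\<^sub>X \<pi>\<^sub>\<omega>(A\<^sub>2) \<Omega>\<close> for
  \<open>X = \<pi>\<^sub>\<omega>(A\<^sub>1)\<close>, and \<open>\<omega>(A\<^sub>0 s\<^sub>N) = \<langle>\<pi>\<^sub>\<omega>(s\<^sub>N) \<Omega>, \<pi>\<^sub>\<omega>(A\<^sub>0\<^sup>*) \<Omega>\<rangle>\<close>.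

  In a fibre, \<open>\<Psi>\<close> is cyclic for the commutant because the support is central: from a vector \<open>x\<close>
  orthogonal to the orbit of \<open>\<Psi>\<close> under the commutant one builds, by limits of resolvents of elements
  of the algebra, a projection of the bidual which is 1 on \<open>\<psi>\<close> and annihilates \<open>x\<close>, whereas a
  central projection which is 1 on \<open>\<psi>\<close> acts as the identity. Replacing \<open>\<pi>(A\<^sub>2) \<Psi>\<close> by \<open>B \<Psi>\<close> with \<open>B\<close>
  in the commutant turns \<open>\<pi>(s\<^sub>N) \<Psi>\<close> into the average of \<open>U^(n(k+1)) B U^(-n) x\<close> with
  \<open>x = \<pi>(A\<^sub>1) \<Psi>\<close>. On eigenvectors \<open>x\<close> the mean ergodic theorem applies; on the orthogonal complement
  of the eigenvectors the van der Corput estimate gives the limit 0, the correlations factorising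
  because extremality of \<open>\<psi>\<close> makes the fixed operators of the commutant scalar.
\<close>

section \<open>Complex inner product spaces\<close>

text \<open>Two obstacles shape the argument. The support lives in the bidual with its Arens
  product, so a projection there involves iterated limits of \<open>f (r * s)\<close>, and
  convergence of a functional along a monotone sequence does not by itself pass to products. The
  remedy is to bound a sum of \<open>K\<close> products by a multiple of \<open>sqrt K\<close>
  instead of \<open>K\<close> (\<open>norm_sum_cpos_mult_le\<close>), which makes the convergence
  uniform over the unit ball. Positivity is handled by norm inequalities, square root series and
  resolvents in place of spectra. In the van der Corput step only \<open>x\<close> is free of
  eigenvectors, and the correlations of \<open>B \<Psi>\<close> need not decay. They are positive
  definite; written as averages of characters they leave trigonometric sums in \<open>x\<close>,
  which are small uniformly on the circle by compactness. Finally,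
  \<open>v powi k * w powi (k + 1) = (v * w) powi k * w\<close>, so at resonance the eigenvalue
  \<open>v * w\<close> determines the pair and the vectors in \<open>V(\<psi>)\<close> are
  orthonormal.\<close>

lemma scaleC_zero_right [simp]: "c *\<^sub>C (0::'v::complex_vector) = 0"
  using scaleC_add_right[of c 0 "0::'v"] by simp

lemma scaleC_zero_left [simp]: "0 *\<^sub>C (x::'v::complex_vector) = 0"
  using scaleC_add_left[of 0 0 x] by simp

lemma scaleC_one' [simp]: "1 *\<^sub>C (x::'v::complex_vector) = x"
  by (rule scaleC_one)

lemma scaleC_minus_right [simp]: "c *\<^sub>C (- x) = - (c *\<^sub>C (x::'v::complex_vector))"
  using scaleC_add_right[of c x "- x"] by (simp add: eq_neg_iff_add_eq_0 add.commute)

lemma scaleC_minus_left [simp]: "(- c) *\<^sub>C x = - (c *\<^sub>C (x::'v::complex_vector))"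
  using scaleC_add_left[of c "- c" x] by (simp add: eq_neg_iff_add_eq_0 add.commute)

lemma scaleC_diff_right: "c *\<^sub>C (x - y) = c *\<^sub>C x - c *\<^sub>C (y::'v::complex_vector)"
  using scaleC_add_right[of c x "- y"] by simp

lemma scaleC_diff_left: "(c - d) *\<^sub>C x = c *\<^sub>C x - d *\<^sub>C (x::'v::complex_vector)"
  using scaleC_add_left[of c "- d" x] by simp

lemma scaleC_scaleC' [simp]: "c *\<^sub>C d *\<^sub>C (x::'v::complex_vector) = (c * d) *\<^sub>C x"
  by (rule scaleC_scaleC)

lemma scaleC_sum_right: "c *\<^sub>C (\<Sum>i\<in>I. f i) = (\<Sum>i\<in>I. c *\<^sub>C (f i :: 'v::complex_vector))"
  by (induction I rule: infinite_finite_induct) (auto simp: scaleC_add_right)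

lemma scaleC_sum_left: "(\<Sum>i\<in>I. f i) *\<^sub>C x = (\<Sum>i\<in>I. f i *\<^sub>C (x :: 'v::complex_vector))"
  by (induction I rule: infinite_finite_induct) (auto simp: scaleC_add_left)

lemma scaleC_left_imp_eq:
  assumes "c *\<^sub>C x = c *\<^sub>C (y::'v::complex_vector)" "c \<noteq> 0"
  shows "x = y"
proof -
  have "inverse c *\<^sub>C c *\<^sub>C x = inverse c *\<^sub>C c *\<^sub>C y"
    using assms(1) by simp
  then show ?thesis using assms(2) by simp
qed

lemma cinner_add_right: "cinner x (y + z) = cinner x y + cinner x (z::'h::chilbert_space)"
  by (metis cinner_add_left cinner_commute complex_cnj_add)

lemma cinner_scaleC_right: "cinner x (c *\<^sub>C y) = cnj c * cinner x (y::'h::chilbert_space)"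
  by (metis cinner_commute cinner_scaleC_left complex_cnj_mult)

lemma cinner_self: "cinner x x = of_real ((norm (x::'h::chilbert_space))\<^sup>2)"
proof -
  have "Im (cinner x x) = 0"
    using cinner_commute[of x x] by (metis complex_cnj_cancel_iff Reals_cnj_iff complex_is_Real_iff)
  moreover have "Re (cinner x x) = (norm x)\<^sup>2"
    using inner_eq_Re_cinner[of x x] by (simp add: power2_norm_eq_inner)
  ultimately show ?thesis by (simp add: complex_eq_iff)
qed

lemma norm_scaleC_hilbert: "norm (c *\<^sub>C (x::'h::chilbert_space)) = cmod c * norm x"
proof -
  have "cinner (c *\<^sub>C x) (c *\<^sub>C x) = (c * cnj c) * cinner x x"
    by (simp add: cinner_scaleC_left cinner_scaleC_right)
  then have "of_real ((norm (c *\<^sub>C x))\<^sup>2) = (of_real ((cmod c * norm x)\<^sup>2) :: complex)"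
    by (simp only: cinner_self complex_norm_square[symmetric] power_mult_distrib of_real_mult)
  then have "(norm (c *\<^sub>C x))\<^sup>2 = (cmod c * norm x)\<^sup>2"
    by (simp only: of_real_eq_iff)
  then show ?thesis
    by (simp add: power2_eq_iff_nonneg)
qed

text \<open>A phase \<open>c\<close> makes the inner product nonnegative; it is then the real inner
  product of \<open>c *\<^sub>C x\<close> and \<open>y\<close>, and the real Cauchy-Schwarz
  inequality applies.\<close>

lemma cinner_norm_le: "cmod (cinner x y) \<le> norm x * norm (y::'h::chilbert_space)"
proof (cases "cinner x y = 0")
  case False
  define c where "c = cnj (cinner x y) / of_real (cmod (cinner x y))"
  have c: "cmod c = 1"
    using False by (simp add: c_def norm_divide)
  have "c * cinner x y = of_real (cmod (cinner x y))"
    using False by (simp add: c_def mult.commute complex_norm_square[symmetric] power2_eq_square)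
  then have "cmod (cinner x y) = inner (c *\<^sub>C x) y"
    by (simp add: inner_eq_Re_cinner cinner_scaleC_left)
  also have "\<dots> \<le> norm (c *\<^sub>C x) * norm y"
    by (rule norm_cauchy_schwarz)
  finally show ?thesis
    by (simp add: norm_scaleC_hilbert c)
qed simp

lemma cinner_scaleR_left: "cinner (r *\<^sub>R x) y = of_real r * cinner x (y::'h::chilbert_space)"
  by (simp add: scaleR_scaleC cinner_scaleC_left)

lemma cinner_scaleR_right: "cinner x (r *\<^sub>R y) = of_real r * cinner x (y::'h::chilbert_space)"
  by (simp add: scaleR_scaleC cinner_scaleC_right)

lemma bounded_bilinear_cinner: "bounded_bilinear (cinner :: 'h::chilbert_space \<Rightarrow> _)"
proof
  show "\<exists>K. \<forall>a b::'h. cmod (cinner a b) \<le> norm a * norm b * K"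
    by (rule exI[of _ 1]) (simp add: cinner_norm_le)
qed (simp_all add: cinner_add_left cinner_add_right cinner_scaleR_left cinner_scaleR_right
      scaleR_conv_of_real)

lemma bounded_bilinear_scaleC_hilbert:
  "bounded_bilinear (scaleC :: complex \<Rightarrow> 'h::chilbert_space \<Rightarrow> 'h)"
proof
  show "\<exists>K. \<forall>a (b::'h). norm (a *\<^sub>C b) \<le> norm a * norm b * K"
    by (rule exI[of _ 1]) (simp add: norm_scaleC_hilbert)
qed (simp_all add: scaleC_add_left scaleC_add_right scaleR_scaleC scaleR_conv_of_real mult.commute)

lemmas tendsto_cinner = bounded_bilinear.tendsto[OF bounded_bilinear_cinner]
lemmas tendsto_scaleC = bounded_bilinear.tendsto[OF bounded_bilinear_scaleC_hilbert]
lemmas cinner_simps [simp] =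
  bounded_bilinear.zero_left[OF bounded_bilinear_cinner]
  bounded_bilinear.zero_right[OF bounded_bilinear_cinner]
  bounded_bilinear.minus_left[OF bounded_bilinear_cinner]
  bounded_bilinear.minus_right[OF bounded_bilinear_cinner]
lemmas cinner_diff_left = bounded_bilinear.diff_left[OF bounded_bilinear_cinner]
lemmas cinner_diff_right = bounded_bilinear.diff_right[OF bounded_bilinear_cinner]
lemmas cinner_sum_left = bounded_bilinear.sum_left[OF bounded_bilinear_cinner]
lemmas cinner_sum_right = bounded_bilinear.sum_right[OF bounded_bilinear_cinner]

lemma cinner_self_eq_0 [simp]: "cinner x x = 0 \<longleftrightarrow> (x::'h::chilbert_space) = 0"
  by (simp add: cinner_self)

lemma cinner_commute_zero: "cinner x y = 0 \<longleftrightarrow> cinner y (x::'h::chilbert_space) = 0"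
  by (metis cinner_commute complex_cnj_zero)

lemma norm_eq_of_cinner:
  "cinner x x = cinner y y \<Longrightarrow> norm (x::'h::chilbert_space) = norm (y::'g::chilbert_space)"
  by (simp add: cinner_self power2_eq_iff_nonneg flip: of_real_power)

section \<open>Projections, Riesz representation and adjoints\<close>

text \<open>Minimising sequence and parallelogram law. Only real scalars are assumed: the subspace
  to which \<open>approximate_projection\<close> applies it involves \<open>star\<close> and need
  not be complex.\<close>

lemma orthogonal_projection_real:
  fixes K :: "'v::{real_inner,complete_space} set"
  assumes cl: "closed K" and z: "0 \<in> K" and add: "\<And>x y. x \<in> K \<Longrightarrow> y \<in> K \<Longrightarrow> x + y \<in> K"
    and sc: "\<And>r x. x \<in> K \<Longrightarrow> r *\<^sub>R x \<in> K"
  shows "\<exists>y\<in>K. \<forall>z\<in>K. inner (x - y) z = 0"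
proof -
  define d where "d = (INF y\<in>K. (norm (x - y))\<^sup>2)"
  have bdd: "bdd_below ((\<lambda>y. (norm (x - y))\<^sup>2) ` K)"
    by (rule bdd_belowI2[of _ 0]) simp
  have d_le: "d \<le> (norm (x - y))\<^sup>2" if "y \<in> K" for y
    unfolding d_def by (rule cINF_lower[OF bdd that])
  have "\<exists>y\<in>K. (norm (x - y))\<^sup>2 < d + inverse (Suc n)" for n
  proof (rule ccontr)
    assume "\<not> ?thesis"
    then have "d + inverse (Suc n) \<le> (norm (x - y))\<^sup>2" if "y \<in> K" for y
      using that by (auto simp: not_less)
    then have "d + inverse (Suc n) \<le> d"
      unfolding d_def using z by (intro cINF_greatest) auto
    moreover have "inverse (real (Suc n)) > 0" by simp
    ultimately show False by linarith
  qed
  then obtain y where yK: "\<And>n. y n \<in> K" and y: "\<And>n. (norm (x - y n))\<^sup>2 < d + inverse (Suc n)"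
    by metis
  \<comment> \<open>Parallelogram law: the midpoint of \<open>u\<close> and \<open>v\<close> lies in
    \<open>K\<close>, so its squared distance from \<open>x\<close> is at least
    \<open>d\<close>.\<close>
  have par: "(norm (u - v))\<^sup>2 \<le> 2 * ((norm (x - u))\<^sup>2 - d) + 2 * ((norm (x - v))\<^sup>2 - d)"
    if "u \<in> K" "v \<in> K" for u v
  proof -
    have "(1/2) *\<^sub>R (u + v) \<in> K"
      using that by (intro sc add)
    from d_le[OF this] have "d \<le> (norm (x - (1/2) *\<^sub>R (u + v)))\<^sup>2" .
    moreover have "4 * (norm (x - (1/2) *\<^sub>R (u + v)))\<^sup>2 + (norm (u - v))\<^sup>2
        = 2 * (norm (x - u))\<^sup>2 + 2 * (norm (x - v))\<^sup>2"
      by (simp add: power2_norm_eq_inner inner_diff_left inner_diff_right inner_add_left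
          inner_add_right inner_commute algebra_simps)
    ultimately show ?thesis by simp
  qed
  have "Cauchy y"
  proof (rule CauchyI)
    fix e :: real assume "e > 0"
    then obtain N where N: "inverse (Suc N) < e\<^sup>2 / 4"
      using reals_Archimedean[of "e\<^sup>2/4"] by auto
    show "\<exists>M. \<forall>m\<ge>M. \<forall>n\<ge>M. norm (y m - y n) < e"
    proof (intro exI[of _ N] allI impI)
      fix m n assume mn: "N \<le> m" "N \<le> n"
      have 1: "inverse (real (Suc j)) \<le> inverse (real (Suc N))" if "N \<le> j" for j
        using that by (simp add: field_simps)
      define q where "q j = inverse (real (Suc j))" for j
      have "s < 2 * p + 2 * r" if "s \<le> 2 * (a - d) + 2 * (b - d)" "a < d + p" "b < d + r"
        for s a b p r :: real using that by simp
      from this[OF par[OF yK yK] y y, folded q_def]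
      have "(norm (y m - y n))\<^sup>2 < 2 * q m + 2 * q n" .
      also have "\<dots> < e\<^sup>2"
        using 1[OF mn(1), folded q_def] 1[OF mn(2), folded q_def] N[folded q_def] by linarith
      finally show "norm (y m - y n) < e"
        using \<open>e > 0\<close> by (simp add: power_less_imp_less_base)
    qed
  qed
  then obtain l where l: "y \<longlonglongrightarrow> l"
    by (auto simp: Cauchy_convergent_iff convergent_def)
  have lK: "l \<in> K"
    using closed_sequentially[OF cl _ l] yK by blast
  have "(\<lambda>n. (norm (x - y n))\<^sup>2) \<longlonglongrightarrow> (norm (x - l))\<^sup>2"
    by (intro tendsto_intros l)
  moreover have "(\<lambda>n. d + inverse (Suc n)) \<longlonglongrightarrow> d + 0"
    by (intro tendsto_intros LIMSEQ_inverse_real_of_nat)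
  ultimately have "(norm (x - l))\<^sup>2 \<le> d + 0"
    by (rule LIMSEQ_le) (use y in \<open>blast intro: less_imp_le\<close>)
  then have le: "(norm (x - l))\<^sup>2 \<le> d" by simp
  have "inner (x - l) w = 0" if w: "w \<in> K" for w
  proof (cases "w = 0")
    case False
    \<comment> \<open>The minimiser of the quadratic
      \<open>r \<mapsto> (norm (x - (l + r *\<^sub>R w)))\<^sup>2\<close>.\<close>
    define t where "t = inner (x - l) w / inner w w"
    have "l + t *\<^sub>R w \<in> K" using lK w by (intro add sc)
    from d_le[OF this] le have "(norm (x - l))\<^sup>2 \<le> (norm (x - (l + t *\<^sub>R w)))\<^sup>2" by (rule order_trans[rotated])
    also have "\<dots> = (norm (x - l))\<^sup>2 - 2 * t * inner (x - l) w + t * t * inner w w"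
      by (simp add: power2_norm_eq_inner inner_diff_left inner_diff_right inner_add_left
          inner_add_right inner_commute algebra_simps)
    also have "t * t * inner w w = t * inner (x - l) w"
      using False by (simp add: t_def)
    finally have "t * inner (x - l) w \<le> 0" by simp
    then have "(inner (x - l) w)\<^sup>2 / inner w w \<le> 0"
      by (simp add: t_def power2_eq_square)
    moreover have "inner w w > 0" using False by simp
    ultimately have "(inner (x - l) w)\<^sup>2 \<le> 0"
      by (simp only: divide_le_0_iff) simp
    then show ?thesis by simp
  qed simp
  then show ?thesis using lK by blast
qed

section \<open>Closed complex subspaces, orthogonality and the Riesz representation\<close>

lemma closed_csubspaceD:
  assumes "closed_csubspace H"
  shows "closed H" "0 \<in> H" "x \<in> H \<Longrightarrow> y \<in> H \<Longrightarrow> x + y \<in> H" "x \<in> H \<Longrightarrow> c *\<^sub>C x \<in> H"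
    "x \<in> H \<Longrightarrow> y \<in> H \<Longrightarrow> x - y \<in> H" "x \<in> H \<Longrightarrow> - x \<in> H" "x \<in> H \<Longrightarrow> r *\<^sub>R x \<in> H"
    "(\<And>i. i \<in> I \<Longrightarrow> g i \<in> H) \<Longrightarrow> (\<Sum>i\<in>I. g i) \<in> H"
proof -
  note * = assms[unfolded closed_csubspace_def]
  show "closed H" "0 \<in> H" using * by auto
  show add: "x \<in> H \<Longrightarrow> y \<in> H \<Longrightarrow> x + y \<in> H" for x y using * by auto
  show sc: "x \<in> H \<Longrightarrow> c *\<^sub>C x \<in> H" for c x using * by auto
  show neg: "x \<in> H \<Longrightarrow> - x \<in> H" for x using sc[of x "-1"] by simp
  show "x \<in> H \<Longrightarrow> y \<in> H \<Longrightarrow> x - y \<in> H" using add[of x "- y"] neg[of y] by simp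
  show "x \<in> H \<Longrightarrow> r *\<^sub>R x \<in> H" using sc by (simp add: scaleR_scaleC)
  show "(\<And>i. i \<in> I \<Longrightarrow> g i \<in> H) \<Longrightarrow> (\<Sum>i\<in>I. g i) \<in> H"
    by (induction I rule: infinite_finite_induct) (use * add in auto)
qed

lemma orthogonal_projection:
  fixes K :: "'h::chilbert_space set"
  assumes "closed_csubspace K"
  shows "\<exists>y\<in>K. \<forall>z\<in>K. cinner (x - y) z = 0"
proof -
  note K = closed_csubspaceD[OF assms]
  obtain y where y: "y \<in> K" "\<And>z. z \<in> K \<Longrightarrow> inner (x - y) z = 0"
    using orthogonal_projection_real[OF K(1,2) K(3) K(7), of x] by blast
  have "cinner (x - y) z = 0" if z: "z \<in> K" for z
  proof -
    have "Re (cinner (x - y) z) = 0" using y(2)[OF z] by (simp add: inner_eq_Re_cinner)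
    moreover have "Re (cinner (x - y) (\<i> *\<^sub>C z)) = 0"
      using y(2)[OF K(4)[OF z]] by (simp add: inner_eq_Re_cinner)
    ultimately show ?thesis by (simp add: cinner_scaleC_right complex_eq_iff)
  qed
  then show ?thesis using y(1) by blast
qed

lemma closed_csubspace_closure:
  fixes S :: "'h::chilbert_space set"
  assumes "0 \<in> S" "\<And>x y. x \<in> S \<Longrightarrow> y \<in> S \<Longrightarrow> x + y \<in> S" "\<And>c x. x \<in> S \<Longrightarrow> c *\<^sub>C x \<in> S"
  shows "closed_csubspace (closure S)"
  unfolding closed_csubspace_def
proof (intro conjI ballI allI)
  show "0 \<in> closure S" using assms(1) closure_subset by blast
  fix x y assume "x \<in> closure S" "y \<in> closure S"
  then obtain f g where "\<And>n. f n \<in> S" "f \<longlonglongrightarrow> x" "\<And>n. g n \<in> S" "g \<longlonglongrightarrow> y"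
    unfolding closure_sequential by blast
  then show "x + y \<in> closure S"
    unfolding closure_sequential
    by (intro exI[of _ "\<lambda>n. f n + g n"]) (auto intro: assms tendsto_add)
next
  fix c x assume "x \<in> closure S"
  then obtain f where "\<And>n. f n \<in> S" "f \<longlonglongrightarrow> x"
    unfolding closure_sequential by blast
  then show "c *\<^sub>C x \<in> closure S"
    unfolding closure_sequential
    by (intro exI[of _ "\<lambda>n. c *\<^sub>C f n"]) (auto intro: assms tendsto_scaleC tendsto_const)
qed simp

lemma orthogonal_closure:
  fixes x :: "'h::chilbert_space"
  assumes "\<And>y. y \<in> S \<Longrightarrow> cinner x y = 0" "y \<in> closure S"
  shows "cinner x y = 0"
proof -
  obtain f where f: "\<And>n. f n \<in> S" "f \<longlonglongrightarrow> y"
    using assms(2) unfolding closure_sequential by blast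
  have "(\<lambda>n. cinner x (f n)) \<longlonglongrightarrow> cinner x y" by (intro tendsto_cinner f tendsto_const)
  then show ?thesis using assms(1) f(1) by (simp add: LIMSEQ_const_iff)
qed

text \<open>The difference of \<open>x\<close> and its projection onto \<open>L\<close> is
  orthogonal to \<open>L\<close>; the last hypothesis puts it into \<open>L\<close>, so it is
  orthogonal to itself. Later density claims are reduced to this form.\<close>

lemma closed_csubspace_eqI:
  assumes "closed_csubspace L" "closed_csubspace H" "L \<subseteq> H"
    "\<And>x. x \<in> H \<Longrightarrow> (\<And>y. y \<in> L \<Longrightarrow> cinner x y = 0) \<Longrightarrow> x \<in> L"
  shows "L = H"
proof
  show "H \<subseteq> L"
  proof
    fix x assume x: "x \<in> H"
    obtain y where y: "y \<in> L" "\<And>z. z \<in> L \<Longrightarrow> cinner (x - y) z = 0"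
      using orthogonal_projection[OF assms(1)] by blast
    have "x - y \<in> L"
    proof (rule assms(4))
      show "x - y \<in> H" using closed_csubspaceD(5)[OF assms(2) x] assms(3) y(1) by blast
    qed (fact y(2))
    then have "x - y = 0" using y(2) cinner_self_eq_0 by blast
    then show "x \<in> L" using y(1) by simp
  qed
qed (fact assms)

definition clinear_on :: "'h::chilbert_space set \<Rightarrow> ('h \<Rightarrow> complex) \<Rightarrow> bool" where
  "clinear_on H f \<longleftrightarrow> (\<forall>x\<in>H. \<forall>y\<in>H. f (x + y) = f x + f y) \<and> (\<forall>c. \<forall>x\<in>H. f (c *\<^sub>C x) = c * f x) \<and>
     (\<exists>K. \<forall>x\<in>H. cmod (f x) \<le> K * norm x)"

text \<open>With \<open>w\<close> orthogonal to the kernel \<open>N\<close>, the representing vector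
  is the multiple \<open>y\<close> of \<open>w\<close> for which
  \<open>cinner w y = f w\<close>.\<close>

lemma riesz_representation:
  fixes H :: "'h::chilbert_space set"
  assumes H: "closed_csubspace H" and f: "clinear_on H f"
  shows "\<exists>y\<in>H. \<forall>x\<in>H. f x = cinner x y"
proof (cases "\<forall>x\<in>H. f x = 0")
  case True
  then show ?thesis using closed_csubspaceD(2)[OF H] by (intro bexI[of _ 0]) auto
next
  case False
  then obtain x0 where x0: "x0 \<in> H" "f x0 \<noteq> 0" by blast
  note Hs = closed_csubspaceD[OF H]
  have add: "f (x + y) = f x + f y" if "x \<in> H" "y \<in> H" for x y
    using f that by (simp add: clinear_on_def)
  have sc: "f (c *\<^sub>C x) = c * f x" if "x \<in> H" for c x
    using f that by (simp add: clinear_on_def)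
  have diff: "f (x - y) = f x - f y" if "x \<in> H" "y \<in> H" for x y
    using add[of x "- y"] sc[of y "-1"] that Hs by auto
  have f0: "f 0 = 0" using sc[of 0 0] Hs by simp
  obtain K where K: "\<And>x. x \<in> H \<Longrightarrow> cmod (f x) \<le> K * norm x"
    using f unfolding clinear_on_def by blast
  define N where "N = {x \<in> H. f x = 0}"
  have "closed N"
    unfolding closed_sequential_limits
  proof (intro allI impI, elim conjE)
    fix g l assume g: "\<forall>n. g n \<in> N" "g \<longlonglongrightarrow> l"
    have lH: "l \<in> H"
      using closed_sequentially[OF Hs(1) _ g(2)] g(1) by (auto simp: N_def)
    have "(\<lambda>n. K * norm (l - g n)) \<longlonglongrightarrow> K * norm (l - l)"
      by (intro tendsto_intros g)
    moreover have "cmod (f l) \<le> K * norm (l - g n)" for n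
      using K[of "l - g n"] g lH Hs diff[of l "g n"] by (auto simp: N_def)
    ultimately have "cmod (f l) \<le> K * norm (l - l)"
      by (intro LIMSEQ_le_const) auto
    then show "l \<in> N" using lH by (simp add: N_def)
  qed
  then have N: "closed_csubspace N"
    unfolding closed_csubspace_def using Hs by (auto simp: N_def f0 add sc)
  obtain n where n: "n \<in> N" "\<And>z. z \<in> N \<Longrightarrow> cinner (x0 - n) z = 0"
    using orthogonal_projection[OF N] by blast
  define w where "w = x0 - n"
  have wH: "w \<in> H" using n x0 Hs by (auto simp: w_def N_def)
  have fw: "f w = f x0" using n x0 diff by (auto simp: w_def N_def)
  have w0: "w \<noteq> 0" using fw x0 f0 by auto
  define y where "y = (cnj (f w) / cinner w w) *\<^sub>C w"
  have "f x = cinner x y" if x: "x \<in> H" for x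
  proof -
    have "x - (f x / f w) *\<^sub>C w \<in> N"
      using x wH Hs fw x0 by (auto simp: N_def diff sc)
    from n(2)[OF this] have "cinner w (x - (f x / f w) *\<^sub>C w) = 0" by (simp add: w_def)
    then have "cinner (x - (f x / f w) *\<^sub>C w) w = 0" using cinner_commute_zero by blast
    then have "cinner x w = (f x / f w) * cinner w w"
      by (simp add: cinner_diff_left cinner_scaleC_left)
    moreover have "cnj (cinner w w) = cinner w w" by (metis cinner_commute)
    ultimately show ?thesis
      using w0 fw x0 by (simp add: y_def cinner_scaleC_right)
  qed
  moreover have "y \<in> H" unfolding y_def by (rule Hs(4)[OF wH])
  ultimately show ?thesis by blast
qed

section \<open>Bounded operators on a closed subspace, adjoints and averages\<close>

lemma bounded_opD:
  assumes "bounded_op H T"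
  shows "x \<in> H \<Longrightarrow> T x \<in> H" "x \<in> H \<Longrightarrow> y \<in> H \<Longrightarrow> T (x + y) = T x + T y"
    "x \<in> H \<Longrightarrow> T (c *\<^sub>C x) = c *\<^sub>C T x"
    "\<exists>K\<ge>0. \<forall>x\<in>H. norm (T x) \<le> K * norm x"
proof -
  note * = assms[unfolded bounded_op_def]
  show "x \<in> H \<Longrightarrow> T x \<in> H" "x \<in> H \<Longrightarrow> y \<in> H \<Longrightarrow> T (x + y) = T x + T y"
    "x \<in> H \<Longrightarrow> T (c *\<^sub>C x) = c *\<^sub>C T x" using * by auto
  obtain K where K: "\<forall>x\<in>H. norm (T x) \<le> K * norm x" using * by blast
  have "norm (T x) \<le> max K 0 * norm x" if "x \<in> H" for x
  proof -
    have "norm (T x) \<le> K * norm x" using K that by blast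
    also have "\<dots> \<le> max K 0 * norm x" by (intro mult_right_mono) auto
    finally show ?thesis .
  qed
  then show "\<exists>K\<ge>0. \<forall>x\<in>H. norm (T x) \<le> K * norm x" by (intro exI[of _ "max K 0"]) auto
qed

lemma bounded_op_linear:
  assumes H: "closed_csubspace H" and T: "bounded_op H T"
  shows "T 0 = 0" "x \<in> H \<Longrightarrow> T (- x) = - T x"
    "x \<in> H \<Longrightarrow> y \<in> H \<Longrightarrow> T (x - y) = T x - T y"
    "(\<And>i. i \<in> I \<Longrightarrow> g i \<in> H) \<Longrightarrow> T (\<Sum>i\<in>I. g i) = (\<Sum>i\<in>I. T (g i))"
proof -
  note Hs = closed_csubspaceD[OF H] and Ts = bounded_opD[OF T]
  show z: "T 0 = 0" using Ts(3)[of 0 0] Hs by simp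
  show n: "x \<in> H \<Longrightarrow> T (- x) = - T x" for x using Ts(3)[of x "-1"] by simp
  show "x \<in> H \<Longrightarrow> y \<in> H \<Longrightarrow> T (x - y) = T x - T y"
    using Ts(2)[of x "- y"] n[of y] Hs by simp
  show "(\<And>i. i \<in> I \<Longrightarrow> g i \<in> H) \<Longrightarrow> T (\<Sum>i\<in>I. g i) = (\<Sum>i\<in>I. T (g i))"
  proof (induction I rule: infinite_finite_induct)
    case (insert i I)
    then show ?case using Ts(2)[of "g i" "sum g I"] Hs(8)[of I g] by auto
  qed (use z in auto)
qed

lemma bounded_op_tendsto:
  assumes H: "closed_csubspace H" and T: "bounded_op H T"
    and f: "\<And>n. f n \<in> H" "f \<longlonglongrightarrow> x"
  shows "(\<lambda>n. T (f n)) \<longlonglongrightarrow> T x"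
proof -
  note Hs = closed_csubspaceD[OF H] and Ts = bounded_opD[OF T]
  obtain K where K: "K \<ge> 0" "\<And>x. x \<in> H \<Longrightarrow> norm (T x) \<le> K * norm x" using Ts(4) by blast
  have x: "x \<in> H" using closed_sequentially[OF Hs(1) _ f(2)] f(1) by blast
  have "(\<lambda>n. K * norm (f n - x)) \<longlonglongrightarrow> K * norm (x - x)" by (intro tendsto_intros f)
  then have "(\<lambda>n. K * norm (f n - x)) \<longlonglongrightarrow> 0" by simp
  then have "(\<lambda>n. T (f n) - T x) \<longlonglongrightarrow> 0"
  proof (rule Lim_null_comparison[rotated])
    show "\<forall>\<^sub>F n in sequentially. norm (T (f n) - T x) \<le> K * norm (f n - x)"
      using K(2)[OF Hs(5)[OF f(1) x]] bounded_op_linear(3)[OF H T f(1) x] by auto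
  qed
  then show ?thesis by (simp add: LIM_zero_iff)
qed

lemma adjoint_exists:
  fixes H :: "'h::chilbert_space set"
  assumes H: "closed_csubspace H" and T: "bounded_op H T"
  shows "\<exists>S. bounded_op H S \<and> (\<forall>x\<in>H. \<forall>y\<in>H. cinner (T x) y = cinner x (S y))"
proof -
  note Hs = closed_csubspaceD[OF H] and Ts = bounded_opD[OF T]
  obtain K where K: "K \<ge> 0" "\<And>x. x \<in> H \<Longrightarrow> norm (T x) \<le> K * norm x" using Ts(4) by blast
  have "\<exists>z\<in>H. \<forall>x\<in>H. cinner (T x) y = cinner x z" if y: "y \<in> H" for y
  proof (rule riesz_representation[OF H])
    show "clinear_on H (\<lambda>x. cinner (T x) y)"
      unfolding clinear_on_def
    proof (intro conjI ballI allI exI[of _ "K * norm y"])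
      fix x assume x: "x \<in> H"
      have "cmod (cinner (T x) y) \<le> norm (T x) * norm y" by (rule cinner_norm_le)
      also have "\<dots> \<le> K * norm x * norm y" using K(2)[OF x] by (intro mult_right_mono) auto
      finally show "cmod (cinner (T x) y) \<le> K * norm y * norm x" by (simp add: mult_ac)
    qed (auto simp: Ts cinner_add_left cinner_scaleC_left)
  qed
  then obtain S where SH: "\<And>y. y \<in> H \<Longrightarrow> S y \<in> H"
    and S: "\<And>x y. x \<in> H \<Longrightarrow> y \<in> H \<Longrightarrow> cinner (T x) y = cinner x (S y)" by metis
  have uniq: "u = v" if "u \<in> H" "v \<in> H" "\<And>x. x \<in> H \<Longrightarrow> cinner x u = cinner x v" for u v
  proof -
    have "cinner (u - v) (u - v) = 0"
      using that(3)[OF Hs(5)[OF that(1,2)]] by (simp add: cinner_diff_right)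
    then show ?thesis by simp
  qed
  have "bounded_op H S"
    unfolding bounded_op_def
  proof (intro conjI ballI allI exI[of _ K])
    show "S ` H \<subseteq> H" using SH by blast
    show "S (x + y) = S x + S y" if "x \<in> H" "y \<in> H" for x y
      using that by (intro uniq) (simp_all add: cinner_add_right S[symmetric] SH Hs(3))
    show "S (c *\<^sub>C x) = c *\<^sub>C S x" if "x \<in> H" for c x
      using that by (intro uniq) (simp_all add: cinner_scaleC_right S[symmetric] SH Hs(4))
    show "norm (S y) \<le> K * norm y" if y: "y \<in> H" for y
    proof (cases "S y = 0")
      case False
      have "(norm (S y))\<^sup>2 = cmod (cinner (S y) (S y))" by (simp add: cinner_self norm_power)
      also have "\<dots> = cmod (cinner (T (S y)) y)" using S[OF SH[OF y] y] by simp
      also have "\<dots> \<le> norm (T (S y)) * norm y" by (rule cinner_norm_le)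
      also have "\<dots> \<le> K * norm (S y) * norm y" using K(2)[OF SH[OF y]] by (intro mult_right_mono) auto
      finally show ?thesis using False by (simp add: power2_eq_square)
    qed (use K(1) in simp)
  qed
  then show ?thesis using S by blast
qed

lemma bounded_op_comp:
  assumes S: "bounded_op H S" and T: "bounded_op H T"
  shows "bounded_op H (\<lambda>x. S (T x))"
  unfolding bounded_op_def
proof (intro conjI ballI allI)
  note Sd = bounded_opD[OF S] and Td = bounded_opD[OF T]
  show "(\<lambda>x. S (T x)) ` H \<subseteq> H" by (auto intro: Sd(1) Td(1))
  show "S (T (x + y)) = S (T x) + S (T y)" if "x \<in> H" "y \<in> H" for x y using that by (simp add: Sd Td)
  show "S (T (c *\<^sub>C x)) = c *\<^sub>C S (T x)" if "x \<in> H" for c x using that by (simp add: Sd Td)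
  obtain K L where KL: "K \<ge> 0" "\<And>x. x \<in> H \<Longrightarrow> norm (S x) \<le> K * norm x" "\<And>x. x \<in> H \<Longrightarrow> norm (T x) \<le> L * norm x"
    using Sd(4) Td(4) by blast
  have "norm (S (T x)) \<le> K * L * norm x" if "x \<in> H" for x
    using KL(2)[OF Td(1)[OF that]] mult_left_mono[OF KL(3)[OF that] KL(1)] by simp
  then show "\<exists>K. \<forall>x\<in>H. norm (S (T x)) \<le> K * norm x" by blast
qed

lemma bounded_op_scaleC:
  assumes H: "closed_csubspace H" and T: "bounded_op H T"
  shows "bounded_op H (\<lambda>x. c *\<^sub>C T x)"
  unfolding bounded_op_def
proof (intro conjI ballI allI)
  note Td = bounded_opD[OF T]
  show "(\<lambda>x. c *\<^sub>C T x) ` H \<subseteq> H" using closed_csubspaceD(4)[OF H Td(1)] by blast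
  obtain L where "\<And>x. x \<in> H \<Longrightarrow> norm (T x) \<le> L * norm x" using Td(4) by blast
  then have "norm (c *\<^sub>C T x) \<le> cmod c * L * norm x" if "x \<in> H" for x
    using mult_left_mono[of "norm (T x)" "L * norm x" "cmod c"] that by (simp add: norm_scaleC_hilbert)
  then show "\<exists>K. \<forall>x\<in>H. norm (c *\<^sub>C T x) \<le> K * norm x" by blast
qed (auto simp: bounded_opD[OF T] scaleC_add_right mult.commute)

lemma bounded_op_add:
  assumes H: "closed_csubspace H" and S: "bounded_op H S" and T: "bounded_op H T"
  shows "bounded_op H (\<lambda>x. S x + T x)"
  unfolding bounded_op_def
proof (intro conjI ballI allI)
  note Sd = bounded_opD[OF S] and Td = bounded_opD[OF T]
  show "(\<lambda>x. S x + T x) ` H \<subseteq> H" using closed_csubspaceD(3)[OF H Sd(1) Td(1)] by blast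
  obtain K L where KL: "\<forall>x\<in>H. norm (S x) \<le> K * norm x" "\<forall>x\<in>H. norm (T x) \<le> L * norm x"
    using Sd(4) Td(4) by blast
  have "norm (S x + T x) \<le> (K + L) * norm x" if "x \<in> H" for x
    using KL that norm_triangle_ineq[of "S x" "T x"] by (fastforce simp: distrib_right)
  then show "\<exists>K. \<forall>x\<in>H. norm (S x + T x) \<le> K * norm x" by blast
qed (simp_all add: bounded_opD[OF S] bounded_opD[OF T] scaleC_add_right)

lemma bounded_op_average:
  assumes H: "closed_csubspace H" and T: "\<And>n. bounded_op H (T n)"
    and K: "\<And>n x. x \<in> H \<Longrightarrow> norm (T n x) \<le> K * norm x"
  shows "bounded_op H (\<lambda>x. (1 / real N) *\<^sub>R (\<Sum>n<N. T n x))"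
    and "x \<in> H \<Longrightarrow> norm ((1 / real N) *\<^sub>R (\<Sum>n<N. T n x)) \<le> K * norm x"
proof -
  note Td = bounded_opD[OF T] and Hs = closed_csubspaceD[OF H]
  have bd: "norm ((1 / real N) *\<^sub>R (\<Sum>n<N. T n x)) \<le> K * norm x" if x: "x \<in> H" for x
  proof -
    have "0 \<le> K * norm x" using K[OF x, of 0] norm_ge_zero order_trans by blast
    moreover have "norm (\<Sum>n<N. T n x) \<le> real N * (K * norm x)"
      using sum_norm_le[of "{..<N}" "\<lambda>n. T n x" "\<lambda>_. K * norm x"] K[OF x] by simp
    ultimately show ?thesis by (cases "N = 0") (simp_all add: divide_le_eq mult.commute)
  qed
  then show "x \<in> H \<Longrightarrow> norm ((1 / real N) *\<^sub>R (\<Sum>n<N. T n x)) \<le> K * norm x" .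
  show "bounded_op H (\<lambda>x. (1 / real N) *\<^sub>R (\<Sum>n<N. T n x))"
    unfolding bounded_op_def
  proof (intro conjI ballI allI exI[of _ K] bd)
    show "(\<lambda>x. (1 / real N) *\<^sub>R (\<Sum>n<N. T n x)) ` H \<subseteq> H" by (auto intro!: Hs(7,8) Td(1))
  qed (simp_all add: Td(2,3) sum.distrib scaleC_add_right scaleR_scaleC scaleC_sum_right[symmetric] mult.commute)
qed

section \<open>The positive cone of a C*-algebra\<close>

lemma star_zero [simp]: "star (0::'a::cstar_algebra) = 0"
  using star_add[of 0 "0::'a"] by simp

lemma star_minus [simp]: "star (- x) = - star (x::'a::cstar_algebra)"
  using star_add[of x "- x"] by (simp add: eq_neg_iff_add_eq_0 add.commute)

lemma star_diff: "star (x - y) = star x - star (y::'a::cstar_algebra)"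
  using star_add[of x "- y"] by simp

lemma star_one [simp]: "star (1::'a::cstar_algebra) = 1"
  by (metis star_star star_mult mult_1 mult_1_right)

lemma star_scaleR [simp]: "star (r *\<^sub>R x) = r *\<^sub>R star (x::'a::cstar_algebra)"
  by (simp add: scaleR_scaleC star_scaleC)

lemma star_power: "star (x ^ n) = star (x::'a::cstar_algebra) ^ n"
  by (induction n) (auto simp: star_mult power_commutes)

lemma norm_star [simp]: "norm (star x) = norm (x::'a::cstar_algebra)"
proof -
  have le: "norm y \<le> norm (star y)" for y :: 'a
  proof (cases "y = 0")
    case False
    have "norm y * norm y \<le> norm (star y) * norm y"
      using cstar_identity[of y] norm_mult_ineq[of "star y" y] by (simp add: power2_eq_square)
    then show ?thesis using False by simp
  qed simp
  show ?thesis using le[of x] le[of "star x"] by (simp add: star_star)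
qed

lemma bounded_linear_star: "bounded_linear (star :: 'a::cstar_algebra \<Rightarrow> 'a)"
  by (rule bounded_linear_intro[of _ 1]) (auto simp: star_add)

lemmas tendsto_star = bounded_linear.tendsto[OF bounded_linear_star]

lemma norm_selfadjoint_square: "star x = x \<Longrightarrow> norm (x * x) = (norm (x::'a::cstar_algebra))\<^sup>2"
  using cstar_identity[of x] by simp

text \<open>The C*-identity gives equality for exponents \<open>2 ^ j\<close>. A general
  \<open>m\<close> is padded to \<open>2 ^ m\<close>: a strict inequality at \<open>m\<close> would
  contradict submultiplicativity there.\<close>

lemma norm_selfadjoint_power:
  fixes x :: "'a::cstar_algebra"
  assumes "star x = x"
  shows "norm (x ^ m) = norm x ^ m"
proof -
  have two: "norm (x ^ (2 ^ j)) = norm x ^ (2 ^ j)" for j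
  proof (induction j)
    case (Suc j)
    have "norm (x ^ 2 ^ Suc j) = norm (x ^ 2 ^ j * x ^ 2 ^ j)"
      by (simp add: power_add[symmetric] mult_2)
    also have "\<dots> = (norm (x ^ 2 ^ j))\<^sup>2"
      by (rule norm_selfadjoint_square) (simp add: star_power assms)
    finally show ?case using Suc by (simp add: power_mult[symmetric] mult.commute)
  qed simp
  show ?thesis
  proof (cases "x = 0")
    case False
    have m: "m \<le> 2 ^ m" by (rule less_imp_le[OF less_exp])
    have "norm x ^ m * norm x ^ (2 ^ m - m) = norm (x ^ m * x ^ (2 ^ m - m))"
      using two[of m] m by (simp add: power_add[symmetric])
    also have "\<dots> \<le> norm (x ^ m) * norm (x ^ (2 ^ m - m))" by (rule norm_mult_ineq)
    also have "\<dots> \<le> norm (x ^ m) * norm x ^ (2 ^ m - m)"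
      by (intro mult_left_mono norm_power_ineq) simp
    finally have "norm x ^ m \<le> norm (x ^ m)" using False by simp
    then show ?thesis using norm_power_ineq[of x m] by simp
  qed (cases m; simp)
qed

subsection \<open>The square root of \<open>1 - x\<close>\<close>

definition sqrt_coeff :: "nat \<Rightarrow> real" where
  "sqrt_coeff n = (-1) ^ n * ((1/2) gchoose n)"

definition sqrt_one_minus :: "'a::cstar_algebra \<Rightarrow> 'a" where
  "sqrt_one_minus x = (\<Sum>n. sqrt_coeff n *\<^sub>R x ^ n)"

lemma sqrt_coeff_bound: "\<bar>sqrt_coeff n\<bar> \<le> 1"
proof (induction n)
  case (Suc n)
  have "\<bar>(1/2::real) gchoose Suc n\<bar> = \<bar>(1/2) gchoose n\<bar> * (\<bar>1/2 - real n\<bar> / real (Suc n))"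
  proof -
    have "real (Suc n) * ((1/2) gchoose Suc n) = (1/2 - real n) * ((1/2) gchoose n)"
      using gbinomial_absorb_comp[of "1/2::real" n] gbinomial_mult_1[of "1/2::real" n]
      by (simp add: algebra_simps)
    then have "(1/2) gchoose Suc n = (1/2 - real n) * ((1/2) gchoose n) / real (Suc n)"
      by (simp add: field_simps)
    then show ?thesis by (simp add: abs_mult)
  qed
  also have "\<dots> \<le> 1 * 1"
    using Suc by (intro mult_mono) (auto simp: sqrt_coeff_def abs_mult divide_simps)
  finally show ?case by (simp add: sqrt_coeff_def abs_mult)
qed (simp add: sqrt_coeff_def)

text \<open>Vandermonde's identity at \<open>1/2 + 1/2 = 1\<close>: these are the coefficients of
  the power series of \<open>sqrt (1 - x)\<close>, whose square is \<open>1 - x\<close>.\<close>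

lemma sqrt_coeff_convolution:
  "(\<Sum>i\<le>k. sqrt_coeff i * sqrt_coeff (k - i)) = (if k = 0 then 1 else if k = 1 then - 1 else 0)"
proof -
  have "(\<Sum>i\<le>k. sqrt_coeff i * sqrt_coeff (k - i))
      = (-1) ^ k * (\<Sum>i\<le>k. ((1/2) gchoose i) * ((1/2) gchoose (k - i)))"
    unfolding sum_distrib_left
  proof (rule sum.cong[OF refl])
    fix i assume "i \<in> {..k}"
    then have "(-1 :: real) ^ k = (-1) ^ i * (-1) ^ (k - i)" by (simp add: power_add[symmetric])
    then show "sqrt_coeff i * sqrt_coeff (k - i)
        = (-1) ^ k * (((1/2) gchoose i) * ((1/2) gchoose (k - i)))"
      by (simp add: sqrt_coeff_def)
  qed
  also have "\<dots> = (-1) ^ k * ((1::real) gchoose k)"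
    using gbinomial_Vandermonde[of "1/2::real" "1/2" k] by (simp add: atMost_atLeast0)
  also have "(1::real) gchoose k = of_nat (1 choose k)"
    using binomial_gbinomial[of 1 k, where 'a=real] by simp
  finally show ?thesis by (cases k) (auto simp: binomial_eq_0_iff)
qed

lemma summable_sqrt_series:
  fixes x :: "'a::cstar_algebra"
  assumes "norm x < 1"
  shows "summable (\<lambda>n. norm (sqrt_coeff n *\<^sub>R x ^ n))"
proof (rule summable_comparison_test')
  show "summable (\<lambda>n. norm x ^ n)" using assms by (intro summable_geometric) simp
  fix n show "norm (norm (sqrt_coeff n *\<^sub>R x ^ n)) \<le> norm x ^ n"
    using mult_mono[OF sqrt_coeff_bound[of n] norm_power_ineq[of x n]] by simp
qed

lemma sqrt_one_minus_square:
  fixes x :: "'a::cstar_algebra"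
  assumes "norm x < 1"
  shows "sqrt_one_minus x * sqrt_one_minus x = 1 - x"
proof -
  have eq: "(\<Sum>i\<le>k. (sqrt_coeff i *\<^sub>R x ^ i) * (sqrt_coeff (k - i) *\<^sub>R x ^ (k - i)))
      = (if k = 0 then 1 else if k = 1 then - x else 0)" for k
  proof -
    have "(\<Sum>i\<le>k. (sqrt_coeff i *\<^sub>R x ^ i) * (sqrt_coeff (k - i) *\<^sub>R x ^ (k - i)))
        = (\<Sum>i\<le>k. sqrt_coeff i * sqrt_coeff (k - i)) *\<^sub>R x ^ k"
      unfolding scaleR_sum_left by (rule sum.cong) (auto simp: power_add[symmetric] mult.commute)
    then show ?thesis by (simp add: sqrt_coeff_convolution)
  qed
  have "(\<lambda>k. if k = 0 then 1 else if k = 1 then - x else 0)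
      sums (sqrt_one_minus x * sqrt_one_minus x)"
    using Cauchy_product_sums[OF summable_sqrt_series summable_sqrt_series, OF assms assms]
    unfolding eq sqrt_one_minus_def .
  moreover have "(\<lambda>k. if k = 0 then 1 else if k = 1 then - x else 0)
      sums (\<Sum>k\<in>{0,1}. if k = 0 then 1 else if k = (1::nat) then - x else 0)"
    by (rule sums_finite) auto
  ultimately show ?thesis by (simp add: sums_iff)
qed

lemma star_sqrt_one_minus:
  fixes x :: "'a::cstar_algebra"
  assumes "norm x < 1" "star x = x"
  shows "star (sqrt_one_minus x) = sqrt_one_minus x"
  using bounded_linear.suminf[OF bounded_linear_star summable_norm_cancel[OF summable_sqrt_series[OF assms(1)]]]
  by (simp add: sqrt_one_minus_def star_power assms(2))

lemma commute_sqrt_one_minus: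
  fixes x :: "'a::cstar_algebra"
  assumes "norm x < 1" "y * x = x * y"
  shows "y * sqrt_one_minus x = sqrt_one_minus x * y"
proof -
  note s = summable_norm_cancel[OF summable_sqrt_series[OF assms(1)]]
  have c: "y * x ^ n = x ^ n * y" for n
    by (induction n) (simp_all add: assms(2) mult.assoc[symmetric], simp add: mult.assoc assms(2))
  show ?thesis
    unfolding sqrt_one_minus_def
    using bounded_linear.suminf[OF bounded_linear_mult_right s, of y]
      bounded_linear.suminf[OF bounded_linear_mult_left s, of y]
    by (simp add: c)
qed

lemma star_mult_commuting:
  fixes h k :: "'a::cstar_algebra"
  assumes "star h = h" "star k = k" "h * k = k * h"
  shows "star (h + \<i> *\<^sub>C k) * (h + \<i> *\<^sub>C k) = h * h + k * k"
proof -
  have "star (h + \<i> *\<^sub>C k) * (h + \<i> *\<^sub>C k) = h * h + \<i> *\<^sub>C (h * k) - \<i> *\<^sub>C (k * h) + k * k"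
    by (simp add: star_add star_scaleC assms(1,2) distrib_left distrib_right left_diff_distrib
        mult_scaleC_left mult_scaleC_right scaleC_diff_right scaleC_add_right)
  then show ?thesis by (simp add: assms(3))
qed

text \<open>For \<open>norm k < 1\<close> the element \<open>u = k + \<i> *\<^sub>C s\<close> with
  \<open>s * s = 1 - k * k\<close> satisfies \<open>star u * u = 1\<close>, so
  \<open>norm u = 1\<close>; as \<open>s\<close> is the imaginary part of \<open>u\<close>,
  \<open>norm s \<le> 1\<close>. The case \<open>norm h = 1\<close> follows by shrinking
  \<open>h\<close>.\<close>

lemma norm_one_minus_square:
  fixes h :: "'a::cstar_algebra"
  assumes h: "star h = h" "norm h \<le> 1"
  shows "norm (1 - h * h) \<le> 1"
proof -
  have strict: "norm (1 - k * k) \<le> 1" if k: "star k = k" "norm k < 1" for k :: 'a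
  proof -
    have kk: "norm (k * k) < 1"
      using k by (simp add: norm_selfadjoint_square power_less_one_iff)
    define s where "s = sqrt_one_minus (k * k)"
    have s: "star s = s" "s * s = 1 - k * k" "k * s = s * k"
      using kk k(1) by (auto simp: s_def star_sqrt_one_minus sqrt_one_minus_square star_mult
          commute_sqrt_one_minus mult.assoc)
    define u where "u = k + \<i> *\<^sub>C s"
    have su: "star u = k - \<i> *\<^sub>C s" by (simp add: u_def star_add star_scaleC k s)
    have "star u * u = 1"
      unfolding u_def using star_mult_commuting[OF k(1) s(1,3)] s(2) by simp
    then have "norm u = 1" using cstar_identity[of u] norm_ge_zero[of u] by (auto simp: power2_eq_1_iff simp del: norm_ge_zero)
    moreover have "(2 * \<i>) *\<^sub>C s = u - star u"
      unfolding su by (simp add: u_def scaleC_add_left[symmetric])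
    then have "norm ((2 * \<i>) *\<^sub>C s) = norm (u - star u)" by simp
    then have "2 * norm s \<le> norm u + norm (star u)"
      using norm_triangle_ineq4[of u "star u"] by (simp add: norm_scaleC norm_mult)
    ultimately have "norm s \<le> 1" by simp
    then have "(norm s)\<^sup>2 \<le> 1" by (simp add: power_le_one)
    then show ?thesis using norm_selfadjoint_square[OF s(1)] s(2) by simp
  qed
  define r where "r n = (1 - inverse (real (Suc n)))" for n
  have r: "r \<longlonglongrightarrow> 1"
    unfolding r_def using tendsto_diff[OF tendsto_const LIMSEQ_inverse_real_of_nat, of 1] by simp
  have "norm (1 - (r n *\<^sub>R h) * (r n *\<^sub>R h)) \<le> 1" for n
  proof (rule strict)
    have "\<bar>r n\<bar> < 1" by (simp add: r_def field_simps)
    then have "\<bar>r n\<bar> * norm h < 1" using h(2) by (smt (verit) mult_left_le norm_ge_zero abs_ge_zero)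
    then show "norm (r n *\<^sub>R h) < 1" by simp
  qed (simp add: h)
  moreover have "(\<lambda>n. norm (1 - (r n *\<^sub>R h) * (r n *\<^sub>R h))) \<longlonglongrightarrow> norm (1 - (1 *\<^sub>R h) * (1 *\<^sub>R h))"
    by (intro tendsto_intros r)
  ultimately show ?thesis by (intro LIMSEQ_le_const2) (auto)
qed

subsection \<open>The cone\<close>

text \<open>For self-adjoint \<open>a\<close>, \<open>norm (t *\<^sub>R 1 - a) \<le> t\<close> means that the spectrum lies in \<open>[0, 2 t]\<close>.\<close>

definition cpos :: "'a::cstar_algebra \<Rightarrow> bool" where
  "cpos a \<longleftrightarrow> star a = a \<and> (\<exists>t. norm (t *\<^sub>R 1 - a) \<le> t)"

lemma cposI: "star a = a \<Longrightarrow> norm (t *\<^sub>R 1 - a) \<le> t \<Longrightarrow> cpos a"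
  by (auto simp: cpos_def)

lemma cpos_star: "cpos a \<Longrightarrow> star a = a"
  by (simp add: cpos_def)

text \<open>The triangle inequality, with the two witnesses added. That sums are immediate is the
  gain of describing positivity by norms.\<close>

lemma cpos_add:
  assumes "cpos a" "cpos b" shows "cpos (a + b)"
proof -
  obtain s t where st: "norm (s *\<^sub>R 1 - a) \<le> s" "norm (t *\<^sub>R 1 - b) \<le> t"
    using assms by (auto simp: cpos_def)
  have "norm ((s + t) *\<^sub>R 1 - (a + b)) \<le> norm (s *\<^sub>R 1 - a) + norm (t *\<^sub>R 1 - b)"
    using norm_triangle_ineq[of "s *\<^sub>R 1 - a" "t *\<^sub>R 1 - b"] by (simp add: algebra_simps)
  then show ?thesis
    using st assms by (intro cposI[of _ "s + t"]) (auto simp: star_add cpos_star)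
qed

lemma cpos_scaleR:
  assumes "cpos a" "r \<ge> 0" shows "cpos (r *\<^sub>R a)"
proof -
  obtain t where t: "norm (t *\<^sub>R 1 - a) \<le> t" using assms by (auto simp: cpos_def)
  have "(r * t) *\<^sub>R 1 - r *\<^sub>R a = r *\<^sub>R (t *\<^sub>R 1 - a)" by (simp add: algebra_simps)
  then have "norm ((r * t) *\<^sub>R 1 - r *\<^sub>R a) \<le> r * t"
    using t assms(2) by (simp add: mult_left_mono)
  then show ?thesis using assms by (intro cposI[of _ "r * t"]) (auto simp: cpos_star)
qed

lemma cpos_scalar_iff: "cpos (r *\<^sub>R (1::'a::cstar_algebra)) \<longleftrightarrow> r \<ge> 0"
proof
  assume "cpos (r *\<^sub>R (1::'a))"
  then obtain t where "norm (t *\<^sub>R 1 - r *\<^sub>R (1::'a)) \<le> t" by (auto simp: cpos_def)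
  then have "\<bar>t - r\<bar> \<le> t" by (simp flip: scaleR_diff_left)
  then show "r \<ge> 0" by simp
qed (auto intro!: cposI[of _ r])

lemma cpos_zero [simp]: "cpos 0" and cpos_one [simp]: "cpos 1"
  using cpos_scalar_iff[of 0] cpos_scalar_iff[of 1] by auto

lemma cpos_sum: "(\<And>i. i \<in> I \<Longrightarrow> cpos (f i)) \<Longrightarrow> cpos (\<Sum>i\<in>I. f i)"
  by (induction I rule: infinite_finite_induct) (auto intro: cpos_add)

lemma cpos_norm_minus: "star a = a \<Longrightarrow> norm a \<le> t \<Longrightarrow> cpos (t *\<^sub>R 1 - a)"
  by (rule cposI[of _ t]) (auto simp: star_diff)

text \<open>The shift by \<open>e\<close> puts \<open>(t - a) / (t + e)\<close> strictly inside the
  unit ball, where the square root series converges. As a norm limit of polynomials in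
  \<open>a\<close>, \<open>h\<close> commutes with whatever commutes with \<open>a\<close>.\<close>

lemma cpos_sqrt:
  assumes a: "cpos a" and e: "e > 0"
  shows "\<exists>h. star h = h \<and> h * h = a + e *\<^sub>R 1 \<and> (\<forall>y. y * a = a * y \<longrightarrow> y * h = h * y)"
proof -
  obtain t where t: "norm (t *\<^sub>R 1 - a) \<le> t" using a by (auto simp: cpos_def)
  have t0: "t \<ge> 0" using t norm_ge_zero order_trans by blast
  define T where "T = t + e"
  have T: "T > 0" using t0 e by (simp add: T_def)
  define x where "x = (1 / T) *\<^sub>R (t *\<^sub>R 1 - a)"
  have "norm x \<le> t / T" using t T by (simp add: x_def divide_right_mono)
  also have "\<dots> < 1" using T e by (simp add: T_def)
  finally have x: "norm x < 1" .
  have sx: "star x = x" using a by (simp add: x_def star_diff cpos_star)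
  define h where "h = sqrt T *\<^sub>R sqrt_one_minus x"
  have "1 - x = (1 / T) *\<^sub>R (T *\<^sub>R 1 - (t *\<^sub>R 1 - a))" using T by (simp add: x_def scaleR_diff_right)
  also have "\<dots> = (1 / T) *\<^sub>R (a + e *\<^sub>R 1)" by (simp add: T_def algebra_simps)
  finally have hh: "h * h = a + e *\<^sub>R 1"
    using T by (simp add: h_def sqrt_one_minus_square[OF x])
  have "y * h = h * y" if "y * a = a * y" for y
  proof -
    have "y * x = x * y" by (simp add: x_def algebra_simps that)
    from commute_sqrt_one_minus[OF x this] show ?thesis by (simp add: h_def)
  qed
  moreover have "star h = h" by (simp add: h_def star_sqrt_one_minus[OF x sx])
  ultimately show ?thesis using hh by blast
qed

lemma cpos_square_norm:
  fixes h :: "'a::cstar_algebra"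
  assumes "star h = h"
  shows "norm ((norm h)\<^sup>2 *\<^sub>R 1 - h * h) \<le> (norm h)\<^sup>2"
proof (cases "h = 0")
  case False
  define k where "k = (1 / norm h) *\<^sub>R h"
  have "norm (1 - k * k) \<le> 1"
    using False assms by (intro norm_one_minus_square) (auto simp: k_def)
  moreover have "(norm h)\<^sup>2 *\<^sub>R 1 - h * h = (norm h)\<^sup>2 *\<^sub>R (1 - k * k)"
    using False by (simp add: k_def scaleR_diff_right power2_eq_square)
  ultimately show ?thesis by (simp add: mult_left_le)
qed simp

lemma cpos_square: "star h = h \<Longrightarrow> cpos (h * h)"
  by (rule cposI[OF _ cpos_square_norm]) (auto simp: star_mult)

lemma tendsto_eps: "(\<lambda>n. x + inverse (real (Suc n)) *\<^sub>R y) \<longlonglongrightarrow> (x :: 'a::real_normed_vector)"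
  using tendsto_add[OF tendsto_const tendsto_scaleR[OF LIMSEQ_inverse_real_of_nat tendsto_const], of x y]
  by simp

text \<open>The witness \<open>t\<close> of \<open>cpos\<close> can always be \<open>norm a\<close>:
  for a square this is \<open>cpos_square_norm\<close>, and \<open>a\<close> is the limit of the
  squares \<open>a + e\<close>. A witness depending continuously on \<open>a\<close> is what makes
  the cone closed.\<close>

lemma cpos_norm:
  assumes "cpos a"
  shows "norm (norm a *\<^sub>R 1 - a) \<le> norm a"
proof -
  define b where "b n = a + inverse (real (Suc n)) *\<^sub>R 1" for n
  have b: "b \<longlonglongrightarrow> a" unfolding b_def by (rule tendsto_eps)
  have "norm (norm (b n) *\<^sub>R 1 - b n) \<le> norm (b n)" for n
  proof -
    have e: "inverse (real (Suc n)) > 0" by simp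
    obtain h where h: "star h = h" "h * h = b n"
      using cpos_sqrt[OF assms e] unfolding b_def by blast
    show ?thesis
      using cpos_square_norm[OF h(1)] norm_selfadjoint_square[OF h(1)] by (simp add: h(2))
  qed
  moreover have "(\<lambda>n. norm (norm (b n) *\<^sub>R 1 - b n)) \<longlonglongrightarrow> norm (norm a *\<^sub>R 1 - a)"
    by (intro tendsto_intros b)
  moreover have "(\<lambda>n. norm (b n)) \<longlonglongrightarrow> norm a"
    by (intro tendsto_intros b)
  ultimately show ?thesis by (intro LIMSEQ_le) auto
qed

lemma cpos_norm':
  assumes "cpos a" "norm a \<le> t"
  shows "norm (t *\<^sub>R 1 - a) \<le> t"
proof -
  have "t *\<^sub>R 1 - a = (t - norm a) *\<^sub>R 1 + (norm a *\<^sub>R 1 - a)" by (simp add: algebra_simps)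
  then have "norm (t *\<^sub>R 1 - a) \<le> norm ((t - norm a) *\<^sub>R (1::'a)) + norm (norm a *\<^sub>R 1 - a)"
    by (simp only: norm_triangle_ineq)
  then show ?thesis using cpos_norm[OF assms(1)] assms(2) by simp
qed

lemma cpos_closed:
  assumes "\<And>n. cpos (f n)" "f \<longlonglongrightarrow> a"
  shows "cpos a"
proof (rule cposI)
  have "(\<lambda>n. star (f n)) \<longlonglongrightarrow> star a" by (rule tendsto_star[OF assms(2)])
  then show "star a = a"
    using assms(2) LIMSEQ_unique by (simp add: cpos_star[OF assms(1)])
  have "(\<lambda>n. norm (norm (f n) *\<^sub>R 1 - f n)) \<longlonglongrightarrow> norm (norm a *\<^sub>R 1 - a)"
    by (intro tendsto_intros assms)
  moreover have "(\<lambda>n. norm (f n)) \<longlonglongrightarrow> norm a"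
    by (intro tendsto_intros assms)
  ultimately show "norm (norm a *\<^sub>R 1 - a) \<le> norm a"
    using cpos_norm[OF assms(1)] by (intro LIMSEQ_le) auto
qed

lemma cpos_eps: "(\<And>e. e > 0 \<Longrightarrow> cpos (a + e *\<^sub>R b)) \<Longrightarrow> cpos a"
  by (rule cpos_closed[OF _ tendsto_eps[of a b]]) simp

text \<open>After a small shift both factors have self-adjoint square roots \<open>h\<close> and
  \<open>k\<close>, which commute, so the product is the square of the self-adjoint
  \<open>h * k\<close>.\<close>

lemma cpos_mult:
  assumes a: "cpos a" and b: "cpos b" and c: "a * b = b * a"
  shows "cpos (a * b)"
proof -
  have "cpos ((a + inverse (real (Suc n)) *\<^sub>R 1) * (b + inverse (real (Suc n)) *\<^sub>R 1))" for n
  proof -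
    define e where "e = inverse (real (Suc n))"
    have e: "e > 0" by (simp add: e_def)
    obtain h where h: "star h = h" "h * h = a + e *\<^sub>R 1" "\<forall>y. y * a = a * y \<longrightarrow> y * h = h * y"
      using cpos_sqrt[OF a e] by blast
    obtain k where k: "star k = k" "k * k = b + e *\<^sub>R 1" "\<forall>y. y * b = b * y \<longrightarrow> y * k = k * y"
      using cpos_sqrt[OF b e] by blast
    have hk: "h * k = k * h" using h(3)[rule_format, of b] k(3)[rule_format, of h] c by simp
    have "cpos ((h * k) * (h * k))" by (rule cpos_square) (simp add: star_mult h k hk)
    also have "(h * k) * (h * k) = h * (k * h) * k" by (simp add: mult.assoc)
    also have "\<dots> = h * (h * k) * k" by (simp only: hk)
    also have "\<dots> = (h * h) * (k * k)" by (simp add: mult.assoc)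
    finally show ?thesis by (simp add: h k e_def)
  qed
  then show ?thesis
    by (rule cpos_closed) (rule tendsto_mult[OF tendsto_eps tendsto_eps])
qed

text \<open>With commuting roots \<open>h\<close> of \<open>a + e\<close> and \<open>k\<close> of
  \<open>t - a + e\<close>, the element \<open>u = h + \<i> *\<^sub>C k\<close> has
  \<open>star u * u = t + 2 * e\<close>, a scalar. So \<open>norm u\<close> is known, and it bounds
  the norm of the real part \<open>h\<close>.\<close>

lemma cpos_le_norm:
  fixes a :: "'a::cstar_algebra"
  assumes a: "cpos a" and b: "cpos (t *\<^sub>R 1 - a)"
  shows "norm a \<le> t"
proof -
  have t: "t \<ge> 0" using cpos_add[OF a b] by (simp add: cpos_scalar_iff)
  have "norm (a + inverse (real (Suc n)) *\<^sub>R 1) \<le> t + inverse (real (Suc n)) *\<^sub>R 2" for n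
  proof -
    define e where "e = inverse (real (Suc n))"
    have e: "e > 0" by (simp add: e_def)
    obtain h where h: "star h = h" "h * h = a + e *\<^sub>R 1" "\<forall>y. y * a = a * y \<longrightarrow> y * h = h * y"
      using cpos_sqrt[OF a e] by blast
    obtain k where k: "star k = k" "k * k = t *\<^sub>R 1 - a + e *\<^sub>R 1"
        "\<forall>y. y * (t *\<^sub>R 1 - a) = (t *\<^sub>R 1 - a) * y \<longrightarrow> y * k = k * y"
      using cpos_sqrt[OF b e] by blast
    have hk: "h * k = k * h"
      using h(3)[rule_format, of a] k(3)[rule_format, of h] by (simp add: algebra_simps)
    define u where "u = h + \<i> *\<^sub>C k"
    have su: "star u = h - \<i> *\<^sub>C k" by (simp add: u_def star_add star_scaleC h k)
    have "star u * u = (t + 2 * e) *\<^sub>R 1"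
      unfolding u_def using star_mult_commuting[OF h(1) k(1) hk] h(2) k(2)
      by (simp add: algebra_simps scaleR_2[symmetric] flip: scaleR_add_left)
    then have nu: "(norm u)\<^sup>2 = t + 2 * e"
      using cstar_identity[of u] t e by simp
    have "2 *\<^sub>R h = u + star u" unfolding su by (simp add: u_def scaleR_2)
    then have "2 * norm h \<le> norm u + norm (star u)"
      using norm_triangle_ineq[of u "star u"] by (metis abs_numeral norm_scaleR)
    then have "norm h \<le> norm u" by simp
    then have "(norm h)\<^sup>2 \<le> t + 2 * e" using nu by (metis norm_ge_zero power_mono)
    then show ?thesis using norm_selfadjoint_square[OF h(1)] by (simp add: h e_def mult.commute)
  qed
  then show ?thesis
    by (intro LIMSEQ_le[OF tendsto_norm[OF tendsto_eps] tendsto_eps]) auto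
qed

lemma cpos_norm_mono:
  assumes "cpos a" "cpos (b - a)"
  shows "norm a \<le> norm b"
proof (rule cpos_le_norm[OF assms(1)])
  have b: "star b = b" using cpos_star[OF cpos_add[OF assms]] by simp
  show "cpos (norm b *\<^sub>R 1 - a)"
    using cpos_add[OF cpos_norm_minus[OF b order_refl] assms(2)] by simp
qed

section \<open>Inverses of \<open>1 + h\<close> for positive \<open>h\<close>\<close>

lemma neumann_inverse:
  fixes x :: "'a::cstar_algebra"
  assumes "norm x < 1"
  shows "\<exists>y. (1 - x) * y = 1 \<and> y * (1 - x) = 1 \<and> norm y \<le> 1 / (1 - norm x)"
proof -
  have sn: "summable (\<lambda>n. norm x ^ n)" using assms by (intro summable_geometric) simp
  have ns: "summable (\<lambda>n. norm (x ^ n))"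
    by (rule summable_comparison_test'[OF sn]) (simp add: norm_power_ineq)
  note s = summable_norm_cancel[OF ns]
  define y where "y = (\<Sum>n. x ^ n)"
  have "y = 1 + (\<Sum>n. x ^ Suc n)" unfolding y_def using suminf_split_head[OF s] by simp
  then have 1: "(\<Sum>n. x ^ Suc n) = y - 1" by simp
  have "x * y = (\<Sum>n. x ^ Suc n)" "y * x = (\<Sum>n. x ^ Suc n)"
    unfolding y_def using bounded_linear.suminf[OF bounded_linear_mult_right s, of x]
      bounded_linear.suminf[OF bounded_linear_mult_left s, of x]
    by (simp_all add: power_commutes)
  then have 2: "(1 - x) * y = 1" "y * (1 - x) = 1" unfolding 1 by (simp_all add: algebra_simps)
  have "norm y \<le> (\<Sum>n. norm (x ^ n))" unfolding y_def by (rule summable_norm[OF ns])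
  also have "\<dots> \<le> (\<Sum>n. norm x ^ n)" by (intro suminf_le norm_power_ineq ns sn)
  also have "\<dots> = 1 / (1 - norm x)" using assms by (simp add: suminf_geometric)
  finally show ?thesis using 2 by blast
qed

text \<open>A substitute for functional calculus: for positive \<open>h\<close>, both
  \<open>resolvent h\<close> and \<open>1 - resolvent h = h * resolvent h\<close> stay between 0 and
  1, however large \<open>h\<close> is.\<close>

definition resolvent :: "'a::cstar_algebra \<Rightarrow> 'a" where
  "resolvent h = (SOME y. (1 + h) * y = 1 \<and> y * (1 + h) = 1)"

text \<open>With \<open>t = norm h\<close>, dividing \<open>1 + h\<close> by \<open>1 + t\<close>
  gives \<open>1 - x\<close> with \<open>norm x \<le> t / (1 + t)\<close>, by
  \<open>cpos_norm\<close>. The Neumann series bounds the inverse of \<open>1 - x\<close> by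
  \<open>1 + t\<close>, and undoing the scaling turns this bound into 1.\<close>

lemma resolvent:
  fixes h :: "'a::cstar_algebra"
  assumes h: "cpos h"
  shows "(1 + h) * resolvent h = 1" "resolvent h * (1 + h) = 1" "norm (resolvent h) \<le> 1"
    "cpos (resolvent h)" "h * resolvent h = 1 - resolvent h" "resolvent h * h = 1 - resolvent h"
    "cpos (1 - resolvent h)" "norm (1 - resolvent h) \<le> 1" "star (resolvent h) = resolvent h"
proof -
  define t where "t = norm h"
  have t: "t \<ge> 0" by (simp add: t_def)
  define x where "x = (1 / (1 + t)) *\<^sub>R (t *\<^sub>R 1 - h)"
  have nx: "norm x \<le> t / (1 + t)"
    using cpos_norm[OF h] t by (simp add: x_def t_def divide_right_mono)
  have nx1: "norm x < 1"
    using nx t by (meson divide_less_eq_1_pos less_add_same_cancel2 order_le_less_trans zero_less_one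
        add_pos_nonneg)
  have "1 - x = (1 / (1 + t)) *\<^sub>R ((1 + t) *\<^sub>R 1 - (t *\<^sub>R 1 - h))"
    using t by (simp add: x_def scaleR_diff_right)
  then have x: "1 - x = (1 / (1 + t)) *\<^sub>R (1 + h)" by (simp add: algebra_simps)
  obtain y where y: "(1 - x) * y = 1" "y * (1 - x) = 1" "norm y \<le> 1 / (1 - norm x)"
    using neumann_inverse[OF nx1] by blast
  define z where "z = (1 / (1 + t)) *\<^sub>R y"
  have z: "(1 + h) * z = 1" "z * (1 + h) = 1" using y(1,2) unfolding x by (simp_all add: z_def)
  have "\<exists>y. (1 + h) * y = 1 \<and> y * (1 + h) = 1" using z by blast
  then have r: "(1 + h) * resolvent h = 1 \<and> resolvent h * (1 + h) = 1"
    unfolding resolvent_def by (rule someI_ex)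
  show r1: "(1 + h) * resolvent h = 1" and r2: "resolvent h * (1 + h) = 1" using r by auto
  have inv_unique: "u = resolvent h" if "u * (1 + h) = 1" for u
  proof -
    have "u = u * ((1 + h) * resolvent h)" by (simp add: r1)
    also have "\<dots> = resolvent h" by (simp add: that flip: mult.assoc)
    finally show ?thesis .
  qed
  have zr: "z = resolvent h" by (rule inv_unique[OF z(2)])
  have "1 - norm x \<ge> 1 / (1 + t)"
    using nx t by (simp add: field_simps)
  then have "1 / (1 - norm x) \<le> 1 + t"
    using t nx1 by (simp add: field_simps)
  then have "norm y \<le> 1 + t" using y(3) by linarith
  then show nr: "norm (resolvent h) \<le> 1" unfolding zr[symmetric] z_def using t by (simp add: field_simps)
  show hr: "h * resolvent h = 1 - resolvent h" using r1 by (simp add: algebra_simps)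
  show rh: "resolvent h * h = 1 - resolvent h" using r2 by (simp add: algebra_simps)
  have "star ((1 + h) * resolvent h) = 1" by (simp add: r1)
  then have "star (resolvent h) * (1 + h) = 1" by (simp add: star_mult star_add cpos_star[OF h])
  then show sr: "star (resolvent h) = resolvent h" by (rule inv_unique)
  have comm: "h * resolvent h = resolvent h * h" by (simp add: hr rh)
  have sq: "cpos (resolvent h * resolvent h)" by (rule cpos_square[OF sr])
  \<comment> \<open>For the positivity of \<open>resolvent h\<close>, it is written as
    \<open>(1 + h) * resolvent h * resolvent h\<close>, a sum of products of commuting positive
    elements.\<close>
  have "cpos (h * (resolvent h * resolvent h))"
  proof (rule cpos_mult[OF h sq])
    have "h * (resolvent h * resolvent h) = (h * resolvent h) * resolvent h" by (simp add: mult.assoc)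
    also have "\<dots> = resolvent h * (h * resolvent h)" by (simp only: comm mult.assoc)
    also have "\<dots> = (resolvent h * resolvent h) * h" by (simp only: comm mult.assoc)
    finally show "h * (resolvent h * resolvent h) = (resolvent h * resolvent h) * h" .
  qed
  from cpos_add[OF sq this] have "cpos ((1 + h) * resolvent h * resolvent h)"
    by (simp add: algebra_simps)
  then show cr: "cpos (resolvent h)" by (simp add: r1)
  show c1: "cpos (1 - resolvent h)"
    using cpos_mult[OF h cr comm] by (simp add: hr)
  show "norm (1 - resolvent h) \<le> 1"
    by (rule cpos_le_norm[OF c1]) (simp add: cr)
qed

section \<open>Positivity of \<open>star b * b\<close>\<close>

lemma real_part_decomposition:
  fixes x :: "'a::cstar_algebra"
  shows "cpos (star x * x + x * star x)"
proof -
  define p where "p = x + star x"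
  define q where "q = \<i> *\<^sub>C (x - star x)"
  have "star p = p" "star q = q"
    by (simp_all add: p_def q_def star_add star_star star_scaleC star_diff scaleC_diff_right add.commute)
  then have "cpos (p * p + q * q)" by (intro cpos_add cpos_square)
  also have "p * p + q * q = 2 *\<^sub>R (star x * x + x * star x)"
    by (simp add: p_def q_def mult_scaleC_left mult_scaleC_right algebra_simps scaleR_2 scaleC_diff_right)
  finally have "cpos ((1/2) *\<^sub>R (2 *\<^sub>R (star x * x + x * star x)))" by (rule cpos_scaleR) simp
  then show ?thesis by simp
qed

text \<open>The norm of the sum, as a scalar, dominates the sum; subtracting \<open>r\<close> leaves
  a scalar that dominates \<open>P\<close>.\<close>

lemma norm_scalar_add_cpos:
  assumes "cpos P" "r \<ge> 0"
  shows "r + norm P \<le> norm (r *\<^sub>R 1 + P)"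
proof -
  define N where "N = norm (r *\<^sub>R 1 + P)"
  have c: "cpos (r *\<^sub>R 1 + P)" using assms by (intro cpos_add) (auto simp: cpos_scalar_iff)
  have "cpos (N *\<^sub>R 1 - (r *\<^sub>R 1 + P))"
    unfolding N_def by (rule cpos_norm_minus[OF cpos_star[OF c] order_refl])
  also have "N *\<^sub>R 1 - (r *\<^sub>R 1 + P) = (N - r) *\<^sub>R 1 - P" by (simp add: algebra_simps)
  finally have "norm P \<le> N - r" by (rule cpos_le_norm[OF assms(1)])
  then show ?thesis by (simp add: N_def)
qed

text \<open>If \<open>x\<^sup>* x\<close> is nearly negative, then \<open>x x\<^sup>*\<close> is nearly positive; comparing
  \<open>(t - x x\<^sup>*)\<^sup>m x = x (t - x\<^sup>* x)\<^sup>m\<close> for large \<open>m\<close> replaces the usual spectral argument.\<close>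

lemma star_mult_not_negative:
  fixes x :: "'a::cstar_algebra"
  assumes z: "cpos (e *\<^sub>R 1 - star x * x)" and e: "0 \<le> e"
  shows "(norm x)\<^sup>2 \<le> 3 * e"
proof (rule ccontr)
  assume "\<not> ?thesis"
  then have big: "3 * e < (norm x)\<^sup>2" by simp
  define t where "t = (norm x)\<^sup>2"
  define w where "w = x * star x"
  define z where "z = - (star x * x)"
  have sz: "star z = z" by (simp add: z_def star_mult star_star)
  have cz: "cpos (e *\<^sub>R 1 + z)" using z by (simp add: z_def)
  have nz: "norm z = t" by (simp add: z_def t_def cstar_identity)
  have nw: "norm w = t" using cstar_identity[of "star x"] by (simp add: w_def t_def star_star)
  \<comment> \<open>\<open>star x * x + x * star x\<close> is positive and
    \<open>star x * x \<le> e\<close>; hence \<open>w \<ge> - e\<close>.\<close>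
  have "cpos (star x * x + w + (e *\<^sub>R 1 + z))"
    unfolding w_def by (rule cpos_add[OF real_part_decomposition cz])
  then have cw: "cpos (w + e *\<^sub>R 1)" by (simp add: z_def add.commute)
  have "norm (w + e *\<^sub>R 1) \<le> norm w + norm (e *\<^sub>R (1::'a))" by (rule norm_triangle_ineq)
  then have "norm (w + e *\<^sub>R 1) \<le> t + e" using nw e by simp
  from cpos_norm'[OF cw this] have ntw: "norm (t *\<^sub>R 1 - w) \<le> t + e" by (simp add: algebra_simps)
  define s where "s = t *\<^sub>R 1 + z"
  have ss: "star s = s" by (simp add: s_def star_add sz)
  define N where "N = norm s"
  have t: "t > 3 * e" using big by (simp add: t_def)
  have "(t - e) + norm (e *\<^sub>R 1 + z) \<le> norm ((t - e) *\<^sub>R 1 + (e *\<^sub>R 1 + z))"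
    using t e by (intro norm_scalar_add_cpos[OF cz]) simp
  moreover have "(t - e) *\<^sub>R 1 + (e *\<^sub>R 1 + z) = s" by (simp add: s_def algebra_simps)
  moreover have "t - e \<le> norm (e *\<^sub>R 1 + z)"
    using norm_triangle_ineq[of "e *\<^sub>R 1 + z" "- (e *\<^sub>R 1)"] nz e by simp
  ultimately have N: "2 * (t - e) \<le> N" by (simp add: N_def)
  \<comment> \<open>\<open>2 * (t - e) > t + e\<close> amounts to \<open>t > 3 * e\<close>; this is
    the origin of the constant 3.\<close>
  have Ngt: "N > t + e" using N t by simp
  have pw: "(t *\<^sub>R 1 - w) ^ m * x = x * s ^ m" for m
  proof (induction m)
    case (Suc m)
    have "(t *\<^sub>R 1 - w) ^ Suc m * x = (t *\<^sub>R 1 - w) * (x * s ^ m)" by (simp add: mult.assoc Suc)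
    also have "\<dots> = ((t *\<^sub>R 1 - w) * x) * s ^ m" by (simp add: mult.assoc)
    also have "(t *\<^sub>R 1 - w) * x = x * s" by (simp add: w_def s_def z_def algebra_simps)
    finally show ?case by (simp add: mult.assoc)
  qed simp
  \<comment> \<open>In \<open>s ^ Suc m = t *\<^sub>R s ^ m + z * s ^ m\<close> the last term is
    \<open>- (star x * (t - w) ^ m * x)\<close> by \<open>pw\<close> and grows at most like
    \<open>(t + e) ^ m\<close>, whereas \<open>norm (s ^ m) = N ^ m\<close> with
    \<open>N > t + e\<close>.\<close>
  have bound: "N ^ m * (N - t) \<le> t * (t + e) ^ m" for m
  proof -
    have "s ^ Suc m = t *\<^sub>R s ^ m + z * s ^ m" by (simp add: s_def algebra_simps)
    then have "norm (s ^ Suc m) \<le> norm (t *\<^sub>R s ^ m) + norm (z * s ^ m)" by (simp only: norm_triangle_ineq)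
    then have "N ^ Suc m \<le> t * N ^ m + norm (z * s ^ m)"
      unfolding N_def norm_selfadjoint_power[OF ss] using t e by (simp add: norm_selfadjoint_power[OF ss])
    moreover have "norm (z * s ^ m) \<le> t * (t + e) ^ m"
    proof -
      have "z * s ^ m = - (star x * ((t *\<^sub>R 1 - w) ^ m * x))"
        by (simp add: pw z_def mult.assoc)
      then have "norm (z * s ^ m) = norm (star x * ((t *\<^sub>R 1 - w) ^ m * x))" by simp
      also have "\<dots> \<le> norm (star x) * (norm ((t *\<^sub>R 1 - w) ^ m) * norm x)"
        by (intro order_trans[OF norm_mult_ineq] mult_left_mono norm_mult_ineq) simp
      also have "\<dots> \<le> norm x * ((t + e) ^ m * norm x)"
        using order_trans[OF norm_power_ineq power_mono[OF ntw norm_ge_zero]]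
        by (auto intro!: mult_left_mono mult_right_mono)
      also have "\<dots> = t * (t + e) ^ m" by (simp add: t_def power2_eq_square)
      finally show ?thesis .
    qed
    ultimately show ?thesis by (simp add: algebra_simps)
  qed
  have te: "t + e > 0" using t e by simp
  define \<rho> where "\<rho> = N / (t + e)"
  have \<rho>: "\<rho> > 1" using Ngt te by (simp add: \<rho>_def)
  have "\<rho> ^ m \<le> t / (N - t)" for m
  proof -
    have "\<rho> ^ m * (N - t) \<le> t"
      using bound[of m] te by (simp add: \<rho>_def power_divide field_simps)
    then show ?thesis using Ngt e by (simp add: field_simps)
  qed
  moreover obtain m where "t / (N - t) < \<rho> ^ m" using real_arch_pow[OF \<rho>] by blast
  ultimately show False by (simp add: not_le[symmetric])
qed

text \<open>Let \<open>\<theta>\<close> be the least shift that makes \<open>a = star b * b\<close>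
  positive. Were it nonzero, \<open>y = resolvent (n *\<^sub>R c)\<close> with
  \<open>c = a + \<theta>\<close> would concentrate where \<open>a\<close> is close to
  \<open>- \<theta>\<close>. Then \<open>x = b * y\<close> has a nearly negative
  \<open>star x * x\<close>, so \<open>x\<close> is small by \<open>star_mult_not_negative\<close>,
  although the norm of \<open>star x * x = y * a * y\<close> is at least
  \<open>\<theta> - e\<close>.\<close>

lemma cpos_star_mult:
  fixes b :: "'a::cstar_algebra"
  shows "cpos (star b * b)"
proof -
  define a where "a = star b * b"
  have sa: "star a = a" by (simp add: a_def star_mult star_star)
  define S where "S = {\<theta>. 0 \<le> \<theta> \<and> cpos (a + \<theta> *\<^sub>R 1)}"
  have bdd: "bdd_below S" by (rule bdd_belowI[of _ 0]) (simp add: S_def)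
  have "norm a \<in> S"
    using cpos_norm_minus[of "- a" "norm a"] sa by (simp add: S_def add.commute)
  then have ne: "S \<noteq> {}" by blast
  have "closed S"
    unfolding closed_sequential_limits
  proof (intro allI impI, elim conjE)
    fix f l assume f: "\<forall>n. f n \<in> S" "f \<longlonglongrightarrow> l"
    have "(\<lambda>n. a + f n *\<^sub>R 1) \<longlonglongrightarrow> a + l *\<^sub>R 1" by (intro tendsto_intros f)
    moreover have "cpos (a + f n *\<^sub>R 1)" for n using f by (simp add: S_def)
    ultimately have "cpos (a + l *\<^sub>R 1)" by (rule cpos_closed[rotated])
    moreover have "0 \<le> l" by (rule LIMSEQ_le_const[OF f(2)]) (use f in \<open>auto simp: S_def\<close>)
    ultimately show "l \<in> S" by (simp add: S_def)
  qed
  define \<theta> where "\<theta> = Inf S"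
  have "\<theta> \<in> S" unfolding \<theta>_def by (rule closed_contains_Inf[OF ne bdd \<open>closed S\<close>])
  then have \<theta>: "0 \<le> \<theta>" "cpos (a + \<theta> *\<^sub>R 1)" by (auto simp: S_def)
  have min: "\<theta> \<le> \<mu>" if "0 \<le> \<mu>" "cpos (a + \<mu> *\<^sub>R 1)" for \<mu>
    unfolding \<theta>_def by (rule cInf_lower[OF _ bdd]) (use that in \<open>simp add: S_def\<close>)
  have "\<theta> = 0"
  proof (rule ccontr)
    assume "\<theta> \<noteq> 0"
    then have pos: "\<theta> > 0" using \<theta> by simp
    define c where "c = a + \<theta> *\<^sub>R 1"
    have cc: "cpos c" using \<theta> by (simp add: c_def)
    \<comment> \<open>With \<open>e = 1 / n\<close> the final estimates are
      \<open>(norm x)\<^sup>2 \<le> 3 * e\<close> and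
      \<open>(norm x)\<^sup>2 \<ge> \<theta> - e\<close>; they clash as soon as
      \<open>n * \<theta> > 4\<close>.\<close>
    define n where "n = 5 / \<theta>"
    have n: "n > 0" using pos by (simp add: n_def)
    define y where "y = resolvent (n *\<^sub>R c)"
    have cnc: "cpos (n *\<^sub>R c)" using cc n by (intro cpos_scaleR) auto
    note y = resolvent[OF cnc, folded y_def]
    \<comment> \<open>If \<open>norm y = \<rho> < 1\<close>, then
      \<open>n *\<^sub>R c \<ge> 1 / \<rho> - 1 > 0\<close>, so a smaller shift than
      \<open>\<theta>\<close> would already make \<open>a\<close> positive.\<close>
    have ny: "norm y = 1"
    proof (rule ccontr)
      assume "norm y \<noteq> 1"
      then have ny: "norm y < 1" using y(3) by simp
      define \<rho> where "\<rho> = norm y"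
      have "y \<noteq> 0" using y(1) by auto
      then have \<rho>: "0 < \<rho>" "\<rho> < 1" using ny by (auto simp: \<rho>_def)
      have c1: "cpos (1 - (1 / \<rho>) *\<^sub>R y)"
        by (rule cposI[of _ 1]) (use \<rho> y(9) in \<open>auto simp: star_diff \<rho>_def\<close>)
      have "cpos ((1 + n *\<^sub>R c) * (1 - (1 / \<rho>) *\<^sub>R y))"
      proof (rule cpos_mult[OF cpos_add[OF cpos_one cnc] c1])
        have "(1 + n *\<^sub>R c) * y = y * (1 + n *\<^sub>R c)" by (simp only: y(1,2))
        then show "(1 + n *\<^sub>R c) * (1 - (1 / \<rho>) *\<^sub>R y) = (1 - (1 / \<rho>) *\<^sub>R y) * (1 + n *\<^sub>R c)"
          by (simp only: right_diff_distrib left_diff_distrib mult_scaleR_left mult_scaleR_right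
              mult_1 mult_1_right)
      qed
      also have "(1 + n *\<^sub>R c) * (1 - (1 / \<rho>) *\<^sub>R y) = (1 + n *\<^sub>R c) - (1 / \<rho>) *\<^sub>R ((1 + n *\<^sub>R c) * y)"
        by (simp only: right_diff_distrib mult_scaleR_right mult_1_right)
      also have "\<dots> = n *\<^sub>R c - (1 / \<rho> - 1) *\<^sub>R 1" by (simp only: y(1)) (simp add: algebra_simps)
      finally have c2: "cpos (n *\<^sub>R c - (1 / \<rho> - 1) *\<^sub>R 1)" .
      define \<delta> where "\<delta> = min \<theta> ((1 / \<rho> - 1) / n)"
      have \<delta>: "\<delta> > 0" "\<delta> \<le> \<theta>" using \<rho> n pos by (auto simp: \<delta>_def)
      have "cpos ((1 / n) *\<^sub>R (n *\<^sub>R c - (1 / \<rho> - 1) *\<^sub>R 1) + ((1 / \<rho> - 1) / n - \<delta>) *\<^sub>R 1)"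
        using c2 n by (intro cpos_add cpos_scaleR) (auto simp: \<delta>_def)
      also have "(1 / n) *\<^sub>R (n *\<^sub>R c - (1 / \<rho> - 1) *\<^sub>R 1) + ((1 / \<rho> - 1) / n - \<delta>) *\<^sub>R 1
          = a + (\<theta> - \<delta>) *\<^sub>R 1"
      proof -
        have "(1 / n) *\<^sub>R (n *\<^sub>R c - k *\<^sub>R 1) + (k / n - \<delta>) *\<^sub>R 1 = c - \<delta> *\<^sub>R 1" for k
          using n by (simp add: algebra_simps)
        from this[of "1 / \<rho> - 1"] show ?thesis by (simp only:) (simp add: c_def algebra_simps)
      qed
      finally have "\<theta> \<le> \<theta> - \<delta>" using \<delta> by (intro min) auto
      then show False using \<delta> by simp
    qed
    define e where "e = 1 / n"
    have e: "e = \<theta> / 5" using pos by (simp add: e_def n_def)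
    define x where "x = b * y"
    have cy: "c * y = e *\<^sub>R (1 - y)" using y(5) n by (simp add: e_def) (metis (no_types, lifting)
        divide_inverse less_irrefl mult_1 mult_scaleR_left scaleR_left_imp_eq scaleR_one scaleR_scaleR
        right_inverse)
    have yc: "y * c = e *\<^sub>R (1 - y)" using y(6) n by (simp add: e_def) (metis (no_types, lifting)
        divide_inverse less_irrefl mult_1 mult_scaleR_right scaleR_left_imp_eq scaleR_one scaleR_scaleR
        right_inverse)
    have "star x * x = y * a * y" by (simp add: x_def star_mult y(9) a_def mult.assoc)
    also have "a = c - \<theta> *\<^sub>R 1" by (simp add: c_def)
    also have "y * (c - \<theta> *\<^sub>R 1) * y = e *\<^sub>R ((1 - y) * y) - \<theta> *\<^sub>R (y * y)"
      by (simp add: right_diff_distrib left_diff_distrib yc)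
    finally have xx: "star x * x = e *\<^sub>R ((1 - y) * y) - \<theta> *\<^sub>R (y * y)" .
    have n1: "norm ((1 - y) * y) \<le> 1"
      using order_trans[OF norm_mult_ineq mult_mono[OF y(8) y(3)]] by simp
    have s1: "star ((1 - y) * y) = (1 - y) * y" by (simp add: star_mult star_diff y(9) algebra_simps)
    have "cpos (e *\<^sub>R (1 *\<^sub>R 1 - (1 - y) * y) + \<theta> *\<^sub>R (y * y))"
      using pos e y(9) by (intro cpos_add cpos_scaleR cpos_norm_minus[OF s1 n1] cpos_square) auto
    also have "e *\<^sub>R (1 *\<^sub>R 1 - (1 - y) * y) + \<theta> *\<^sub>R (y * y) = e *\<^sub>R 1 - star x * x"
      by (simp add: xx algebra_simps)
    finally have "(norm x)\<^sup>2 \<le> 3 * e" by (rule star_mult_not_negative) (use e pos in simp)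
    moreover have "(norm x)\<^sup>2 \<ge> \<theta> - e"
    proof -
      have "\<theta> = norm (\<theta> *\<^sub>R (y * y))" using norm_selfadjoint_square[OF y(9)] ny pos by simp
      also have "\<theta> *\<^sub>R (y * y) = e *\<^sub>R ((1 - y) * y) - star x * x" by (simp add: xx)
      also have "norm \<dots> \<le> norm (e *\<^sub>R ((1 - y) * y)) + norm (star x * x)" by (rule norm_triangle_ineq4)
      also have "\<dots> \<le> e * 1 + (norm x)\<^sup>2"
        using e pos n1 by (simp add: cstar_identity mult_left_le)
      finally show ?thesis by simp
    qed
    ultimately show False using e pos by simp
  qed
  then show ?thesis using \<theta>(2) by (simp add: a_def)
qed

text \<open>A square root \<open>h\<close> of \<open>a + e\<close> turns the product into
  \<open>star (h * b) * (h * b)\<close>; then \<open>e\<close> tends to 0.\<close>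

lemma cpos_sandwich:
  fixes a :: "'a::cstar_algebra"
  assumes "cpos a"
  shows "cpos (star b * a * b)"
proof (rule cpos_eps)
  fix e :: real assume "e > 0"
  then obtain h where h: "star h = h" "h * h = a + e *\<^sub>R 1" using cpos_sqrt[OF assms] by blast
  have "cpos (star (h * b) * (h * b))" by (rule cpos_star_mult)
  also have "star (h * b) * (h * b) = star b * (h * h) * b" by (simp add: star_mult h(1) mult.assoc)
  also have "\<dots> = star b * a * b + e *\<^sub>R (star b * b)" by (simp add: h(2) algebra_simps)
  finally show "cpos (star b * a * b + e *\<^sub>R (star b * b))" .
qed

text \<open>The resolvent identity in both orders, \<open>r - s = r * d * s\<close> and
  \<open>r = s + s * d * r\<close>, writes the difference as
  \<open>s * d * s + (s * d) * r * (d * s)\<close>, a sum of two sandwiched positive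
  elements.\<close>

lemma resolvent_antimono:
  assumes h: "cpos h" and d: "cpos d"
  shows "cpos (resolvent h - resolvent (h + d))"
proof -
  define r s where "r = resolvent h" and "s = resolvent (h + d)"
  note r = resolvent[OF h, folded r_def] and s = resolvent[OF cpos_add[OF h d], folded s_def]
  have "r * (1 + (h + d)) * s = r" using s(1) by (simp add: mult.assoc add.assoc)
  moreover have "r * (1 + (h + d)) * s = (r * (1 + h)) * s + r * d * s" by (simp add: algebra_simps)
  ultimately have 1: "r - s = r * d * s" by (simp only: r(2)) (simp add: algebra_simps)
  have "s * (1 + (h + d)) * r = r" using s(2) by (simp add: mult.assoc add.assoc)
  moreover have "s * (1 + (h + d)) * r = s * ((1 + h) * r) + s * d * r" by (simp add: algebra_simps)
  ultimately have 2: "r = s + s * d * r" by (simp only: r(1)) simp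
  have "r - s = (s + s * d * r) * d * s" using 1 2 by metis
  also have "\<dots> = star s * d * s + star (d * s) * r * (d * s)"
    by (simp add: star_mult s(9) cpos_star[OF d] algebra_simps)
  finally show ?thesis
    unfolding r_def[symmetric] s_def[symmetric] using cpos_sandwich[OF d] cpos_sandwich[OF r(4)]
    by (simp add: cpos_add)
qed

text \<open>Polarisation around 1: after weighting with \<open>cnj (\<i> ^ j)\<close>, the sum over
  the fourth roots of unity keeps only the term linear in \<open>b\<close>. The scale
  \<open>\<delta>\<close> stays free, to be balanced against the number of summands.\<close>

lemma four_term_polarisation:
  fixes g b :: "'a::cstar_algebra"
  shows "(4 * complex_of_real \<delta>) *\<^sub>C (g * b) =
    (\<Sum>j<4. cnj (\<i> ^ j) *\<^sub>C (star (1 + (\<i> ^ j * of_real \<delta>) *\<^sub>C b) * g * (1 + (\<i> ^ j * of_real \<delta>) *\<^sub>C b)))"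
proof -
  have *: "cnj w *\<^sub>C (star (1 + (w * of_real \<delta>) *\<^sub>C b) * g * (1 + (w * of_real \<delta>) *\<^sub>C b)) =
     cnj w *\<^sub>C (g + (of_real \<delta> * of_real \<delta> * (w * cnj w)) *\<^sub>C (star b * g * b))
     + (of_real \<delta> * (w * cnj w)) *\<^sub>C (g * b) + (of_real \<delta> * (cnj w * cnj w)) *\<^sub>C (star b * g)" for w
    by (simp add: star_add star_scaleC distrib_left distrib_right mult_scaleC_left mult_scaleC_right
        scaleC_add_right mult_ac)
  show ?thesis
    unfolding * by (simp add: eval_nat_numeral lessThan_Suc scaleC_add_left[symmetric] algebra_simps)
qed

text \<open>The trivial bound is \<open>card I\<close>; the square root is what limits the number of
  increments of a bounded monotone sequence that a functional can see. For \<open>cmod w = 1\<close>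
  the element \<open>Z w\<close> is positive and dominated by \<open>Z w + Z (- w)\<close>, of norm
  at most \<open>2 * (1 + \<delta> * \<delta> * card I)\<close>. The choice
  \<open>\<delta> = 1 / sqrt (card I)\<close> makes this 4.\<close>

lemma norm_sum_cpos_mult_le:
  fixes g b :: "'i \<Rightarrow> 'a::cstar_algebra"
  assumes I: "finite I" "I \<noteq> {}" and g: "\<And>i. i \<in> I \<Longrightarrow> cpos (g i)"
    and s: "norm (\<Sum>i\<in>I. g i) \<le> 1" and b: "\<And>i. i \<in> I \<Longrightarrow> norm (b i) \<le> 1"
  shows "norm (\<Sum>i\<in>I. g i * b i) \<le> 4 * sqrt (card I)"
proof -
  define K where "K = real (card I)"
  have K: "K > 0" using I by (simp add: K_def card_gt_0_iff)
  define \<delta> where "\<delta> = 1 / sqrt K"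
  have \<delta>: "\<delta> > 0" "\<delta> * \<delta> * K = 1" using K by (auto simp: \<delta>_def)
  define u where "u w i = 1 + (w * of_real \<delta>) *\<^sub>C b i" for w i
  define Z where "Z w = (\<Sum>i\<in>I. star (u w i) * g i * u w i)" for w
  have cZ: "cpos (Z w)" for w
    unfolding Z_def by (intro cpos_sum cpos_sandwich g)
  have gi: "norm (g i) \<le> 1" if "i \<in> I" for i
  proof -
    have "cpos ((\<Sum>i\<in>I. g i) - g i)"
      using I that g by (subst sum.remove[OF I(1) that]) (auto intro: cpos_sum)
    from cpos_norm_mono[OF g[OF that] this] s show ?thesis by simp
  qed
  have nZ: "norm (Z w) \<le> 4" if w: "cmod w = 1" for w
  proof -
    have ww: "w * cnj w = 1" using w by (simp add: complex_norm_square[symmetric])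
    define W where "W = 2 *\<^sub>R ((\<Sum>i\<in>I. g i) + (\<delta> * \<delta>) *\<^sub>R (\<Sum>i\<in>I. star (b i) * g i * b i))"
    have "star (u w i) * g i * u w i + star (u (- w) i) * g i * u (- w) i
        = 2 *\<^sub>R (g i + (\<delta> * \<delta>) *\<^sub>R (star (b i) * g i * b i))" for i
    proof -
      have "star (u w i) * g i * u w i + star (u (- w) i) * g i * u (- w) i
        = 2 *\<^sub>R g i + 2 *\<^sub>R ((of_real \<delta> * of_real \<delta> * (w * cnj w)) *\<^sub>C (star (b i) * g i * b i))"
        by (simp add: u_def star_add star_scaleC distrib_left distrib_right mult_scaleC_left
            mult_scaleC_right mult_ac star_diff left_diff_distrib right_diff_distrib scaleR_2
            scaleC_add_right scaleC_diff_right)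
      then show ?thesis by (simp add: ww scaleR_scaleC scaleC_add_right)
    qed
    then have "Z w + Z (- w) = W"
      by (simp add: Z_def W_def sum.distrib[symmetric] scaleR_sum_right scaleR_add_right)
    then have "W - Z w = Z (- w)" by (simp add: algebra_simps)
    then have "norm (Z w) \<le> norm W" using cpos_norm_mono[OF cZ, of W w] cZ[of "- w"] by simp
    also have "norm W \<le> 2 * (norm (\<Sum>i\<in>I. g i) + norm ((\<delta> * \<delta>) *\<^sub>R (\<Sum>i\<in>I. star (b i) * g i * b i)))"
      unfolding W_def norm_scaleR[of 2] abs_numeral by (intro mult_left_mono norm_triangle_ineq) simp
    also have "norm ((\<delta> * \<delta>) *\<^sub>R (\<Sum>i\<in>I. star (b i) * g i * b i)) \<le> \<delta> * \<delta> * K"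
    proof -
      have "norm (star (b i) * g i * b i) \<le> 1" if "i \<in> I" for i
      proof -
        have "norm (star (b i) * g i * b i) \<le> norm (star (b i)) * norm (g i) * norm (b i)"
          by (intro order_trans[OF norm_mult_ineq] mult_right_mono norm_mult_ineq) simp
        also have "\<dots> \<le> 1 * 1 * 1" using b[OF that] gi[OF that] by (intro mult_mono) auto
        finally show ?thesis by simp
      qed
      then have "norm (\<Sum>i\<in>I. star (b i) * g i * b i) \<le> K"
        unfolding K_def using sum_norm_le[of I "\<lambda>i. star (b i) * g i * b i" "\<lambda>_. 1"] by simp
      then show ?thesis using mult_left_mono[of _ K "\<delta> * \<delta>"] \<delta>(1) by simp
    qed
    finally show ?thesis using s \<delta> by simp
  qed
  have "(4 * complex_of_real \<delta>) *\<^sub>C (\<Sum>i\<in>I. g i * b i) = (\<Sum>j<4. cnj (\<i> ^ j) *\<^sub>C Z (\<i> ^ j))"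
    unfolding scaleC_sum_right four_term_polarisation Z_def u_def
    by (rule sum.swap)
  also have "norm \<dots> \<le> (\<Sum>j<(4::nat). 4)"
  proof (intro order_trans[OF norm_sum] sum_mono)
    fix j show "norm (cnj (\<i> ^ j) *\<^sub>C Z (\<i> ^ j)) \<le> 4"
      using nZ[of "\<i> ^ j"] by (simp add: norm_scaleC norm_power)
  qed
  finally have "4 * \<delta> * norm (\<Sum>i\<in>I. g i * b i) \<le> 16"
    using \<delta> by (simp add: norm_scaleC norm_mult)
  then show ?thesis using K by (simp add: \<delta>_def K_def field_simps)
qed

section \<open>Covariant GNS representations\<close>

text \<open>A relation instead of a function, since operators are determined only by their values on
  \<open>H\<close>.\<close>

definition adjoint_on :: "'h::chilbert_space set \<Rightarrow> ('h \<Rightarrow> 'h) \<Rightarrow> ('h \<Rightarrow> 'h) \<Rightarrow> bool" where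
  "adjoint_on H T S \<longleftrightarrow> (\<forall>x\<in>H. \<forall>y\<in>H. cinner (T x) y = cinner x (S y))"

definition star_closed_on :: "'h::chilbert_space set \<Rightarrow> ('h \<Rightarrow> 'h) set \<Rightarrow> bool" where
  "star_closed_on H X \<longleftrightarrow> (\<forall>T\<in>X. T ` H \<subseteq> H \<and> (\<exists>S\<in>X. adjoint_on H T S))"

lemma adjoint_onD: "adjoint_on H T S \<Longrightarrow> x \<in> H \<Longrightarrow> y \<in> H \<Longrightarrow> cinner (T x) y = cinner x (S y)"
  by (simp add: adjoint_on_def)

lemma adjoint_onD': "adjoint_on H T S \<Longrightarrow> x \<in> H \<Longrightarrow> y \<in> H \<Longrightarrow> cinner (S x) y = cinner x (T y)"
  unfolding adjoint_on_def by (metis cinner_commute)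

lemma cinner_ext:
  assumes "closed_csubspace H" "u \<in> H" "v \<in> H" "\<And>x. x \<in> H \<Longrightarrow> cinner u x = cinner v x"
  shows "u = v"
proof -
  have "cinner (u - v) (u - v) = 0"
    using assms(4)[OF closed_csubspaceD(5)[OF assms(1-3)]] by (simp add: cinner_diff_left)
  then show ?thesis by simp
qed

lemma commutantD:
  "T \<in> commutant H S \<Longrightarrow> bounded_op H T"
  "T \<in> commutant H S \<Longrightarrow> A \<in> S \<Longrightarrow> x \<in> H \<Longrightarrow> T (A x) = A (T x)"
  by (auto simp: commutant_def)

lemma adjoint_in_commutant:
  assumes H: "closed_csubspace H" and Y: "star_closed_on H Y" and T: "T \<in> commutant H Y"
    and S: "bounded_op H S" "adjoint_on H T S"
  shows "S \<in> commutant H Y"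
  unfolding commutant_def
proof (intro CollectI conjI S ballI)
  fix A x assume A: "A \<in> Y" and x: "x \<in> H"
  obtain B where B: "B \<in> Y" "adjoint_on H A B" using Y A unfolding star_closed_on_def by blast
  have AH: "A y \<in> H" and BH: "B y \<in> H" if "y \<in> H" for y
    using Y A B(1) that unfolding star_closed_on_def by blast+
  note SH = bounded_opD(1)[OF S(1)] and TH = bounded_opD(1)[OF commutantD(1)[OF T]]
  show "S (A x) = A (S x)"
  proof (rule cinner_ext[OF H])
    fix y assume y: "y \<in> H"
    have "cinner (S (A x)) y = cinner (A x) (T y)" by (rule adjoint_onD'[OF S(2) AH[OF x] y])
    also have "\<dots> = cinner x (B (T y))" by (rule adjoint_onD[OF B(2) x TH[OF y]])
    also have "B (T y) = T (B y)" by (rule commutantD(2)[OF T B(1) y, symmetric])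
    also have "cinner x (T (B y)) = cinner (S x) (B y)"
      by (rule adjoint_onD'[OF S(2) x BH[OF y], symmetric])
    also have "\<dots> = cinner (A (S x)) y" by (rule adjoint_onD[OF B(2) SH[OF x] y, symmetric])
    finally show "cinner (S (A x)) y = cinner (A (S x)) y" .
  qed (use AH SH x in auto)
qed

lemma star_closed_commutant:
  assumes H: "closed_csubspace H" and Y: "star_closed_on H Y"
  shows "star_closed_on H (commutant H Y)"
  unfolding star_closed_on_def
proof (intro ballI conjI)
  fix T assume T: "T \<in> commutant H Y"
  show "T ` H \<subseteq> H" using bounded_opD(1)[OF commutantD(1)[OF T]] by blast
  obtain S where S: "bounded_op H S" "adjoint_on H T S"
    using adjoint_exists[OF H commutantD(1)[OF T]] unfolding adjoint_on_def by blast
  show "\<exists>S\<in>commutant H Y. adjoint_on H T S"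
    using adjoint_in_commutant[OF H Y T S] S(2) by blast
qed

locale covariant_system =
  fixes \<beta> :: "'a::cstar_algebra \<Rightarrow> 'a" and \<psi> :: "'a \<Rightarrow> complex"
    and R :: "('a, 'k::chilbert_space) covariant_rep"
  assumes gns: "covariant_gns \<beta> \<psi> R" and state: "\<psi> \<in> states"
begin

abbreviation "H \<equiv> hilb R"
abbreviation "\<pi> \<equiv> rep R"
abbreviation "U \<equiv> evol R"
abbreviation "\<Psi> \<equiv> cyc R"

lemma H: "closed_csubspace H"
  using gns by (simp add: covariant_gns_def)

lemmas H_closed = closed_csubspaceD(1)[OF H]
  and H_zero [simp] = closed_csubspaceD(2)[OF H]
  and H_add = closed_csubspaceD(3)[OF H]
  and H_scaleC = closed_csubspaceD(4)[OF H]
  and H_diff = closed_csubspaceD(5)[OF H]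
  and H_scaleR = closed_csubspaceD(7)[OF H]
  and H_sum = closed_csubspaceD(8)[OF H]

lemma pi_op: "bounded_op H (\<pi> a)"
  using gns by (simp add: covariant_gns_def)

lemmas pi_H [simp] = bounded_opD(1)[OF pi_op]
  and pi_add_right = bounded_opD(2)[OF pi_op]
  and pi_scaleC_right = bounded_opD(3)[OF pi_op]
  and pi_zero_right = bounded_op_linear(1)[OF H pi_op]
  and pi_diff_right = bounded_op_linear(3)[OF H pi_op]

lemma pi_all: "\<forall>x\<in>H.
        (\<forall>a b. \<pi> (a + b) x = \<pi> a x + \<pi> b x) \<and> (\<forall>c a. \<pi> (c *\<^sub>C a) x = c *\<^sub>C \<pi> a x) \<and>
        (\<forall>a b. \<pi> (a * b) x = \<pi> a (\<pi> b x)) \<and> \<pi> 1 x = x \<and>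
        (\<forall>a. \<forall>y\<in>H. cinner (\<pi> a x) y = cinner x (\<pi> (star a) y))"
  using gns unfolding covariant_gns_def by (elim conjE) assumption

lemma pi_add: "x \<in> H \<Longrightarrow> \<pi> (a + b) x = \<pi> a x + \<pi> b x"
  and pi_scaleC: "x \<in> H \<Longrightarrow> \<pi> (c *\<^sub>C a) x = c *\<^sub>C \<pi> a x"
  and pi_mult: "x \<in> H \<Longrightarrow> \<pi> (a * b) x = \<pi> a (\<pi> b x)"
  and pi_one [simp]: "x \<in> H \<Longrightarrow> \<pi> 1 x = x"
  and pi_adjoint: "x \<in> H \<Longrightarrow> y \<in> H \<Longrightarrow> cinner (\<pi> a x) y = cinner x (\<pi> (star a) y)"
  using pi_all by auto

lemma pi_zero [simp]: "x \<in> H \<Longrightarrow> \<pi> 0 x = 0"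
  using pi_add[of x 0 0] by simp

lemma pi_minus: "x \<in> H \<Longrightarrow> \<pi> (- a) x = - \<pi> a x"
  using pi_scaleC[of x "-1" a] by simp

lemma pi_diff: "x \<in> H \<Longrightarrow> \<pi> (a - b) x = \<pi> a x - \<pi> b x"
  using pi_add[of x a "- b"] by (simp add: pi_minus)

lemma pi_scaleR: "x \<in> H \<Longrightarrow> \<pi> (r *\<^sub>R a) x = r *\<^sub>R \<pi> a x"
  by (simp add: scaleR_scaleC pi_scaleC)

lemma pi_sum: "x \<in> H \<Longrightarrow> \<pi> (\<Sum>i\<in>I. f i) x = (\<Sum>i\<in>I. \<pi> (f i) x)"
  by (induction I rule: infinite_finite_induct) (auto simp: pi_add)

lemma Psi_H [simp]: "\<Psi> \<in> H"
  and cyclic: "closure (range (\<lambda>a. \<pi> a \<Psi>)) = H"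
  and psi_eq: "\<psi> a = cinner (\<pi> a \<Psi>) \<Psi>"
  and U_unitary: "unitary_op H U"
  and U_Psi: "U \<Psi> = \<Psi>"
  and covariance: "x \<in> H \<Longrightarrow> U (\<pi> a (inv_into H U x)) = \<pi> (\<beta> a) x"
  using gns by (simp_all add: covariant_gns_def)

lemma psi_star_mult: "\<psi> (star b * a) = cinner (\<pi> a \<Psi>) (\<pi> b \<Psi>)"
  by (simp add: psi_eq pi_mult pi_adjoint star_star)

lemma cinner_Psi: "cinner \<Psi> \<Psi> = 1"
  using psi_eq[of 1] state by (simp add: states_def)

lemma norm_Psi [simp]: "norm \<Psi> = 1"
  using cinner_Psi norm_ge_zero[of \<Psi>] by (auto simp: cinner_self power2_eq_1_iff simp del: norm_ge_zero of_real_power)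

lemma pi_cpos:
  assumes a: "cpos a" and x: "x \<in> H"
  shows "0 \<le> Re (cinner (\<pi> a x) x)"
proof -
  have "0 \<le> Re (cinner (\<pi> a x) x) + e *\<^sub>R (norm x)\<^sup>2" if e: "e > 0" for e
  proof -
    obtain h where h: "star h = h" "h * h = a + e *\<^sub>R 1"
      using cpos_sqrt[OF a e] by blast
    have "cinner (\<pi> (h * h) x) x = cinner (\<pi> h x) (\<pi> h x)"
      using x by (simp add: pi_mult pi_adjoint h(1))
    then have "Re (cinner (\<pi> (h * h) x) x) \<ge> 0" by (simp add: cinner_self del: of_real_power)
    then show ?thesis
      using x by (simp add: h(2) pi_add pi_scaleR cinner_add_left cinner_scaleR_left cinner_self
          del: of_real_power)
  qed
  then show ?thesis by (intro LIMSEQ_le_const[OF tendsto_eps[of _ "(norm x)\<^sup>2"]]) auto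
qed

text \<open>\<open>(norm a)\<^sup>2 - star a * a\<close> is positive, and the representation
  preserves positivity.\<close>

lemma pi_norm: "x \<in> H \<Longrightarrow> norm (\<pi> a x) \<le> norm a * norm x"
proof -
  assume x: "x \<in> H"
  have "cpos ((norm a)\<^sup>2 *\<^sub>R 1 - star a * a)"
    by (rule cpos_norm_minus) (simp_all add: star_mult star_star cstar_identity)
  from pi_cpos[OF this x] have "Re (cinner (\<pi> a x) (\<pi> a x)) \<le> (norm a)\<^sup>2 * (norm x)\<^sup>2"
    using x by (simp add: pi_diff pi_scaleR cinner_diff_left cinner_scaleR_left pi_mult pi_adjoint
        star_star cinner_self del: of_real_power)
  then have "(norm (\<pi> a x))\<^sup>2 \<le> (norm a * norm x)\<^sup>2"
    by (simp add: cinner_self power_mult_distrib del: of_real_power)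
  then show ?thesis by (rule power2_le_imp_le) simp
qed

lemma range_pi_star_closed: "star_closed_on H (range \<pi>)"
  unfolding star_closed_on_def adjoint_on_def using pi_adjoint by fastforce

abbreviation "M' \<equiv> rep_commutant R"

lemma M'_def: "M' = commutant H (range \<pi>)"
  by (simp add: rep_commutant_def)

lemma M'_op: "T \<in> M' \<Longrightarrow> bounded_op H T"
  and M'_commute: "T \<in> M' \<Longrightarrow> x \<in> H \<Longrightarrow> T (\<pi> a x) = \<pi> a (T x)"
  by (auto simp: M'_def commutant_def)

lemma M'_star_closed: "star_closed_on H M'"
  unfolding M'_def by (rule star_closed_commutant[OF H range_pi_star_closed])

lemma M'_I:
  assumes "bounded_op H T" "\<And>a x. x \<in> H \<Longrightarrow> T (\<pi> a x) = \<pi> a (T x)"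
  shows "T \<in> M'"
  using assms by (auto simp: M'_def commutant_def)

end

section \<open>The support of a state and the commutant\<close>

text \<open>Projections in the direct sum \<open>H \<times> H\<close> have four matrix entries that
  are operators on \<open>H\<close>; these will supply elements of the commutant.\<close>

instantiation prod :: (complex_vector, complex_vector) complex_vector
begin

definition scaleC_prod_def: "c *\<^sub>C x = (c *\<^sub>C fst x, c *\<^sub>C snd x)"

instance
  by standard (auto simp: scaleC_prod_def scaleC_add_left scaleC_add_right scaleR_prod_def scaleR_scaleC)

end

lemma fst_scaleC [simp]: "fst (c *\<^sub>C x) = c *\<^sub>C fst x"
  and snd_scaleC [simp]: "snd (c *\<^sub>C x) = c *\<^sub>C snd x"
  by (simp_all add: scaleC_prod_def)

lemma scaleC_Pair [simp]: "c *\<^sub>C (x, y) = (c *\<^sub>C x, c *\<^sub>C y)"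
  by (simp add: scaleC_prod_def)

instantiation prod :: (chilbert_space, chilbert_space) chilbert_space
begin

definition cinner_prod_def: "cinner x y = cinner (fst x) (fst y) + cinner (snd x) (snd y)"

instance
proof
  fix x y z :: "'a \<times> 'b" and c
  show "cinner (x + y) z = cinner x z + cinner y z" "cinner (c *\<^sub>C x) y = c * cinner x y"
    by (simp_all add: cinner_prod_def cinner_add_left cinner_scaleC_left algebra_simps)
  show "cinner x y = cnj (cinner y x)"
    using cinner_commute[of "fst x"] cinner_commute[of "snd x"] by (simp add: cinner_prod_def)
  show "inner x y = Re (cinner x y)"
    by (simp add: cinner_prod_def inner_prod_def inner_eq_Re_cinner)
qed

end

lemma cinner_Pair [simp]: "cinner (x, y) (z, w) = cinner x z + cinner y w"
  by (simp add: cinner_prod_def)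

context covariant_system
begin

abbreviation "M'\<Psi> \<equiv> (\<lambda>T. T \<Psi>) ` M'"

lemma M'_Psi_subset: "M'\<Psi> \<subseteq> H"
  using bounded_opD(1)[OF M'_op] by auto

lemma M'_id: "(\<lambda>x. x) \<in> M'"
  by (rule M'_I) (auto simp: bounded_op_def intro!: exI[of _ 1])

lemma M'_add: "S \<in> M' \<Longrightarrow> T \<in> M' \<Longrightarrow> (\<lambda>x. S x + T x) \<in> M'"
  by (rule M'_I) (auto intro: bounded_op_add[OF H] simp: M'_op M'_commute pi_add_right bounded_opD(1)[OF M'_op])

lemma M'_comp: "S \<in> M' \<Longrightarrow> T \<in> M' \<Longrightarrow> (\<lambda>x. S (T x)) \<in> M'"
  by (rule M'_I) (auto intro: bounded_op_comp simp: M'_op M'_commute bounded_opD(1)[OF M'_op])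

lemma M'_scaleC: "T \<in> M' \<Longrightarrow> (\<lambda>x. c *\<^sub>C T x) \<in> M'"
  by (rule M'_I) (auto intro: bounded_op_scaleC[OF H] simp: M'_op M'_commute pi_scaleC_right bounded_opD(1)[OF M'_op])

lemma M'_zero: "(\<lambda>x. 0) \<in> M'"
  using M'_scaleC[OF M'_id, of 0] by simp

lemma closure_M'_Psi: "closed_csubspace (closure M'\<Psi>)"
proof (rule closed_csubspace_closure)
  show "0 \<in> M'\<Psi>" using M'_zero by force
  fix x y assume "x \<in> M'\<Psi>" "y \<in> M'\<Psi>"
  then obtain S T where "S \<in> M'" "T \<in> M'" "x = S \<Psi>" "y = T \<Psi>" by blast
  then show "x + y \<in> M'\<Psi>" using M'_add[of S T] by force
next
  fix c x assume "x \<in> M'\<Psi>"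
  then obtain S where "S \<in> M'" "x = S \<Psi>" by blast
  then show "c *\<^sub>C x \<in> M'\<Psi>" using M'_scaleC[of S c] by force
qed

lemma closure_M'_Psi_invariant:
  assumes T: "T \<in> M'" and y: "y \<in> closure M'\<Psi>"
  shows "T y \<in> closure M'\<Psi>"
proof -
  obtain f where f: "\<And>n. f n \<in> M'\<Psi>" "f \<longlonglongrightarrow> y" using y unfolding closure_sequential by blast
  have fH: "f n \<in> H" for n using f(1) M'_Psi_subset by blast
  have "(\<lambda>n. T (f n)) \<longlonglongrightarrow> T y" by (rule bounded_op_tendsto[OF H M'_op[OF T] fH f(2)])
  moreover have "T (f n) \<in> M'\<Psi>" for n
  proof -
    obtain S where "S \<in> M'" "f n = S \<Psi>" using f(1)[of n] by blast
    then show ?thesis using M'_comp[OF T, of S] by force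
  qed
  ultimately show ?thesis unfolding closure_sequential by (intro exI[of _ "\<lambda>n. T (f n)"]) blast
qed

lemma orthogonal_M'_Psi_invariant:
  assumes T: "T \<in> M'" and y: "y \<in> H" "\<And>z. z \<in> closure M'\<Psi> \<Longrightarrow> cinner y z = 0"
    and z: "z \<in> closure M'\<Psi>"
  shows "cinner (T y) z = 0"
proof -
  obtain S where S: "S \<in> M'" "adjoint_on H T S"
    using M'_star_closed T unfolding star_closed_on_def by blast
  have "z \<in> H" using z M'_Psi_subset H_closed closure_minimal by blast
  then have "cinner (T y) z = cinner y (S z)" by (rule adjoint_onD[OF S(2) y(1)])
  also have "\<dots> = 0" by (rule y(2)[OF closure_M'_Psi_invariant[OF S(1) z]])
  finally show ?thesis .
qed

text \<open>\<open>K\<close> is invariant under the diagonal action of a star-closed family, so the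
  projection onto \<open>K\<close> commutes with that action, and so does each matrix entry.\<close>

lemma projection_entries_in_M':
  fixes K :: "('k \<times> 'k) set"
  assumes K: "closed_csubspace K" "K \<subseteq> H \<times> H"
    and inv: "\<And>a y z. (y, z) \<in> K \<Longrightarrow> (\<pi> a y, \<pi> a z) \<in> K"
  obtains P where "\<And>w. w \<in> H \<times> H \<Longrightarrow> P w \<in> K"
    and "\<And>w z. w \<in> H \<times> H \<Longrightarrow> z \<in> K \<Longrightarrow> cinner (w - P w) z = 0"
    and "\<And>w w'. w \<in> H \<times> H \<Longrightarrow> w' \<in> H \<times> H \<Longrightarrow> P (w + w') = P w + P w'"
    and "(\<lambda>y. fst (P (y, 0))) \<in> M'" "(\<lambda>y. snd (P (y, 0))) \<in> M'"
    and "(\<lambda>y. fst (P (0, y))) \<in> M'" "(\<lambda>y. snd (P (0, y))) \<in> M'"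
proof -
  have "\<forall>w. \<exists>p\<in>K. \<forall>z\<in>K. cinner (w - p) z = 0"
    using orthogonal_projection[OF K(1)] by blast
  then obtain P where PK: "\<And>w. P w \<in> K" and P: "\<And>w z. z \<in> K \<Longrightarrow> cinner (w - P w) z = 0"
    by metis
  note Kc = closed_csubspaceD[OF K(1)]
  have uniq: "P w = p" if "p \<in> K" "\<And>z. z \<in> K \<Longrightarrow> cinner (w - p) z = 0" for w p
  proof (rule cinner_ext[OF K(1) PK that(1)])
    fix z assume "z \<in> K"
    from P[OF this, of w] that(2)[OF this] show "cinner (P w) z = cinner p z"
      by (simp add: cinner_diff_left)
  qed
  have Pin: "cinner (P w) z = cinner w z" if "z \<in> K" for w z
    using P[OF that, of w] by (simp add: cinner_diff_left)
  have add: "P (w + w') = P w + P w'" for w w'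
    by (rule uniq[OF Kc(3)[OF PK PK]]) (simp add: cinner_diff_left cinner_add_left Pin)
  have sc: "P (c *\<^sub>C w) = c *\<^sub>C P w" for c w
    by (rule uniq[OF Kc(4)[OF PK]])
       (simp add: cinner_diff_left cinner_scaleC_left Pin)
  define A where "A a w = (\<pi> a (fst w), \<pi> a (snd w))" for a w
  have AK: "A a w \<in> K" if "w \<in> K" for a w
    using inv[of "fst w" "snd w"] that by (simp add: A_def)
  have comm: "P (A a w) = A a (P w)" if w: "w \<in> H \<times> H" for a w
  proof (rule uniq[OF AK[OF PK]])
    fix z assume z: "z \<in> K"
    have PH: "P w \<in> H \<times> H" and zH: "z \<in> H \<times> H" using PK[of w] z K(2) by blast+
    have "cinner (A a w - A a (P w)) z = cinner (w - P w) (A (star a) z)"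
      using w PH zH by (auto simp: A_def cinner_prod_def cinner_diff_left pi_adjoint mem_Times_iff)
    then show "cinner (A a w - A a (P w)) z = 0" using P[OF AK[OF z]] by simp
  qed
  have nrm: "norm (P w) \<le> norm w" for w
  proof -
    have "cinner w (P w) = cinner (P w) (P w)" using P[OF PK, of w w] by (simp add: cinner_diff_left)
    then have "(norm (P w))\<^sup>2 = cmod (cinner w (P w))" by (simp add: cinner_self norm_power)
    also have "\<dots> \<le> norm w * norm (P w)" by (rule cinner_norm_le)
    finally have "norm (P w) * norm (P w) \<le> norm w * norm (P w)" by (simp add: power2_eq_square)
    then show ?thesis by (cases "P w = 0") (auto simp: mult_le_cancel_right)
  qed
  have fst_le: "norm (fst w) \<le> norm w" and snd_le: "norm (snd w) \<le> norm w" for w :: "'k \<times> 'k"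
    using norm_fst_le[of "fst w" "snd w"] norm_snd_le[of "snd w" "fst w"] by simp_all
  have entry: "(\<lambda>y. L (P (J y))) \<in> M'"
    if L: "L = fst \<or> L = snd" and J: "J = (\<lambda>y. (y, 0)) \<or> J = (\<lambda>y. (0, y))" for L J
  proof (rule M'_I)
    have LH: "L (P w) \<in> H" for w using L PK[of w] K(2) by (auto simp: mem_Times_iff)
    have Ladd: "L (w + w') = L w + L w'" and Lsc: "L (c *\<^sub>C w) = c *\<^sub>C L w" for w w' c
      using L by auto
    have Lle: "norm (L w) \<le> norm w" for w
      using L fst_le[of w] snd_le[of w] by (elim disjE) simp_all
    have Jadd: "J (y + y') = J y + J y'" and Jsc: "J (c *\<^sub>C y) = c *\<^sub>C J y" and Jn: "norm (J y) = norm y"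
      for y y' c using J by auto
    show "bounded_op H (\<lambda>y. L (P (J y)))"
      unfolding bounded_op_def
    proof (intro conjI ballI allI exI[of _ 1])
      show "norm (L (P (J y))) \<le> 1 * norm y" for y
        using order_trans[OF Lle nrm, of "J y"] Jn by simp
    qed (auto simp: LH Jadd Jsc add sc Ladd Lsc)
    show "L (P (J (\<pi> a y))) = \<pi> a (L (P (J y)))" if y: "y \<in> H" for a y
    proof -
      have "J (\<pi> a y) = A a (J y)" "J y \<in> H \<times> H" using J y by (auto simp: A_def pi_zero_right)
      then have "L (P (J (\<pi> a y))) = L (A a (P (J y)))" by (simp add: comm)
      also have "\<dots> = \<pi> a (L (P (J y)))" using L by (auto simp: A_def)
      finally show ?thesis .
    qed
  qed
  show ?thesis
  proof (rule that[of P])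
    show "P w \<in> K" for w by (rule PK)
    show "z \<in> K \<Longrightarrow> cinner (w - P w) z = 0" for w z by (rule P)
    show "P (w + w') = P w + P w'" for w w' by (rule add)
  qed (rule entry; simp)+
qed

text \<open>The hypothesis \<open>van\<close> says that \<open>(x, v)\<close> is orthogonal to the
  orbit of \<open>(u, \<Psi>)\<close> under the diagonal action. The projection onto the closed
  orbit has entries in the commutant, hence respects both \<open>closure M'\<Psi>\<close> and its
  orthogonal complement. When \<open>v\<close> is split accordingly as \<open>d + e\<close>, the
  projection annihilates \<open>(x, e)\<close>, so this is orthogonal to \<open>(u, \<Psi>)\<close>;
  and \<open>e\<close> is orthogonal to \<open>\<Psi>\<close>.\<close>

lemma orthogonal_of_vanishing:
  assumes x: "x \<in> H" "\<And>z. z \<in> closure M'\<Psi> \<Longrightarrow> cinner x z = 0"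
    and uv: "u \<in> H" "v \<in> H" and van: "\<And>c. cinner (\<pi> c x) u + cinner (\<pi> c v) \<Psi> = 0"
  shows "cinner x u = 0"
proof -
  define D where "D = closure M'\<Psi>"
  have DH: "D \<subseteq> H" unfolding D_def using M'_Psi_subset H_closed by (rule closure_minimal)
  have Dc: "closed_csubspace D" unfolding D_def by (rule closure_M'_Psi)
  obtain d where d: "d \<in> D" "\<And>z. z \<in> D \<Longrightarrow> cinner (v - d) z = 0"
    using orthogonal_projection[OF Dc] by blast
  define e where "e = v - d"
  have dH: "d \<in> H" using d(1) DH by blast
  have eH: "e \<in> H" using uv(2) dH by (simp add: e_def H_diff)
  define S where "S = range (\<lambda>b. (\<pi> b u, \<pi> b \<Psi>))"
  define K where "K = closure S"
  have Kc: "closed_csubspace K"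
    unfolding K_def
  proof (rule closed_csubspace_closure)
    show "0 \<in> S" using uv by (auto simp: S_def zero_prod_def intro!: image_eqI[of _ _ 0])
    fix y z assume "y \<in> S" "z \<in> S"
    then obtain a b where "y = (\<pi> a u, \<pi> a \<Psi>)" "z = (\<pi> b u, \<pi> b \<Psi>)" by (auto simp: S_def)
    then have "y + z = (\<pi> (a + b) u, \<pi> (a + b) \<Psi>)" using uv by (simp add: pi_add)
    then show "y + z \<in> S" by (auto simp: S_def)
  next
    fix c y assume "y \<in> S"
    then obtain a where "y = (\<pi> a u, \<pi> a \<Psi>)" by (auto simp: S_def)
    then have "c *\<^sub>C y = (\<pi> (c *\<^sub>C a) u, \<pi> (c *\<^sub>C a) \<Psi>)" using uv by (simp add: pi_scaleC)
    then show "c *\<^sub>C y \<in> S" by (auto simp: S_def)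
  qed
  have KH: "K \<subseteq> H \<times> H"
    unfolding K_def
  proof (rule closure_minimal)
    show "S \<subseteq> H \<times> H" using uv by (auto simp: S_def)
    show "closed (H \<times> H)" by (intro closed_Times H_closed)
  qed
  have Kinv: "(\<pi> a y, \<pi> a z) \<in> K" if yz: "(y, z) \<in> K" for a y z
  proof -
    obtain f where f: "\<And>n. f n \<in> S" "f \<longlonglongrightarrow> (y, z)"
      using yz unfolding K_def closure_sequential by blast
    have "\<forall>n. \<exists>b. f n = (\<pi> b u, \<pi> b \<Psi>)" using f(1) by (auto simp: S_def)
    then obtain b where b: "\<And>n. f n = (\<pi> (b n) u, \<pi> (b n) \<Psi>)" by metis
    have "(\<lambda>n. \<pi> (b n) u) \<longlonglongrightarrow> y" "(\<lambda>n. \<pi> (b n) \<Psi>) \<longlonglongrightarrow> z"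
      using tendsto_fst[OF f(2)] tendsto_snd[OF f(2)] by (simp_all add: b)
    then have "(\<lambda>n. (\<pi> a (\<pi> (b n) u), \<pi> a (\<pi> (b n) \<Psi>))) \<longlonglongrightarrow> (\<pi> a y, \<pi> a z)"
      using uv by (intro tendsto_Pair bounded_op_tendsto[OF H pi_op]) auto
    moreover have "(\<pi> a (\<pi> (b n) u), \<pi> a (\<pi> (b n) \<Psi>)) \<in> S" for n
      using uv by (auto simp: S_def pi_mult[symmetric])
    ultimately show ?thesis
      unfolding K_def closure_sequential
      by (intro exI[of _ "\<lambda>n. (\<pi> a (\<pi> (b n) u), \<pi> a (\<pi> (b n) \<Psi>))"]) blast
  qed
  obtain P where PK: "\<And>w. w \<in> H \<times> H \<Longrightarrow> P w \<in> K"
    and P: "\<And>w z. w \<in> H \<times> H \<Longrightarrow> z \<in> K \<Longrightarrow> cinner (w - P w) z = 0"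
    and Padd: "\<And>w w'. w \<in> H \<times> H \<Longrightarrow> w' \<in> H \<times> H \<Longrightarrow> P (w + w') = P w + P w'"
    and P1: "(\<lambda>y. fst (P (y, 0))) \<in> M'" "(\<lambda>y. snd (P (y, 0))) \<in> M'"
    and P2: "(\<lambda>y. fst (P (0, y))) \<in> M'" "(\<lambda>y. snd (P (0, y))) \<in> M'"
    using projection_entries_in_M'[OF Kc KH Kinv] by blast
  have "cinner (x, v) z = 0" if "z \<in> K" for z
  proof (rule orthogonal_closure[OF _ that[unfolded K_def]])
    fix y assume "y \<in> S"
    then obtain b where b: "y = (\<pi> b u, \<pi> b \<Psi>)" by (auto simp: S_def)
    have "cinner (x, v) y = cinner (\<pi> (star b) x) u + cinner (\<pi> (star b) v) \<Psi>"
      using x(1) uv by (simp add: b pi_adjoint star_star)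
    then show "cinner (x, v) y = 0" by (simp add: van)
  qed
  then have "cinner (P (x, v)) (P (x, v)) = 0"
    using P[OF _ PK, of "(x, v)" "(x, v)"] PK[of "(x, v)"] x(1) uv by (simp add: cinner_diff_left)
  then have Pxv: "P (x, v) = 0" by simp
  have "P ((x, e) + (0, d)) = P (x, e) + P (0, d)" by (rule Padd) (use x eH dH in auto)
  \<comment> \<open>Both components are orthogonal to \<open>D\<close> on the left and lie in
    \<open>D\<close> on the right, so both sides vanish.\<close>
  then have 1: "P (x, e) = - P (0, d)" using Pxv by (simp add: e_def eq_neg_iff_add_eq_0)
  have D: "fst (P (0, d)) \<in> D" "snd (P (0, d)) \<in> D"
    using closure_M'_Psi_invariant[OF P2(1)] closure_M'_Psi_invariant[OF P2(2)] d(1)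
    unfolding D_def by blast+
  have "P ((x, 0) + (0, e)) = P (x, 0) + P (0, e)" by (rule Padd) (use x eH in auto)
  then have 2: "P (x, e) = P (x, 0) + P (0, e)" by simp
  have orthe: "cinner e z = 0" if "z \<in> closure M'\<Psi>" for z
    using d(2) that by (simp add: D_def e_def)
  have O: "cinner (fst (P (x, e))) z = 0" "cinner (snd (P (x, e))) z = 0" if z: "z \<in> D" for z
    unfolding 2 fst_add snd_add cinner_add_left
    using orthogonal_M'_Psi_invariant[OF P1(1) x(1) x(2) z[unfolded D_def]]
      orthogonal_M'_Psi_invariant[OF P1(2) x(1) x(2) z[unfolded D_def]]
      orthogonal_M'_Psi_invariant[OF P2(1) eH orthe z[unfolded D_def]]
      orthogonal_M'_Psi_invariant[OF P2(2) eH orthe z[unfolded D_def]] by simp_all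
  have "cinner (fst (P (0, d))) (fst (P (0, d))) = 0" "cinner (snd (P (0, d))) (snd (P (0, d))) = 0"
    using O(1)[OF D(1)] O(2)[OF D(2)] unfolding 1 by simp_all
  then have "P (x, e) = 0" unfolding 1 by (simp add: prod_eq_iff)
  moreover have "(u, \<Psi>) \<in> K"
  proof -
    have "(u, \<Psi>) \<in> S" unfolding S_def using uv by (intro image_eqI[of _ _ 1]) auto
    then show ?thesis unfolding K_def by (rule subsetD[OF closure_subset])
  qed
  ultimately have "cinner (x, e) (u, \<Psi>) = 0"
    using P[of "(x, e)" "(u, \<Psi>)"] x(1) eH by simp
  moreover have "cinner e \<Psi> = 0"
  proof (rule orthe)
    have "\<Psi> \<in> M'\<Psi>" by (rule image_eqI[OF _ M'_id]) simp
    then show "\<Psi> \<in> closure M'\<Psi>" by (rule subsetD[OF closure_subset])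
  qed
  ultimately show ?thesis by simp
qed

text \<open>The projection onto the orthogonal complement of \<open>closure M'\<Psi>\<close> fixes
  \<open>x\<close> and annihilates \<open>\<Psi>\<close>; \<open>c\<close> imitates it at these two
  vectors, with \<open>star c\<close> in the second place. The pair \<open>(u, v)\<close>, the
  deviation of \<open>(x, 0)\<close> from its projection onto the closure of all
  \<open>(\<pi> c x, \<pi> (star c) \<Psi>)\<close>, is shown to vanish by
  \<open>orthogonal_of_vanishing\<close>.\<close>

lemma approximate_projection:
  assumes x: "x \<in> H" "\<And>z. z \<in> closure M'\<Psi> \<Longrightarrow> cinner x z = 0" and e: "e > 0"
  shows "\<exists>c. norm (\<pi> c x - x) < e \<and> norm (\<pi> (star c) \<Psi>) < e"
proof -
  define S where "S = range (\<lambda>c. (\<pi> c x, \<pi> (star c) \<Psi>))"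
  have S0: "0 \<in> S" using x by (auto simp: S_def zero_prod_def intro!: image_eqI[of _ _ 0])
  have Sadd: "y + z \<in> S" if yz: "y \<in> S" "z \<in> S" for y z
  proof -
    obtain a b where "y = (\<pi> a x, \<pi> (star a) \<Psi>)" "z = (\<pi> b x, \<pi> (star b) \<Psi>)"
      using yz by (auto simp: S_def)
    then have "y + z = (\<pi> (a + b) x, \<pi> (star (a + b)) \<Psi>)" using x by (simp add: pi_add star_add)
    then show "y + z \<in> S" by (auto simp: S_def)
  qed
  have Ssc: "r *\<^sub>R y \<in> S" if y: "y \<in> S" for r y
  proof -
    obtain a where "y = (\<pi> a x, \<pi> (star a) \<Psi>)" using y by (auto simp: S_def)
    then have "r *\<^sub>R y = (\<pi> (r *\<^sub>R a) x, \<pi> (star (r *\<^sub>R a)) \<Psi>)" using x by (simp add: pi_scaleR)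
    then show "r *\<^sub>R y \<in> S" by (auto simp: S_def)
  qed
  have "\<exists>y\<in>closure S. \<forall>z\<in>closure S. inner ((x, 0) - y) z = 0"
  proof (rule orthogonal_projection_real)
    show "0 \<in> closure S" using S0 closure_subset by blast
    fix y z assume "y \<in> closure S" "z \<in> closure S"
    then obtain f g where "\<And>n. f n \<in> S" "f \<longlonglongrightarrow> y" "\<And>n. g n \<in> S" "g \<longlonglongrightarrow> z"
      unfolding closure_sequential by blast
    then show "y + z \<in> closure S"
      unfolding closure_sequential
      by (intro exI[of _ "\<lambda>n. f n + g n"]) (auto intro: Sadd tendsto_add)
  next
    fix r y assume "y \<in> closure S"
    then obtain f where "\<And>n. f n \<in> S" "f \<longlonglongrightarrow> y"
      unfolding closure_sequential by blast
    then show "r *\<^sub>R y \<in> closure S"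
      unfolding closure_sequential
      by (intro exI[of _ "\<lambda>n. r *\<^sub>R f n"]) (auto intro: Ssc tendsto_intros)
  qed simp
  then obtain w0 where w0: "w0 \<in> closure S" "\<And>z. z \<in> closure S \<Longrightarrow> inner ((x, 0) - w0) z = 0"
    by blast
  obtain p q where w0_eq: "w0 = (p, q)" by (cases w0)
  note pq = w0(1)[unfolded w0_eq] and orth = w0(2)[unfolded w0_eq]
  have "closure S \<subseteq> H \<times> H"
    by (rule closure_minimal) (use x in \<open>auto simp: S_def intro: closed_Times H_closed\<close>)
  then have pqH: "p \<in> H" "q \<in> H" using pq by auto
  define u v where "u = x - p" and "v = - q"
  have uv: "u \<in> H" "v \<in> H" using pqH x(1) closed_csubspaceD(6)[OF H] by (auto simp: u_def v_def H_diff)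
  have re: "Re (cinner u (\<pi> c x)) + Re (cinner v (\<pi> (star c) \<Psi>)) = 0" for c
  proof -
    have "(\<pi> c x, \<pi> (star c) \<Psi>) \<in> S" by (simp add: S_def)
    then have "(\<pi> c x, \<pi> (star c) \<Psi>) \<in> closure S" by (rule subsetD[OF closure_subset])
    from orth[OF this] show ?thesis by (simp add: u_def v_def inner_prod_def inner_eq_Re_cinner)
  qed
  \<comment> \<open>Orthogonality is available for the real inner product only; replacing
    \<open>c\<close> by \<open>\<i> *\<^sub>C c\<close> supplies the imaginary part.\<close>
  have van: "cinner (\<pi> c x) u + cinner (\<pi> c v) \<Psi> = 0" for c
  proof -
    have "cinner (\<pi> c v) \<Psi> = cinner v (\<pi> (star c) \<Psi>)" using uv by (simp add: pi_adjoint)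
    moreover have "cinner (\<pi> c x) u = cnj (cinner u (\<pi> c x))" by (rule cinner_commute)
    ultimately show ?thesis
      using re[of c] re[of "\<i> *\<^sub>C c"] x(1)
      by (simp add: complex_eq_iff pi_scaleC pi_minus star_scaleC cinner_scaleC_right)
  qed
  have "cinner x u = 0" by (rule orthogonal_of_vanishing[OF x uv van])
  moreover have "inner (u, v) (p, q) = 0" using orth[OF pq] by (simp add: u_def v_def)
  ultimately have "inner (u, v) (u, v) = 0"
    using cinner_commute_zero[of x u]
    by (simp add: u_def v_def inner_prod_def inner_eq_Re_cinner cinner_diff_right)
  then have "(u, v) = 0" by (simp only: inner_eq_zero_iff)
  then have "(x, 0) \<in> closure S" using pq by (simp add: u_def v_def zero_prod_def)
  then obtain w where w: "w \<in> S" "dist w (x, 0) < e" using e unfolding closure_approachable by blast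
  then obtain c where c: "w = (\<pi> c x, \<pi> (star c) \<Psi>)" by (auto simp: S_def)
  have "norm (\<pi> c x - x) \<le> norm (w - (x, 0))" "norm (\<pi> (star c) \<Psi>) \<le> norm (w - (x, 0))"
    using norm_fst_le[of "\<pi> c x - x" "\<pi> (star c) \<Psi>"] norm_snd_le[of "\<pi> (star c) \<Psi>" "\<pi> c x - x"]
    by (simp_all add: c)
  then show ?thesis using w(2) by (intro exI[of _ c]) (simp add: dist_norm)
qed

end

section \<open>Functionals, the Arens product and monotone sequences\<close>

lemma dualD:
  assumes "f \<in> dual"
  shows "bounded_linear f" "f (c *\<^sub>C a) = c * f a" "f (a + b) = f a + f b" "f (a - b) = f a - f b"
    "f 0 = 0" "cmod (f a) \<le> onorm f * norm a" "0 \<le> onorm f" "f (\<Sum>i\<in>I. g i) = (\<Sum>i\<in>I. f (g i))"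
proof -
  show bl: "bounded_linear f" and "f (c *\<^sub>C a) = c * f a" using assms by (auto simp: dual_def)
  show "f (a + b) = f a + f b" by (rule linear_add[OF bounded_linear.linear[OF bl]])
  show "f (a - b) = f a - f b" by (rule linear_diff[OF bounded_linear.linear[OF bl]])
  show "f 0 = 0" by (rule linear_0[OF bounded_linear.linear[OF bl]])
  show "cmod (f a) \<le> onorm f * norm a" by (rule onorm[OF bl])
  show "0 \<le> onorm f" by (rule onorm_pos_le[OF bl])
  show "f (\<Sum>i\<in>I. g i) = (\<Sum>i\<in>I. f (g i))" by (rule linear_sum[OF bounded_linear.linear[OF bl]])
qed

lemma dualI:
  assumes "\<And>a b. f (a + b) = f a + f b" "\<And>c a. f (c *\<^sub>C a) = c * f a" "\<And>a. cmod (f a) \<le> K * norm a"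
  shows "f \<in> dual"
proof -
  have "bounded_linear f"
    by (rule bounded_linear_intro[of _ K])
       (use assms in \<open>auto simp: scaleR_scaleC scaleR_conv_of_real mult.commute\<close>)
  then show ?thesis using assms(2) by (simp add: dual_def)
qed

lemma onorm_dual_le:
  assumes "f \<in> dual" "\<And>a. cmod (f a) \<le> K * norm a"
  shows "onorm f \<le> K"
  by (rule onorm_le) (use assms in auto)

lemma dual_mult_left:
  assumes f: "f \<in> dual"
  shows "(\<lambda>b. f (a * b)) \<in> dual" "onorm (\<lambda>b. f (a * b)) \<le> onorm f * norm a"
proof -
  have bd: "cmod (f (a * b)) \<le> (onorm f * norm a) * norm b" for b
    using order_trans[OF dualD(6)[OF f] mult_left_mono[OF norm_mult_ineq dualD(7)[OF f]], of a b]
    by (simp add: mult.assoc)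
  show "(\<lambda>b. f (a * b)) \<in> dual"
    by (rule dualI[OF _ _ bd]) (simp_all add: distrib_left mult_scaleC_right dualD[OF f])
  then show "onorm (\<lambda>b. f (a * b)) \<le> onorm f * norm a" by (rule onorm_dual_le[OF _ bd])
qed

lemma dual_star:
  assumes f: "f \<in> dual"
  shows "(\<lambda>a. cnj (f (star a))) \<in> dual"
proof (rule dualI)
  show "cmod (cnj (f (star a))) \<le> onorm f * norm a" for a
    using dualD(6)[OF f, of "star a"] by simp
qed (simp_all add: star_add star_scaleC dualD[OF f])

lemma dual_add: "f \<in> dual \<Longrightarrow> g \<in> dual \<Longrightarrow> (\<lambda>a. f a + g a) \<in> dual"
proof (rule dualI)
  assume f: "f \<in> dual" and g: "g \<in> dual"
  show "cmod (f a + g a) \<le> (onorm f + onorm g) * norm a" for a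
    using norm_triangle_le[OF add_mono[OF dualD(6)[OF f] dualD(6)[OF g]], of a a]
    by (simp add: distrib_right)
qed (simp_all add: dualD algebra_simps)

lemma dual_scaleC: "f \<in> dual \<Longrightarrow> (\<lambda>a. c * f a) \<in> dual"
proof (rule dualI)
  assume f: "f \<in> dual"
  show "cmod (c * f a) \<le> (cmod c * onorm f) * norm a" for a
    using mult_left_mono[OF dualD(6)[OF f], of "cmod c" a] by (simp add: norm_mult mult.assoc)
qed (simp_all add: dualD algebra_simps)

lemma bidualD:
  assumes "F \<in> bidual"
  shows "f \<in> dual \<Longrightarrow> g \<in> dual \<Longrightarrow> F (\<lambda>a. f a + g a) = F f + F g"
    "f \<in> dual \<Longrightarrow> F (\<lambda>a. c * f a) = c * F f" "\<exists>K\<ge>0. \<forall>f\<in>dual. cmod (F f) \<le> K * onorm f"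
proof -
  show "f \<in> dual \<Longrightarrow> g \<in> dual \<Longrightarrow> F (\<lambda>a. f a + g a) = F f + F g"
    and "f \<in> dual \<Longrightarrow> F (\<lambda>a. c * f a) = c * F f"
    using assms by (simp_all add: bidual_def)
  obtain K where K: "\<And>f. f \<in> dual \<Longrightarrow> cmod (F f) \<le> K * onorm f"
    using assms unfolding bidual_def by blast
  have "cmod (F f) \<le> max K 0 * onorm f" if "f \<in> dual" for f
    using order_trans[OF K[OF that] mult_right_mono[OF _ dualD(7)[OF that]], of "max K 0"] by simp
  then show "\<exists>K\<ge>0. \<forall>f\<in>dual. cmod (F f) \<le> K * onorm f" by (intro exI[of _ "max K 0"]) auto
qed

text \<open>Makes the inner functional of the Arens product a legitimate argument of the outer
  one.\<close>

lemma dual_bidual_left: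
  assumes F: "F \<in> bidual" and f: "f \<in> dual"
  shows "(\<lambda>a. F (\<lambda>b. f (a * b))) \<in> dual"
proof -
  obtain K where K: "K \<ge> 0" "\<And>f. f \<in> dual \<Longrightarrow> cmod (F f) \<le> K * onorm f" using bidualD(3)[OF F] by blast
  show ?thesis
  proof (rule dualI)
    show "cmod (F (\<lambda>b. f (a * b))) \<le> (K * onorm f) * norm a" for a
      using order_trans[OF K(2)[OF dual_mult_left(1)[OF f]] mult_left_mono[OF dual_mult_left(2)[OF f] K(1)]]
      by (simp add: mult.assoc)
    show "F (\<lambda>b. f ((a + a') * b)) = F (\<lambda>b. f (a * b)) + F (\<lambda>b. f (a' * b))" for a a'
      using bidualD(1)[OF F dual_mult_left(1)[OF f, of a] dual_mult_left(1)[OF f, of a']]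
      by (simp add: distrib_right dualD[OF f])
    show "F (\<lambda>b. f ((c *\<^sub>C a) * b)) = c * F (\<lambda>b. f (a * b))" for c a
      using bidualD(2)[OF F dual_mult_left(1)[OF f, of a]] by (simp add: mult_scaleC_left dualD[OF f])
  qed
qed

text \<open>The increments over the index intervals from \<open>p k\<close> to \<open>q k\<close>
  are positive and add up to at most \<open>c 0\<close>, so \<open>norm_sum_cpos_mult_le\<close>
  bounds \<open>K * \<epsilon>\<close> by \<open>4 * sqrt K * onorm f\<close>.\<close>

lemma positive_increments_bounded:
  fixes c :: "nat \<Rightarrow> 'a::cstar_algebra" and b :: "nat \<Rightarrow> 'a"
  assumes f: "f \<in> dual"
    and mono: "\<And>m n. m \<le> n \<Longrightarrow> cpos (c m - c n)" and pos: "\<And>n. cpos (c n)" and c0: "norm (c 0) \<le> 1"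
    and pq: "\<And>k. p k \<le> q k" "\<And>k. q k \<le> p (Suc k)"
    and b: "\<And>k. norm (b k) \<le> 1" and K: "K \<ge> 1"
    and big: "\<And>k. k < K \<Longrightarrow> \<epsilon> < cmod (f ((c (p k) - c (q k)) * b k))"
  shows "sqrt (real K) * \<epsilon> \<le> 4 * onorm f"
proof -
  define g where "g k = c (p k) - c (q k)" for k
  have cg: "cpos (g k)" for k unfolding g_def by (rule mono[OF pq(1)])
  have part: "cpos (c 0 - c (p K) - (\<Sum>k<K. g k))" for K
  proof (induction K)
    case 0 show ?case using mono[of 0 "p 0"] by simp
  next
    case (Suc K)
    have eq: "c 0 - c (p (Suc K)) - (\<Sum>k<Suc K. g k)
        = (c 0 - c (p K) - (\<Sum>k<K. g k)) + (c (q K) - c (p (Suc K)))" by (simp add: g_def)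
    show ?case unfolding eq by (rule cpos_add[OF Suc mono[OF pq(2)]])
  qed
  have "cpos (c 0 - (\<Sum>k<K. g k))" using cpos_add[OF part pos, of K "p K"] by simp
  from cpos_norm_mono[OF cpos_sum[OF cg] this] c0 have s: "norm (\<Sum>k<K. g k) \<le> 1" by linarith
  \<comment> \<open>Phases that make all values of \<open>f\<close> nonnegative, so that they cannot
    cancel.\<close>
  define \<theta> where "\<theta> k = (if f (g k * b k) = 0 then 1 else cnj (sgn (f (g k * b k))))" for k
  have \<theta>: "cmod (\<theta> k) = 1" for k by (simp add: \<theta>_def norm_sgn)
  have f\<theta>: "f (g k * (\<theta> k *\<^sub>C b k)) = of_real (cmod (f (g k * b k)))" for k
    by (simp add: mult_scaleC_right dualD[OF f] \<theta>_def sgn_div_norm scaleR_conv_of_real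
        complex_norm_square[symmetric] power2_eq_square field_simps)
  have "norm (\<Sum>k<K. g k * (\<theta> k *\<^sub>C b k)) \<le> 4 * sqrt (card {..<K})"
    by (rule norm_sum_cpos_mult_le) (use K cg s b \<theta> in \<open>auto simp: norm_scaleC lessThan_empty_iff\<close>)
  then have "cmod (f (\<Sum>k<K. g k * (\<theta> k *\<^sub>C b k))) \<le> onorm f * (4 * sqrt (real K))"
    using order_trans[OF dualD(6)[OF f] mult_left_mono[OF _ dualD(7)[OF f]]] by simp
  moreover have "f (\<Sum>k<K. g k * (\<theta> k *\<^sub>C b k)) = of_real (\<Sum>k<K. cmod (f (g k * b k)))"
    by (simp add: dualD(8)[OF f] f\<theta>)
  then have "cmod (f (\<Sum>k<K. g k * (\<theta> k *\<^sub>C b k))) = (\<Sum>k<K. cmod (f (g k * b k)))"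
    by (simp only: norm_of_real) (simp add: sum_nonneg)
  moreover have "real K * \<epsilon> \<le> (\<Sum>k<K. cmod (f (g k * b k)))"
    using sum_mono[of "{..<K}" "\<lambda>_. \<epsilon>" "\<lambda>k. cmod (f (g k * b k))"] big by (auto simp: g_def less_imp_le)
  ultimately have "real K * \<epsilon> \<le> onorm f * (4 * sqrt (real K))" by simp
  moreover have "real K = sqrt (real K) * sqrt (real K)" by simp
  ultimately have "sqrt (real K) * (sqrt (real K) * \<epsilon>) \<le> sqrt (real K) * (4 * onorm f)"
    by (simp only: mult.assoc[symmetric]) (simp add: mult_ac)
  then show ?thesis using K by simp
qed

text \<open>Each interval is chosen beyond the right end of the preceding one, by iterating
  \<open>M \<mapsto> n M\<close>.\<close>

lemma interval_chain:
  assumes "\<And>M::nat. \<exists>m\<ge>M. \<exists>n\<ge>m. P m n"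
  obtains p q where "\<And>k::nat. p k \<le> q k" "\<And>k. q k \<le> p (Suc k)" "\<And>k. P (p k) (q k)"
proof -
  obtain m n where mn: "\<And>M. M \<le> m M" "\<And>M. m M \<le> n M" "\<And>M. P (m M) (n M)"
    using assms by metis
  define s where "s k = (n ^^ k) 0" for k
  show ?thesis
  proof (rule that[of "\<lambda>k. m (s k)" "\<lambda>k. n (s k)"])
    show "n (s k) \<le> m (s (Suc k))" for k using mn(1)[of "s (Suc k)"] by (simp add: s_def)
  qed (use mn in auto)
qed

lemma sqrt_unbounded: "\<epsilon> > 0 \<Longrightarrow> \<exists>K\<ge>1. L < sqrt (real K) * \<epsilon>"
proof -
  assume e: "\<epsilon> > 0"
  obtain n :: nat where n: "\<bar>L\<bar> / \<epsilon> < real n" using reals_Archimedean2 by blast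
  have "L < sqrt (real ((Suc n)\<^sup>2)) * \<epsilon>"
  proof -
    have "L \<le> \<bar>L\<bar>" by simp
    also have "\<dots> < real n * \<epsilon>" using n e by (simp add: field_simps)
    also have "\<dots> \<le> real (Suc n) * \<epsilon>" using e by simp
    finally show ?thesis by (simp only: of_nat_power real_sqrt_abs abs_of_nat)
  qed
  then show ?thesis by (intro exI[of _ "(Suc n)\<^sup>2"]) simp
qed

text \<open>Were there increments larger than \<open>\<epsilon>\<close> arbitrarily far out, many of
  them in successive intervals would violate \<open>positive_increments_bounded\<close>. The
  uniformity in \<open>b\<close> is what later makes the limit projection idempotent.\<close>

lemma monotone_dual_cauchy:
  fixes c :: "nat \<Rightarrow> 'a::cstar_algebra"
  assumes f: "f \<in> dual"
    and mono: "\<And>m n. m \<le> n \<Longrightarrow> cpos (c m - c n)" and pos: "\<And>n. cpos (c n)" and c0: "norm (c 0) \<le> 1"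
    and e: "\<epsilon> > 0"
  shows "\<exists>M. \<forall>m\<ge>M. \<forall>n\<ge>m. \<forall>b. norm b \<le> 1 \<longrightarrow> cmod (f ((c m - c n) * b)) \<le> \<epsilon>"
proof (rule ccontr)
  assume "\<not> ?thesis"
  then have "\<exists>m\<ge>M. \<exists>n\<ge>m. \<exists>b. norm b \<le> 1 \<and> \<epsilon> < cmod (f ((c m - c n) * b))" for M
    by (meson not_le)
  then obtain p q where pq: "\<And>k::nat. p k \<le> q k" "\<And>k. q k \<le> p (Suc k)"
    "\<And>k. \<exists>b. norm b \<le> 1 \<and> \<epsilon> < cmod (f ((c (p k) - c (q k)) * b))"
    by (rule interval_chain) blast
  then obtain b where b: "\<And>k. norm (b k) \<le> 1" "\<And>k. \<epsilon> < cmod (f ((c (p k) - c (q k)) * b k))"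
    by metis
  obtain K where K: "K \<ge> 1" "4 * onorm f < sqrt (real K) * \<epsilon>" using sqrt_unbounded[OF e] by blast
  have "sqrt (real K) * \<epsilon> \<le> 4 * onorm f"
    by (rule positive_increments_bounded[where c = c and p = p and q = q and b = b,
          OF f mono pos c0 pq(1) pq(2) b(1) K(1) b(2)])
  then show False using K(2) by simp
qed

lemma monotone_dual_convergent:
  fixes c :: "nat \<Rightarrow> 'a::cstar_algebra"
  assumes f: "f \<in> dual"
    and mono: "\<And>m n. m \<le> n \<Longrightarrow> cpos (c m - c n)" and pos: "\<And>n. cpos (c n)" and c0: "norm (c 0) \<le> 1"
  shows "convergent (\<lambda>n. f (c n))"
proof -
  have "Cauchy (\<lambda>n. f (c n))"
  proof (rule CauchyI')
    fix e :: real assume "e > 0"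
    then obtain M where M: "\<forall>m\<ge>M. \<forall>n\<ge>m. \<forall>b. norm b \<le> 1 \<longrightarrow> cmod (f ((c m - c n) * b)) \<le> e / 2"
      using monotone_dual_cauchy[where c = c and \<epsilon> = "e/2", OF f mono pos c0] by auto
    show "\<exists>M. \<forall>m\<ge>M. \<forall>n>m. dist (f (c m)) (f (c n)) < e"
    proof (intro exI[of _ M] allI impI)
      fix m n assume "M \<le> m" "m < n"
      then have "cmod (f ((c m - c n) * 1)) \<le> e / 2" using M[rule_format, of m n 1] by simp
      then show "dist (f (c m)) (f (c n)) < e" using \<open>e > 0\<close> by (simp add: dualD[OF f] dist_norm)
    qed
  qed
  then show ?thesis by (simp add: Cauchy_convergent_iff)
qed

text \<open>If \<open>L\<close> had infinitely many increments of size \<open>e\<close>, any finite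
  number of them would show, with size \<open>e / 2\<close>, at one common \<open>m\<close>; there
  the bound on the number of increments applies to \<open>1 - r i m\<close>.\<close>

lemma monotone_double_limit:
  fixes r :: "nat \<Rightarrow> nat \<Rightarrow> 'a::cstar_algebra"
  assumes f: "f \<in> dual"
    and mono: "\<And>i j m. i \<le> j \<Longrightarrow> cpos (r j m - r i m)" and pos: "\<And>i m. cpos (1 - r i m)"
      "\<And>i m. norm (1 - r i m) \<le> 1"
    and lim: "\<And>i. (\<lambda>m. f (r i m)) \<longlonglongrightarrow> L i"
  shows "convergent L"
proof -
  have "Cauchy L"
  proof (rule ccontr)
    assume "\<not> Cauchy L"
    then obtain e where e: "e > 0" "\<And>M. \<exists>m\<ge>M. \<exists>n>m. \<not> dist (L m) (L n) < e"
      using CauchyI'[of L] by blast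
    have "\<exists>m\<ge>M. \<exists>n\<ge>m. e \<le> norm (L m - L n)" for M
      using e(2)[of M] by (metis dist_norm less_imp_le not_le)
    then obtain p q where pq: "\<And>k::nat. p k \<le> q k" "\<And>k. q k \<le> p (Suc k)"
      "\<And>k. e \<le> norm (L (p k) - L (q k))"
      by (rule interval_chain) blast
    obtain K where K: "K \<ge> 1" "4 * onorm f < sqrt (real K) * (e / 2)"
      using sqrt_unbounded[OF half_gt_zero[OF e(1)]] by blast
    have "\<forall>\<^sub>F m in sequentially. \<forall>k\<in>{..<K}. e / 2 < cmod (f (r (p k) m) - f (r (q k) m))"
    proof (rule eventually_ball_finite)
      show "\<forall>k\<in>{..<K}. \<forall>\<^sub>F m in sequentially. e / 2 < cmod (f (r (p k) m) - f (r (q k) m))"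
      proof
        fix k assume "k \<in> {..<K}"
        have "(\<lambda>m. cmod (f (r (p k) m) - f (r (q k) m))) \<longlonglongrightarrow> cmod (L (p k) - L (q k))"
          by (intro tendsto_intros lim)
        moreover have "e / 2 < cmod (L (p k) - L (q k))" using pq(3)[of k] e(1) by linarith
        ultimately show "\<forall>\<^sub>F m in sequentially. e / 2 < cmod (f (r (p k) m) - f (r (q k) m))"
          by (rule order_tendstoD)
      qed
    qed simp
    then obtain m where m: "\<And>k. k < K \<Longrightarrow> e / 2 < cmod (f (r (p k) m) - f (r (q k) m))"
      by (auto simp: eventually_sequentially)
    have "sqrt (real K) * (e / 2) \<le> 4 * onorm f"
    proof (rule positive_increments_bounded[OF f, of "\<lambda>i. 1 - r i m" p q "\<lambda>_. 1"])
      show "e / 2 < cmod (f (((1 - r (p k) m) - (1 - r (q k) m)) * 1))" if "k < K" for k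
        using m[OF that] by (simp add: dualD[OF f] norm_minus_commute)
    qed (use pos mono pq K in auto)
    then show False using K(2) by simp
  qed
  then show ?thesis by (simp add: Cauchy_convergent_iff)
qed

text \<open>The limit \<open>lim\<^sub>i lim\<^sub>m (1 + h\<^sub>m / (i + 1))\<^sup>-\<^sup>1\<close> is the projection onto the part where the
  increasing sequence \<open>h\<^sub>m\<close> has a finite limit.\<close>

definition finite_part :: "(nat \<Rightarrow> 'a::cstar_algebra) \<Rightarrow> nat \<Rightarrow> nat \<Rightarrow> 'a" where
  "finite_part h i m = resolvent (inverse (real (Suc i)) *\<^sub>R h m)"

text \<open>The last estimate is approximate idempotence: for \<open>j\<close> much larger than
  \<open>i\<close>, multiplication by \<open>finite_part h j m\<close> hardly changes
  \<open>r = finite_part h i m\<close>. Indeed \<open>r * h m\<close> equals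
  \<open>(i + 1) *\<^sub>R (1 - r)\<close>, while \<open>finite_part h j m - 1\<close> contains the
  factor \<open>h m / (j + 1)\<close>.\<close>

lemma finite_part_estimates:
  fixes h :: "nat \<Rightarrow> 'a::cstar_algebra"
  assumes h: "\<And>m. cpos (h m)" and inc: "\<And>m. cpos (h (Suc m) - h m)"
  shows "cpos (inverse (real (Suc i)) *\<^sub>R h m)"
    "m \<le> n \<Longrightarrow> cpos (finite_part h i m - finite_part h i n)"
    "i \<le> j \<Longrightarrow> cpos (finite_part h j m - finite_part h i m)"
    "norm (finite_part h i m * (finite_part h j m - 1)) \<le> real (Suc i) / real (Suc j)"
proof -
  show ch: "cpos (inverse (real (Suc i)) *\<^sub>R h m)" for i m by (rule cpos_scaleR[OF h]) simp
  have mono: "cpos (h n - h m)" if "m \<le> n" for m n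
    using that
  proof (induction n rule: dec_induct)
    case (step n)
    from cpos_add[OF inc[of n] step.IH] show ?case by simp
  qed simp
  show "cpos (finite_part h i m - finite_part h i n)" if "m \<le> n"
  proof -
    have "cpos (inverse (real (Suc i)) *\<^sub>R (h n - h m))" by (rule cpos_scaleR[OF mono[OF that]]) simp
    from resolvent_antimono[OF ch this, of i m] show ?thesis
      by (simp add: finite_part_def scaleR_diff_right del: of_nat_Suc)
  qed
  show "cpos (finite_part h j m - finite_part h i m)" if "i \<le> j"
  proof -
    have "inverse (real (Suc j)) \<le> inverse (real (Suc i))" using that by (simp add: field_simps)
    then have "cpos ((inverse (real (Suc i)) - inverse (real (Suc j))) *\<^sub>R h m)"
      by (intro cpos_scaleR h) (simp only: diff_ge_0_iff_ge)
    from resolvent_antimono[OF ch this, of j m] show ?thesis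
      by (simp add: finite_part_def scaleR_diff_left del: of_nat_Suc)
  qed
  define r s where "r = finite_part h i m" and "s = finite_part h j m"
  note r = resolvent[OF ch[of i m], folded finite_part_def r_def]
    and s = resolvent[OF ch[of j m], folded finite_part_def s_def]
  have "inverse (real (Suc i)) *\<^sub>R (r * h m) = 1 - r" using r(6) by simp
  then have rh: "r * h m = real (Suc i) *\<^sub>R (1 - r)"
    by (metis of_nat_neq_0 inverse_nonzero_iff_nonzero real_scaleR_def right_inverse scaleR_one
        scaleR_scaleR)
  have "s - 1 = - ((inverse (real (Suc j)) *\<^sub>R h m) * s)" unfolding s(5) by simp
  then have "r * (s - 1) = - (inverse (real (Suc j)) *\<^sub>R (r * h m * s))"
    by (simp add: mult.assoc del: of_nat_Suc)
  also have "\<dots> = - ((real (Suc i) / real (Suc j)) *\<^sub>R ((1 - r) * s))"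
    by (simp add: rh divide_inverse mult.commute del: of_nat_Suc)
  finally have "norm (r * (s - 1)) = real (Suc i) / real (Suc j) * norm ((1 - r) * s)"
    by (simp del: of_nat_Suc)
  also have "\<dots> \<le> real (Suc i) / real (Suc j) * (1 * 1)"
    using order_trans[OF norm_mult_ineq mult_mono[OF r(8) s(3)]] by (intro mult_left_mono) auto
  finally show "norm (finite_part h i m * (finite_part h j m - 1)) \<le> real (Suc i) / real (Suc j)"
    by (simp add: r_def s_def)
qed

text \<open>Both limits exist by monotonicity, decreasing in \<open>m\<close> and increasing in
  \<open>i\<close>. The difficulty is idempotence, where the two factors carry independent pairs of
  indices.\<close>

lemma finite_part_projection:
  fixes h :: "nat \<Rightarrow> 'a::cstar_algebra"
  assumes h: "\<And>m. cpos (h m)" and inc: "\<And>m. cpos (h (Suc m) - h m)"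
  obtains e L where "e \<in> bidual" "bidual_mult e e = e" "bidual_star e = e"
    "\<And>f i. f \<in> dual \<Longrightarrow> (\<lambda>m. f (finite_part h i m)) \<longlonglongrightarrow> L f i"
    "\<And>f. f \<in> dual \<Longrightarrow> L f \<longlonglongrightarrow> e f"
proof -
  define r where "r = finite_part h"
  note ff = finite_part_estimates[where h = h, OF h inc, folded r_def]
  note res = resolvent[OF ff(1), folded finite_part_def, folded r_def]
  have conv: "convergent (\<lambda>m. f (r i m))" if "f \<in> dual" for f i
    by (rule monotone_dual_convergent[OF that]) (use ff(2) res(3,4) in auto)
  define L where "L f i = lim (\<lambda>m. f (r i m))" for f :: "'a \<Rightarrow> complex" and i
  have L: "(\<lambda>m. f (r i m)) \<longlonglongrightarrow> L f i" if "f \<in> dual" for f i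
    using conv[OF that] by (simp add: L_def convergent_LIMSEQ_iff)
  have convL: "convergent (L f)" if "f \<in> dual" for f
    by (rule monotone_double_limit[OF that _ _ _ L[OF that]]) (use ff(3) res(7,8) in auto)
  define e where "e = (\<lambda>f\<in>dual. lim (L f))"
  have e: "L f \<longlonglongrightarrow> e f" if "f \<in> dual" for f
    using convL[OF that] that by (simp add: e_def convergent_LIMSEQ_iff)
  have Ladd: "L (\<lambda>a. f a + g a) = (\<lambda>i. L f i + L g i)" if "f \<in> dual" "g \<in> dual" for f g
    by (rule ext, rule LIMSEQ_unique[OF L[OF dual_add[OF that]] tendsto_add[OF L L]]) (use that in auto)
  have Lsc: "L (\<lambda>a. c * f a) = (\<lambda>i. c * L f i)" if "f \<in> dual" for c f
    by (rule ext, rule LIMSEQ_unique[OF L[OF dual_scaleC[OF that]] tendsto_mult[OF tendsto_const L]]) (use that in auto)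
  have eadd: "e (\<lambda>a. f a + g a) = e f + e g" if "f \<in> dual" "g \<in> dual" for f g
    using LIMSEQ_unique[OF e[OF dual_add[OF that]]] tendsto_add[OF e[OF that(1)] e[OF that(2)]]
    by (simp add: Ladd[OF that])
  have esc: "e (\<lambda>a. c * f a) = c * e f" if "f \<in> dual" for c f
    using LIMSEQ_unique[OF e[OF dual_scaleC[OF that]]] tendsto_mult[OF tendsto_const e[OF that]]
    by (simp add: Lsc[OF that])
  have fr: "cmod (f (r i m)) \<le> onorm f" if "f \<in> dual" for f i m
    using order_trans[OF dualD(6)[OF that] mult_left_mono[OF res(3) dualD(7)[OF that]]] by simp
  have ebd: "cmod (e f) \<le> onorm f" if "f \<in> dual" for f
  proof (rule LIMSEQ_le_const2[OF tendsto_norm[OF e[OF that]]], intro exI allI impI)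
    show "cmod (L f i) \<le> onorm f" for i
      by (rule LIMSEQ_le_const2[OF tendsto_norm[OF L[OF that]]]) (use fr[OF that] in auto)
  qed
  have ebid: "e \<in> bidual"
    unfolding bidual_def using eadd esc ebd
    by (auto simp: e_def intro!: exI[of _ 1])
  have idem: "e (\<lambda>a. e (\<lambda>b. f (a * b))) = e f" if f: "f \<in> dual" for f
  proof -
    define t where "t = (\<lambda>a. e (\<lambda>b. f (a * b)))"
    have td: "t \<in> dual" unfolding t_def by (rule dual_bidual_left[OF ebid f])
    have Lt: "L t i = L f i" for i
    proof -
      have "(\<lambda>m. t (r i m) - f (r i m)) \<longlonglongrightarrow> 0"
      proof (rule LIMSEQ_I)
        fix \<epsilon> :: real assume "\<epsilon> > 0"
        then have e4: "\<epsilon> / 4 > 0" by simp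
        obtain M where M: "\<And>m n b. M \<le> m \<Longrightarrow> m \<le> n \<Longrightarrow> norm b \<le> 1 \<Longrightarrow> cmod (f ((r i m - r i n) * b)) \<le> \<epsilon> / 4"
          using monotone_dual_cauchy[where c = "r i" and \<epsilon> = "\<epsilon> / 4", OF f ff(2) res(4) res(3) e4] by blast
        show "\<exists>M. \<forall>m\<ge>M. norm (t (r i m) - f (r i m) - 0) < \<epsilon>"
        proof (intro exI[of _ M] allI impI)
          fix m assume m: "M \<le> m"
          define fm where "fm = (\<lambda>b. f (r i m * b))"
          have fmd: "fm \<in> dual" unfolding fm_def by (rule dual_mult_left[OF f])
          have Lb: "cmod (L fm j - f (r i m)) \<le> \<epsilon> / 4 + onorm f * (real (Suc i) / real (Suc j))" for j
          proof (rule LIMSEQ_le_const2[OF tendsto_norm[OF tendsto_diff[OF L[OF fmd] tendsto_const]]],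
              intro exI[of _ m] allI impI)
            fix n assume n: "m \<le> n"
            have "norm (r j n - 1) \<le> 1" using res(8)[of j n] by (simp add: norm_minus_commute)
            from M[OF m n this]
            have 1: "cmod (f ((r i m - r i n) * (r j n - 1))) \<le> \<epsilon> / 4" .
            have 2: "cmod (f (r i n * (r j n - 1))) \<le> onorm f * (real (Suc i) / real (Suc j))"
              using order_trans[OF dualD(6)[OF f] mult_left_mono[OF ff(4) dualD(7)[OF f]]] .
            \<comment> \<open>The left factor is moved to the index \<open>n\<close> of the right
              one, where approximate idempotence applies; the error is small uniformly over the unit
              ball, to which \<open>r j n - 1\<close> belongs.\<close>
            have "fm (r j n) - f (r i m) = f ((r i m - r i n) * (r j n - 1)) + f (r i n * (r j n - 1))"
              unfolding fm_def dualD(3)[OF f, symmetric] dualD(4)[OF f, symmetric]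
              by (simp add: algebra_simps)
            then show "cmod (fm (r j n) - f (r i m)) \<le> \<epsilon> / 4 + onorm f * (real (Suc i) / real (Suc j))"
              using norm_triangle_le[OF add_mono[OF 1 2]] by simp
          qed
          have "(\<lambda>j. \<epsilon> / 4 + onorm f * (real (Suc i) / real (Suc j))) \<longlonglongrightarrow> \<epsilon> / 4 + onorm f * 0"
          proof (intro tendsto_intros)
            show "(\<lambda>j. real (Suc i) / real (Suc j)) \<longlonglongrightarrow> 0"
              using tendsto_mult[OF tendsto_const LIMSEQ_inverse_real_of_nat, of "real (Suc i)"]
              by (simp add: divide_inverse)
          qed
          then have "cmod (e fm - f (r i m)) \<le> \<epsilon> / 4 + onorm f * 0"
            by (rule LIMSEQ_le[OF tendsto_norm[OF tendsto_diff[OF e[OF fmd] tendsto_const]]])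
               (use Lb in auto)
          then show "norm (t (r i m) - f (r i m) - 0) < \<epsilon>"
            using \<open>\<epsilon> > 0\<close> by (simp add: t_def fm_def)
        qed
      qed
      from tendsto_add[OF this L[OF f, of i]] have "(\<lambda>m. t (r i m)) \<longlonglongrightarrow> L f i" by simp
      then show ?thesis using LIMSEQ_unique[OF L[OF td]] by blast
    qed
    have "L t = L f" using Lt by blast
    then have "e t = e f" using LIMSEQ_unique[OF e[OF td]] e[OF f] by simp
    then show ?thesis by (simp add: t_def)
  qed
  have e_out: "e f = undefined" if "f \<notin> dual" for f using that by (simp add: e_def)
  have "bidual_mult e e f = e f" for f
    by (cases "f \<in> dual") (simp_all add: bidual_mult_def idem e_out)
  then have "bidual_mult e e = e" ..
  moreover have star: "e (\<lambda>a. cnj (f (star a))) = cnj (e f)" if f: "f \<in> dual" for f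
  proof -
    have "L (\<lambda>a. cnj (f (star a))) = (\<lambda>i. cnj (L f i))"
    proof
      fix i
      show "L (\<lambda>a. cnj (f (star a))) i = cnj (L f i)"
        using LIMSEQ_unique[OF L[OF dual_star[OF f]]] tendsto_cnj[OF L[OF f, of i]] by (simp add: res(9))
    qed
    then show ?thesis
      using LIMSEQ_unique[OF e[OF dual_star[OF f]]] tendsto_cnj[OF e[OF f]] by simp
  qed
  have "bidual_star e f = e f" for f
    by (cases "f \<in> dual") (simp_all add: bidual_star_def star e_out)
  then have "bidual_star e = e" ..
  ultimately show ?thesis using that[of e L] ebid L e by (simp add: r_def)
qed

text \<open>Evaluation at 1 is the unit of the bidual, so this is the complementary
  projection.\<close>

lemma complement_of_bidual_projection:
  assumes e: "e \<in> bidual" "bidual_mult e e = e" "bidual_star e = e"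
  shows "(\<lambda>f\<in>dual. f 1 - e f) \<in> bidual_projections"
proof -
  define q where "q = (\<lambda>f\<in>dual. f 1 - e f)"
  have q: "q f = f 1 - e f" if "f \<in> dual" for f using that by (simp add: q_def)
  have q_out: "q f = undefined" if "f \<notin> dual" for f using that by (simp add: q_def)
  note ed = bidualD[OF e(1)]
  obtain K where K: "\<And>f. f \<in> dual \<Longrightarrow> cmod (e f) \<le> K * onorm f" using ed(3) by blast
  have eneg: "e (\<lambda>a. f a - g a) = e f - e g" if "f \<in> dual" "g \<in> dual" for f g
    using ed(1)[OF that(1) dual_scaleC[OF that(2), of "-1"]] ed(2)[OF that(2), of "-1"] by simp
  have ee: "e (\<lambda>a. e (\<lambda>b. f (a * b))) = e f" if "f \<in> dual" for f
    using fun_cong[OF e(2), of f] that by (simp add: bidual_mult_def)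
  have es: "cnj (e (\<lambda>a. cnj (f (star a)))) = e f" if "f \<in> dual" for f
    using fun_cong[OF e(3), of f] that by (simp add: bidual_star_def)
  have qb: "q \<in> bidual"
    unfolding bidual_def
  proof (intro CollectI conjI ballI allI exI[of _ "1 + K"])
    show "q \<in> extensional dual" by (simp add: q_def)
    show "q (\<lambda>a. f a + g a) = q f + q g" if "f \<in> dual" "g \<in> dual" for f g
      using that by (simp add: q dual_add ed(1))
    show "q (\<lambda>a. c * f a) = c * q f" if "f \<in> dual" for c f
      using that by (simp add: q dual_scaleC ed(2) algebra_simps)
    show "cmod (q f) \<le> (1 + K) * onorm f" if "f \<in> dual" for f
      using norm_triangle_le_diff[OF add_mono[OF dualD(6)[OF that, of 1] K[OF that]]] that
      by (simp add: q distrib_right)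
  qed
  have "bidual_mult q q f = q f" for f
  proof (cases "f \<in> dual")
    case True
    have "(\<lambda>a. q (\<lambda>b. f (a * b))) = (\<lambda>a. f a - e (\<lambda>b. f (a * b)))"
      using dual_mult_left(1)[OF True] by (simp add: q)
    moreover have "(\<lambda>a. f a - e (\<lambda>b. f (a * b))) \<in> dual"
      using dual_add[OF True dual_scaleC[OF dual_bidual_left[OF e(1) True], of "-1"]] by simp
    ultimately show ?thesis
      using True dual_mult_left(1)[OF True, of 1] dual_bidual_left[OF e(1) True]
      by (simp add: bidual_mult_def q eneg ee)
  qed (simp add: bidual_mult_def q_out)
  moreover have "bidual_star q f = q f" for f
  proof (cases "f \<in> dual")
    case True
    then show ?thesis using dual_star[OF True] es[OF True] by (simp add: bidual_star_def q)
  qed (simp add: bidual_star_def q_out)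
  ultimately show ?thesis
    unfolding q_def[symmetric] bidual_projections_def using qb by (auto intro!: ext)
qed

text \<open>The difference equals \<open>h * r * h + r * h * r\<close> with
  \<open>r = resolvent h\<close>. It turns a bound for the quadratic form of \<open>h\<close> at a
  vector into a bound for the norm of \<open>1 - r\<close> applied to that vector.\<close>

lemma cpos_minus_square_one_minus_resolvent:
  assumes h: "cpos h"
  shows "cpos (h - (1 - resolvent h) * (1 - resolvent h))"
proof -
  define r where "r = resolvent h"
  note r = resolvent[OF h, folded r_def]
  have "h - (1 - r) * (1 - r) = h * r * h + r * h * r"
  proof -
    have "h * r * h = h - h * r" using r(6) by (simp add: mult.assoc right_diff_distrib)
    also have "\<dots> = h - (1 - r)" by (simp only: r(5))
    finally have 1: "h * r * h = h - (1 - r)" .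
    have "r * h * r = (1 - r) * r" by (simp only: r(6))
    then show ?thesis unfolding 1 by (simp add: algebra_simps)
  qed
  moreover have "cpos (star h * r * h + star r * h * r)"
    by (intro cpos_add cpos_sandwich r(4) h)
  ultimately show ?thesis by (simp add: r_def[symmetric] r(9) cpos_star[OF h])
qed

section \<open>Central support and cyclicity for the commutant\<close>

context covariant_system
begin

lemma vector_functional_dual:
  assumes "y \<in> H" "z \<in> H"
  shows "(\<lambda>a. cinner (\<pi> a y) z) \<in> dual" "onorm (\<lambda>a. cinner (\<pi> a y) z) \<le> norm y * norm z"
proof -
  have bd: "cmod (cinner (\<pi> a y) z) \<le> (norm y * norm z) * norm a" for a
  proof -
    have "cmod (cinner (\<pi> a y) z) \<le> norm (\<pi> a y) * norm z" by (rule cinner_norm_le)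
    also have "\<dots> \<le> norm a * norm y * norm z" by (intro mult_right_mono pi_norm assms) simp
    finally show ?thesis by (simp add: mult_ac)
  qed
  show "(\<lambda>a. cinner (\<pi> a y) z) \<in> dual"
    by (rule dualI[OF _ _ bd]) (use assms in \<open>simp_all add: pi_add pi_scaleC cinner_add_left cinner_scaleC_left\<close>)
  then show "onorm (\<lambda>a. cinner (\<pi> a y) z) \<le> norm y * norm z" by (rule onorm_dual_le[OF _ bd])
qed

text \<open>The form \<open>B\<close> is given by an operator \<open>P\<close>. Idempotence and
  self-adjointness of \<open>p\<close> make \<open>P\<close> a projection, centrality makes it
  commute with the representation, and \<open>p \<psi> = 1\<close> gives
  \<open>P \<Psi> = \<Psi>\<close>; cyclicity of \<open>\<Psi>\<close> then forces \<open>P\<close>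
  to be the identity.\<close>

lemma central_projection_acts_trivially:
  assumes p: "p \<in> bidual_centre" "p \<in> bidual_projections" "p \<psi> = 1"
    and yz: "y \<in> H" "z \<in> H"
  shows "p (\<lambda>a. cinner (\<pi> a y) z) = cinner y z"
proof -
  define B where "B y z = p (\<lambda>a. cinner (\<pi> a y) z)" for y z
  have pb: "p \<in> bidual" using p(1) by (simp add: bidual_centre_def)
  note padd = bidualD(1)[OF pb] and psc = bidualD(2)[OF pb]
  obtain K where K: "K \<ge> 0" "\<And>f. f \<in> dual \<Longrightarrow> cmod (p f) \<le> K * onorm f"
    using bidualD(3)[OF pb] by blast
  have pmult: "p (\<lambda>a. p (\<lambda>b. f (a * b))) = p f" if "f \<in> dual" for f
  proof -
    have "bidual_mult p p f = p f" using p(2) by (simp add: bidual_projections_def)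
    then show ?thesis using that by (simp add: bidual_mult_def)
  qed
  have pstar: "p f = cnj (p (\<lambda>a. cnj (f (star a))))" if "f \<in> dual" for f
  proof -
    have "bidual_star p f = p f" using p(2) by (simp add: bidual_projections_def)
    then show ?thesis using that by (simp add: bidual_star_def)
  qed
  have pcomm: "p (\<lambda>b. f (a * b)) = p (\<lambda>b. f (b * a))" if f: "f \<in> dual" for f a
  proof -
    \<comment> \<open>The image of \<open>a\<close> in the bidual, with which the central
      \<open>p\<close> commutes.\<close>
    define A where "A = (\<lambda>f\<in>dual. f a)"
    have "A \<in> bidual"
      unfolding bidual_def
      by (auto simp: A_def dual_add dual_scaleC intro!: exI[of _ "norm a"] order_trans[OF dualD(6)])
    then have "bidual_mult p A f = bidual_mult A p f" using p(1) by (simp add: bidual_centre_def)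
    then show ?thesis
      using f dual_mult_left(1)[OF f] dual_bidual_left[OF pb f]
      by (simp add: bidual_mult_def A_def)
  qed
  have vd: "(\<lambda>a. cinner (\<pi> a y) z) \<in> dual" if "y \<in> H" "z \<in> H" for y z
    by (rule vector_functional_dual[OF that])
  have Badd: "B (y + y') z = B y z + B y' z" if "y \<in> H" "y' \<in> H" "z \<in> H" for y y' z
    using padd[OF vd vd, OF that(1,3) that(2,3)] that by (simp add: B_def pi_add_right cinner_add_left)
  have Bsc: "B (c *\<^sub>C y) z = c * B y z" if "y \<in> H" "z \<in> H" for c y z
    using psc[OF vd[OF that]] that by (simp add: B_def pi_scaleC_right cinner_scaleC_left)
  have Bsym: "B y z = cnj (B z y)" if "y \<in> H" "z \<in> H" for y z
  proof -
    have "cnj (cinner (\<pi> (star a) y) z) = cinner (\<pi> a z) y" for a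
      using that by (simp only: pi_adjoint cinner_commute[of "\<pi> (star a) y"] complex_cnj_cnj)
    then show ?thesis using pstar[OF vd[OF that]] by (simp add: B_def)
  qed
  have Bbd: "cmod (B y z) \<le> K * norm z * norm y" if "y \<in> H" "z \<in> H" for y z
  proof -
    have "cmod (B y z) \<le> K * onorm (\<lambda>a. cinner (\<pi> a y) z)" unfolding B_def by (rule K(2)[OF vd[OF that]])
    also have "\<dots> \<le> K * (norm y * norm z)"
      by (intro mult_left_mono vector_functional_dual that K)
    finally show ?thesis by (simp add: mult_ac)
  qed
  have "\<exists>w\<in>H. \<forall>y\<in>H. B y z = cinner y w" if z: "z \<in> H" for z
    by (rule riesz_representation[OF H])
       (auto simp: clinear_on_def Badd Bsc z intro!: exI[of _ "K * norm z"] Bbd)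
  then obtain P where PH: "\<And>z. z \<in> H \<Longrightarrow> P z \<in> H"
    and P': "\<And>y z. y \<in> H \<Longrightarrow> z \<in> H \<Longrightarrow> B y z = cinner y (P z)" by metis
  have P: "B y z = cinner (P y) z" if "y \<in> H" "z \<in> H" for y z
    using Bsym[OF that] P'[OF that(2,1)] by (metis cinner_commute)
  have PP: "cinner (P y) (P z) = cinner (P y) z" if y: "y \<in> H" and z: "z \<in> H" for y z
  proof -
    have "p (\<lambda>b. cinner (\<pi> (a * b) y) z) = cinner (\<pi> a (P y)) z" for a
    proof -
      have "p (\<lambda>b. cinner (\<pi> (a * b) y) z) = B y (\<pi> (star a) z)"
        using y z by (simp add: B_def pi_mult pi_adjoint[of "\<pi> _ y"])
      also have "\<dots> = cinner (\<pi> a (P y)) z" using y z PH by (simp add: P pi_adjoint)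
      finally show ?thesis .
    qed
    then have "B (P y) z = B y z"
      using pmult[OF vd[OF y z]] by (simp add: B_def)
    then show ?thesis using P'[OF PH[OF y] z] P[OF y z] by simp
  qed
  have comm: "B y (\<pi> (star a) z) = B (\<pi> a y) z" if y: "y \<in> H" and z: "z \<in> H" for a y z
    using pcomm[OF vd[OF y z], of a] y z by (simp add: B_def pi_mult pi_adjoint[of "\<pi> _ y"])
  have "\<psi> = (\<lambda>a. cinner (\<pi> a \<Psi>) \<Psi>)" by (rule ext) (rule psi_eq)
  then have 1: "cinner (P \<Psi>) \<Psi> = 1" and 2: "cinner \<Psi> \<Psi> = 1"
    using p(3) P[of \<Psi> \<Psi>] cinner_Psi by (simp_all add: B_def)
  have "cinner \<Psi> (P \<Psi>) = cnj (cinner (P \<Psi>) \<Psi>)" by (rule cinner_commute)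
  then have "cinner (P \<Psi> - \<Psi>) (P \<Psi> - \<Psi>) = 0"
    using PP[of \<Psi> \<Psi>] 1 2 by (simp add: cinner_diff_left cinner_diff_right)
  then have P1: "P \<Psi> = \<Psi>" by simp
  have dense: "B (\<pi> a \<Psi>) z = cinner (\<pi> a \<Psi>) z" if z: "z \<in> H" for a z
    using comm[of \<Psi> z a] P[of \<Psi> "\<pi> (star a) z"] z by (simp add: P1 pi_adjoint)
  have "cinner (P z - z) y = 0"
  proof (rule orthogonal_closure)
    fix w assume "w \<in> range (\<lambda>a. \<pi> a \<Psi>)"
    then obtain a where w: "w = \<pi> a \<Psi>" by blast
    have "cinner w (P z - z) = 0" using dense[OF yz(2), of a] P'[of w z] yz by (simp add: w cinner_diff_right)
    then show "cinner (P z - z) w = 0" using cinner_commute_zero by blast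
  qed (use yz cyclic in simp)
  then have "cinner y (P z - z) = 0" using cinner_commute_zero by blast
  then have "B y z = cinner y z" using P'[OF yz] by (simp add: cinner_diff_right)
  then show ?thesis by (simp add: B_def)
qed

lemma Re_cinner_scaleR_left: "Re (cinner (r *\<^sub>R x) y) = r * Re (cinner x (y::'k))"
  by (simp add: cinner_scaleR_left)

lemma Re_cinner_star_mult: "x \<in> H \<Longrightarrow> Re (cinner (\<pi> (star a * a) x) x) = (norm (\<pi> a x))\<^sup>2"
  by (simp add: pi_mult pi_adjoint star_star cinner_self del: of_real_power)

text \<open>The increasing \<open>h m\<close> stays bounded at \<open>x\<close>, where the weight
  \<open>4 ^ n\<close> meets a squared error of at most \<open>(1/16) ^ n\<close>, but tends to
  infinity at \<open>\<Psi>\<close>, which \<open>c n\<close> moves almost into the orthogonal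
  complement of \<open>\<Psi>\<close>. So the projection \<open>e\<close> onto the part where
  \<open>h\<close> stays finite fixes \<open>x\<close>, while \<open>e \<psi> = 0\<close>. Its
  complement \<open>q\<close> then dominates the central support \<open>p\<close>; but
  \<open>q\<close> annihilates \<open>x\<close>, and \<open>p\<close> acts as the identity.\<close>

theorem commutant_cyclic:
  assumes "central_support \<psi>"
  shows "closure M'\<Psi> = H"
proof (rule closed_csubspace_eqI[OF closure_M'_Psi H])
  show "closure M'\<Psi> \<subseteq> H" using M'_Psi_subset H_closed by (rule closure_minimal)
  fix x assume x: "x \<in> H" "\<And>z. z \<in> closure M'\<Psi> \<Longrightarrow> cinner x z = 0"
  obtain p where p: "p \<in> bidual_centre" "p \<in> bidual_projections" "p \<psi> = 1"
    and pmin: "\<And>q. q \<in> bidual_projections \<Longrightarrow> q \<psi> = 1 \<Longrightarrow> bidual_mult p q = p"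
    using assms unfolding central_support_def is_support_def by blast
  have "\<exists>c. norm (\<pi> c x - x) < (1/4) ^ n \<and> norm (\<pi> (star c) \<Psi>) < (1/4) ^ n" for n
    by (rule approximate_projection[OF x]) simp_all
  then obtain c where c: "\<And>n. norm (\<pi> (c n) x - x) < (1/4) ^ n"
      "\<And>n. norm (\<pi> (star (c n)) \<Psi>) < (1/4) ^ n" by metis
  define d where "d n = 4 ^ n *\<^sub>R (star (1 - c n) * (1 - c n))" for n
  define h where "h m = (\<Sum>n<m. d n)" for m
  have cd: "cpos (d n)" for n unfolding d_def by (rule cpos_scaleR[OF cpos_star_mult]) simp
  have ch: "cpos (h m)" for m unfolding h_def by (rule cpos_sum[OF cd])
  have inc: "cpos (h (Suc m) - h m)" for m using cd by (simp add: h_def)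
  have Re_d: "Re (cinner (\<pi> (d n) y) y) = 4 ^ n * (norm (y - \<pi> (c n) y))\<^sup>2" if "y \<in> H" for n y
    using that Re_cinner_star_mult[OF that, of "1 - c n"]
    by (simp add: d_def pi_scaleR cinner_scaleR_left pi_diff del: of_real_power)
  have hx: "Re (cinner (\<pi> (h m) x) x) \<le> 2" for m
  proof -
    have "Re (cinner (\<pi> (h m) x) x) = (\<Sum>n<m. 4 ^ n * (norm (x - \<pi> (c n) x))\<^sup>2)"
      using x(1) by (simp add: h_def pi_sum cinner_sum_left Re_d)
    also have "\<dots> \<le> (\<Sum>n<m. (1/4) ^ n)"
    proof (rule sum_mono)
      fix n
      have "norm (x - \<pi> (c n) x) \<le> (1/4) ^ n" using c(1)[of n] by (simp add: norm_minus_commute)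
      then have "(norm (x - \<pi> (c n) x))\<^sup>2 \<le> ((1/4) ^ n)\<^sup>2" by (rule power_mono) simp
      then have "4 ^ n * (norm (x - \<pi> (c n) x))\<^sup>2 \<le> 4 ^ n * ((1/4) ^ n)\<^sup>2" by simp
      also have "\<dots> = (1/4) ^ n" by (simp add: power2_eq_square power_mult_distrib[symmetric] flip: mult.assoc)
      finally show "4 ^ n * (norm (x - \<pi> (c n) x))\<^sup>2 \<le> (1/4) ^ n" .
    qed
    also have "\<dots> = (1 - (1/4) ^ m) / (1 - 1/4)" by (subst sum_gp_strict) simp
    also have "\<dots> \<le> 2" by (simp add: field_simps)
    finally show ?thesis .
  qed
  obtain e L where e: "e \<in> bidual" "bidual_mult e e = e" "bidual_star e = e"
    and L: "\<And>f i. f \<in> dual \<Longrightarrow> (\<lambda>m. f (finite_part h i m)) \<longlonglongrightarrow> L f i"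
    and Le: "\<And>f. f \<in> dual \<Longrightarrow> L f \<longlonglongrightarrow> e f"
    using finite_part_projection[where h = h, OF ch inc] by blast
  define g where "g i m = inverse (real (Suc i)) *\<^sub>R h m" for i m
  have cg: "cpos (g i m)" for i m unfolding g_def by (rule finite_part_estimates(1)[where h = h, OF ch inc])
  have r_eq: "finite_part h i m = resolvent (g i m)" for i m by (simp add: finite_part_def g_def)
  note res = resolvent[OF cg, folded r_eq]
  have rx: "norm (\<pi> (1 - finite_part h i m) x) \<le> sqrt (2 * inverse (real (Suc i)))" for i m
  proof -
    have "0 \<le> Re (cinner (\<pi> (g i m - (1 - finite_part h i m) * (1 - finite_part h i m)) x) x)"
      by (rule pi_cpos[OF cpos_minus_square_one_minus_resolvent[OF cg, folded r_eq] x(1)])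
    also have "\<dots> = inverse (real (Suc i)) * Re (cinner (\<pi> (h m) x) x)
        - (norm (\<pi> (1 - finite_part h i m) x))\<^sup>2"
      using x(1) Re_cinner_star_mult[OF x(1), of "1 - finite_part h i m"]
      unfolding pi_diff[OF x(1), of "g i m"]
      by (simp add: cinner_diff_left g_def pi_scaleR Re_cinner_scaleR_left star_diff res(9) del: of_nat_Suc)
    also have "\<dots> \<le> inverse (real (Suc i)) * 2 - (norm (\<pi> (1 - finite_part h i m) x))\<^sup>2"
      by (intro diff_right_mono mult_left_mono hx) simp
    finally have "(norm (\<pi> (1 - finite_part h i m) x))\<^sup>2 \<le> inverse (real (Suc i)) * 2" by simp
    then show ?thesis by (intro real_le_rsqrt) (simp add: mult.commute)
  qed
  have ex: "e (\<lambda>b. cinner (\<pi> b x) y) = cinner x y" if y: "y \<in> H" for y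
  proof -
    define f where "f = (\<lambda>b. cinner (\<pi> b x) y)"
    have f: "f \<in> dual" unfolding f_def by (rule vector_functional_dual[OF x(1) y])
    have Lb: "cmod (L f i - cinner x y) \<le> sqrt (2 * inverse (real (Suc i))) * norm y" for i
    proof (rule LIMSEQ_le_const2[OF tendsto_norm[OF tendsto_diff[OF L[OF f] tendsto_const]]],
        intro exI allI impI)
      fix m
      have "cmod (f (finite_part h i m) - cinner x y) = cmod (cinner (\<pi> (1 - finite_part h i m) x) y)"
        using x(1) by (simp add: f_def pi_diff cinner_diff_left norm_minus_commute)
      also have "\<dots> \<le> norm (\<pi> (1 - finite_part h i m) x) * norm y" by (rule cinner_norm_le)
      also have "\<dots> \<le> sqrt (2 * inverse (real (Suc i))) * norm y" by (intro mult_right_mono rx) simp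
      finally show "cmod (f (finite_part h i m) - cinner x y) \<le> sqrt (2 * inverse (real (Suc i))) * norm y" .
    qed
    have "(\<lambda>i. sqrt (2 * inverse (real (Suc i))) * norm y) \<longlonglongrightarrow> sqrt (2 * 0) * norm y"
      by (intro tendsto_intros LIMSEQ_inverse_real_of_nat)
    then have "cmod (e f - cinner x y) \<le> sqrt (2 * 0) * norm y"
      by (rule LIMSEQ_le[OF tendsto_norm[OF tendsto_diff[OF Le[OF f] tendsto_const]]]) (use Lb in auto)
    then show ?thesis by (simp add: f_def)
  qed
  have psi_f: "\<psi> = (\<lambda>a. cinner (\<pi> a \<Psi>) \<Psi>)" by (rule ext) (rule psi_eq)
  have psi_dual: "\<psi> \<in> dual" unfolding psi_f by (rule vector_functional_dual) simp_all
  \<comment> \<open>With \<open>z = \<pi> r \<Psi>\<close>, the relation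
    \<open>g i m * r = 1 - r\<close> bounds the form of \<open>h m\<close> at \<open>z\<close> by
    \<open>i + 1\<close>. The single summand \<open>d n\<close> then forces \<open>z\<close> close
    to \<open>\<pi> (c n) z\<close>, which is almost orthogonal to \<open>\<Psi>\<close> because
    \<open>star (c n)\<close> almost annihilates \<open>\<Psi>\<close>.\<close>
  have psi_r: "cmod (\<psi> (finite_part h i m)) \<le> (1/4) ^ n + sqrt (real (Suc i)) * (1/2) ^ n" if nm: "n < m" for i m n
  proof -
    define r where "r = finite_part h i m"
    define z where "z = \<pi> r \<Psi>"
    have zH: "z \<in> H" by (simp add: z_def)
    have nz: "norm z \<le> 1"
      using order_trans[OF pi_norm[OF Psi_H] res(3)[of i m, THEN mult_right_mono[of _ _ "norm \<Psi>"]]]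
      by (simp add: z_def r_def)
    have "cpos (h m - d n)"
      unfolding h_def using nm by (subst sum.remove[of _ n]) (auto intro: cpos_sum cd)
    from pi_cpos[OF this zH] have "4 ^ n * (norm (z - \<pi> (c n) z))\<^sup>2 \<le> Re (cinner (\<pi> (h m) z) z)"
      using zH by (simp add: pi_diff cinner_diff_left Re_d)
    also have "\<dots> = real (Suc i) * Re (cinner (\<pi> (g i m) z) z)"
      using zH by (simp add: g_def pi_scaleR cinner_scaleR_left field_simps)
    also have "Re (cinner (\<pi> (g i m) z) z) \<le> 1"
    proof -
      have "star r = r" unfolding r_def by (rule res(9))
      then have "cinner (\<pi> (g i m) z) z = cinner (\<pi> r (\<pi> (g i m) z)) \<Psi>"
        using pi_adjoint[of "\<pi> (g i m) z" \<Psi> r] zH by (simp add: z_def)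
      also have "\<dots> = cinner (\<pi> (r * (g i m * r)) \<Psi>) \<Psi>" by (simp add: z_def pi_mult)
      also have "g i m * r = 1 - r" unfolding r_def by (rule res(5))
      finally have "Re (cinner (\<pi> (g i m) z) z) \<le> norm (\<pi> (r * (1 - r)) \<Psi>) * norm \<Psi>"
        using order_trans[OF complex_Re_le_cmod cinner_norm_le[of "\<pi> (r * (1 - r)) \<Psi>" \<Psi>]] by simp
      also have "\<dots> \<le> norm (r * (1 - r))" using pi_norm[OF Psi_H, of "r * (1 - r)"] by simp
      also have "\<dots> \<le> 1 * 1"
        unfolding r_def by (rule order_trans[OF norm_mult_ineq mult_mono[OF res(3) res(8)]]) simp_all
      finally show ?thesis by simp
    qed
    finally have "4 ^ n * (norm (z - \<pi> (c n) z))\<^sup>2 \<le> real (Suc i)" by simp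
    then have "(norm (z - \<pi> (c n) z))\<^sup>2 \<le> real (Suc i) * (1/4) ^ n"
      by (simp add: power_divide field_simps)
    also have "\<dots> = (sqrt (real (Suc i)) * (1/2) ^ n)\<^sup>2"
      by (simp add: power_mult_distrib power2_eq_square[of "(1/2) ^ n"] flip: power_mult_distrib[of "1/2" "1/2"])
    finally have 1: "norm (z - \<pi> (c n) z) \<le> sqrt (real (Suc i)) * (1/2) ^ n"
      by (rule power2_le_imp_le) simp
    have "cmod (cinner (z - \<pi> (c n) z) \<Psi>) \<le> norm (z - \<pi> (c n) z) * norm \<Psi>" by (rule cinner_norm_le)
    then have 2: "cmod (cinner (z - \<pi> (c n) z) \<Psi>) \<le> sqrt (real (Suc i)) * (1/2) ^ n" using 1 by simp
    have "cmod (cinner (\<pi> (c n) z) \<Psi>) = cmod (cinner z (\<pi> (star (c n)) \<Psi>))"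
      using zH by (simp add: pi_adjoint)
    also have "\<dots> \<le> norm z * norm (\<pi> (star (c n)) \<Psi>)" by (rule cinner_norm_le)
    also have "\<dots> \<le> 1 * (1/4) ^ n" using nz c(2)[of n] by (intro mult_mono) auto
    finally have 3: "cmod (cinner (\<pi> (c n) z) \<Psi>) \<le> (1/4) ^ n" by simp
    have "\<psi> r = cinner (\<pi> (c n) z) \<Psi> + cinner (z - \<pi> (c n) z) \<Psi>"
      by (simp add: psi_eq z_def cinner_diff_left)
    then show ?thesis using norm_triangle_le[OF add_mono[OF 3 2]] by (simp add: r_def)
  qed
  have "L \<psi> i = 0" for i
  proof -
    have "cmod (L \<psi> i) \<le> (1/4) ^ n + sqrt (real (Suc i)) * (1/2) ^ n" for n
      by (rule LIMSEQ_le_const2[OF tendsto_norm[OF L[OF psi_dual]]])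
         (use psi_r[of n _ i] in \<open>auto intro!: exI[of _ "Suc n"]\<close>)
    moreover have "(\<lambda>n. (1/4) ^ n + sqrt (real (Suc i)) * (1/2) ^ n) \<longlonglongrightarrow> 0 + sqrt (real (Suc i)) * 0"
      by (intro tendsto_intros LIMSEQ_power_zero) auto
    ultimately have "cmod (L \<psi> i) \<le> 0 + sqrt (real (Suc i)) * 0" by (intro LIMSEQ_le_const) auto
    then show ?thesis by simp
  qed
  then have "L \<psi> = (\<lambda>i. 0)" by blast
  then have e\<psi>: "e \<psi> = 0" using LIMSEQ_unique[OF Le[OF psi_dual]] by simp
  define q where "q = (\<lambda>f\<in>dual. f 1 - e f)"
  have qp: "q \<in> bidual_projections" unfolding q_def by (rule complement_of_bidual_projection[OF e])
  have "q \<psi> = 1" using psi_dual state by (simp add: q_def e\<psi> states_def)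
  with pmin[OF qp] have pq: "bidual_mult p q = p" .
  define f where "f = (\<lambda>a. cinner (\<pi> a x) x)"
  have f: "f \<in> dual" unfolding f_def by (rule vector_functional_dual[OF x(1) x(1)])
  have "q (\<lambda>b. f (a * b)) = 0" for a
  proof -
    have "(\<lambda>b. f (a * b)) = (\<lambda>b. cinner (\<pi> b x) (\<pi> (star a) x))"
      using x(1) by (simp add: f_def pi_mult pi_adjoint[of "\<pi> _ x"])
    then have "e (\<lambda>b. f (a * b)) = f a" using ex[of "\<pi> (star a) x"] x(1) by (simp add: f_def pi_adjoint)
    then show ?thesis using dual_mult_left(1)[OF f] by (simp add: q_def)
  qed
  then have "p (\<lambda>a. 0) = p f" using fun_cong[OF pq, of f] f by (simp add: bidual_mult_def)
  moreover have "p (\<lambda>a. 0) = 0"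
    using bidualD(2)[of p f 0] p(2) f by (simp add: bidual_projections_def)
  ultimately have "cinner x x = 0"
    using central_projection_acts_trivially[OF p x(1) x(1)] by (simp add: f_def)
  then show "x \<in> closure M'\<Psi>" using closed_csubspaceD(2)[OF closure_M'_Psi] by simp
qed

end

section \<open>Ergodic theorems for unitary groups\<close>

definition unit_root :: "nat \<Rightarrow> int \<Rightarrow> complex" where
  "unit_root P m = cis (2 * pi * of_int m / of_nat P)"

lemma unit_root_add: "unit_root P (m + n) = unit_root P m * unit_root P n"
  by (simp add: unit_root_def cis_mult add_divide_distrib algebra_simps)

lemma unit_root_power: "unit_root P m ^ j = unit_root P (int j * m)"
  by (simp add: unit_root_def Complex.DeMoivre mult.left_commute)

lemma cnj_unit_root: "cnj (unit_root P m) = unit_root P (- m)"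
  by (simp add: unit_root_def cis_cnj)

lemma norm_unit_root [simp]: "cmod (unit_root P m) = 1"
  by (simp add: unit_root_def)

lemma unit_root_eq_1_iff: "P > 0 \<Longrightarrow> unit_root P m = 1 \<longleftrightarrow> int P dvd m"
proof
  assume P: "P > 0" and "unit_root P m = 1"
  then have "exp (\<i> * of_real (2 * pi * of_int m / of_nat P)) = 1"
    by (simp only: unit_root_def cis_conv_exp)
  then obtain n :: int where "2 * pi * of_int m / of_nat P = of_int (2 * n) * pi"
    unfolding exp_eq_1 by auto
  then have "of_int m = (of_int (int P * n) :: real)" using P by (simp add: field_simps)
  then have "m = int P * n" by (simp only: of_int_eq_iff)
  then show "int P dvd m" by simp
next
  assume "P > 0" "int P dvd m"
  then obtain n where "m = int P * n" by blast
  then have "2 * pi * of_int m / of_nat P = 2 * pi * of_int n" using \<open>P > 0\<close> by simp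
  then show "unit_root P m = 1" unfolding unit_root_def by (simp only: cis_multiple_2pi[OF Ints_of_int])
qed

lemma sum_unit_root:
  assumes P: "P > 0"
  shows "(\<Sum>j<P. unit_root P (int j * m)) = (if int P dvd m then of_nat P else 0)"
proof (cases "int P dvd m")
  case True
  then have "unit_root P (int j * m) = 1" for j using unit_root_eq_1_iff[OF P] by simp
  then show ?thesis using True by simp
next
  case False
  define q where "q = unit_root P m"
  have q: "q \<noteq> 1" using False unit_root_eq_1_iff[OF P] by (simp add: q_def)
  have "q ^ P = 1" using unit_root_eq_1_iff[OF P, of "int P * m"] by (simp add: q_def unit_root_power)
  then have "(\<Sum>j<P. q ^ j) = 0" using geometric_sum[OF q, of P] by simp
  then show ?thesis using False by (simp add: q_def unit_root_power)
qed

section \<open>Unitary groups indexed by the integers and the mean ergodic theorem\<close>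

locale unitary_group =
  fixes H :: "'h::chilbert_space set" and W :: "int \<Rightarrow> 'h \<Rightarrow> 'h"
  assumes closed_csubspace: "closed_csubspace H"
    and W_H [simp]: "x \<in> H \<Longrightarrow> W n x \<in> H"
    and W_add: "x \<in> H \<Longrightarrow> y \<in> H \<Longrightarrow> W n (x + y) = W n x + W n y"
    and W_scaleC: "x \<in> H \<Longrightarrow> W n (c *\<^sub>C x) = c *\<^sub>C W n x"
    and W_cinner [simp]: "x \<in> H \<Longrightarrow> y \<in> H \<Longrightarrow> cinner (W n x) (W n y) = cinner x y"
    and W_plus: "x \<in> H \<Longrightarrow> W (m + n) x = W m (W n x)"
    and W_0 [simp]: "x \<in> H \<Longrightarrow> W 0 x = x"
begin

lemmas Hs = closed_csubspaceD[OF closed_csubspace]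

lemma norm_W [simp]: "x \<in> H \<Longrightarrow> norm (W n x) = norm x"
  by (rule norm_eq_of_cinner) simp

lemma W_op: "bounded_op H (W n)"
  by (auto simp: bounded_op_def W_add W_scaleC intro!: exI[of _ 1])

lemmas W_zero = bounded_op_linear(1)[OF closed_csubspace W_op]
  and W_diff = bounded_op_linear(3)[OF closed_csubspace W_op]
  and W_sum = bounded_op_linear(4)[OF closed_csubspace W_op]

lemma W_inverse [simp]: "x \<in> H \<Longrightarrow> W n (W (- n) x) = x" "x \<in> H \<Longrightarrow> W (- n) (W n x) = x"
  using W_plus[of x n "- n"] W_plus[of x "- n" n] by simp_all

lemma W_adjoint: "x \<in> H \<Longrightarrow> y \<in> H \<Longrightarrow> cinner (W n x) y = cinner x (W (- n) y)"
  using W_cinner[of x "W (- n) y" n] by simp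

lemma subgroup: "unitary_group H (\<lambda>n. W (b * n))"
  by unfold_locales (auto simp: closed_csubspace W_add W_scaleC distrib_left W_plus)

text \<open>Averages weighted by powers of \<open>\<mu>\<close> become plain averages of another
  unitary group.\<close>

lemma twist:
  assumes "cmod \<mu> = 1"
  shows "unitary_group H (\<lambda>n x. (\<mu> powi n) *\<^sub>C W n x)"
proof -
  have "\<mu> \<noteq> 0" using assms by auto
  have u: "\<mu> powi n * cnj (\<mu> powi n) = 1" for n
    using assms complex_norm_square[of "\<mu> powi n"] by (simp add: norm_power_int)
  show ?thesis
  proof
    show "cinner (\<mu> powi n *\<^sub>C W n x) (\<mu> powi n *\<^sub>C W n y) = cinner x y" if "x \<in> H" "y \<in> H" for x y n
    proof -
      have "cinner (\<mu> powi n *\<^sub>C W n x) (\<mu> powi n *\<^sub>C W n y)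
          = (\<mu> powi n * cnj (\<mu> powi n)) * cinner (W n x) (W n y)"
        by (simp only: cinner_scaleC_left cinner_scaleC_right mult_ac)
      then show ?thesis unfolding u using that by simp
    qed
    show "\<mu> powi (m + n) *\<^sub>C W (m + n) x = \<mu> powi m *\<^sub>C W m (\<mu> powi n *\<^sub>C W n x)" if "x \<in> H" for x m n
      using that \<open>\<mu> \<noteq> 0\<close> by (simp add: W_scaleC power_int_add W_plus)
  qed (simp_all add: closed_csubspace Hs(4) W_add W_scaleC scaleC_add_right mult.commute)
qed

definition avg :: "nat \<Rightarrow> 'h \<Rightarrow> 'h" where
  "avg N x = (1 / real N) *\<^sub>R (\<Sum>n<N. W (int n) x)"

lemma avg_H: "x \<in> H \<Longrightarrow> avg N x \<in> H"
  unfolding avg_def by (intro Hs(7,8)) simp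

lemma norm_avg: "x \<in> H \<Longrightarrow> norm (avg N x) \<le> norm x"
proof -
  assume x: "x \<in> H"
  have "norm (\<Sum>n<N. W (int n) x) \<le> real N * norm x"
    using sum_norm_le[of "{..<N}" "\<lambda>n. W (int n) x" "\<lambda>_. norm x"] x by simp
  then show ?thesis by (cases "N = 0") (simp_all add: avg_def divide_le_eq mult.commute)
qed

lemma avg_add: "x \<in> H \<Longrightarrow> y \<in> H \<Longrightarrow> avg N (x + y) = avg N x + avg N y"
  by (simp add: avg_def W_add sum.distrib scaleR_add_right)

lemma avg_diff: "x \<in> H \<Longrightarrow> y \<in> H \<Longrightarrow> avg N (x - y) = avg N x - avg N y"
  by (simp add: avg_def W_diff sum_subtractf scaleR_diff_right)

lemma avg_op: "bounded_op H (avg N)"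
  unfolding bounded_op_def
proof (intro conjI ballI allI exI[of _ 1])
  show "avg N (c *\<^sub>C x) = c *\<^sub>C avg N x" if "x \<in> H" for c x
    using that by (simp add: avg_def W_scaleC scaleR_scaleC scaleC_sum_right[symmetric] mult.commute)
qed (auto simp: avg_H avg_add norm_avg)

lemma avg_fixed: "x \<in> H \<Longrightarrow> W 1 x = x \<Longrightarrow> N > 0 \<Longrightarrow> avg N x = x"
proof -
  assume x: "x \<in> H" "W 1 x = x" and N: "N > 0"
  have "W (int n) x = x" for n
    by (induction n) (use x W_plus[of x 1 "int _"] in \<open>simp_all add: W_plus\<close>)
  then show ?thesis using N by (simp add: avg_def sum_constant_scaleR)
qed

lemma avg_coboundary:
  assumes "y \<in> H"
  shows "norm (avg N (y - W 1 y)) \<le> 2 * norm y / real N"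
proof -
  have "(\<Sum>n<N. W (int n) (y - W 1 y)) = (\<Sum>n<N. W (int n) y - W (int (Suc n)) y)"
    using assms by (intro sum.cong) (simp_all add: W_diff W_plus[symmetric] add.commute)
  also have "\<dots> = W 0 y - W (int N) y" by (subst sum_lessThan_telescope') simp
  finally have "norm (\<Sum>n<N. W (int n) (y - W 1 y)) \<le> norm (W 0 y) + norm (W (int N) y)"
    by (simp only: norm_triangle_ineq4)
  then show ?thesis using assms by (simp add: avg_def divide_right_mono)
qed

lemma fixed_of_orthogonal:
  assumes z: "z \<in> H" and orth: "\<And>y. y \<in> H \<Longrightarrow> cinner z (y - W 1 y) = 0"
  shows "W 1 z = z"
proof (rule cinner_ext[OF closed_csubspace])
  fix y assume y: "y \<in> H"
  have "cinner (W 1 z) y = cinner z (W (- 1) y)" using z y by (rule W_adjoint)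
  also have "\<dots> = cinner z (W 1 (W (- 1) y))"
    using orth[of "W (- 1) y"] y by (simp add: cinner_diff_right)
  also have "\<dots> = cinner z y" using y by simp
  finally show "cinner (W 1 z) y = cinner z y" .
qed (use z in auto)

text \<open>Averages of coboundaries \<open>y - W 1 y\<close> are of order \<open>1 / N\<close>, and
  a vector orthogonal to all coboundaries is fixed; the projection onto the closure of the
  coboundaries separates the two cases.\<close>

theorem mean_ergodic:
  assumes x: "x \<in> H"
  shows "\<exists>z\<in>H. (\<lambda>N. avg N x) \<longlonglongrightarrow> z \<and> W 1 z = z \<and> (\<forall>w\<in>H. W 1 w = w \<longrightarrow> cinner (x - z) w = 0)"
proof -
  define S where "S = (\<lambda>y. y - W 1 y) ` H"
  define K where "K = closure S"
  have SH: "S \<subseteq> H" by (auto simp: S_def intro: Hs(5))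
  have KH: "K \<subseteq> H" unfolding K_def by (rule closure_minimal[OF SH Hs(1)])
  have K: "closed_csubspace K"
    unfolding K_def
  proof (rule closed_csubspace_closure)
    show "0 \<in> S" unfolding S_def by (rule image_eqI[of _ _ 0]) (simp_all add: W_zero Hs(2))
    fix u v assume "u \<in> S" "v \<in> S"
    then obtain y y' where "u = y - W 1 y" "v = y' - W 1 y'" "y \<in> H" "y' \<in> H" by (auto simp: S_def)
    then show "u + v \<in> S"
      unfolding S_def by (intro image_eqI[of _ _ "y + y'"]) (simp_all add: W_add Hs(3))
  next
    fix c u assume "u \<in> S"
    then obtain y where "u = y - W 1 y" "y \<in> H" by (auto simp: S_def)
    then show "c *\<^sub>C u \<in> S"
      unfolding S_def by (intro image_eqI[of _ _ "c *\<^sub>C y"]) (simp_all add: W_scaleC Hs(4) scaleC_diff_right)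
  qed
  obtain u where u: "u \<in> K" "\<And>v. v \<in> K \<Longrightarrow> cinner (x - u) v = 0"
    using orthogonal_projection[OF K] by blast
  have uH: "u \<in> H" using u KH by blast
  have zH: "x - u \<in> H" using x uH by (rule Hs(5))
  have fix': "W 1 (x - u) = x - u"
  proof (rule fixed_of_orthogonal[OF zH])
    fix y assume "y \<in> H"
    then have "y - W 1 y \<in> S" by (simp add: S_def)
    then show "cinner (x - u) (y - W 1 y) = 0"
      by (intro u(2)) (simp add: K_def subsetD[OF closure_subset])
  qed
  have "(\<lambda>N. avg N u) \<longlonglongrightarrow> 0"
  proof (rule LIMSEQ_I)
    fix e :: real assume e: "e > 0"
    obtain s where s: "s \<in> S" "dist s u < e / 2"
      using u(1) half_gt_zero[OF e] unfolding K_def closure_approachable by blast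
    obtain y where y: "y \<in> H" "s = y - W 1 y" using s(1) by (auto simp: S_def)
    obtain M where M: "4 * norm y / e < real M" using reals_Archimedean2 by blast
    show "\<exists>M. \<forall>N\<ge>M. norm (avg N u - 0) < e"
    proof (intro exI[of _ "Suc M"] allI impI)
      fix N assume N: "Suc M \<le> N"
      have sH: "s \<in> H" using s(1) SH by blast
      have "avg N u = avg N s + avg N (u - s)" using avg_diff[OF uH sH] by simp
      then have "norm (avg N u) \<le> norm (avg N s) + norm (avg N (u - s))" by (simp add: norm_triangle_ineq)
      moreover have "norm (avg N (u - s)) < e / 2"
        using norm_avg[OF Hs(5)[OF uH sH], of N] s(2) by (simp add: dist_norm norm_minus_commute)
      moreover have "norm (avg N s) \<le> e / 2"
      proof -
        have "4 * norm y < e * real M" using M e by (simp add: field_simps)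
        also have "\<dots> \<le> e * real N" using N e by simp
        finally have "2 * norm y / real N \<le> e / 2" using N by (simp add: field_simps)
        then show ?thesis using avg_coboundary[OF y(1), of N] y(2) by simp
      qed
      ultimately show "norm (avg N u - 0) < e" by simp
    qed
  qed
  moreover have "avg N x = avg N u + (x - u)" if "N > 0" for N
    using avg_fixed[OF zH fix' that] avg_diff[OF x uH, of N] by (simp add: algebra_simps)
  then have "\<forall>\<^sub>F N in sequentially. avg N u + (x - u) = avg N x"
    by (intro eventually_mono[OF eventually_gt_at_top[of 0]]) simp
  ultimately have "(\<lambda>N. avg N x) \<longlonglongrightarrow> 0 + (x - u)"
    by (intro Lim_transform_eventually[OF tendsto_add[OF _ tendsto_const]])
  moreover have "cinner (x - (x - u)) w = 0" if w: "w \<in> H" "W 1 w = w" for w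
  proof -
    have "cinner w u = 0"
    proof (rule orthogonal_closure[OF _ u(1)[unfolded K_def]])
      fix s assume "s \<in> S"
      then obtain y where y: "y \<in> H" "s = y - W 1 y" by (auto simp: S_def)
      have "cinner w (W 1 y) = cinner w y" using W_cinner[OF w(1) y(1), of 1] unfolding w(2) .
      then show "cinner w s = 0" using y w by (simp add: cinner_diff_right)
    qed
    then show ?thesis using cinner_commute_zero[of w u] by simp
  qed
  ultimately show ?thesis using zH fix' by (intro bexI[of _ "x - u"]) auto
qed

text \<open>\<open>avg N (avg M x)\<close> differs from \<open>avg N x\<close> only by averages of
  coboundaries, and \<open>avg N\<close> is a contraction. One small average thus keeps all much
  longer ones small, with an error that does not depend on the group; this gives uniformity over
  twists.\<close>

lemma avg_compare:
  assumes x: "x \<in> H" and M: "M > 0"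
  shows "norm (avg N x) \<le> norm (avg M x) + 2 * real M * norm x / real N"
proof -
  have step: "norm (avg N (x - W (int j) x)) \<le> real j * (2 * norm x / real N)" for j
  proof (induction j)
    case (Suc j)
    have eq: "x - W (int (Suc j)) x = (x - W (int j) x) + (W (int j) x - W 1 (W (int j) x))"
      using x by (simp add: W_plus[symmetric])
    have "avg N (x - W (int (Suc j)) x) = avg N (x - W (int j) x) + avg N (W (int j) x - W 1 (W (int j) x))"
      unfolding eq using x by (intro avg_add Hs(5)) auto
    then have "norm (avg N (x - W (int (Suc j)) x))
        \<le> norm (avg N (x - W (int j) x)) + norm (avg N (W (int j) x - W 1 (W (int j) x)))"
      by (simp only: norm_triangle_ineq)
    also have "\<dots> \<le> real j * (2 * norm x / real N) + 2 * norm x / real N"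
      using Suc avg_coboundary[of "W (int j) x" N] x by (intro add_mono) auto
    finally show ?case by (simp add: algebra_simps add_divide_distrib)
  qed (use x in \<open>simp add: avg_def W_zero\<close>)
  have "avg N x - avg N (avg M x) = (1 / real M) *\<^sub>R (\<Sum>j<M. avg N (x - W (int j) x))"
  proof -
    have "avg N (avg M x) = (1 / real M) *\<^sub>R (\<Sum>j<M. avg N (W (int j) x))"
      unfolding avg_def[of M] scaleR_scaleC
      using x by (simp add: bounded_opD(3)[OF avg_op] Hs(8) bounded_op_linear(4)[OF closed_csubspace avg_op])
    then show ?thesis
      using x M by (simp add: avg_diff sum_subtractf scaleR_diff_right sum_constant_scaleR)
  qed
  then have "norm (avg N x - avg N (avg M x)) \<le> (1 / real M) * (\<Sum>j<M. real M * (2 * norm x / real N))"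
  proof -
    assume eq: "avg N x - avg N (avg M x) = (1 / real M) *\<^sub>R (\<Sum>j<M. avg N (x - W (int j) x))"
    have n: "norm (\<Sum>j<M. avg N (x - W (int j) x)) \<le> (\<Sum>j<M. real M * (2 * norm x / real N))"
    proof (rule sum_norm_le)
      fix j assume "j \<in> {..<M}"
      then have "real j * (2 * norm x / real N) \<le> real M * (2 * norm x / real N)"
        by (intro mult_right_mono) auto
      then show "norm (avg N (x - W (int j) x)) \<le> real M * (2 * norm x / real N)" using step[of j] by linarith
    qed
    show ?thesis unfolding eq norm_scaleR by (rule mult_mono[OF _ n]) simp_all
  qed
  then have "norm (avg N x - avg N (avg M x)) \<le> 2 * real M * norm x / real N"
    using M by (simp add: mult_ac)
  moreover have "norm (avg N x) \<le> norm (avg N (avg M x)) + norm (avg N x - avg N (avg M x))"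
    by (metis norm_triangle_sub)
  moreover have "norm (avg N (avg M x)) \<le> norm (avg M x)" by (rule norm_avg[OF avg_H[OF x]])
  ultimately show ?thesis by linarith
qed

definition weakly_mixing :: "'h \<Rightarrow> bool" where
  "weakly_mixing x \<longleftrightarrow> x \<in> H \<and> (\<forall>v. \<forall>y\<in>H. W 1 y = v *\<^sub>C y \<longrightarrow> cinner x y = 0)"

text \<open>The limit \<open>z\<close> for the group twisted by \<open>v\<close> satisfies
  \<open>W 1 z = inverse v *\<^sub>C z\<close>, so it is orthogonal to \<open>x\<close>; it is also
  orthogonal to \<open>x - z\<close>, hence to itself.\<close>

lemma weakly_mixing_avg:
  assumes x: "weakly_mixing x" and v: "cmod v = 1"
  shows "(\<lambda>N. (1 / real N) *\<^sub>R (\<Sum>n<N. v ^ n *\<^sub>C W (int n) x)) \<longlonglongrightarrow> 0"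
proof -
  interpret T: unitary_group H "\<lambda>n x. (v powi n) *\<^sub>C W n x" by (rule twist[OF v])
  have xH: "x \<in> H" using x by (simp add: weakly_mixing_def)
  have v0: "v \<noteq> 0" using v by auto
  obtain z where z: "z \<in> H" "(\<lambda>N. T.avg N x) \<longlonglongrightarrow> z" "v *\<^sub>C W 1 z = z" "cinner (x - z) z = 0"
    using T.mean_ergodic[OF xH] by auto
  have "inverse v *\<^sub>C v *\<^sub>C W 1 z = inverse v *\<^sub>C z" using z(3) by simp
  then have "W 1 z = inverse v *\<^sub>C z" using v0 by simp
  then have "cinner x z = 0" using x z(1) unfolding weakly_mixing_def by blast
  then have "z = 0" using z(4) by (simp add: cinner_diff_left)
  then show ?thesis using z(2) by (simp add: T.avg_def)
qed

text \<open>For each \<open>v\<close> on the circle some average is below \<open>e / 2\<close>, and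
  remains so near \<open>v\<close> by continuity. By compactness finitely many lengths suffice, and
  \<open>avg_compare\<close> passes from them to all large \<open>N\<close>.\<close>

lemma weakly_mixing_avg_uniform:
  assumes x: "weakly_mixing x" and e: "e > 0"
  shows "\<exists>N0. \<forall>N\<ge>N0. \<forall>v. cmod v = 1 \<longrightarrow> norm ((1 / real N) *\<^sub>R (\<Sum>n<N. v ^ n *\<^sub>C W (int n) x)) \<le> e"
proof -
  have xH: "x \<in> H" using x by (simp add: weakly_mixing_def)
  define a where "a M v = norm ((1 / real M) *\<^sub>R (\<Sum>n<M. v ^ n *\<^sub>C W (int n) x))" for M v
  define B where "B M = {v. a (Suc M) v < e / 2}" for M
  have cont: "continuous_on UNIV (a M)" for M
    unfolding a_def
    by (intro continuous_on_norm continuous_on_scaleR continuous_on_const continuous_on_sum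
        bounded_bilinear.continuous_on[OF bounded_bilinear_scaleC_hilbert] continuous_on_power continuous_on_id)
  have "open (B M)" for M
    unfolding B_def by (rule open_Collect_less[OF cont continuous_on_const])
  moreover have "sphere 0 1 \<subseteq> (\<Union>M\<in>UNIV. B M)"
  proof
    fix v :: complex assume "v \<in> sphere 0 1"
    then have "(\<lambda>M. a M v) \<longlonglongrightarrow> 0"
      using tendsto_norm_zero[OF weakly_mixing_avg[OF x]] by (simp add: a_def)
    from order_tendstoD(2)[OF this half_gt_zero[OF e]] obtain M where "\<forall>N\<ge>M. a N v < e / 2"
      by (auto simp: eventually_sequentially)
    then have "v \<in> B M" by (simp add: B_def)
    then show "v \<in> (\<Union>M\<in>UNIV. B M)" by blast
  qed
  ultimately obtain C where C: "finite C" "sphere 0 1 \<subseteq> (\<Union>M\<in>C. B M)"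
    using compactE_image[OF compact_sphere, of UNIV B] by metis
  define M0 where "M0 = Suc (Max (insert 0 C))"
  obtain N0 where N0: "2 * real M0 * norm x / (e / 2) < real N0" using reals_Archimedean2 by blast
  show ?thesis
  proof (intro exI[of _ "Suc N0"] allI impI)
    fix N v assume N: "Suc N0 \<le> N" and v: "cmod v = 1"
    interpret T: unitary_group H "\<lambda>n x. (v powi n) *\<^sub>C W n x" by (rule twist[OF v])
    have aT: "a M v = norm (T.avg M x)" for M by (simp add: a_def T.avg_def)
    have "v \<in> sphere 0 1" using v by simp
    then obtain M where M: "M \<in> C" "a (Suc M) v < e / 2" using C(2) by (auto simp: B_def)
    have "Suc M \<le> M0" using C(1) M(1) by (simp add: M0_def)
    have "a N v \<le> a (Suc M) v + 2 * real (Suc M) * norm x / real N"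
      unfolding aT by (rule T.avg_compare[OF xH]) simp
    also have "2 * real (Suc M) * norm x / real N \<le> e / 2"
    proof -
      have "2 * real (Suc M) * norm x \<le> 2 * real M0 * norm x"
        using \<open>Suc M \<le> M0\<close> by (intro mult_right_mono) auto
      also have "\<dots> \<le> e / 2 * real N0" using N0 e by (simp add: field_simps)
      also have "\<dots> \<le> e / 2 * real N" using N e by (intro mult_left_mono) auto
      finally show ?thesis using N by (simp add: field_simps)
    qed
    finally have "a N v \<le> a (Suc M) v + e / 2" by simp
    then have "a N v \<le> e" using M(2) by linarith
    then show "norm ((1 / real N) *\<^sub>R (\<Sum>n<N. v ^ n *\<^sub>C W (int n) x)) \<le> e"
      by (simp only: a_def)
  qed
qed

end

context unitary_group
begin

lemma W_eigen_multiple: "x \<in> H \<Longrightarrow> W 1 x = v *\<^sub>C x \<Longrightarrow> W (int n) x = v ^ n *\<^sub>C x"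
proof (induction n)
  case (Suc n)
  have "W (int (Suc n)) x = W (int n) (W 1 x)"
    using W_plus[of x "int n" 1] Suc.prems(1) by (simp add: add.commute)
  then show ?case using Suc by (simp add: W_scaleC)
qed simp

lemma eigenvalue_norm: "x \<in> H \<Longrightarrow> W n x = v *\<^sub>C x \<Longrightarrow> x \<noteq> 0 \<Longrightarrow> cmod v = 1"
  using norm_W[of x n] by (simp add: norm_scaleC_hilbert)

text \<open>\<open>z\<close> is the mean of the \<open>b\<close> vectors \<open>y j\<close>, and
  these satisfy the eigenvector equation of \<open>W 1\<close> for the \<open>b\<close>-th roots
  \<open>\<theta> j\<close> of \<open>\<kappa>\<close>; \<open>x\<close> is orthogonal to each of
  them.\<close>

lemma weakly_mixing_multiple:
  assumes x: "weakly_mixing x" and b: "b > 0" and z: "z \<in> H" "W (int b) z = \<kappa> *\<^sub>C z"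
  shows "cinner x z = 0"
proof (cases "z = 0")
  case False
  have k: "cmod \<kappa> = 1" by (rule eigenvalue_norm[OF z False])
  then have k0: "\<kappa> \<noteq> 0" by auto
  obtain \<mu> where \<mu>: "\<kappa> = \<mu> ^ b" using exists_complex_root[of b \<kappa>] b by auto
  have "cmod \<mu> ^ b = 1 ^ b" using k by (simp add: \<mu> norm_power)
  then have \<mu>1: "cmod \<mu> = 1" using b power_eq_imp_eq_base[of "cmod \<mu>" b 1] by simp
  define \<theta> where "\<theta> j = \<mu> * unit_root b (int j)" for j
  have \<theta>0: "\<theta> j \<noteq> 0" and \<theta>b: "\<theta> j ^ b = \<kappa>" for j
  proof -
    have "cmod (\<theta> j) = 1" by (simp add: \<theta>_def norm_mult \<mu>1)
    then show "\<theta> j \<noteq> 0" by auto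
    show "\<theta> j ^ b = \<kappa>"
      using unit_root_eq_1_iff[OF b, of "int b * int j"]
      by (simp add: \<theta>_def power_mult_distrib \<mu> unit_root_power)
  qed
  define y where "y j = (\<Sum>n<b. inverse (\<theta> j) ^ n *\<^sub>C W (int n) z)" for j
  have yH: "y j \<in> H" for j unfolding y_def using z by (intro Hs(8) Hs(4)) simp
  have eig: "W 1 (y j) = \<theta> j *\<^sub>C y j" for j
  proof -
    define f where "f n = inverse (\<theta> j) ^ n *\<^sub>C W (int n) z" for n
    have "W 1 (y j) = (\<Sum>n<b. \<theta> j *\<^sub>C f (Suc n))"
      unfolding y_def using z \<theta>0[of j]
      by (subst W_sum) (auto simp: Hs(4) W_scaleC W_plus[symmetric] f_def field_simps intro!: sum.cong)
    also have "\<dots> = \<theta> j *\<^sub>C (\<Sum>n<b. f (Suc n))" by (simp add: scaleC_sum_right)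
    also have "(\<Sum>n<b. f (Suc n)) = (\<Sum>n<b. f n) + (f b - f 0)"
      using sum_lessThan_telescope[of f b] by (simp add: sum_subtractf algebra_simps)
    also have "f b = f 0"
      using z \<theta>b[of j] \<theta>0[of j] by (simp add: f_def power_inverse k0)
    finally show ?thesis by (simp add: y_def f_def)
  qed
  have "cinner x (y j) = 0" for j
    using x yH eig unfolding weakly_mixing_def by blast
  then have "0 = (\<Sum>j<b. cinner x (y j))" by simp
  also have "\<dots> = (\<Sum>j<b. \<Sum>n<b. unit_root b (int j * int n) * (cnj (inverse \<mu> ^ n) * cinner x (W (int n) z)))"
  proof (intro sum.cong refl)
    fix j
    have "cnj (inverse (\<theta> j) ^ n) = unit_root b (int j * int n) * cnj (inverse \<mu> ^ n)" for n
    proof -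
      have "inverse (unit_root b (int j)) = cnj (unit_root b (int j))"
        by (rule inverse_unique) (simp add: complex_norm_square[symmetric])
      then show ?thesis
        by (simp add: \<theta>_def power_mult_distrib unit_root_power mult.commute)
    qed
    then show "cinner x (y j) = (\<Sum>n<b. unit_root b (int j * int n) * (cnj (inverse \<mu> ^ n) * cinner x (W (int n) z)))"
      by (simp add: y_def cinner_sum_right cinner_scaleC_right mult.assoc)
  qed
  also have "\<dots> = (\<Sum>n<b. (\<Sum>j<b. unit_root b (int j * int n)) * (cnj (inverse \<mu> ^ n) * cinner x (W (int n) z)))"
    by (subst sum.swap) (simp add: sum_distrib_right)
  also have "\<dots> = (\<Sum>n<b. if n = 0 then of_nat b * cinner x z else 0)"
  proof (intro sum.cong refl)
    fix n assume "n \<in> {..<b}"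
    then have "int b dvd int n \<longleftrightarrow> n = 0" by (auto dest: dvd_imp_le)
    then show "(\<Sum>j<b. unit_root b (int j * int n)) * (cnj (inverse \<mu> ^ n) * cinner x (W (int n) z))
        = (if n = 0 then of_nat b * cinner x z else 0)"
      using z by (simp add: sum_unit_root[OF b])
  qed
  also have "\<dots> = of_nat b * cinner x z" using b by simp
  finally show ?thesis using b by simp
qed simp

lemma weakly_mixing_subgroup:
  assumes x: "weakly_mixing x" and b: "b \<noteq> 0"
  shows "unitary_group.weakly_mixing H (\<lambda>n. W (b * n)) x"
proof -
  interpret T: unitary_group H "\<lambda>n. W (b * n)" by (rule subgroup)
  have xH: "x \<in> H" using x by (simp add: weakly_mixing_def)
  have "cinner x z = 0" if z: "z \<in> H" "W b z = v *\<^sub>C z" for v z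
  proof (cases "z = 0")
    case False
    have v: "v \<noteq> 0" using eigenvalue_norm[OF z False] by auto
    show ?thesis
    proof (cases "b > 0")
      case True
      then show ?thesis using weakly_mixing_multiple[OF x, of "nat b" z v] z by simp
    next
      case neg: False
      have "z = W (- b) (v *\<^sub>C z)" using W_inverse(2)[OF z(1), of b] z(2) by simp
      then have "inverse v *\<^sub>C z = inverse v *\<^sub>C v *\<^sub>C W (- b) z" using z(1) by (simp add: W_scaleC)
      then have "W (- b) z = inverse v *\<^sub>C z" using v by simp
      then show ?thesis using weakly_mixing_multiple[OF x, of "nat (- b)" z "inverse v"] z b neg by simp
    qed
  qed simp
  then show ?thesis using xH by (simp add: T.weakly_mixing_def)
qed

text \<open>The positive definite sequence \<open>\<langle>T\<^sub>m y, y\<rangle>\<close> is, up to a factor tending to 1, a positive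
  combination of characters at roots of unity (a discrete form of Herglotz' theorem). Hence the
  left-hand side is dominated by the values of the trigonometric polynomial with coefficients \<open>X\<close>.\<close>

lemma herglotz_bound:
  fixes X :: "nat \<Rightarrow> 'g::chilbert_space"
  assumes y: "y \<in> H" and s: "0 \<le> s" and X: "\<And>v. cmod v = 1 \<Longrightarrow> norm (\<Sum>h<L. v ^ h *\<^sub>C X h) \<le> s"
  shows "cmod (\<Sum>h<L. \<Sum>h'<L. cinner (W (int h) y) (W (int h') y) * cinner (X h) (X h'))
    \<le> (norm y)\<^sup>2 * s\<^sup>2"
proof -
  define g where "g m n = cinner (W (int m) y) (W (int n) y)" for m n
  \<comment> \<open>The pairs of positions below \<open>N\<close> with difference
    \<open>h - h'\<close>; divided by \<open>N\<close> this is the Fejer weight, the factor that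
    tends to 1.\<close>
  define cnt where "cnt N h h' = card {(n, n'). n < N \<and> n' < N \<and> n + h' = n' + h}" for N h h' :: nat
  have gshift: "g n n' = g h h'" if "n + h' = n' + h" for n n' h h'
  proof -
    have "int n = (int n - int h) + int h" "int n' = (int n - int h) + int h'" using that by auto
    then have "W (int n) y = W (int n - int h) (W (int h) y)" "W (int n') y = W (int n - int h) (W (int h') y)"
      using W_plus[OF y] by metis+
    then show ?thesis using y by (simp add: g_def)
  qed
  have main: "cmod (\<Sum>h<L. \<Sum>h'<L. of_nat (cnt N h h') * (g h h' * cinner (X h) (X h')))
      \<le> real N * ((norm y)\<^sup>2 * s\<^sup>2)" if NL: "N \<ge> L" and N: "N > 0" for N
  proof -
    \<comment> \<open>For \<open>L \<le> N\<close> the index \<open>n' - n + h - h'\<close> has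
      absolute value below \<open>2 * N\<close>, so it is divisible by \<open>P\<close> only if it
      is 0.\<close>
    define P where "P = 2 * N"
    have P: "P > 0" using N by (simp add: P_def)
    \<comment> \<open>The squared norms of the \<open>Y j\<close> are the masses at the
      \<open>P\<close>-th roots of unity, and \<open>Z j\<close> is the trigonometric polynomial
      with coefficients \<open>X\<close> at such a root.\<close>
    define Y where "Y j = (\<Sum>n<N. unit_root P (int j * - int n) *\<^sub>C W (int n) y)" for j
    define Z where "Z j = (\<Sum>h<L. unit_root P (int j * int h) *\<^sub>C X h)" for j
    have cY: "cinner (Y j) (Y j) = (\<Sum>n<N. \<Sum>n'<N. unit_root P (int j * (int n' - int n)) * g n n')" for j
      by (simp add: Y_def g_def cinner_sum_left cinner_sum_right cinner_scaleC_left cinner_scaleC_right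
          cnj_unit_root unit_root_add[symmetric] mult.assoc[symmetric] right_diff_distrib sum_distrib_left
          add.commute[of "int j * _"])
         (rule sum.swap)
    have cZ: "cinner (Z j) (Z j) = (\<Sum>h<L. \<Sum>h'<L. unit_root P (int j * (int h - int h')) * cinner (X h) (X h'))" for j
      by (simp add: Z_def cinner_sum_left cinner_sum_right cinner_scaleC_left cinner_scaleC_right
          cnj_unit_root unit_root_add[symmetric] mult.assoc[symmetric] right_diff_distrib sum_distrib_left)
         (rule sum.swap)
    have orth: "(\<Sum>j<P. unit_root P (int j * (int n' - int n)) * unit_root P (int j * (int h - int h')))
        = (if n + h' = n' + h then of_nat P else 0)" if "n < N" "n' < N" "h < L" "h' < L" for n n' h h'
    proof -
      define m where "m = int n' - int n + (int h - int h')"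
      have "\<bar>m\<bar> < int P" using that NL by (auto simp: m_def P_def)
      then have "int P dvd m \<longleftrightarrow> m = 0" using dvd_imp_le_int[of m "int P"] by auto
      moreover have "m = 0 \<longleftrightarrow> n + h' = n' + h" by (auto simp: m_def)
      ultimately show ?thesis
        by (simp add: unit_root_add[symmetric] distrib_left[symmetric] m_def[symmetric] sum_unit_root[OF P])
    qed
    have "(\<Sum>j<P. cinner (Y j) (Y j) * cinner (Z j) (Z j))
        = (\<Sum>h<L. \<Sum>h'<L. \<Sum>n<N. \<Sum>n'<N. (\<Sum>j<P. unit_root P (int j * (int n' - int n)) *
            unit_root P (int j * (int h - int h'))) * (g n n' * cinner (X h) (X h')))"
    proof -
      have "(\<Sum>j<P. cinner (Y j) (Y j) * cinner (Z j) (Z j))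
        = (\<Sum>j<P. \<Sum>h<L. \<Sum>h'<L. \<Sum>n<N. \<Sum>n'<N. unit_root P (int j * (int n' - int n)) *
            unit_root P (int j * (int h - int h')) * (g n n' * cinner (X h) (X h')))"
        unfolding cY cZ sum_distrib_left sum_distrib_right by (intro sum.cong refl) (simp add: mult_ac)
      also have "\<dots> = (\<Sum>h<L. \<Sum>h'<L. \<Sum>n<N. \<Sum>n'<N. \<Sum>j<P. unit_root P (int j * (int n' - int n)) *
            unit_root P (int j * (int h - int h')) * (g n n' * cinner (X h) (X h')))"
        unfolding sum.swap[where A = "{..<P}"] ..
      finally show ?thesis by (simp only: sum_distrib_right)
    qed
    also have "\<dots> = of_nat P * (\<Sum>h<L. \<Sum>h'<L. of_nat (cnt N h h') * (g h h' * cinner (X h) (X h')))"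
      unfolding sum_distrib_left
    proof (intro sum.cong refl)
      fix h h' assume h: "h \<in> {..<L}" "h' \<in> {..<L}"
      have "(\<Sum>n<N. \<Sum>n'<N. (\<Sum>j<P. unit_root P (int j * (int n' - int n)) *
            unit_root P (int j * (int h - int h'))) * (g n n' * cinner (X h) (X h')))
          = (\<Sum>n<N. \<Sum>n'<N. if n + h' = n' + h then of_nat P * (g h h' * cinner (X h) (X h')) else 0)"
        using h orth gshift by (intro sum.cong refl) auto
      also have "\<dots> = (\<Sum>(n, n')\<in>{..<N} \<times> {..<N}. if n + h' = n' + h then of_nat P * (g h h' * cinner (X h) (X h')) else 0)"
        by (rule sum.cartesian_product)
      also have "\<dots> = (\<Sum>q\<in>{q \<in> {..<N} \<times> {..<N}. fst q + h' = snd q + h}. of_nat P * (g h h' * cinner (X h) (X h')))"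
        by (subst sum.inter_filter) (auto intro: sum.cong)
      also have "{q \<in> {..<N} \<times> {..<N}. fst q + h' = snd q + h} = {(n, n'). n < N \<and> n' < N \<and> n + h' = n' + h}"
        by auto
      finally show "(\<Sum>n<N. \<Sum>n'<N. (\<Sum>j<P. unit_root P (int j * (int n' - int n)) *
            unit_root P (int j * (int h - int h'))) * (g n n' * cinner (X h) (X h')))
          = of_nat P * (of_nat (cnt N h h') * (g h h' * cinner (X h) (X h')))"
        by (simp add: cnt_def)
    qed
    finally have eq: "of_nat P * (\<Sum>h<L. \<Sum>h'<L. of_nat (cnt N h h') * (g h h' * cinner (X h) (X h')))
        = of_real (\<Sum>j<P. (norm (Y j))\<^sup>2 * (norm (Z j))\<^sup>2)"
      by (simp add: cinner_self)
    \<comment> \<open>The total mass, which is where the factor \<open>(norm y)\<^sup>2\<close>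
      comes from.\<close>
    have "(\<Sum>j<P. cinner (Y j) (Y j)) = (\<Sum>n<N. \<Sum>n'<N. (\<Sum>j<P. unit_root P (int j * (int n' - int n))) * g n n')"
      unfolding cY sum_distrib_right unfolding sum.swap[where A = "{..<P}"] ..
    also have "\<dots> = (\<Sum>n<N. \<Sum>n'<N. if n = n' then of_nat P * g n n else 0)"
    proof (intro sum.cong refl)
      fix n n' assume n: "n \<in> {..<N}" "n' \<in> {..<N}"
      then have "\<bar>int n' - int n\<bar> < int P" by (auto simp: P_def)
      then have "int P dvd (int n' - int n) \<longleftrightarrow> n = n'"
        using dvd_imp_le_int[of "int n' - int n" "int P"] by auto
      then show "(\<Sum>j<P. unit_root P (int j * (int n' - int n))) * g n n' = (if n = n' then of_nat P * g n n else 0)"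
        by (simp add: sum_unit_root[OF P])
    qed
    also have "\<dots> = of_nat P * (of_nat N * cinner y y)" using y by (simp add: g_def)
    finally have Ysum: "of_real (\<Sum>j<P. (norm (Y j))\<^sup>2) = (of_real (real P * (real N * (norm y)\<^sup>2)) :: complex)"
      by (simp add: cinner_self)
    have "norm (Z j) \<le> s" for j
      using X[of "unit_root P (int j)"] by (simp add: Z_def unit_root_power mult.commute)
    then have Zs: "(norm (Z j))\<^sup>2 \<le> s\<^sup>2" for j by (intro power_mono) auto
    have "real P * cmod (\<Sum>h<L. \<Sum>h'<L. of_nat (cnt N h h') * (g h h' * cinner (X h) (X h')))
        = cmod (of_real (\<Sum>j<P. (norm (Y j))\<^sup>2 * (norm (Z j))\<^sup>2))"
      using arg_cong[OF eq, of cmod] by (simp only: norm_mult norm_of_nat)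
    also have "\<dots> = (\<Sum>j<P. (norm (Y j))\<^sup>2 * (norm (Z j))\<^sup>2)"
      by (simp only: norm_of_real) (simp add: sum_nonneg)
    also have "\<dots> \<le> (\<Sum>j<P. (norm (Y j))\<^sup>2 * s\<^sup>2)" by (intro sum_mono mult_left_mono Zs) simp
    also have "\<dots> = (\<Sum>j<P. (norm (Y j))\<^sup>2) * s\<^sup>2" by (simp add: sum_distrib_right)
    also have "\<dots> = real P * (real N * (norm y)\<^sup>2) * s\<^sup>2" using Ysum by (simp only: of_real_eq_iff)
    finally show ?thesis using P by (simp add: mult.assoc)
  qed
  have cnt_lim: "(\<lambda>N. real (cnt N h h') / real N) \<longlonglongrightarrow> 1" for h h'
  proof (rule tendsto_sandwich)
    have "cnt N h h' \<le> N" and "N \<le> cnt N h h' + (h + h')" for N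
    proof -
      define A where "A = {(n, n'). n < N \<and> n' < N \<and> n + h' = n' + h}"
      have fin: "finite A" by (rule finite_subset[of _ "{..<N} \<times> {..<N}"]) (auto simp: A_def)
      have "inj_on fst A" by (auto simp: A_def inj_on_def)
      then have "card A = card (fst ` A)" by (simp add: card_image)
      also have "\<dots> \<le> card {..<N}" by (intro card_mono) (auto simp: A_def)
      finally show "cnt N h h' \<le> N" by (simp add: cnt_def A_def)
      have "inj_on (\<lambda>n. (n + h, n + h')) {..<N - (h + h')}" by (auto simp: inj_on_def)
      then have "card {..<N - (h + h')} = card ((\<lambda>n. (n + h, n + h')) ` {..<N - (h + h')})"
        by (simp add: card_image)
      also have "\<dots> \<le> card A" by (intro card_mono fin) (auto simp: A_def)
      finally show "N \<le> cnt N h h' + (h + h')" by (simp add: cnt_def A_def)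
    qed
    then have c: "real (cnt N h h') \<le> real N" "real N \<le> real (cnt N h h') + real (h + h')" for N
      by (metis of_nat_le_iff, metis of_nat_le_iff of_nat_add)
    show "\<forall>\<^sub>F N in sequentially. real (cnt N h h') / real N \<le> 1"
    proof (intro always_eventually allI)
      fix N show "real (cnt N h h') / real N \<le> 1" using c(1)[of N] by (cases "N = 0") (auto simp: divide_le_eq)
    qed
    show "\<forall>\<^sub>F N in sequentially. 1 - real (h + h') * inverse (real N) \<le> real (cnt N h h') / real N"
    proof (rule eventually_mono[OF eventually_gt_at_top[of 0]])
      fix N :: nat assume "0 < N"
      then show "1 - real (h + h') * inverse (real N) \<le> real (cnt N h h') / real N"
        using divide_right_mono[OF c(2)[of N], of "real N"]
        by (simp add: add_divide_distrib divide_inverse distrib_right)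
    qed
    have "(\<lambda>N. 1 - real (h + h') * inverse (real N)) \<longlonglongrightarrow> 1 - real (h + h') * 0"
      by (intro tendsto_intros lim_inverse_n)
    then show "(\<lambda>N. 1 - real (h + h') * inverse (real N)) \<longlonglongrightarrow> 1" by simp
  qed (rule tendsto_const)
  have "(\<lambda>N. cmod (\<Sum>h<L. \<Sum>h'<L. of_real (real (cnt N h h') / real N) * (g h h' * cinner (X h) (X h'))))
      \<longlonglongrightarrow> cmod (\<Sum>h<L. \<Sum>h'<L. of_real 1 * (g h h' * cinner (X h) (X h')))"
    by (intro tendsto_norm tendsto_sum tendsto_mult tendsto_of_real cnt_lim tendsto_const)
  moreover have "cmod (\<Sum>h<L. \<Sum>h'<L. of_real (real (cnt N h h') / real N) * (g h h' * cinner (X h) (X h')))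
      \<le> (norm y)\<^sup>2 * s\<^sup>2" if "N \<ge> Suc L" for N
  proof -
    have "(\<Sum>h<L. \<Sum>h'<L. of_real (real (cnt N h h') / real N) * (g h h' * cinner (X h) (X h')))
        = (\<Sum>h<L. \<Sum>h'<L. of_nat (cnt N h h') * (g h h' * cinner (X h) (X h'))) / of_nat N"
      by (simp add: sum_divide_distrib)
    then show ?thesis using main[of N] that by (simp add: norm_divide divide_le_eq mult.commute)
  qed
  ultimately have "cmod (\<Sum>h<L. \<Sum>h'<L. of_real 1 * (g h h' * cinner (X h) (X h'))) \<le> (norm y)\<^sup>2 * s\<^sup>2"
    by (intro LIMSEQ_le_const2) auto
  then show ?thesis by (simp add: g_def)
qed

end

text \<open>Replacing \<open>u\<close> by its averages over windows of length \<open>L\<close>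
  changes the mean by at most \<open>2 * L * K / N\<close>. Cauchy-Schwarz bounds the new mean by
  the averaged squared norms of the window averages, which tend to the double sum of
  \<open>\<gamma>\<close> divided by \<open>L * L\<close>. The double sum is kept because positive
  definiteness can be used in this form.\<close>

lemma van_der_corput:
  fixes u :: "nat \<Rightarrow> 'h::chilbert_space"
  assumes K: "\<And>n. norm (u n) \<le> K"
    and lim: "\<And>h h'. (\<lambda>N. (\<Sum>n<N. cinner (u (n + h)) (u (n + h'))) / of_nat N) \<longlonglongrightarrow> \<gamma> h h'"
    and small: "\<And>\<epsilon>. \<epsilon> > 0 \<Longrightarrow> \<exists>L>0. cmod (\<Sum>h<L. \<Sum>h'<L. \<gamma> h h') \<le> \<epsilon> * (real L)\<^sup>2"
  shows "(\<lambda>N. (1 / real N) *\<^sub>R (\<Sum>n<N. u n)) \<longlonglongrightarrow> 0"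
proof (rule LIMSEQ_I)
  fix e :: real assume e: "e > 0"
  have K0: "K \<ge> 0" using K[of 0] norm_ge_zero order_trans by blast
  \<comment> \<open>Half of the target \<open>(e / 2)\<^sup>2\<close>, so that the bound on the
    limit is strict and holds for all large \<open>N\<close>.\<close>
  define \<epsilon> where "\<epsilon> = (e / 2)\<^sup>2 / 2"
  have \<epsilon>: "\<epsilon> > 0" using e by (simp add: \<epsilon>_def)
  obtain L where L: "L > 0" "cmod (\<Sum>h<L. \<Sum>h'<L. \<gamma> h h') \<le> \<epsilon> * (real L)\<^sup>2" using small[OF \<epsilon>] by blast
  define z where "z n = (1 / real L) *\<^sub>R (\<Sum>h<L. u (n + h))" for n
  define q where "q N = (\<Sum>h<L. \<Sum>h'<L. (\<Sum>n<N. cinner (u (n + h)) (u (n + h'))) / of_nat N) / of_nat (L * L)" for N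
  have "q \<longlonglongrightarrow> (\<Sum>h<L. \<Sum>h'<L. \<gamma> h h') / of_nat (L * L)"
    unfolding q_def by (intro tendsto_divide tendsto_sum lim tendsto_const) (use L in simp)
  then have "(\<lambda>N. cmod (q N)) \<longlonglongrightarrow> cmod ((\<Sum>h<L. \<Sum>h'<L. \<gamma> h h') / of_nat (L * L))" by (rule tendsto_norm)
  moreover have "cmod ((\<Sum>h<L. \<Sum>h'<L. \<gamma> h h') / of_nat (L * L)) < (e / 2)\<^sup>2"
  proof -
    have "cmod ((\<Sum>h<L. \<Sum>h'<L. \<gamma> h h') / of_nat (L * L)) \<le> \<epsilon>"
      using L by (simp add: norm_divide norm_mult divide_le_eq power2_eq_square)
    also have "\<epsilon> < (e / 2)\<^sup>2" using e by (simp add: \<epsilon>_def)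
    finally show ?thesis .
  qed
  ultimately have "\<forall>\<^sub>F N in sequentially. cmod (q N) < (e / 2)\<^sup>2" by (rule order_tendstoD)
  then obtain N1 where N1: "\<And>N. N \<ge> N1 \<Longrightarrow> cmod (q N) < (e / 2)\<^sup>2" by (auto simp: eventually_sequentially)
  obtain N2 where N2: "4 * real L * K / e < real N2" using reals_Archimedean2 by blast
  show "\<exists>N0. \<forall>N\<ge>N0. norm ((1 / real N) *\<^sub>R (\<Sum>n<N. u n) - 0) < e"
  proof (intro exI[of _ "max N1 (Suc N2)"] allI impI)
    fix N assume "max N1 (Suc N2) \<le> N"
    then have N: "N1 \<le> N" "Suc N2 \<le> N" by auto
    have Npos: "N > 0" using N by simp
    have shift: "norm ((\<Sum>n<N. u n) - (\<Sum>n<N. u (n + h))) \<le> 2 * real h * K" for h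
    proof (induction h)
      case (Suc h)
      have "(\<Sum>n<N. u (n + h)) - (\<Sum>n<N. u (n + Suc h)) = u h - u (N + h)"
        using sum_lessThan_telescope'[of "\<lambda>n. u (n + h)" N] by (simp add: sum_subtractf)
      then have eq: "(\<Sum>n<N. u n) - (\<Sum>n<N. u (n + Suc h))
          = ((\<Sum>n<N. u n) - (\<Sum>n<N. u (n + h))) + (u h - u (N + h))" by (simp add: algebra_simps)
      have "norm ((\<Sum>n<N. u n) - (\<Sum>n<N. u (n + Suc h))) \<le> 2 * real h * K + (K + K)"
        unfolding eq
        by (rule norm_triangle_le[OF add_mono[OF Suc norm_triangle_le_diff[OF add_mono[OF K K]]]])
      then show ?case by (simp add: algebra_simps)
    qed simp
    have zu: "(\<Sum>n<N. z n) = (1 / real L) *\<^sub>R (\<Sum>h<L. \<Sum>n<N. u (n + h))"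
      unfolding z_def scaleR_sum_right by (rule sum.swap)
    have "norm ((\<Sum>n<N. u n) - (\<Sum>n<N. z n)) \<le> 2 * real L * K"
    proof -
      have "(\<Sum>n<N. u n) - (\<Sum>n<N. z n) = (1 / real L) *\<^sub>R (\<Sum>h<L. (\<Sum>n<N. u n) - (\<Sum>n<N. u (n + h)))"
        unfolding zu using L by (simp add: sum_subtractf scaleR_diff_right sum_constant_scaleR)
      moreover have "norm (\<Sum>h<L. (\<Sum>n<N. u n) - (\<Sum>n<N. u (n + h))) \<le> (\<Sum>h<L. 2 * real L * K)"
      proof (rule sum_norm_le)
        fix h assume "h \<in> {..<L}"
        then have "2 * real h * K \<le> 2 * real L * K" using K0 by (intro mult_right_mono) auto
        then show "norm ((\<Sum>n<N. u n) - (\<Sum>n<N. u (n + h))) \<le> 2 * real L * K" using shift[of h] by linarith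
      qed
      ultimately show ?thesis using L by (simp add: divide_le_eq mult.commute)
    qed
    then have "norm ((1 / real N) *\<^sub>R ((\<Sum>n<N. u n) - (\<Sum>n<N. z n))) \<le> 2 * real L * K / real N"
      by (simp add: divide_right_mono)
    also have "\<dots> < e / 2"
    proof -
      have "4 * real L * K < e * real N2" using N2 e by (simp add: field_simps)
      also have "\<dots> \<le> e * real N" using N e by simp
      finally show ?thesis using Npos by (simp add: field_simps)
    qed
    finally have 1: "norm ((1 / real N) *\<^sub>R ((\<Sum>n<N. u n) - (\<Sum>n<N. z n))) < e / 2" .
    have zz: "(\<Sum>n<N. of_real ((norm (z n))\<^sup>2)) / of_nat N = q N"
    proof -
      have "cinner (\<Sum>h<L. u (n + h)) (\<Sum>h'<L. u (n + h')) = (\<Sum>h<L. \<Sum>h'<L. cinner (u (n + h)) (u (n + h')))" for n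
        by (simp only: cinner_sum_left) (simp only: cinner_sum_right)
      then have "of_real ((norm (z n))\<^sup>2) = (\<Sum>h<L. \<Sum>h'<L. cinner (u (n + h)) (u (n + h'))) / of_nat (L * L)" for n
        unfolding cinner_self[symmetric] z_def
        by (simp add: cinner_scaleR_left cinner_scaleR_right)
      then have "(\<Sum>n<N. of_real ((norm (z n))\<^sup>2)) / of_nat N
          = (\<Sum>n<N. \<Sum>h<L. \<Sum>h'<L. cinner (u (n + h)) (u (n + h')) / of_nat N) / of_nat (L * L)"
        by (simp add: sum_divide_distrib mult.commute)
      also have "\<dots> = q N"
        unfolding q_def sum_divide_distrib unfolding sum.swap[where A = "{..<N}"] ..
      finally show ?thesis .
    qed
    have "(norm ((1 / real N) *\<^sub>R (\<Sum>n<N. z n)))\<^sup>2 \<le> (\<Sum>n<N. (norm (z n))\<^sup>2) / real N"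
    proof -
      have "(norm (\<Sum>n<N. z n))\<^sup>2 \<le> (\<Sum>n<N. norm (z n) * 1)\<^sup>2" by (intro power_mono) (simp_all add: norm_sum)
      also have "\<dots> \<le> (\<Sum>n<N. (norm (z n))\<^sup>2) * (\<Sum>n<N. 1\<^sup>2)" by (rule Cauchy_Schwarz_ineq_sum)
      finally show ?thesis using Npos by (simp add: power_divide power2_eq_square[of "real N"] field_simps)
    qed
    also have "\<dots> = cmod (q N)"
    proof -
      have "q N = of_real ((\<Sum>n<N. (norm (z n))\<^sup>2) / real N)" using zz by simp
      then show ?thesis by (simp only: norm_of_real) (simp add: sum_nonneg)
    qed
    also have "\<dots> < (e / 2)\<^sup>2" by (rule N1[OF N(1)])
    finally have 2: "norm ((1 / real N) *\<^sub>R (\<Sum>n<N. z n)) < e / 2"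
      by (rule power_less_imp_less_base) (use e in simp)
    have eq: "(1 / real N) *\<^sub>R (\<Sum>n<N. u n) = (1 / real N) *\<^sub>R ((\<Sum>n<N. u n) - (\<Sum>n<N. z n)) + (1 / real N) *\<^sub>R (\<Sum>n<N. z n)"
      by (simp add: scaleR_diff_right)
    have "norm ((1 / real N) *\<^sub>R (\<Sum>n<N. u n)) < e"
      unfolding eq
      using norm_triangle_ineq[of "(1 / real N) *\<^sub>R ((\<Sum>n<N. u n) - (\<Sum>n<N. z n))" "(1 / real N) *\<^sub>R (\<Sum>n<N. z n)"] 1 2
      by linarith
    then show "norm ((1 / real N) *\<^sub>R (\<Sum>n<N. u n) - 0) < e" by simp
  qed
qed

section \<open>Averages of operators and eigenoperators\<close>

lemma int_iter_simps [simp]: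
  "int_iter S f 0 = (\<lambda>x. x)" "int_iter S f 1 = f" "int_iter S f (- 1) = inv_into S f"
  by (simp_all add: int_iter_def fun_eq_iff)

lemma int_iter_in: "bij_betw f S S \<Longrightarrow> x \<in> S \<Longrightarrow> int_iter S f n x \<in> S"
proof -
  assume f: "bij_betw f S S" and x: "x \<in> S"
  have "(g ^^ m) x \<in> S" if "bij_betw g S S" for g m
    by (induction m) (use x that in \<open>auto simp: bij_betw_def\<close>)
  then show ?thesis using f bij_betw_inv_into[OF f] by (simp add: int_iter_def)
qed

lemma int_iter_succ:
  assumes f: "bij_betw f S S" and x: "x \<in> S"
  shows "int_iter S f (n + 1) x = f (int_iter S f n x)"
proof (cases "0 \<le> n")
  case True
  then show ?thesis by (simp add: int_iter_def nat_add_distrib)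
next
  case False
  define y where "y = int_iter S f (n + 1) x"
  have y: "y \<in> S" unfolding y_def by (rule int_iter_in[OF f x])
  have "nat (- n) = Suc (nat (- (n + 1)))" using False by simp
  then have "int_iter S f n x = inv_into S f y" using False by (auto simp: int_iter_def y_def)
  then show ?thesis using y f by (simp add: y_def f_inv_into_f bij_betw_imp_surj_on)
qed

lemma int_iter_pred:
  assumes f: "bij_betw f S S" and x: "x \<in> S"
  shows "int_iter S f (n - 1) x = inv_into S f (int_iter S f n x)"
  using int_iter_succ[OF f x, of "n - 1"] int_iter_in[OF f x, of "n - 1"] f
  by (simp add: bij_betw_imp_inj_on)

lemma int_iter_add:
  assumes f: "bij_betw f S S" and x: "x \<in> S"
  shows "int_iter S f (m + n) x = int_iter S f m (int_iter S f n x)"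
proof (induction m rule: int_induct[where k = 0])
  case (step1 i)
  then show ?case
    using int_iter_succ[OF f x, of "i + n"] int_iter_succ[OF f int_iter_in[OF f x], of i n]
    by (simp add: algebra_simps)
next
  case (step2 i)
  then show ?case
    using int_iter_pred[OF f x, of "i + n"] int_iter_pred[OF f int_iter_in[OF f x], of i n]
    by (simp add: algebra_simps)
qed simp

lemma int_iter_int_iter:
  assumes f: "bij_betw f S S" and x: "x \<in> S"
  shows "int_iter S (int_iter S f l) m x = int_iter S f (m * l) x"
proof -
  have "bij_betw (int_iter S f l) S S"
    by (rule bij_betw_byWitness[of _ "int_iter S f (- l)"])
       (auto simp: int_iter_add[OF f, symmetric] int_iter_in[OF f])
  note g = this
  show ?thesis
  proof (induction m rule: int_induct[where k = 0])
    case (step1 i)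
    then show ?case
      using int_iter_succ[OF g x, of i] by (simp add: int_iter_add[OF f x] algebra_simps)
  next
    case (step2 i)
    have "int_iter S f l (int_iter S f ((i - 1) * l) x) = int_iter S f (i * l) x"
      by (simp add: int_iter_add[OF f x, symmetric] algebra_simps)
    then have "inv_into S (int_iter S f l) (int_iter S f (i * l) x) = int_iter S f ((i - 1) * l) x"
      using int_iter_in[OF f x, of "(i - 1) * l"] g by (metis bij_betw_inv_into_left)
    then show ?case using int_iter_pred[OF g x, of i] step2 by simp
  qed simp
qed

lemma unitary_op_inv_into:
  assumes H: "closed_csubspace H" and U: "unitary_op H U"
  shows "bij_betw U H H" "unitary_op H (inv_into H U)"
proof -
  have b: "bounded_op H U" and s: "U ` H = H" and c: "\<And>x y. x \<in> H \<Longrightarrow> y \<in> H \<Longrightarrow> cinner (U x) (U y) = cinner x y"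
    using U by (auto simp: unitary_op_def)
  have "inj_on U H"
  proof (rule inj_onI)
    fix x y assume xy: "x \<in> H" "y \<in> H" "U x = U y"
    have d: "x - y \<in> H" using H xy by (intro closed_csubspaceD)
    have "U (x - y) = 0" using bounded_op_linear(3)[OF H b xy(1,2)] xy(3) by simp
    then have "cinner (x - y) (x - y) = 0" using c[OF d d] by simp
    then show "x = y" by simp
  qed
  then show bij: "bij_betw U H H" using s by (simp add: bij_betw_def)
  define V where "V = inv_into H U"
  have V: "V x \<in> H" "U (V x) = x" if "x \<in> H" for x
    using that s by (simp_all add: V_def f_inv_into_f inv_into_into)
  have VU: "V (U x) = x" if "x \<in> H" for x using that \<open>inj_on U H\<close> by (simp add: V_def)
  have Vc: "cinner (V x) (V y) = cinner x y" if "x \<in> H" "y \<in> H" for x y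
    using c[OF V(1)[OF that(1)] V(1)[OF that(2)]] that by (simp add: V)
  have "bounded_op H V"
    unfolding bounded_op_def
  proof (intro conjI ballI allI exI[of _ 1])
    show "V ` H \<subseteq> H" using V by blast
    show "V (x + y) = V x + V y" if "x \<in> H" "y \<in> H" for x y
    proof -
      have "V (U (V x + V y)) = V (x + y)" using that b V by (simp add: bounded_opD(2))
      then show ?thesis using VU[of "V x + V y"] closed_csubspaceD(3)[OF H V(1) V(1)] that by simp
    qed
    show "V (c *\<^sub>C x) = c *\<^sub>C V x" if "x \<in> H" for c x
    proof -
      have "V (U (c *\<^sub>C V x)) = V (c *\<^sub>C x)" using that b V by (simp add: bounded_opD(3))
      then show ?thesis using VU[of "c *\<^sub>C V x"] closed_csubspaceD(4)[OF H V(1)] that by simp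
    qed
    show "norm (V x) \<le> 1 * norm x" if "x \<in> H" for x
      using norm_eq_of_cinner[OF Vc[OF that that]] by simp
  qed
  moreover have "V ` H = H" using V VU bounded_opD(1)[OF b] by (metis image_eqI subsetI subset_antisym image_subset_iff)
  ultimately show "unitary_op H (inv_into H U)" using Vc by (simp add: unitary_op_def V_def)
qed

lemma unitary_op_funpow:
  assumes U: "unitary_op H U"
  shows "unitary_op H (U ^^ n)"
proof (induction n)
  case 0
  show ?case by (auto simp: unitary_op_def bounded_op_def intro!: exI[of _ 1])
next
  case (Suc n)
  have a: "bounded_op H U" "U ` H = H" "\<And>x y. x \<in> H \<Longrightarrow> y \<in> H \<Longrightarrow> cinner (U x) (U y) = cinner x y"
    using U by (auto simp: unitary_op_def)
  have b: "bounded_op H (U ^^ n)" "(U ^^ n) ` H = H"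
    "\<And>x y. x \<in> H \<Longrightarrow> y \<in> H \<Longrightarrow> cinner ((U ^^ n) x) ((U ^^ n) y) = cinner x y"
    using Suc by (auto simp: unitary_op_def)
  note ad = bounded_opD[OF a(1)] and bd = bounded_opD[OF b(1)]
  have "norm ((U ^^ Suc n) x) \<le> 1 * norm x" if "x \<in> H" for x
    using norm_eq_of_cinner[OF a(3)[OF bd(1) bd(1)], OF that that] norm_eq_of_cinner[OF b(3)[OF that that]]
    by simp
  then have "bounded_op H (U ^^ Suc n)"
    unfolding bounded_op_def
    by (intro conjI ballI allI exI[of _ 1]) (auto simp: ad(1-3) bd(1-3))
  moreover have "(U ^^ Suc n) ` H = H"
  proof -
    have "(U ^^ Suc n) ` H = U ` ((U ^^ n) ` H)" by (simp add: image_comp)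
    then show ?thesis by (simp only: a(2) b(2))
  qed
  moreover have "cinner ((U ^^ Suc n) x) ((U ^^ Suc n) y) = cinner x y" if "x \<in> H" "y \<in> H" for x y
    using that by (simp add: a(3) b(3) bd(1))
  ultimately show ?case unfolding unitary_op_def by blast
qed

lemma unitary_group_int_iter:
  assumes H: "closed_csubspace H" and U: "unitary_op H U"
  shows "unitary_group H (int_iter H U)"
proof -
  have u: "unitary_op H (int_iter H U n)" for n
    unfolding int_iter_def using unitary_op_funpow[OF U] unitary_op_funpow[OF unitary_op_inv_into(2)[OF H U]] by simp
  note u' = u[unfolded unitary_op_def]
  show ?thesis
  proof
    show "x \<in> H \<Longrightarrow> int_iter H U n x \<in> H" for n x using u'[of n] by blast
    show "x \<in> H \<Longrightarrow> y \<in> H \<Longrightarrow> int_iter H U n (x + y) = int_iter H U n x + int_iter H U n y" for n x y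
      using u'[of n] bounded_opD(2) by blast
    show "x \<in> H \<Longrightarrow> int_iter H U n (c *\<^sub>C x) = c *\<^sub>C int_iter H U n x" for n c x
      using u'[of n] bounded_opD(3) by blast
    show "x \<in> H \<Longrightarrow> y \<in> H \<Longrightarrow> cinner (int_iter H U n x) (int_iter H U n y) = cinner x y" for n x y
      using u'[of n] by blast
    show "x \<in> H \<Longrightarrow> int_iter H U (m + n) x = int_iter H U m (int_iter H U n x)" for m n x
      by (rule int_iter_add[OF unitary_op_inv_into(1)[OF H U]])
  qed (simp_all add: H)
qed

text \<open>The common bound \<open>K\<close> carries the Cauchy property from the dense set
  \<open>D\<close> to \<open>H\<close>, and the limit inherits linearity and the bound.\<close>

lemma strong_limit_of_dense:
  fixes H :: "'h::chilbert_space set"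
  assumes H: "closed_csubspace H" and T: "\<And>n. bounded_op H (T n)"
    and K: "\<And>n x. x \<in> H \<Longrightarrow> norm (T n x) \<le> K * norm x"
    and D: "D \<subseteq> H" "closure D = H" and conv: "\<And>x. x \<in> D \<Longrightarrow> convergent (\<lambda>n. T n x)"
  shows "\<exists>S. bounded_op H S \<and> (\<forall>x\<in>H. (\<lambda>n. T n x) \<longlonglongrightarrow> S x)"
proof -
  note Hs = closed_csubspaceD[OF H]
  have "Cauchy (\<lambda>n. T n x)" if x: "x \<in> H" for x
  proof (rule CauchyI)
    fix e :: real assume e: "e > 0"
    define K' where "K' = max K 1"
    have K': "K' > 0" "\<And>n y. y \<in> H \<Longrightarrow> norm (T n y) \<le> K' * norm y"
      using order_trans[OF K mult_right_mono[OF max.cobounded1 norm_ge_zero]] by (auto simp: K'_def)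
    have "e / (4 * K') > 0" using e K' by simp
    moreover have "x \<in> closure D" using x D by simp
    ultimately obtain d where d: "d \<in> D" "dist d x < e / (4 * K')" unfolding closure_approachable by blast
    have dH: "d \<in> H" using d D by blast
    have near: "norm (T n x - T n d) \<le> e / 4" for n
    proof -
      have "norm (T n x - T n d) = norm (T n (x - d))" using bounded_op_linear(3)[OF H T x dH] by simp
      also have "\<dots> \<le> K' * norm (x - d)" by (rule K'(2)[OF Hs(5)[OF x dH]])
      also have "\<dots> \<le> K' * (e / (4 * K'))"
        using d(2) K' by (intro mult_left_mono) (auto simp: dist_norm norm_minus_commute)
      finally show ?thesis using K' by simp
    qed
    have "Cauchy (\<lambda>n. T n d)" using conv[OF d(1)] by (rule convergent_Cauchy)
    then obtain M where M: "\<And>m n. m \<ge> M \<Longrightarrow> n \<ge> M \<Longrightarrow> norm (T m d - T n d) < e / 4"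
      using e unfolding Cauchy_iff by (metis zero_less_divide_iff zero_less_numeral)
    show "\<exists>M. \<forall>m\<ge>M. \<forall>n\<ge>M. norm (T m x - T n x) < e"
    proof (intro exI[of _ M] allI impI)
      fix m n assume mn: "M \<le> m" "M \<le> n"
      have eq: "T m x - T n x = (T m x - T m d) + (T m d - T n d) + (T n d - T n x)" by simp
      have "norm (T m x - T n x) \<le> norm (T m x - T m d) + norm (T m d - T n d) + norm (T n d - T n x)"
        unfolding eq by (intro order_trans[OF norm_triangle_ineq] add_right_mono norm_triangle_ineq)
      then show "norm (T m x - T n x) < e"
        using near[of m] near[of n] M[OF mn] e by (simp add: norm_minus_commute)
    qed
  qed
  then have "\<forall>x\<in>H. \<exists>y. (\<lambda>n. T n x) \<longlonglongrightarrow> y" by (simp add: Cauchy_convergent_iff convergent_def)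
  then obtain S where S: "\<And>x. x \<in> H \<Longrightarrow> (\<lambda>n. T n x) \<longlonglongrightarrow> S x" by metis
  have "bounded_op H S"
    unfolding bounded_op_def
  proof (intro conjI ballI allI exI[of _ K])
    show "S ` H \<subseteq> H"
      using closed_sequentially[OF Hs(1) _ S] bounded_opD(1)[OF T] by blast
    show "S (x + y) = S x + S y" if "x \<in> H" "y \<in> H" for x y
      using LIMSEQ_unique[OF S[OF Hs(3)[OF that]]] tendsto_add[OF S[OF that(1)] S[OF that(2)]] that
      by (simp add: bounded_opD(2)[OF T])
    show "S (c *\<^sub>C x) = c *\<^sub>C S x" if "x \<in> H" for c x
      using LIMSEQ_unique[OF S[OF Hs(4)[OF that]]] tendsto_scaleC[OF tendsto_const S[OF that]] that
      by (simp add: bounded_opD(3)[OF T])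
    show "norm (S x) \<le> K * norm x" if "x \<in> H" for x
      by (rule LIMSEQ_le_const2[OF tendsto_norm[OF S[OF that]]]) (use K[OF that] in auto)
  qed
  then show ?thesis using S by blast
qed

locale covariant_automorphism = covariant_system \<beta> \<psi> R
  for \<beta> :: "'a::cstar_algebra \<Rightarrow> 'a" and \<psi> :: "'a \<Rightarrow> complex"
    and R :: "('a, 'k::chilbert_space) covariant_rep" +
  assumes automorphism: "star_automorphism \<beta>"
begin

abbreviation "W \<equiv> int_iter H U"

sublocale W: unitary_group H W
  by (rule unitary_group_int_iter[OF H U_unitary])

lemma W_Psi [simp]: "W n \<Psi> = \<Psi>"
proof (induction n rule: int_induct[where k = 0])
  case (step1 i)
  then show ?case using W.W_plus[of \<Psi> 1 i] by (simp add: U_Psi add.commute)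
next
  case (step2 i)
  have "inv_into H U \<Psi> = \<Psi>" using W.W_inverse(2)[of \<Psi> 1] by (simp add: U_Psi)
  then show ?case using step2 W.W_plus[of \<Psi> "- 1" i] by simp
qed simp

lemma bij_beta: "bij_betw \<beta> UNIV UNIV"
  using automorphism by (simp add: star_automorphism_def)

lemma W_pi: "x \<in> H \<Longrightarrow> W n (\<pi> a (W (- n) x)) = \<pi> (int_iter UNIV \<beta> n a) x"
proof (induction n arbitrary: x rule: int_induct[where k = 0])
  case (step1 i)
  define y where "y = W (- 1) x"
  have y: "y \<in> H" using step1 by (simp add: y_def del: int_iter_simps)
  have "W (i + 1) (\<pi> a (W (- (i + 1)) x)) = W 1 (W i (\<pi> a (W (- i) y)))"
    using W.W_plus[of x "- i" "- 1"] W.W_plus[of "\<pi> a (W (- i) y)" 1 i] step1.prems y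
    by (simp add: y_def algebra_simps del: int_iter_simps)
  also have "\<dots> = W 1 (\<pi> (int_iter UNIV \<beta> i a) y)" using step1.IH[OF y] by (simp del: int_iter_simps)
  also have "\<dots> = \<pi> (\<beta> (int_iter UNIV \<beta> i a)) x" using covariance[OF step1.prems] by (simp add: y_def)
  also have "\<beta> (int_iter UNIV \<beta> i a) = int_iter UNIV \<beta> (i + 1) a"
    using int_iter_succ[OF bij_beta, of a i] by simp
  finally show ?case .
next
  case (step2 i)
  define y where "y = W 1 x"
  have y: "y \<in> H" using step2 by (simp add: y_def del: int_iter_simps)
  define b where "b = int_iter UNIV \<beta> (i - 1) a"
  have b: "\<beta> b = int_iter UNIV \<beta> i a" using int_iter_succ[OF bij_beta, of a "i - 1"] by (simp add: b_def)
  have "W (i - 1) (\<pi> a (W (- (i - 1)) x)) = W (- 1) (W i (\<pi> a (W (- i) y)))"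
    using W.W_plus[of x "- i" 1] W.W_plus[of "\<pi> a (W (- i) y)" "- 1" i] step2.prems y
    by (simp add: y_def algebra_simps del: int_iter_simps)
  also have "\<dots> = W (- 1) (\<pi> (\<beta> b) y)" using step2.IH[OF y] b by (simp del: int_iter_simps)
  also have "\<pi> (\<beta> b) y = W 1 (\<pi> b x)"
    using covariance[OF y, of b] W.W_inverse(2)[OF step2.prems, of 1] by (simp add: y_def)
  also have "W (- 1) (W 1 (\<pi> b x)) = \<pi> b x" using step2.prems W.W_inverse(2)[of "\<pi> b x" 1] by simp
  finally show ?case by (simp add: b_def)
qed simp

lemma W_pi': "x \<in> H \<Longrightarrow> W n (\<pi> a x) = \<pi> (int_iter UNIV \<beta> n a) (W n x)"
  using W_pi[of "W n x" n a] by simp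

end

text \<open>One set of arguments for two algebras: \<open>Y\<close> is the range of the
  representation in one instance and the commutant in the other, so that \<open>X\<close> is the
  commutant or the bicommutant. By \<open>Y_dense\<close> an element of \<open>X\<close> is
  determined by its value at \<open>\<Psi>\<close>.\<close>

locale covariant_pair = covariant_automorphism \<beta> \<psi> R
  for \<beta> :: "'a::cstar_algebra \<Rightarrow> 'a" and \<psi> :: "'a \<Rightarrow> complex"
    and R :: "('a, 'k::chilbert_space) covariant_rep" +
  fixes Y :: "('k \<Rightarrow> 'k) set"
  assumes Y_op: "A \<in> Y \<Longrightarrow> bounded_op H A"
    and Y_star: "star_closed_on H Y"
    and Y_conj: "A \<in> Y \<Longrightarrow> \<exists>B\<in>Y. \<forall>x\<in>H. W n (A (W (- n) x)) = B x"
    and Y_dense: "closure ((\<lambda>A. A \<Psi>) ` Y) = H"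
begin

abbreviation "X \<equiv> commutant H Y"

lemma X_op: "T \<in> X \<Longrightarrow> bounded_op H T"
  by (rule commutantD)

lemma X_commute: "T \<in> X \<Longrightarrow> A \<in> Y \<Longrightarrow> x \<in> H \<Longrightarrow> T (A x) = A (T x)"
  by (rule commutantD)

lemma X_I: "bounded_op H T \<Longrightarrow> (\<And>A x. A \<in> Y \<Longrightarrow> x \<in> H \<Longrightarrow> T (A x) = A (T x)) \<Longrightarrow> T \<in> X"
  by (simp add: commutant_def)

lemma Y_H: "A \<in> Y \<Longrightarrow> x \<in> H \<Longrightarrow> A x \<in> H"
  by (rule bounded_opD(1)[OF Y_op])

definition rot :: "int \<Rightarrow> ('k \<Rightarrow> 'k) \<Rightarrow> 'k \<Rightarrow> 'k" where
  "rot n T = (\<lambda>x. W n (T (W (- n) x)))"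

lemma rot_in_X:
  assumes T: "T \<in> X"
  shows "rot n T \<in> X"
proof (rule X_I)
  note Td = bounded_opD[OF X_op[OF T]]
  obtain K where K: "\<And>x. x \<in> H \<Longrightarrow> norm (T x) \<le> K * norm x" using Td(4) by blast
  show "bounded_op H (rot n T)"
    unfolding bounded_op_def rot_def
  proof (intro conjI ballI allI exI[of _ K])
    show "norm (W n (T (W (- n) x))) \<le> K * norm x" if "x \<in> H" for x
      using K[of "W (- n) x"] that by (simp add: Td(1))
  qed (auto simp: W.W_add W.W_scaleC Td(1-3))
  fix A x assume A: "A \<in> Y" and x: "x \<in> H"
  obtain B where B: "B \<in> Y" "\<And>x. x \<in> H \<Longrightarrow> W (- n) (A (W n x)) = B x"
    using Y_conj[OF A, of "- n"] by auto
  have AB: "A (W n y) = W n (B y)" if "y \<in> H" for y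
    using B(2)[OF that, symmetric] W.W_inverse(1)[OF Y_H[OF A W.W_H[OF that]], of n n] by simp
  have BA: "W (- n) (A x) = B (W (- n) x)" using B(2)[OF W.W_H[OF x], of "- n"] x by simp
  have "rot n T (A x) = W n (T (B (W (- n) x)))" by (simp add: rot_def BA)
  also have "\<dots> = W n (B (T (W (- n) x)))" using X_commute[OF T B(1)] x by simp
  also have "\<dots> = A (W n (T (W (- n) x)))" using AB Td(1) x by simp
  finally show "rot n T (A x) = A (rot n T x)" by (simp add: rot_def)
qed

lemma rot_rot: "T \<in> X \<Longrightarrow> x \<in> H \<Longrightarrow> W 1 (rot n T (W (- 1) x)) = rot (n + 1) T x"
  using W.W_plus[of x "- n" "- 1"] W.W_plus[of "T (W (- n) (W (- 1) x))" 1 n] bounded_opD(1)[OF X_op]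
  by (simp add: rot_def add.commute del: int_iter_simps)

lemma norm_rot:
  assumes "T \<in> X"
  shows "\<exists>K\<ge>0. \<forall>n. \<forall>x\<in>H. norm (rot n T x) \<le> K * norm x"
proof -
  note Td = bounded_opD[OF X_op[OF assms]]
  obtain K where K: "K \<ge> 0" "\<And>x. x \<in> H \<Longrightarrow> norm (T x) \<le> K * norm x" using Td(4) by blast
  have "norm (rot n T x) \<le> K * norm x" if "x \<in> H" for n x
    using K(2)[of "W (- n) x"] that by (simp add: rot_def Td(1))
  then show ?thesis using K(1) by blast
qed

text \<open>At \<open>A \<Psi>\<close> with \<open>A\<close> in \<open>Y\<close> the averages are
  \<open>A\<close> applied to averages of the twisted group at \<open>T \<Psi>\<close>, so the mean
  ergodic theorem gives convergence there; density and the common bound do the rest.\<close>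

lemma twisted_average:
  assumes T: "T \<in> X" and v: "cmod v = 1"
  shows "\<exists>S\<in>X. (\<forall>x\<in>H. (\<lambda>N. (1 / real N) *\<^sub>R (\<Sum>n<N. v ^ n *\<^sub>C rot (int n) T x)) \<longlonglongrightarrow> S x) \<and>
    (\<forall>x\<in>H. W 1 (S (W (- 1) x)) = inverse v *\<^sub>C S x)"
proof -
  define a where "a N x = (1 / real N) *\<^sub>R (\<Sum>n<N. v ^ n *\<^sub>C rot (int n) T x)" for N x
  note rX = rot_in_X[OF T]
  note rd = bounded_opD[OF X_op[OF rX]]
  note Td = bounded_opD[OF X_op[OF T]]
  have v0: "v \<noteq> 0" using v by auto
  obtain K where K: "K \<ge> 0" "\<And>n x. x \<in> H \<Longrightarrow> norm (rot n T x) \<le> K * norm x"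
    using norm_rot[OF T] by blast
  have op: "bounded_op H (\<lambda>x. v ^ n *\<^sub>C rot (int n) T x)" for n
    by (rule bounded_op_scaleC[OF H X_op[OF rX]])
  have nop: "norm (v ^ n *\<^sub>C rot (int n) T x) \<le> K * norm x" if "x \<in> H" for n x
    using K(2)[OF that] by (simp add: norm_scaleC_hilbert norm_power v)
  have aop: "bounded_op H (a N)" and aK: "x \<in> H \<Longrightarrow> norm (a N x) \<le> K * norm x" for N x
    unfolding a_def by (rule bounded_op_average[OF H op nop]; assumption)+
  have conv: "convergent (\<lambda>N. a N x)" if xD: "x \<in> (\<lambda>A. A \<Psi>) ` Y" for x
  proof -
    obtain A where A: "A \<in> Y" "x = A \<Psi>" using xD by blast
    interpret T: unitary_group H "\<lambda>n x. (v powi n) *\<^sub>C W n x" by (rule W.twist[OF v])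
    have TH: "T \<Psi> \<in> H" by (simp add: Td(1))
    obtain z where z: "(\<lambda>N. T.avg N (T \<Psi>)) \<longlonglongrightarrow> z" using T.mean_ergodic[OF TH] by blast
    have "a N x = A (T.avg N (T \<Psi>))" for N
    proof -
      have r: "rot (int n) T (A \<Psi>) = A (W (int n) (T \<Psi>))" for n
        using X_commute[OF rX A(1) Psi_H, of "int n"] by (simp add: rot_def)
      have "A (T.avg N (T \<Psi>)) = (1 / real N) *\<^sub>R A (\<Sum>n<N. v ^ n *\<^sub>C W (int n) (T \<Psi>))"
        using bounded_opD(3)[OF Y_op[OF A(1)]] TH
        by (simp add: T.avg_def scaleR_scaleC H_sum H_scaleC)
      also have "A (\<Sum>n<N. v ^ n *\<^sub>C W (int n) (T \<Psi>)) = (\<Sum>n<N. v ^ n *\<^sub>C A (W (int n) (T \<Psi>)))"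
        using bounded_op_linear(4)[OF H Y_op[OF A(1)], of "{..<N}" "\<lambda>n. v ^ n *\<^sub>C W (int n) (T \<Psi>)"]
          bounded_opD(3)[OF Y_op[OF A(1)]] TH by (simp add: H_scaleC)
      finally show ?thesis by (simp add: a_def A(2) r)
    qed
    moreover have "(\<lambda>N. A (T.avg N (T \<Psi>))) \<longlonglongrightarrow> A z"
      by (rule bounded_op_tendsto[OF H Y_op[OF A(1)] T.avg_H[OF TH] z])
    ultimately show ?thesis by (auto simp: convergent_def)
  qed
  have "(\<lambda>A. A \<Psi>) ` Y \<subseteq> H" using Y_H by auto
  from strong_limit_of_dense[OF H aop aK this Y_dense conv]
  obtain S where S: "bounded_op H S" "\<And>x. x \<in> H \<Longrightarrow> (\<lambda>N. a N x) \<longlonglongrightarrow> S x" by blast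
  have SX: "S \<in> X"
  proof (rule X_I[OF S(1)])
    fix A x assume A: "A \<in> Y" and x: "x \<in> H"
    have "(\<lambda>N. A (a N x)) \<longlonglongrightarrow> A (S x)"
      by (rule bounded_op_tendsto[OF H Y_op[OF A] bounded_opD(1)[OF aop x] S(2)[OF x]])
    moreover have "a N (A x) = A (a N x)" for N
    proof -
      have "A (\<Sum>n<N. v ^ n *\<^sub>C rot (int n) T x) = (\<Sum>n<N. v ^ n *\<^sub>C A (rot (int n) T x))"
        using bounded_op_linear(4)[OF H Y_op[OF A], of "{..<N}" "\<lambda>n. v ^ n *\<^sub>C rot (int n) T x"]
          bounded_opD(3)[OF Y_op[OF A]] rd(1)[OF x] by (simp add: H_scaleC)
      moreover have "A (a N x) = (1 / real N) *\<^sub>R A (\<Sum>n<N. v ^ n *\<^sub>C rot (int n) T x)"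
        unfolding a_def scaleR_scaleC
        using rd(1)[OF x] by (intro bounded_opD(3)[OF Y_op[OF A]] H_sum H_scaleC)
      ultimately show ?thesis using X_commute[OF rX A x] by (simp add: a_def)
    qed
    ultimately show "S (A x) = A (S x)" using LIMSEQ_unique[OF S(2)[OF Y_H[OF A x]]] by simp
  qed
  have "W 1 (S (W (- 1) x)) = inverse v *\<^sub>C S x" if x: "x \<in> H" for x
  proof -
    have Wx: "W (- 1) x \<in> H" by (rule W.W_H[OF x])
    have "(\<lambda>N. W 1 (a N (W (- 1) x))) \<longlonglongrightarrow> W 1 (S (W (- 1) x))"
      by (rule bounded_op_tendsto[OF H W.W_op bounded_opD(1)[OF aop Wx] S(2)[OF Wx]])
    \<comment> \<open>Conjugation by \<open>W 1\<close> shifts the summation index; the two boundary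
      terms are divided by \<open>N\<close>.\<close>
    moreover have "W 1 (a N (W (- 1) x))
        = inverse v *\<^sub>C (a N x + (1 / real N) *\<^sub>R (v ^ N *\<^sub>C rot (int N) T x - rot 0 T x))" for N
    proof -
      define f where "f n = v ^ n *\<^sub>C rot (int n) T x" for n
      have "W 1 (\<Sum>n<N. v ^ n *\<^sub>C rot (int n) T (W (- 1) x)) = (\<Sum>n<N. v ^ n *\<^sub>C rot (int n + 1) T x)"
        using rd(1)[OF Wx] by (subst W.W_sum) (auto simp: H_scaleC W.W_scaleC rot_rot[OF T x] simp del: int_iter_simps)
      also have "\<dots> = (\<Sum>n<N. inverse v *\<^sub>C f (Suc n))"
        using v0 by (intro sum.cong) (simp_all add: f_def add.commute mult.assoc[symmetric])
      also have "\<dots> = inverse v *\<^sub>C (\<Sum>n<N. f (Suc n))" by (simp add: scaleC_sum_right)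
      also have "(\<Sum>n<N. f (Suc n)) = (\<Sum>n<N. f n) + (f N - f 0)"
        using sum_lessThan_telescope[of f N] by (simp add: sum_subtractf algebra_simps)
      finally have 1: "W 1 (\<Sum>n<N. v ^ n *\<^sub>C rot (int n) T (W (- 1) x)) = inverse v *\<^sub>C ((\<Sum>n<N. f n) + (f N - f 0))" .
      have "W 1 (a N (W (- 1) x)) = (1 / real N) *\<^sub>R W 1 (\<Sum>n<N. v ^ n *\<^sub>C rot (int n) T (W (- 1) x))"
        unfolding a_def scaleR_scaleC using rd(1)[OF Wx] by (intro W.W_scaleC H_sum H_scaleC)
      also have "\<dots> = inverse v *\<^sub>C ((1 / real N) *\<^sub>R ((\<Sum>n<N. f n) + (f N - f 0)))"
        unfolding 1 by (simp add: scaleR_scaleC mult.commute)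
      finally show ?thesis by (simp add: a_def f_def scaleR_add_right)
    qed
    moreover have "(\<lambda>N. inverse v *\<^sub>C (a N x + (1 / real N) *\<^sub>R (v ^ N *\<^sub>C rot (int N) T x - rot 0 T x)))
        \<longlonglongrightarrow> inverse v *\<^sub>C (S x + 0)"
    proof (intro tendsto_scaleC tendsto_const tendsto_add S(2) x)
      have bd: "norm ((1 / real N) *\<^sub>R (v ^ N *\<^sub>C rot (int N) T x - rot 0 T x)) \<le> inverse (real N) * (2 * K * norm x)" for N
      proof -
        have "norm (v ^ N *\<^sub>C rot (int N) T x - rot 0 T x) \<le> K * norm x + K * norm x"
          using K(2)[OF x] v
          by (intro order_trans[OF norm_triangle_ineq4] add_mono) (auto simp: norm_scaleC_hilbert norm_power)
        then have "inverse (real N) * norm (v ^ N *\<^sub>C rot (int N) T x - rot 0 T x) \<le> inverse (real N) * (2 * K * norm x)"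
          by (intro mult_left_mono) simp_all
        then show ?thesis by (simp add: divide_inverse)
      qed
      have lim: "(\<lambda>N. inverse (real N) * (2 * K * norm x)) \<longlonglongrightarrow> 0"
        by (rule tendsto_mult_left_zero[OF lim_inverse_n])
      show "(\<lambda>N. (1 / real N) *\<^sub>R (v ^ N *\<^sub>C rot (int N) T x - rot 0 T x)) \<longlonglongrightarrow> 0"
        by (rule Lim_null_comparison[OF _ lim]) (intro always_eventually allI bd)
    qed
    ultimately show ?thesis using LIMSEQ_unique by fastforce
  qed
  then show ?thesis using SX S(2) unfolding a_def by blast
qed

lemma adjoint_twisted:
  assumes S: "S \<in> X" "\<And>x. x \<in> H \<Longrightarrow> W 1 (S (W (- 1) x)) = v *\<^sub>C S x"
    and T: "T \<in> X" "adjoint_on H S T" and x: "x \<in> H"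
  shows "W 1 (T (W (- 1) x)) = cnj v *\<^sub>C T x"
proof (rule cinner_ext[OF H])
  note Sd = bounded_opD[OF X_op[OF S(1)]] and Td = bounded_opD[OF X_op[OF T(1)]]
  show "W 1 (T (W (- 1) x)) \<in> H" "cnj v *\<^sub>C T x \<in> H" using x by (simp_all add: Td(1) H_scaleC del: int_iter_simps)
  fix y assume y: "y \<in> H"
  have "cinner (W 1 (T (W (- 1) x))) y = cinner (T (W (- 1) x)) (W (- 1) y)"
    using x y by (intro W.W_adjoint) (simp_all add: Td(1) del: int_iter_simps)
  also have "\<dots> = cinner (W (- 1) x) (S (W (- 1) y))"
    by (rule adjoint_onD'[OF T(2)]) (use x y in \<open>simp_all del: int_iter_simps\<close>)
  also have "\<dots> = cinner x (W 1 (S (W (- 1) y)))"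
    using W.W_cinner[of "W (- 1) x" "S (W (- 1) y)" 1] W.W_inverse(1)[of x 1] x y
    by (simp add: Sd(1) del: int_iter_simps)
  also have "\<dots> = cinner x (v *\<^sub>C S y)" using S(2)[OF y] by simp
  also have "\<dots> = cinner (cnj v *\<^sub>C T x) y"
    using adjoint_onD'[OF T(2) x y] by (simp add: cinner_scaleC_right cinner_scaleC_left)
  finally show "cinner (W 1 (T (W (- 1) x))) y = cinner (cnj v *\<^sub>C T x) y" .
qed

lemma X_compose: "S \<in> X \<Longrightarrow> T \<in> X \<Longrightarrow> (\<lambda>x. S (T x)) \<in> X"
  by (rule X_I) (auto intro: bounded_op_comp simp: X_op X_commute bounded_opD(1)[OF X_op])

lemma X_scaleC: "T \<in> X \<Longrightarrow> (\<lambda>x. c *\<^sub>C T x) \<in> X"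
  by (rule X_I) (auto intro: bounded_op_scaleC[OF H] simp: X_op X_commute bounded_opD(1)[OF X_op] bounded_opD(3)[OF Y_op])

lemma twisted_compose:
  assumes S: "S \<in> X" "\<And>x. x \<in> H \<Longrightarrow> W 1 (S (W (- 1) x)) = v *\<^sub>C S x"
    and T: "T \<in> X" "\<And>x. x \<in> H \<Longrightarrow> W 1 (T (W (- 1) x)) = w *\<^sub>C T x" and x: "x \<in> H"
  shows "W 1 (S (T (W (- 1) x))) = (v * w) *\<^sub>C S (T x)"
proof -
  note Sd = bounded_opD[OF X_op[OF S(1)]] and Td = bounded_opD[OF X_op[OF T(1)]]
  have TH: "T (W (- 1) x) \<in> H" by (rule Td(1)[OF W.W_H[OF x]])
  have "W 1 (S (T (W (- 1) x))) = W 1 (S (W (- 1) (W 1 (T (W (- 1) x)))))"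
    using W.W_inverse(2)[OF TH, of 1] by simp
  also have "\<dots> = v *\<^sub>C S (W 1 (T (W (- 1) x)))" by (rule S(2)[OF W.W_H[OF TH]])
  also have "\<dots> = v *\<^sub>C S (w *\<^sub>C T x)" using T(2)[OF x] by simp
  finally show ?thesis using Sd(3)[OF Td(1)[OF x]] by simp
qed

text \<open>By density some \<open>T\<close> in \<open>X\<close> has
  \<open>cinner (T \<Psi>) z \<noteq> 0\<close>. Averaging with weights \<open>inverse v ^ n\<close>
  yields \<open>S\<close> in \<open>X\<close> with eigenvalue \<open>v\<close> under conjugation and
  the same inner product, so \<open>S\<close> is nonzero. Its products with the adjoint
  \<open>Q\<close> in either order are fixed, hence scalar, and a multiple of \<open>S\<close> is
  unitary.\<close>

theorem eigen_unitary_exists: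
  assumes scalar: "\<And>S. S \<in> X \<Longrightarrow> (\<And>x. x \<in> H \<Longrightarrow> W 1 (S (W (- 1) x)) = S x) \<Longrightarrow> \<exists>c. \<forall>x\<in>H. S x = c *\<^sub>C x"
    and dense: "closure ((\<lambda>T. T \<Psi>) ` X) = H"
    and z: "z \<in> H" "z \<noteq> 0" "W 1 z = v *\<^sub>C z"
  shows "\<exists>V\<in>X. unitary_op H V \<and> (\<forall>x\<in>H. W 1 (V (W (- 1) x)) = v *\<^sub>C V x)"
proof -
  have v: "cmod v = 1" by (rule W.eigenvalue_norm[OF z(1,3,2)])
  then have iv: "cmod (inverse v) = 1" and v0: "v \<noteq> 0" by (auto simp: norm_inverse)
  have "\<exists>T\<in>X. cinner (T \<Psi>) z \<noteq> 0"
  proof (rule ccontr)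
    assume "\<not> ?thesis"
    then have "cinner z y = 0" if "y \<in> (\<lambda>T. T \<Psi>) ` X" for y using that cinner_commute_zero[of z] by auto
    then have "cinner z z = 0" by (rule orthogonal_closure) (use z dense in auto)
    then show False using z by simp
  qed
  then obtain T where T: "T \<in> X" "cinner (T \<Psi>) z \<noteq> 0" by blast
  note Td = bounded_opD[OF X_op[OF T(1)]]
  obtain S where S: "S \<in> X" "\<And>x. x \<in> H \<Longrightarrow> (\<lambda>N. (1 / real N) *\<^sub>R (\<Sum>n<N. inverse v ^ n *\<^sub>C rot (int n) T x)) \<longlonglongrightarrow> S x"
    "\<And>x. x \<in> H \<Longrightarrow> W 1 (S (W (- 1) x)) = v *\<^sub>C S x"
    using twisted_average[OF T(1) iv] by auto
  note Sd = bounded_opD[OF X_op[OF S(1)]]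
  have "(\<lambda>N. cinner ((1 / real N) *\<^sub>R (\<Sum>n<N. inverse v ^ n *\<^sub>C rot (int n) T \<Psi>)) z) \<longlonglongrightarrow> cinner (S \<Psi>) z"
    by (intro tendsto_cinner S(2) tendsto_const) simp
  moreover have "cinner ((1 / real N) *\<^sub>R (\<Sum>n<N. inverse v ^ n *\<^sub>C rot (int n) T \<Psi>)) z = cinner (T \<Psi>) z" if "N > 0" for N
  proof -
    have "cinner (rot (int n) T \<Psi>) z = v ^ n * cinner (T \<Psi>) z" for n
    proof -
      have vv: "cnj v = inverse v"
        using v by (intro inverse_unique[symmetric]) (simp add: complex_norm_square[symmetric])
      have "cinner (T \<Psi>) z = cinner (W (int n) (T \<Psi>)) (W (int n) z)" using z by (simp add: Td(1))
      also have "\<dots> = inverse v ^ n * cinner (W (int n) (T \<Psi>)) z"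
        by (simp add: W.W_eigen_multiple[OF z(1,3)] cinner_scaleC_right vv)
      finally show ?thesis using v0 by (simp add: rot_def field_simps)
    qed
    then show ?thesis using that v0
      by (simp add: cinner_scaleR_left cinner_sum_left cinner_scaleC_left power_inverse mult.assoc[symmetric])
  qed
  then have "\<forall>\<^sub>F N in sequentially. cinner ((1 / real N) *\<^sub>R (\<Sum>n<N. inverse v ^ n *\<^sub>C rot (int n) T \<Psi>)) z = cinner (T \<Psi>) z"
    by (intro eventually_mono[OF eventually_gt_at_top[of 0]]) simp
  ultimately have "(\<lambda>N::nat. cinner (T \<Psi>) z) \<longlonglongrightarrow> cinner (S \<Psi>) z"
    by (rule Lim_transform_eventually)
  then have "cinner (S \<Psi>) z \<noteq> 0" using T(2) by (simp add: LIMSEQ_const_iff)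
  then have S0: "S \<Psi> \<noteq> 0" by auto
  obtain Q where Q: "Q \<in> X" "adjoint_on H S Q"
    using star_closed_commutant[OF H Y_star] S(1) unfolding star_closed_on_def by blast
  note Qd = bounded_opD[OF X_op[OF Q(1)]]
  have Qt: "W 1 (Q (W (- 1) x)) = cnj v *\<^sub>C Q x" if "x \<in> H" for x
    by (rule adjoint_twisted[OF S(1,3) Q that])
  have vv: "v * cnj v = 1" "cnj v * v = 1" using v by (simp_all add: complex_norm_square[symmetric] mult.commute)
  obtain c where c: "\<And>x. x \<in> H \<Longrightarrow> Q (S x) = c *\<^sub>C x"
    using scalar[OF X_compose[OF Q(1) S(1)]] twisted_compose[OF Q(1) Qt S(1,3)] by (auto simp: vv)
  obtain d where d: "\<And>x. x \<in> H \<Longrightarrow> S (Q x) = d *\<^sub>C x"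
    using scalar[OF X_compose[OF S(1) Q(1)]] twisted_compose[OF S(1,3) Q(1) Qt] by (auto simp: vv)
  have "cinner (S \<Psi>) (S \<Psi>) = cinner (Q (S \<Psi>)) \<Psi>"
    using adjoint_onD'[OF Q(2) Sd(1)[OF Psi_H] Psi_H] by simp
  also have "\<dots> = c" by (simp add: c cinner_scaleC_left cinner_Psi)
  finally have c_eq: "c = of_real ((norm (S \<Psi>))\<^sup>2)" by (simp add: cinner_self)
  \<comment> \<open>\<open>S (Q (S \<Psi>))\<close> is both \<open>d\<close> and \<open>c\<close>
    times the nonzero vector \<open>S \<Psi>\<close>, so the two scalars agree and the normalised
    \<open>S\<close> is onto.\<close>
  have "d *\<^sub>C S \<Psi> = c *\<^sub>C S \<Psi>" using d[OF Sd(1)[OF Psi_H]] c[OF Psi_H] Sd(3)[OF Psi_H] by simp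
  then have "(d - c) *\<^sub>C S \<Psi> = 0" by (simp add: scaleC_diff_left)
  then have "cmod (d - c) * norm (S \<Psi>) = 0" by (simp add: norm_scaleC_hilbert[symmetric])
  then have dc: "d = c" using S0 by simp
  define r where "r = norm (S \<Psi>)"
  have r: "r > 0" using S0 by (simp add: r_def)
  define V where "V x = of_real (1 / r) *\<^sub>C S x" for x
  have VX: "V \<in> X" unfolding V_def by (rule X_scaleC[OF S(1)])
  have VH: "V x \<in> H" if "x \<in> H" for x by (rule bounded_opD(1)[OF X_op[OF VX] that])
  have "cinner (V x) (V y) = cinner x y" if "x \<in> H" "y \<in> H" for x y
  proof -
    have "cinner (S x) (S y) = cinner x (Q (S y))" by (rule adjoint_onD[OF Q(2) that(1) Sd(1)[OF that(2)]])
    also have "\<dots> = of_real (r * r) * cinner x y"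
      using c[OF that(2)] by (simp add: c_eq cinner_scaleC_right r_def power2_eq_square)
    finally show ?thesis using r by (simp add: V_def cinner_scaleC_left cinner_scaleC_right field_simps)
  qed
  moreover have "V ` H = H"
  proof
    show "V ` H \<subseteq> H" using VH by blast
    show "H \<subseteq> V ` H"
    proof
      fix x assume x: "x \<in> H"
      have "V (of_real (1 / r) *\<^sub>C Q x) = x"
        using d[OF x] r Qd(1)[OF x]
        by (simp add: V_def Sd(3) dc c_eq r_def[symmetric] power2_eq_square)
      then show "x \<in> V ` H" using Qd(1)[OF x] by (metis H_scaleC image_eqI)
    qed
  qed
  ultimately have "unitary_op H V" using X_op[OF VX] by (simp add: unitary_op_def)
  moreover have "W 1 (V (W (- 1) x)) = v *\<^sub>C V x" if "x \<in> H" for x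
    using S(3)[OF that] Sd(1)[OF W.W_H[OF that]] W.W_scaleC[of "S (W (- 1) x)" 1]
    by (simp add: V_def mult.commute del: int_iter_simps)
  ultimately show ?thesis using VX by blast
qed

end

section \<open>Orthonormal series\<close>

lemma norm_sum_orthonormal:
  fixes e :: "'i \<Rightarrow> 'h::chilbert_space"
  assumes "finite F" and e: "\<And>i j. i \<in> F \<Longrightarrow> j \<in> F \<Longrightarrow> cinner (e i) (e j) = (if i = j then 1 else 0)"
  shows "(norm (\<Sum>i\<in>F. c i *\<^sub>C e i))\<^sup>2 = (\<Sum>i\<in>F. (cmod (c i))\<^sup>2)"
proof -
  have "cinner (\<Sum>i\<in>F. c i *\<^sub>C e i) (\<Sum>j\<in>F. c j *\<^sub>C e j) = (\<Sum>i\<in>F. \<Sum>j\<in>F. c i * cnj (c j) * (if i = j then 1 else 0))"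
    unfolding cinner_sum_left cinner_sum_right
    by (intro sum.cong refl) (simp add: cinner_scaleC_left cinner_scaleC_right e)
  also have "\<dots> = (\<Sum>i\<in>F. of_real ((cmod (c i))\<^sup>2))"
    using assms(1) by (intro sum.cong refl) (simp add: complex_norm_square if_distrib del: of_real_power cong: if_cong)
  finally have "of_real ((norm (\<Sum>i\<in>F. c i *\<^sub>C e i))\<^sup>2) = (of_real (\<Sum>i\<in>F. (cmod (c i))\<^sup>2) :: complex)"
    by (simp add: cinner_self)
  then show ?thesis by (simp only: of_real_eq_iff)
qed

lemma bessel_finite:
  fixes e :: "'i \<Rightarrow> 'h::chilbert_space"
  assumes "finite F" and e: "\<And>i j. i \<in> F \<Longrightarrow> j \<in> F \<Longrightarrow> cinner (e i) (e j) = (if i = j then 1 else 0)"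
  shows "(\<Sum>i\<in>F. (cmod (cinner x (e i)))\<^sup>2) \<le> (norm x)\<^sup>2"
proof -
  define y where "y = (\<Sum>i\<in>F. cinner x (e i) *\<^sub>C e i)"
  define s where "s = (\<Sum>i\<in>F. (cmod (cinner x (e i)))\<^sup>2)"
  have "cinner x y = of_real s"
    by (simp add: y_def s_def cinner_sum_right cinner_scaleC_right complex_norm_square mult.commute
        del: of_real_power)
  then have "s = Re (cinner x y)" by simp
  also have "\<dots> \<le> norm x * norm y" by (rule order_trans[OF complex_Re_le_cmod cinner_norm_le])
  also have "norm y = sqrt s"
    using norm_sum_orthonormal[OF assms, of "\<lambda>i. cinner x (e i)"]
    by (simp add: y_def s_def real_sqrt_unique)
  finally have le: "s \<le> norm x * sqrt s" .
  have s0: "s \<ge> 0" by (simp add: s_def sum_nonneg)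
  show ?thesis
  proof (cases "s = 0")
    case False
    have "sqrt s * sqrt s \<le> norm x * sqrt s" using le s0 by simp
    moreover have "sqrt s > 0" using False s0 by simp
    ultimately have "sqrt s \<le> norm x" by (rule mult_right_le_imp_le)
    then have "(sqrt s)\<^sup>2 \<le> (norm x)\<^sup>2" using s0 by (intro power_mono) auto
    then show ?thesis using s0 by (simp add: s_def[symmetric])
  qed (simp add: s_def[symmetric])
qed

text \<open>By Pythagoras the partial sums are Cauchy as soon as the squared coefficients are
  summable. The index set is arbitrary, hence convergence is along the finite subsets.\<close>

lemma orthonormal_series:
  fixes e :: "'i \<Rightarrow> 'h::chilbert_space"
  assumes e: "\<And>i j. i \<in> S \<Longrightarrow> j \<in> S \<Longrightarrow> cinner (e i) (e j) = (if i = j then 1 else 0)"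
    and B: "\<And>F. finite F \<Longrightarrow> F \<subseteq> S \<Longrightarrow> (\<Sum>i\<in>F. (cmod (c i))\<^sup>2) \<le> B"
  shows "(\<lambda>i. c i *\<^sub>C e i) summable_on S" "(norm (\<Sum>\<^sub>\<infinity>i\<in>S. c i *\<^sub>C e i))\<^sup>2 \<le> B"
proof -
  define f where "f = (\<lambda>i. c i *\<^sub>C e i)"
  have nf: "(norm (sum f F))\<^sup>2 = (\<Sum>i\<in>F. (cmod (c i))\<^sup>2)" if "finite F" "F \<subseteq> S" for F
    unfolding f_def by (rule norm_sum_orthonormal[OF that(1)], rule e) (use that in blast)+
  have sq: "(\<lambda>i. (cmod (c i))\<^sup>2) summable_on S"
    by (rule nonneg_bdd_above_summable_on) (auto intro!: bdd_aboveI2[of _ _ B] B)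
  have "f summable_on S"
  proof -
    have "cauchy_filter (filtermap (sum f) (finite_subsets_at_top S))"
      unfolding cauchy_filter_metric_filtermap
    proof (intro allI impI)
      fix \<epsilon> :: real assume \<epsilon>: "\<epsilon> > 0"
      obtain F0 where F0: "finite F0" "F0 \<subseteq> S"
        "dist (\<Sum>i\<in>F0. (cmod (c i))\<^sup>2) (\<Sum>\<^sub>\<infinity>i\<in>S. (cmod (c i))\<^sup>2) \<le> (\<epsilon> / 4)\<^sup>2"
        using infsum_finite_approximation[OF sq, of "(\<epsilon> / 4)\<^sup>2"] \<epsilon> by auto
      have near: "norm (sum f F - sum f F0) \<le> \<epsilon> / 4" if F: "finite F" "F \<subseteq> S" "F0 \<subseteq> F" for F
      proof -
        have "sum f F - sum f F0 = sum f (F - F0)" using F by (simp add: sum_diff)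
        then have "(norm (sum f F - sum f F0))\<^sup>2 = (\<Sum>i\<in>F - F0. (cmod (c i))\<^sup>2)"
          using nf[of "F - F0"] F by auto
        also have "\<dots> = (\<Sum>i\<in>F. (cmod (c i))\<^sup>2) - (\<Sum>i\<in>F0. (cmod (c i))\<^sup>2)" using F by (simp add: sum_diff)
        also have "(\<Sum>i\<in>F. (cmod (c i))\<^sup>2) \<le> (\<Sum>\<^sub>\<infinity>i\<in>S. (cmod (c i))\<^sup>2)"
          by (rule finite_sum_le_infsum[OF sq F(1,2)]) simp
        finally have "(norm (sum f F - sum f F0))\<^sup>2 \<le> (\<epsilon> / 4)\<^sup>2" using F0(3) by (simp add: dist_real_def)
        then show ?thesis by (rule power2_le_imp_le) (use \<epsilon> in simp)
      qed
      show "\<exists>P. eventually P (finite_subsets_at_top S) \<and> (\<forall>x y. P x \<and> P y \<longrightarrow> dist (sum f x) (sum f y) < \<epsilon>)"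
      proof (intro exI[of _ "\<lambda>F. finite F \<and> F \<subseteq> S \<and> F0 \<subseteq> F"] conjI allI impI)
        show "\<forall>\<^sub>F F in finite_subsets_at_top S. finite F \<and> F \<subseteq> S \<and> F0 \<subseteq> F"
          unfolding eventually_finite_subsets_at_top using F0 by blast
        fix F G assume "(finite F \<and> F \<subseteq> S \<and> F0 \<subseteq> F) \<and> (finite G \<and> G \<subseteq> S \<and> F0 \<subseteq> G)"
        then have "norm (sum f F - sum f F0) \<le> \<epsilon> / 4" "norm (sum f G - sum f F0) \<le> \<epsilon> / 4" using near by auto
        then have "dist (sum f F) (sum f F0) \<le> \<epsilon> / 4" "dist (sum f G) (sum f F0) \<le> \<epsilon> / 4" by (simp_all add: dist_norm)
        then show "dist (sum f F) (sum f G) < \<epsilon>" using \<epsilon> dist_triangle2[of "sum f F" "sum f G" "sum f F0"] by linarith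
      qed
    qed
    then obtain L where "(sum f \<longlongrightarrow> L) (finite_subsets_at_top S)"
      using complete_uniform[where S = "UNIV :: 'h set"] complete_UNIV[where 'a = 'h]
      by (force simp add: filterlim_def)
    then show ?thesis by (auto simp: summable_on_def has_sum_def)
  qed
  then show "(\<lambda>i. c i *\<^sub>C e i) summable_on S" by (simp add: f_def)
  have "(sum f \<longlongrightarrow> infsum f S) (finite_subsets_at_top S)"
    using \<open>f summable_on S\<close> has_sum_infsum unfolding has_sum_def by blast
  then have "((\<lambda>F. (norm (sum f F))\<^sup>2) \<longlongrightarrow> (norm (infsum f S))\<^sup>2) (finite_subsets_at_top S)"
    by (intro tendsto_intros)
  moreover have "\<forall>\<^sub>F F in finite_subsets_at_top S. (norm (sum f F))\<^sup>2 \<le> B"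
    unfolding eventually_finite_subsets_at_top using nf B by (intro exI[of _ "{}"]) auto
  ultimately have "(norm (infsum f S))\<^sup>2 \<le> B"
    by (rule tendsto_upperbound) simp
  then show "(norm (\<Sum>\<^sub>\<infinity>i\<in>S. c i *\<^sub>C e i))\<^sup>2 \<le> B" by (simp add: f_def)
qed

lemma infsum_in_closed_csubspace:
  assumes H: "closed_csubspace H" and f: "f summable_on S" "\<And>i. i \<in> S \<Longrightarrow> f i \<in> H"
  shows "infsum f S \<in> H"
proof -
  have "(sum f \<longlongrightarrow> infsum f S) (finite_subsets_at_top S)"
    using f(1) has_sum_infsum unfolding has_sum_def by blast
  moreover have "\<forall>\<^sub>F F in finite_subsets_at_top S. sum f F \<in> H"
    unfolding eventually_finite_subsets_at_top
    by (intro exI[of _ "{}"] conjI allI impI closed_csubspaceD(8)[OF H] f(2)) auto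
  ultimately show ?thesis
    by (intro Lim_in_closed_set[OF closed_csubspaceD(1)[OF H]]) auto
qed

text \<open>\<open>N = 0\<close> is exempt because empty averages are 0.\<close>

lemma LIMSEQ_eq_const:
  fixes l :: "'t::t2_space"
  assumes "f \<longlonglongrightarrow> l" "\<And>N. N > 0 \<Longrightarrow> f N = c"
  shows "l = c"
proof -
  have "f \<longlonglongrightarrow> c"
    by (rule tendsto_eventually, rule eventually_mono[OF eventually_gt_at_top[of 0]]) (rule assms(2))
  then show ?thesis using assms(1) by (rule LIMSEQ_unique[rotated])
qed

section \<open>Ergodic systems with a separating cyclic vector\<close>

locale ergodic_system = covariant_automorphism \<beta> \<psi> R
  for \<beta> :: "'a::cstar_algebra \<Rightarrow> 'a" and \<psi> :: "'a \<Rightarrow> complex"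
    and R :: "('a, 'k::chilbert_space) covariant_rep" +
  assumes extreme: "\<psi> \<in> extreme_invariant_states \<beta>" and central: "central_support \<psi>"
begin

lemmas M'_cyclic = commutant_cyclic[OF central]

sublocale P: covariant_pair \<beta> \<psi> R "range \<pi>"
  rewrites "commutant H (range \<pi>) = M'"
proof -
  show "covariant_pair \<beta> \<psi> R (range \<pi>)"
  proof
    show "A \<in> range \<pi> \<Longrightarrow> bounded_op H A" for A using pi_op by blast
    show "star_closed_on H (range \<pi>)" by (rule range_pi_star_closed)
    show "A \<in> range \<pi> \<Longrightarrow> \<exists>B\<in>range \<pi>. \<forall>x\<in>H. W n (A (W (- n) x)) = B x" for A n
      using W_pi by blast
    show "closure ((\<lambda>A. A \<Psi>) ` range \<pi>) = H" using cyclic by (simp add: image_image)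
  qed
qed (simp add: M'_def)

lemma op_eq_scalar:
  assumes S: "bounded_op H S" and D: "D \<subseteq> H" "closure D = H" and eq: "\<And>y. y \<in> D \<Longrightarrow> S y = c *\<^sub>C y" and x: "x \<in> H"
  shows "S x = c *\<^sub>C x"
proof -
  obtain f where f: "\<And>n. f n \<in> D" "f \<longlonglongrightarrow> x" using x D(2) unfolding closure_sequential[symmetric] by (metis closure_sequential)
  have "(\<lambda>n. S (f n)) \<longlonglongrightarrow> S x" by (rule bounded_op_tendsto[OF H S _ f(2)]) (use f D in blast)
  moreover have "(\<lambda>n. S (f n)) \<longlonglongrightarrow> c *\<^sub>C x"
    unfolding eq[OF f(1)] by (intro tendsto_scaleC tendsto_const f)
  ultimately show ?thesis by (rule LIMSEQ_unique)
qed

text \<open>For large \<open>c\<close> the functionals \<open>a \<mapsto> \<langle>\<pi>(a) (c \<plusminus> S) \<Psi>, \<Psi>\<rangle>\<close> are multiples of invariant states with a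
  multiple of \<open>\<psi>\<close> as sum, so extremality applies.\<close>

lemma fixed_selfadjoint_scalar:
  assumes S: "S \<in> M'" "adjoint_on H S S" and fix': "\<And>x. x \<in> H \<Longrightarrow> W 1 (S (W (- 1) x)) = S x" and x: "x \<in> H"
  shows "S x = cinner (S \<Psi>) \<Psi> *\<^sub>C x"
proof -
  note Sd = bounded_opD[OF M'_op[OF S(1)]]
  obtain K where K: "K \<ge> 0" "\<And>x. x \<in> H \<Longrightarrow> norm (S x) \<le> K * norm x" using Sd(4) by blast
  have real: "cinner (S y) y = of_real (Re (cinner (S y) y))" if "y \<in> H" for y
  proof -
    have "cinner (S y) y = cinner y (S y)" by (rule adjoint_onD[OF S(2) that that])
    then have "cinner (S y) y = cnj (cinner (S y) y)" using cinner_commute[of y "S y"] by simp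
    then show ?thesis by (metis Reals_cnj_iff of_real_Re)
  qed
  have bd: "\<bar>Re (cinner (S y) y)\<bar> \<le> K * (norm y)\<^sup>2" if "y \<in> H" for y
  proof -
    have "\<bar>Re (cinner (S y) y)\<bar> \<le> norm (S y) * norm y"
      by (rule order_trans[OF abs_Re_le_cmod cinner_norm_le])
    also have "\<dots> \<le> K * norm y * norm y" by (intro mult_right_mono K that) simp
    finally show ?thesis by (simp add: power2_eq_square)
  qed
  \<comment> \<open>One more than the bound of \<open>S\<close>: then
    \<open>c \<plusminus> S\<close> is positive and the normalising constants
    \<open>c \<plusminus> s\<close> do not vanish.\<close>
  define c where "c = K + 1"
  define s where "s = Re (cinner (S \<Psi>) \<Psi>)"
  have s: "\<bar>s\<bar> < c" using bd[of \<Psi>] by (simp add: s_def c_def)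
  have sC: "cinner (S \<Psi>) \<Psi> = of_real s" unfolding s_def by (rule real) simp
  have SPsi: "W (- 1) (S \<Psi>) = S \<Psi>"
  proof -
    have "W 1 (S \<Psi>) = S \<Psi>" using fix'[OF Psi_H] by (simp del: int_iter_simps)
    then show ?thesis using W.W_inverse(2)[OF Sd(1)[OF Psi_H], of 1] by simp
  qed
  define \<phi> where "\<phi> \<epsilon> a = cinner (\<pi> a (of_real c *\<^sub>C \<Psi> + of_real \<epsilon> *\<^sub>C S \<Psi>)) \<Psi> / of_real (c + \<epsilon> * s)" for \<epsilon> :: real and a
  have phi: "\<phi> \<epsilon> \<in> invariant_states \<beta>" if \<epsilon>: "\<epsilon> = 1 \<or> \<epsilon> = -1" for \<epsilon>
  proof -
    have N: "c + \<epsilon> * s > 0" using \<epsilon> s by auto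
    define y where "y = of_real c *\<^sub>C \<Psi> + of_real \<epsilon> *\<^sub>C S \<Psi>"
    have yH: "y \<in> H" by (simp add: y_def H_add H_scaleC Sd(1))
    have "\<phi> \<epsilon> \<in> states"
      unfolding states_def
    proof (intro CollectI conjI allI)
      show "\<phi> \<epsilon> (a + b) = \<phi> \<epsilon> a + \<phi> \<epsilon> b" for a b
        using yH by (simp add: \<phi>_def y_def[symmetric] pi_add cinner_add_left add_divide_distrib)
      show "\<phi> \<epsilon> (d *\<^sub>C a) = d * \<phi> \<epsilon> a" for d a
        using yH by (simp add: \<phi>_def y_def[symmetric] pi_scaleC cinner_scaleC_left)
      show "\<phi> \<epsilon> (star a * a) \<in> \<real>\<^sub>\<ge>\<^sub>0" for a
      proof -
        define z where "z = \<pi> a \<Psi>"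
        have zH: "z \<in> H" by (simp add: z_def)
        have "\<pi> a y = of_real c *\<^sub>C z + of_real \<epsilon> *\<^sub>C S z"
          by (simp add: y_def z_def pi_add_right pi_scaleC_right M'_commute[OF S(1)] Sd(1) H_scaleC)
        moreover have "cinner (\<pi> (star a * a) y) \<Psi> = cinner (\<pi> a y) z"
          using yH by (simp add: pi_mult pi_adjoint star_star z_def)
        ultimately have "cinner (\<pi> (star a * a) y) \<Psi> = of_real c * cinner z z + of_real \<epsilon> * cinner (S z) z"
          by (simp add: cinner_add_left cinner_scaleC_left)
        also have "\<dots> = of_real (c * (norm z)\<^sup>2 + \<epsilon> * Re (cinner (S z) z))"
          by (subst real[OF zH]) (simp add: cinner_self)
        finally have 1: "\<phi> \<epsilon> (star a * a) = of_real ((c * (norm z)\<^sup>2 + \<epsilon> * Re (cinner (S z) z)) / (c + \<epsilon> * s))"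
          by (simp add: \<phi>_def y_def[symmetric])
        have "- (K * (norm z)\<^sup>2) \<le> \<epsilon> * Re (cinner (S z) z)" using bd[OF zH] \<epsilon> by auto
        moreover have "K * (norm z)\<^sup>2 \<le> c * (norm z)\<^sup>2" by (intro mult_right_mono) (simp_all add: c_def)
        ultimately have "0 \<le> c * (norm z)\<^sup>2 + \<epsilon> * Re (cinner (S z) z)" by linarith
        then show ?thesis unfolding 1 nonneg_Reals_of_real_iff using N by simp
      qed
      show "\<phi> \<epsilon> 1 = 1"
        using N yH by (simp add: \<phi>_def y_def[symmetric])
          (simp add: y_def cinner_add_left cinner_scaleC_left cinner_Psi sC flip: of_real_mult of_real_add)
    qed
    moreover have "\<phi> \<epsilon> (\<beta> a) = \<phi> \<epsilon> a" for a
    proof -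
      have "W (- 1) y = y"
        using SPsi by (simp add: y_def W.W_add W.W_scaleC H_scaleC Sd(1) del: int_iter_simps)
      moreover have "\<pi> (\<beta> a) y = W 1 (\<pi> a (W (- 1) y))" using covariance[OF yH] by simp
      ultimately have "cinner (\<pi> (\<beta> a) y) \<Psi> = cinner (W 1 (\<pi> a y)) (W 1 \<Psi>)" by (simp del: int_iter_simps)
      also have "\<dots> = cinner (\<pi> a y) \<Psi>" using yH by (intro W.W_cinner) auto
      finally show ?thesis by (simp add: \<phi>_def y_def[symmetric])
    qed
    ultimately show ?thesis by (auto simp: invariant_states_def)
  qed
  \<comment> \<open>The weights cancel the normalisations: \<open>t / (c + s)\<close> and
    \<open>(1 - t) / (c - s)\<close> are both \<open>1 / (2 * c)\<close>.\<close>
  define t where "t = (c + s) / (2 * c)"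
  have c0: "c > 0" using K by (simp add: c_def)
  have t: "0 < t" "t < 1" using s c0 by (auto simp: t_def field_simps)
  have "\<psi> a = of_real t * \<phi> 1 a + of_real (1 - t) * \<phi> (- 1) a" for a
  proof -
    have n: "c + s \<noteq> 0" "c - s \<noteq> 0" using s by auto
    have 1: "of_real t * \<phi> 1 a = cinner (\<pi> a (of_real c *\<^sub>C \<Psi> + S \<Psi>)) \<Psi> / of_real (2 * c)"
      using n by (simp add: \<phi>_def t_def flip: of_real_add)
    have "1 - t = (c - s) / (2 * c)" using c0 by (simp add: t_def field_simps)
    then have 2: "of_real (1 - t) * \<phi> (- 1) a = cinner (\<pi> a (of_real c *\<^sub>C \<Psi> - S \<Psi>)) \<Psi> / of_real (2 * c)"
      using n by (simp add: \<phi>_def flip: of_real_diff)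
    show ?thesis unfolding 1 2 using c0
      by (simp add: add_divide_distrib[symmetric] cinner_add_left[symmetric] pi_add_right[symmetric]
          pi_add_right pi_diff_right H_add H_diff H_scaleC Sd(1) cinner_add_left cinner_diff_left
          pi_scaleC_right cinner_scaleC_left psi_eq)
  qed
  then have "\<phi> 1 = \<psi>"
    using extreme phi[of 1] phi[of "- 1"] t unfolding extreme_invariant_states_def by blast
  then have eq: "cinner (\<pi> a (of_real c *\<^sub>C \<Psi> + S \<Psi>)) \<Psi> = of_real (c + s) * cinner (\<pi> a \<Psi>) \<Psi>" for a
  proof -
    have "complex_of_real (c + s) \<noteq> 0" unfolding of_real_eq_0_iff using s by auto
    moreover have "cinner (\<pi> a (of_real c *\<^sub>C \<Psi> + S \<Psi>)) \<Psi> / of_real (c + s) = cinner (\<pi> a \<Psi>) \<Psi>"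
      using fun_cong[OF \<open>\<phi> 1 = \<psi>\<close>, of a] by (simp add: \<phi>_def psi_eq)
    ultimately show ?thesis by (metis nonzero_divide_eq_eq mult.commute)
  qed
  \<comment> \<open>Equality of the two states, read at \<open>star a\<close>, says that
    \<open>S \<Psi>\<close> minus \<open>s\<close> times \<open>\<Psi>\<close> is orthogonal to
    \<open>\<pi> a \<Psi>\<close>.\<close>
  have van: "cinner (S \<Psi> - of_real s *\<^sub>C \<Psi>) (\<pi> a \<Psi>) = 0" for a
    using eq[of "star a"]
    by (simp add: pi_add_right H_scaleC Sd(1) pi_scaleC_right pi_adjoint star_star cinner_add_left
        cinner_scaleC_left cinner_diff_left distrib_right)
  have "cinner (S \<Psi> - of_real s *\<^sub>C \<Psi>) (S \<Psi> - of_real s *\<^sub>C \<Psi>) = 0"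
    by (rule orthogonal_closure[of "range (\<lambda>a. \<pi> a \<Psi>)"])
       (use van cyclic in \<open>auto simp: H_diff H_scaleC Sd(1)\<close>)
  then have "S \<Psi> = of_real s *\<^sub>C \<Psi>" by simp
  then have "S y = of_real s *\<^sub>C y" if "y \<in> range (\<lambda>a. \<pi> a \<Psi>)" for y
    using that M'_commute[OF S(1) Psi_H] by (auto simp: pi_scaleC_right)
  then show ?thesis
    unfolding sC by (intro op_eq_scalar[OF M'_op[OF S(1)] _ cyclic _ x]) auto
qed

text \<open>Real and imaginary parts: \<open>S1\<close> and \<open>S2\<close> are self-adjoint and
  fixed, and \<open>S\<close> is half of \<open>S1\<close> minus \<open>\<i> / 2\<close> times
  \<open>S2\<close>.\<close>

lemma fixed_M'_scalar:
  assumes S: "S \<in> M'" and fix': "\<And>x. x \<in> H \<Longrightarrow> W 1 (S (W (- 1) x)) = S x"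
  shows "\<exists>c. \<forall>x\<in>H. S x = c *\<^sub>C x"
proof -
  obtain Q where Q: "Q \<in> M'" "adjoint_on H S Q"
    using M'_star_closed S unfolding star_closed_on_def by blast
  have fixQ: "W 1 (Q (W (- 1) x)) = Q x" if "x \<in> H" for x
    using P.adjoint_twisted[of S 1 Q x] S Q fix' that by (simp del: int_iter_simps)
  note Sd = bounded_opD[OF M'_op[OF S]] and Qd = bounded_opD[OF M'_op[OF Q(1)]]
  define S1 where "S1 = (\<lambda>x. S x + Q x)"
  define S2 where "S2 = (\<lambda>x. \<i> *\<^sub>C S x + (- \<i>) *\<^sub>C Q x)"
  have "S1 \<in> M'" unfolding S1_def by (rule M'_add[OF S Q(1)])
  moreover have "adjoint_on H S1 S1"
    using adjoint_onD[OF Q(2)] adjoint_onD'[OF Q(2)]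
    by (simp add: adjoint_on_def S1_def cinner_add_left cinner_add_right)
  moreover have "W 1 (S1 (W (- 1) x)) = S1 x" if "x \<in> H" for x
    using that by (simp add: S1_def W.W_add fix' fixQ Sd(1) Qd(1) del: int_iter_simps)
  ultimately have 1: "S1 x = cinner (S1 \<Psi>) \<Psi> *\<^sub>C x" if "x \<in> H" for x
    using that by (rule fixed_selfadjoint_scalar)
  have "S2 \<in> M'" unfolding S2_def by (intro M'_add M'_scaleC S Q)
  moreover have "adjoint_on H S2 S2"
    using adjoint_onD[OF Q(2)] adjoint_onD'[OF Q(2)]
    by (simp add: adjoint_on_def S2_def cinner_add_left cinner_add_right cinner_scaleC_left cinner_scaleC_right
        cinner_diff_left cinner_diff_right)
  moreover have "W 1 (S2 (W (- 1) x)) = S2 x" if "x \<in> H" for x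
    using that by (simp add: S2_def W.W_add W.W_diff W.W_scaleC fix' fixQ Sd(1) Qd(1) H_scaleC del: int_iter_simps)
  ultimately have 2: "S2 x = cinner (S2 \<Psi>) \<Psi> *\<^sub>C x" if "x \<in> H" for x
    using that by (rule fixed_selfadjoint_scalar)
  have "S x = (cinner (S1 \<Psi>) \<Psi> / 2 - \<i> * cinner (S2 \<Psi>) \<Psi> / 2) *\<^sub>C x" if x: "x \<in> H" for x
  proof -
    have "S x = (1 / 2) *\<^sub>C S1 x + (- \<i> / 2) *\<^sub>C S2 x"
      by (simp add: S1_def S2_def scaleC_add_right scaleC_diff_right scaleC_add_left[symmetric])
    also have "\<dots> = (1 / 2 * cinner (S1 \<Psi>) \<Psi>) *\<^sub>C x + (- \<i> / 2 * cinner (S2 \<Psi>) \<Psi>) *\<^sub>C x"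
      unfolding 1[OF x] 2[OF x] by simp
    finally show ?thesis by (simp add: scaleC_diff_left)
  qed
  then show ?thesis by blast
qed

text \<open>The limit operator is fixed, hence a scalar; the scalar is read off by pairing with
  \<open>\<Psi>\<close>, where every term of the average has the same value.\<close>

lemma M'_average:
  assumes T: "T \<in> M'" and x: "x \<in> H"
  shows "(\<lambda>N. (1 / real N) *\<^sub>R (\<Sum>n<N. P.rot (int n) T x)) \<longlonglongrightarrow> cinner (T \<Psi>) \<Psi> *\<^sub>C x"
proof -
  obtain S where S: "S \<in> M'" "\<And>x. x \<in> H \<Longrightarrow> (\<lambda>N. (1 / real N) *\<^sub>R (\<Sum>n<N. P.rot (int n) T x)) \<longlonglongrightarrow> S x"
    "\<And>x. x \<in> H \<Longrightarrow> W 1 (S (W (- 1) x)) = S x"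
    using P.twisted_average[OF T, of 1] by auto
  obtain c where c: "\<And>x. x \<in> H \<Longrightarrow> S x = c *\<^sub>C x" using fixed_M'_scalar[OF S(1,3)] by blast
  have TH: "T \<Psi> \<in> H" by (rule bounded_opD(1)[OF M'_op[OF T] Psi_H])
  have "(\<lambda>N. cinner ((1 / real N) *\<^sub>R (\<Sum>n<N. P.rot (int n) T \<Psi>)) \<Psi>) \<longlonglongrightarrow> cinner (S \<Psi>) \<Psi>"
    by (intro tendsto_cinner S(2) tendsto_const Psi_H)
  moreover have "cinner ((1 / real N) *\<^sub>R (\<Sum>n<N. P.rot (int n) T \<Psi>)) \<Psi> = cinner (T \<Psi>) \<Psi>" if "N > 0" for N
  proof -
    have "cinner (P.rot (int n) T \<Psi>) \<Psi> = cinner (T \<Psi>) \<Psi>" for n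
      using W.W_cinner[OF TH Psi_H, of "int n"] by (simp add: P.rot_def)
    then show ?thesis using that by (simp add: cinner_scaleR_left cinner_sum_left)
  qed
  ultimately have "cinner (S \<Psi>) \<Psi> = cinner (T \<Psi>) \<Psi>"
    by (rule LIMSEQ_eq_const)
  then have "c = cinner (T \<Psi>) \<Psi>" using c[OF Psi_H] by (simp add: cinner_scaleC_left cinner_Psi)
  then show ?thesis using S(2)[OF x] c[OF x] by simp
qed

text \<open>For fixed \<open>y\<close> orthogonal to \<open>\<Psi>\<close>, the number
  \<open>cinner (T \<Psi>) y\<close> is unchanged by averaging \<open>T\<close>, and the averages
  tend to \<open>cinner (T \<Psi>) \<Psi> * cinner \<Psi> y = 0\<close>. The vectors
  \<open>T \<Psi>\<close> are dense because the support is central.\<close>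

lemma fixed_vector:
  assumes z: "z \<in> H" "W 1 z = z"
  shows "z = cinner z \<Psi> *\<^sub>C \<Psi>"
proof -
  define y where "y = z - cinner z \<Psi> *\<^sub>C \<Psi>"
  have y: "y \<in> H" by (simp add: y_def z H_diff H_scaleC)
  have "W 1 y = 1 *\<^sub>C y" by (simp add: y_def z W.W_diff W.W_scaleC H_scaleC del: int_iter_simps)
  then have Wy: "W (int n) y = y" for n using W.W_eigen_multiple[OF y, of 1 n] by simp
  have yPsi: "cinner \<Psi> y = 0"
    by (subst cinner_commute_zero) (simp add: y_def cinner_diff_left cinner_scaleC_left cinner_Psi)
  have "cinner (T \<Psi>) y = 0" if T: "T \<in> M'" for T
  proof -
    have TH: "T \<Psi> \<in> H" by (rule bounded_opD(1)[OF M'_op[OF T] Psi_H])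
    have "(\<lambda>N. cinner ((1 / real N) *\<^sub>R (\<Sum>n<N. P.rot (int n) T \<Psi>)) y) \<longlonglongrightarrow> cinner (cinner (T \<Psi>) \<Psi> *\<^sub>C \<Psi>) y"
      by (intro tendsto_cinner M'_average T tendsto_const Psi_H)
    moreover have "cinner ((1 / real N) *\<^sub>R (\<Sum>n<N. P.rot (int n) T \<Psi>)) y = cinner (T \<Psi>) y" if "N > 0" for N
    proof -
      have "cinner (P.rot (int n) T \<Psi>) y = cinner (T \<Psi>) y" for n
        using W.W_cinner[OF TH y, of "int n"] by (simp add: P.rot_def Wy)
      then show ?thesis using that by (simp add: cinner_scaleR_left cinner_sum_left)
    qed
    ultimately have "cinner (cinner (T \<Psi>) \<Psi> *\<^sub>C \<Psi>) y = cinner (T \<Psi>) y"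
      by (rule LIMSEQ_eq_const)
    then show ?thesis by (simp add: cinner_scaleC_left yPsi)
  qed
  then have "cinner y t = 0" if "t \<in> M'\<Psi>" for t using that cinner_commute_zero[of y] by auto
  then have "cinner y y = 0" by (rule orthogonal_closure[of "M'\<Psi>"]) (use y M'_cyclic in \<open>simp_all only:\<close>)
  then show ?thesis by (simp add: y_def)
qed

sublocale Q: covariant_pair \<beta> \<psi> R M'
  rewrites "commutant H M' = rep_bicommutant R"
proof -
  show "covariant_pair \<beta> \<psi> R M'"
  proof
    show "A \<in> M' \<Longrightarrow> bounded_op H A" for A by (rule M'_op)
    show "star_closed_on H M'" by (rule M'_star_closed)
    show "A \<in> M' \<Longrightarrow> \<exists>B\<in>M'. \<forall>x\<in>H. W n (A (W (- n) x)) = B x" for A n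
      using P.rot_in_X[of A n] by (auto simp: P.rot_def)
    show "closure M'\<Psi> = H" by (rule M'_cyclic)
  qed
qed (simp add: rep_bicommutant_def)

lemma bicommutant_cyclic: "closure ((\<lambda>T. T \<Psi>) ` rep_bicommutant R) = H"
proof
  have "(\<lambda>T. T \<Psi>) ` rep_bicommutant R \<subseteq> H" using bounded_opD(1)[OF Q.X_op] by auto
  then show "closure ((\<lambda>T. T \<Psi>) ` rep_bicommutant R) \<subseteq> H" using H_closed by (rule closure_minimal)
  have "\<pi> a \<in> rep_bicommutant R" for a
    by (rule Q.X_I) (simp_all add: pi_op M'_commute)
  then have "range (\<lambda>a. \<pi> a \<Psi>) \<subseteq> (\<lambda>T. T \<Psi>) ` rep_bicommutant R" by auto
  then show "H \<subseteq> closure ((\<lambda>T. T \<Psi>) ` rep_bicommutant R)"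
    using closure_mono cyclic by blast
qed

text \<open>\<open>S \<Psi>\<close> is a fixed vector, so a multiple of \<open>\<Psi>\<close>, and
  \<open>S\<close> commutes with the commutant, for which \<open>\<Psi>\<close> is cyclic.\<close>

lemma fixed_bicommutant_scalar:
  assumes S: "S \<in> rep_bicommutant R" and fix': "\<And>x. x \<in> H \<Longrightarrow> W 1 (S (W (- 1) x)) = S x"
  shows "\<exists>c. \<forall>x\<in>H. S x = c *\<^sub>C x"
proof -
  have "W 1 (S \<Psi>) = S \<Psi>" using fix'[OF Psi_H] by (simp del: int_iter_simps)
  then obtain c where c: "S \<Psi> = c *\<^sub>C \<Psi>" using fixed_vector bounded_opD(1)[OF Q.X_op[OF S] Psi_H] by blast
  have "S y = c *\<^sub>C y" if "y \<in> M'\<Psi>" for y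
    using that Q.X_commute[OF S _ Psi_H] bounded_opD(3)[OF M'_op Psi_H] by (auto simp: c)
  then have "S x = c *\<^sub>C x" if "x \<in> H" for x
    by (rule op_eq_scalar[OF Q.X_op[OF S] M'_Psi_subset M'_cyclic _ that])
  then show ?thesis by blast
qed

text \<open>The common property of \<open>eigen_unitary\<close> and \<open>eigen_unitary'\<close>,
  so that spectral facts are proved once for both.\<close>

definition twisted_unitary :: "complex \<Rightarrow> ('k \<Rightarrow> 'k) \<Rightarrow> bool" where
  "twisted_unitary v T \<longleftrightarrow> unitary_op H T \<and> (\<forall>x\<in>H. W 1 (T (W (- 1) x)) = v *\<^sub>C T x)"

lemma eigen_unitary:
  assumes "v \<in> point_spectrum H U"
  shows "eigen_unitary R v \<in> rep_bicommutant R" "twisted_unitary v (eigen_unitary R v)"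
    "eigen_unitary' R v \<in> M'" "twisted_unitary v (eigen_unitary' R v)"
proof -
  obtain z where z: "z \<in> H" "z \<noteq> 0" "W 1 z = v *\<^sub>C z" using assms by (auto simp: point_spectrum_def)
  have "\<exists>T. T \<in> rep_bicommutant R \<and> unitary_op H T \<and> (\<forall>x\<in>H. U (T (inv_into H U x)) = v *\<^sub>C T x)"
    using Q.eigen_unitary_exists[OF fixed_bicommutant_scalar bicommutant_cyclic z] by auto
  from someI_ex[OF this] have "eigen_unitary R v \<in> rep_bicommutant R \<and> twisted_unitary v (eigen_unitary R v)"
    by (simp add: eigen_unitary_def twisted_unitary_def)
  moreover have "\<exists>T. T \<in> M' \<and> unitary_op H T \<and> (\<forall>x\<in>H. U (T (inv_into H U x)) = v *\<^sub>C T x)"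
    using P.eigen_unitary_exists[OF fixed_M'_scalar M'_cyclic z] by auto
  from someI_ex[OF this] have "eigen_unitary' R v \<in> M' \<and> twisted_unitary v (eigen_unitary' R v)"
    by (simp add: eigen_unitary'_def twisted_unitary_def)
  ultimately show "eigen_unitary R v \<in> rep_bicommutant R" "twisted_unitary v (eigen_unitary R v)"
    "eigen_unitary' R v \<in> M'" "twisted_unitary v (eigen_unitary' R v)" by blast+
qed

context
  fixes v T
  assumes T: "twisted_unitary v T"
begin

lemma twisted_unitaryD:
  "bounded_op H T" "T ` H = H" "\<lbrakk>x \<in> H; y \<in> H\<rbrakk> \<Longrightarrow> cinner (T x) (T y) = cinner x y"
  "x \<in> H \<Longrightarrow> T x \<in> H" "x \<in> H \<Longrightarrow> norm (T x) = norm x"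
proof -
  show 1: "bounded_op H T" "T ` H = H" "\<lbrakk>x \<in> H; y \<in> H\<rbrakk> \<Longrightarrow> cinner (T x) (T y) = cinner x y" for x y
    using T by (auto simp: twisted_unitary_def unitary_op_def)
  then show "x \<in> H \<Longrightarrow> T x \<in> H" "x \<in> H \<Longrightarrow> norm (T x) = norm x"
    using bounded_opD(1)[OF 1(1)] by (auto intro!: norm_eq_of_cinner)
qed

lemma twisted_unitary_W: "x \<in> H \<Longrightarrow> W 1 (T x) = v *\<^sub>C T (W 1 x)"
proof -
  assume x: "x \<in> H"
  have "W (- 1) (W 1 x) = x" using x W.W_inverse(2)[of x 1] by simp
  then show ?thesis using T x W.W_H[OF x, of 1] unfolding twisted_unitary_def by metis
qed

lemma twisted_unitary_norm: "cmod v = 1"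
proof -
  have "W 1 (T \<Psi>) = v *\<^sub>C T \<Psi>" using twisted_unitary_W[OF Psi_H] by (simp del: int_iter_simps)
  moreover have "T \<Psi> \<noteq> 0" using twisted_unitaryD(5)[OF Psi_H] by auto
  ultimately show ?thesis using W.eigenvalue_norm twisted_unitaryD(4)[OF Psi_H] by blast
qed

lemma twisted_unitary_Psi: "W 1 (T \<Psi>) = v *\<^sub>C T \<Psi>"
  using twisted_unitary_W[OF Psi_H] by (simp del: int_iter_simps)

lemma twisted_unitary_W_int: "x \<in> H \<Longrightarrow> W n (T x) = (v powi n) *\<^sub>C T (W n x)"
proof (induction n rule: int_induct[where k = 0])
  case base
  then show ?case by simp
next
  case (step1 i)
  have v: "v \<noteq> 0" using twisted_unitary_norm by auto
  have "W (i + 1) (T x) = W 1 (W i (T x))"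
    using W.W_plus[of "T x" 1 i] step1.prems twisted_unitaryD(4) by (simp add: add.commute)
  also have "\<dots> = (v powi i) *\<^sub>C W 1 (T (W i x))"
    using step1 twisted_unitaryD(4) by (simp add: W.W_scaleC del: int_iter_simps)
  also have "\<dots> = (v powi (i + 1)) *\<^sub>C T (W 1 (W i x))"
    using step1.prems v by (simp add: twisted_unitary_W power_int_add del: int_iter_simps)
  finally show ?case using W.W_plus[of x 1 i] step1.prems by (simp add: add.commute)
next
  case (step2 i)
  have v: "v \<noteq> 0" using twisted_unitary_norm by auto
  define y where "y = W (i - 1) x"
  have y: "y \<in> H" using step2.prems by (simp add: y_def)
  have "W i x = W 1 y" using W.W_plus[of x 1 "i - 1"] step2.prems by (simp add: y_def)
  then have "W i (T x) = (v powi (i - 1)) *\<^sub>C v *\<^sub>C T (W 1 y)"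
    using step2 v power_int_add[of v "i - 1" 1] by simp
  also have "v *\<^sub>C T (W 1 y) = W 1 (T y)" using twisted_unitary_W[OF y] by simp
  finally have "W (- 1) (W i (T x)) = (v powi (i - 1)) *\<^sub>C T y"
    using y twisted_unitaryD(4)[OF y] W.W_inverse(2)[of "T y" 1] by (simp add: W.W_scaleC del: int_iter_simps)
  then show ?case
    using W.W_plus[of "T x" "- 1" i] step2.prems twisted_unitaryD(4) by (simp add: y_def)
qed

text \<open>The preimage of \<open>z\<close> under \<open>T\<close> is fixed, hence a multiple of
  \<open>\<Psi>\<close>: eigenvalues are simple.\<close>

lemma eigenvector_multiple:
  assumes z: "z \<in> H" "W 1 z = v *\<^sub>C z"
  shows "z = cinner z (T \<Psi>) *\<^sub>C T \<Psi>"
proof -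
  obtain y where y: "y \<in> H" "z = T y" using z(1) twisted_unitaryD(2) by blast
  have v: "v \<noteq> 0" using twisted_unitary_norm by auto
  have "v *\<^sub>C T (W 1 y) = v *\<^sub>C T y" using twisted_unitary_W[OF y(1)] z(2) y(2) by simp
  then have "T (W 1 y) = T y" using v by (rule scaleC_left_imp_eq)
  then have "T (W 1 y - y) = 0"
    using bounded_op_linear(3)[OF H twisted_unitaryD(1) W.W_H[OF y(1), of 1] y(1)] by simp
  then have "W 1 y = y"
    using twisted_unitaryD(5)[OF H_diff[OF W.W_H[OF y(1)] y(1)], of 1] by simp
  then have "y = cinner y \<Psi> *\<^sub>C \<Psi>" by (rule fixed_vector[OF y(1)])
  then have "T y = cinner y \<Psi> *\<^sub>C T \<Psi>" using bounded_opD(3)[OF twisted_unitaryD(1) Psi_H] by metis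
  moreover have "cinner y \<Psi> = cinner z (T \<Psi>)" using twisted_unitaryD(3)[OF y(1) Psi_H] y(2) by simp
  ultimately show ?thesis using y(2) by simp
qed

end

end

section \<open>The operator on the fibres\<close>

lemma (in unitary_group) eigenvectors_orthogonal:
  assumes x: "x \<in> H" "W 1 x = a *\<^sub>C x" and y: "y \<in> H" "W 1 y = b *\<^sub>C y" and ab: "a \<noteq> b" "cmod b = 1"
  shows "cinner x y = 0"
proof -
  have "cinner x y = a * cnj b * cinner x y"
    using W_cinner[OF x(1) y(1), of 1] by (simp add: x(2) y(2) cinner_scaleC_left cinner_scaleC_right mult.commute)
  moreover have "b * cnj b = 1" using ab(2) complex_norm_square[of b] by simp
  then have "a * cnj b \<noteq> 1" using ab(1) by (metis mult_right_cancel mult_zero_right zero_neq_one)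
  ultimately show ?thesis by simp
qed

lemma tendsto_geometric_average:
  fixes q :: complex
  assumes q: "cmod q = 1"
  shows "(\<lambda>N. (\<Sum>n<N. q ^ n) / of_nat N) \<longlonglongrightarrow> (if q = 1 then 1 else 0)"
proof (cases "q = 1")
  case True
  have "\<forall>\<^sub>F N in sequentially. (\<Sum>n<N. q ^ n) / of_nat N = 1"
    by (rule eventually_mono[OF eventually_gt_at_top[of 0]]) (simp add: True)
  then show ?thesis using True by (simp add: tendsto_eventually)
next
  case False
  have "cmod ((\<Sum>n<N. q ^ n) / of_nat N) \<le> inverse (real N) * (2 / cmod (1 - q))" for N
  proof -
    have "cmod (\<Sum>n<N. q ^ n) = cmod (1 - q ^ N) / cmod (1 - q)"
      using False by (simp add: sum_gp_strict norm_divide)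
    also have "cmod (1 - q ^ N) \<le> 2" using norm_triangle_ineq4[of 1 "q ^ N"] q by (simp add: norm_power)
    finally have "cmod (\<Sum>n<N. q ^ n) \<le> 2 / cmod (1 - q)" by (simp add: divide_right_mono)
    then have "inverse (real N) * cmod (\<Sum>n<N. q ^ n) \<le> inverse (real N) * (2 / cmod (1 - q))"
      by (rule mult_left_mono) simp
    then show ?thesis by (simp add: norm_divide divide_inverse norm_mult norm_inverse mult.commute)
  qed
  then have "(\<lambda>N. (\<Sum>n<N. q ^ n) / of_nat N) \<longlonglongrightarrow> 0"
    by (intro Lim_null_comparison[OF _ tendsto_mult_left_zero[OF lim_inverse_n]] always_eventually allI)
  then show ?thesis using False by simp
qed

context ergodic_system
begin

abbreviation "\<sigma> \<equiv> point_spectrum H U"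

definition resonant :: "int \<Rightarrow> (complex \<times> complex) set" where
  "resonant k = {(v, w). v \<in> \<sigma> \<and> w \<in> \<sigma> \<and> v powi k * w powi (k + 1) = 1}"

definition basis :: "complex \<times> complex \<Rightarrow> 'k" where
  "basis p = eigen_unitary R (fst p) (eigen_unitary' R (snd p) \<Psi>)"

definition coefficient :: "'k \<Rightarrow> 'k \<Rightarrow> complex \<times> complex \<Rightarrow> complex" where
  "coefficient x \<xi> p = cinner x (eigen_unitary R (fst p) \<Psi>) * cinner \<xi> (eigen_unitary' R (snd p) \<Psi>)"

lemma V_fibre_tensor: "V_fibre k R (tensor x \<xi>) = (\<Sum>\<^sub>\<infinity>p\<in>resonant k. coefficient x \<xi> p *\<^sub>C basis p)"
  unfolding V_fibre_def resonant_def tensor_def coefficient_def basis_def by (simp only: case_prod_unfold)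

lemma eigenvectors_orthonormal:
  assumes T: "\<And>v. v \<in> \<sigma> \<Longrightarrow> twisted_unitary v (T v)" and v: "v \<in> \<sigma>" "w \<in> \<sigma>"
  shows "cinner (T v \<Psi>) (T w \<Psi>) = (if v = w then 1 else 0)"
proof (cases "v = w")
  case True
  then show ?thesis using twisted_unitaryD(3)[OF T[OF v(1)] Psi_H Psi_H] by (simp add: cinner_Psi)
next
  case False
  then show ?thesis
    using W.eigenvectors_orthogonal[OF twisted_unitaryD(4)[OF T[OF v(1)] Psi_H] twisted_unitary_Psi[OF T[OF v(1)]]
        twisted_unitaryD(4)[OF T[OF v(2)] Psi_H] twisted_unitary_Psi[OF T[OF v(2)]] False
        twisted_unitary_norm[OF T[OF v(2)]]] by simp
qed

lemma basis_H: "p \<in> resonant k \<Longrightarrow> basis p \<in> H"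
  by (auto simp: basis_def resonant_def intro!: twisted_unitaryD(4)[OF eigen_unitary(2)]
      twisted_unitaryD(4)[OF eigen_unitary(4)])

text \<open>\<open>basis (v, w)\<close> is an eigenvector for \<open>v * w\<close>. Resonance reads
  \<open>(v * w) powi k * w = 1\<close>, so \<open>v * w\<close> determines \<open>w\<close> and
  then \<open>v\<close>: distinct resonant pairs belong to distinct eigenvalues.\<close>

lemma basis_orthonormal:
  assumes p: "p \<in> resonant k" "q \<in> resonant k"
  shows "cinner (basis p) (basis q) = (if p = q then 1 else 0)"
proof -
  obtain v w v' w' where vw: "p = (v, w)" "q = (v', w')" by fastforce
  have s: "v \<in> \<sigma>" "w \<in> \<sigma>" "v' \<in> \<sigma>" "w' \<in> \<sigma>"
    and r: "v powi k * w powi (k + 1) = 1" "v' powi k * w' powi (k + 1) = 1"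
    using p by (auto simp: vw resonant_def)
  note n = s[THEN eigen_unitary(2), THEN twisted_unitary_norm]
  have nz: "v \<noteq> 0" "w \<noteq> 0" "v' \<noteq> 0" "w' \<noteq> 0" using n by auto
  have W: "W 1 (basis (v, w)) = (v * w) *\<^sub>C basis (v, w)" if s: "v \<in> \<sigma>" "w \<in> \<sigma>" for v w
  proof -
    note E = eigen_unitary(2)[OF s(1)] and E' = eigen_unitary(4)[OF s(2)]
    have y: "eigen_unitary' R w \<Psi> \<in> H" by (rule twisted_unitaryD(4)[OF E' Psi_H])
    have "W 1 (basis (v, w)) = v *\<^sub>C eigen_unitary R v (w *\<^sub>C eigen_unitary' R w \<Psi>)"
      unfolding basis_def fst_conv snd_conv twisted_unitary_W[OF E y] twisted_unitary_Psi[OF E'] ..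
    also have "\<dots> = v *\<^sub>C w *\<^sub>C eigen_unitary R v (eigen_unitary' R w \<Psi>)"
      unfolding bounded_opD(3)[OF twisted_unitaryD(1)[OF E] y] ..
    finally show ?thesis by (simp add: basis_def)
  qed
  show ?thesis
  proof (cases "v * w = v' * w'")
    case True
    have "(v * w) powi k * w = 1" "(v' * w') powi k * w' = 1"
      using r nz by (simp_all add: power_int_mult_distrib power_int_add mult.assoc)
    then have "w = w'" using True by (metis mult.commute mult_cancel_right1 mult_right_cancel)
    then have "p = q" using True nz by (simp add: vw)
    moreover have "cinner (basis p) (basis p) = 1"
      unfolding basis_def vw fst_conv snd_conv
      by (simp only: twisted_unitaryD(3)[OF eigen_unitary(2)[OF s(1)]
            twisted_unitaryD(4)[OF eigen_unitary(4)[OF s(2)] Psi_H] twisted_unitaryD(4)[OF eigen_unitary(4)[OF s(2)] Psi_H]]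
            twisted_unitaryD(3)[OF eigen_unitary(4)[OF s(2)] Psi_H Psi_H] cinner_Psi)
    ultimately show ?thesis by simp
  next
    case False
    have "cinner (basis p) (basis q) = 0"
    proof (rule W.eigenvectors_orthogonal[OF basis_H[OF p(1)] _ basis_H[OF p(2)] _ False])
      show "W 1 (basis p) = (v * w) *\<^sub>C basis p" "W 1 (basis q) = (v' * w') *\<^sub>C basis q"
        unfolding vw by (rule W s)+
      show "cmod (v' * w') = 1" by (simp add: norm_mult n)
    qed
    moreover have "p \<noteq> q" using False by (auto simp: vw)
    ultimately show ?thesis by simp
  qed
qed

text \<open>Enlarging \<open>F\<close> to the product of its two projections splits the sum into two
  Bessel sums, one for each tensor factor.\<close>

lemma coefficient_bound:
  assumes F: "finite F" "F \<subseteq> resonant k"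
  shows "(\<Sum>p\<in>F. (cmod (coefficient x \<xi> p))\<^sup>2) \<le> (norm x * norm \<xi>)\<^sup>2"
proof -
  define a where "a = (\<lambda>v. (cmod (cinner x (eigen_unitary R v \<Psi>)))\<^sup>2)"
  define b where "b = (\<lambda>w. (cmod (cinner \<xi> (eigen_unitary' R w \<Psi>)))\<^sup>2)"
  have A: "fst ` F \<subseteq> \<sigma>" "snd ` F \<subseteq> \<sigma>" using F(2) by (auto simp: resonant_def)
  have "(\<Sum>p\<in>F. (cmod (coefficient x \<xi> p))\<^sup>2) = (\<Sum>p\<in>F. a (fst p) * b (snd p))"
    by (simp add: coefficient_def a_def b_def norm_mult power_mult_distrib)
  also have "\<dots> \<le> (\<Sum>p\<in>fst ` F \<times> snd ` F. a (fst p) * b (snd p))"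
    using F(1) by (intro sum_mono2) (force simp: a_def b_def)+
  also have "\<dots> = (\<Sum>v\<in>fst ` F. a v) * (\<Sum>w\<in>snd ` F. b w)"
    by (simp add: sum_product sum.cartesian_product case_prod_beta)
  also have "\<dots> \<le> (norm x)\<^sup>2 * (norm \<xi>)\<^sup>2"
  proof (rule mult_mono)
    show "(\<Sum>v\<in>fst ` F. a v) \<le> (norm x)\<^sup>2"
      unfolding a_def using F(1) A(1)
      by (intro bessel_finite eigenvectors_orthonormal eigen_unitary) auto
    show "(\<Sum>w\<in>snd ` F. b w) \<le> (norm \<xi>)\<^sup>2"
      unfolding b_def using F(1) A(2)
      by (intro bessel_finite eigenvectors_orthonormal eigen_unitary) auto
  qed (auto simp: b_def intro: sum_nonneg)
  finally show ?thesis by (simp add: power_mult_distrib)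
qed

lemma V_fibre_summable: "(\<lambda>p. coefficient x \<xi> p *\<^sub>C basis p) summable_on resonant k"
  by (rule orthonormal_series(1)[OF basis_orthonormal coefficient_bound])

lemma V_fibre_norm: "norm (V_fibre k R (tensor x \<xi>)) \<le> norm x * norm \<xi>"
proof -
  have "(norm (V_fibre k R (tensor x \<xi>)))\<^sup>2 \<le> (norm x * norm \<xi>)\<^sup>2"
    unfolding V_fibre_tensor by (rule orthonormal_series(2)[OF basis_orthonormal coefficient_bound])
  then show ?thesis by (rule power2_le_imp_le) simp
qed

lemma V_fibre_H: "V_fibre k R (tensor x \<xi>) \<in> H"
  unfolding V_fibre_tensor
  by (rule infsum_in_closed_csubspace[OF H V_fibre_summable]) (auto intro: H_scaleC basis_H)

lemma V_fibre_add_left: "V_fibre k R (tensor (x + y) \<xi>) = V_fibre k R (tensor x \<xi>) + V_fibre k R (tensor y \<xi>)"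
  unfolding V_fibre_tensor infsum_add[OF V_fibre_summable V_fibre_summable, symmetric]
  by (simp add: coefficient_def cinner_add_left distrib_right scaleC_add_left)

lemma V_fibre_add_right: "V_fibre k R (tensor x (\<xi> + \<eta>)) = V_fibre k R (tensor x \<xi>) + V_fibre k R (tensor x \<eta>)"
  unfolding V_fibre_tensor infsum_add[OF V_fibre_summable V_fibre_summable, symmetric]
  by (simp add: coefficient_def cinner_add_left distrib_left scaleC_add_left)

lemma infsum_coefficient_scaleC:
  "(\<Sum>\<^sub>\<infinity>p\<in>resonant k. (c * coefficient x \<xi> p) *\<^sub>C basis p) = c *\<^sub>C V_fibre k R (tensor x \<xi>)"
proof -
  have "bounded_linear (\<lambda>y::'k. c *\<^sub>C y)"
    by (rule bounded_bilinear.bounded_linear_right[OF bounded_bilinear_scaleC_hilbert])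
  from infsumI[OF has_sum_bounded_linear[OF this has_sum_infsum[OF V_fibre_summable]]]
  show ?thesis by (simp add: V_fibre_tensor o_def)
qed

lemma V_fibre_scaleC:
  "V_fibre k R (tensor (c *\<^sub>C x) \<xi>) = c *\<^sub>C V_fibre k R (tensor x \<xi>)"
  "V_fibre k R (tensor x (c *\<^sub>C \<xi>)) = c *\<^sub>C V_fibre k R (tensor x \<xi>)"
  unfolding infsum_coefficient_scaleC[symmetric] V_fibre_tensor[of k "c *\<^sub>C x"] V_fibre_tensor[of k x "c *\<^sub>C \<xi>"]
  by (simp_all add: coefficient_def cinner_scaleC_left mult_ac)

lemma V_fibre_op:
  "bounded_op H (\<lambda>x. V_fibre k R (tensor x \<xi>))" "bounded_op H (\<lambda>\<xi>. V_fibre k R (tensor x \<xi>))"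
proof -
  have "\<exists>K. \<forall>x\<in>H. norm (V_fibre k R (tensor x \<xi>)) \<le> K * norm x"
    using V_fibre_norm[of k _ \<xi>] by (metis mult.commute)
  then show "bounded_op H (\<lambda>x. V_fibre k R (tensor x \<xi>))"
    unfolding bounded_op_def by (auto simp: V_fibre_H V_fibre_add_left V_fibre_scaleC)
  have "\<exists>K. \<forall>\<xi>\<in>H. norm (V_fibre k R (tensor x \<xi>)) \<le> K * norm \<xi>"
    using V_fibre_norm[of k x] by blast
  then show "bounded_op H (\<lambda>\<xi>. V_fibre k R (tensor x \<xi>))"
    unfolding bounded_op_def by (auto simp: V_fibre_H V_fibre_add_right V_fibre_scaleC)
qed

lemma V_fibre_eigenvectors:
  assumes v: "v \<in> \<sigma>" and w: "w \<in> \<sigma>"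
  shows "V_fibre k R (tensor (eigen_unitary R v \<Psi>) (eigen_unitary' R w \<Psi>))
    = (if v powi k * w powi (k + 1) = 1 then 1 else 0) *\<^sub>C basis (v, w)"
proof -
  have c: "coefficient (eigen_unitary R v \<Psi>) (eigen_unitary' R w \<Psi>) p = (if p = (v, w) then 1 else 0)"
    if "p \<in> resonant k" for p
    using that eigenvectors_orthonormal[OF eigen_unitary(2) v, of "fst p"]
      eigenvectors_orthonormal[OF eigen_unitary(4) w, of "snd p"]
    by (auto simp: coefficient_def resonant_def split: if_splits)
  have "V_fibre k R (tensor (eigen_unitary R v \<Psi>) (eigen_unitary' R w \<Psi>))
      = (\<Sum>\<^sub>\<infinity>p\<in>resonant k \<inter> {(v, w)}. basis p)"
    unfolding V_fibre_tensor by (rule infsum_cong_neutral) (auto simp: c)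
  also have "\<dots> = (if v powi k * w powi (k + 1) = 1 then 1 else 0) *\<^sub>C basis (v, w)"
    using v w by (auto simp: resonant_def)
  finally show ?thesis .
qed

text \<open>Each coefficient is a product of inner products with eigenvectors, one for each
  argument.\<close>

lemma V_fibre_weakly_mixing:
  assumes "W.weakly_mixing x \<or> W.weakly_mixing \<xi>"
  shows "V_fibre k R (tensor x \<xi>) = 0"
  unfolding V_fibre_tensor
proof (rule infsum_0)
  fix p assume p: "p \<in> resonant k"
  then have s: "fst p \<in> \<sigma>" "snd p \<in> \<sigma>" by (auto simp: resonant_def)
  have "cinner y (T \<Psi>) = 0" if "W.weakly_mixing y" "twisted_unitary v T" for y v T
    using that(1) twisted_unitaryD(4)[OF that(2) Psi_H] twisted_unitary_Psi[OF that(2)]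
    unfolding W.weakly_mixing_def by blast
  then have "coefficient x \<xi> p = 0"
    using assms eigen_unitary(2)[OF s(1)] eigen_unitary(4)[OF s(2)] by (auto simp: coefficient_def)
  then show "coefficient x \<xi> p *\<^sub>C basis p = 0" by simp
qed

end

section \<open>Convergence in the fibres\<close>

text \<open>The common bound \<open>K\<close> of the \<open>f N\<close> makes the set of vectors
  with the desired limit closed.\<close>

lemma closed_csubspace_convergence:
  assumes H: "closed_csubspace H" and f: "\<And>N. bounded_op H (f N)" and g: "bounded_op H g"
    and K: "\<And>N x. x \<in> H \<Longrightarrow> norm (f N x) \<le> K * norm x"
  shows "closed_csubspace {x \<in> H. (\<lambda>N. f N x) \<longlonglongrightarrow> g x}" (is "closed_csubspace ?L")
proof -
  note Hs = closed_csubspaceD[OF H] and fd = bounded_opD[OF f] and gd = bounded_opD[OF g]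
  have z: "0 \<in> ?L" using Hs(2) bounded_op_linear(1)[OF H f] bounded_op_linear(1)[OF H g] by simp
  have a: "x + y \<in> ?L" if "x \<in> ?L" "y \<in> ?L" for x y
    using that tendsto_add[of "\<lambda>N. f N x" "g x" sequentially "\<lambda>N. f N y" "g y"] by (simp add: Hs(3) fd(2) gd(2))
  have s: "c *\<^sub>C x \<in> ?L" if "x \<in> ?L" for c x
    using that tendsto_scaleC[OF tendsto_const[of c], of "\<lambda>N. f N x" "g x" sequentially]
    by (simp add: Hs(4) fd(3) gd(3))
  have "x \<in> ?L" if x: "x \<in> closure ?L" for x
  proof -
    have "closure ?L \<subseteq> H" by (rule closure_minimal[OF _ Hs(1)]) blast
    then have xH: "x \<in> H" using x by blast
    obtain M where M: "M \<ge> 0" "\<And>x. x \<in> H \<Longrightarrow> norm (g x) \<le> M * norm x" using gd(4) by blast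
    define C where "C = \<bar>K\<bar> + M + 1"
    have C: "C > 0" using M by (simp add: C_def)
    have fC: "norm (f N y) \<le> C * norm y" and gC: "norm (g y) \<le> C * norm y" if "y \<in> H" for N y
      using order_trans[OF K[OF that]] order_trans[OF M(2)[OF that]] M(1)
      by (simp_all add: C_def mult_right_mono)
    have "(\<lambda>N. f N x) \<longlonglongrightarrow> g x"
    proof (rule LIMSEQ_I)
      fix e :: real assume e: "e > 0"
      have "e / (4 * C) > 0" using e C by simp
      then obtain y where y: "y \<in> ?L" "dist y x < e / (4 * C)" using x unfolding closure_approachable by blast
      have yH: "y \<in> H" using y by simp
      have "C * norm (x - y) \<le> C * (e / (4 * C))"
        using y(2) C by (intro mult_left_mono) (auto simp: dist_norm norm_minus_commute)
      then have small: "C * norm (x - y) \<le> e / 4" using C by simp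
      have 1: "norm (f N x - f N y) \<le> e / 4" for N
        using fC[OF Hs(5)[OF xH yH], of N] small bounded_op_linear(3)[OF H f xH yH] by simp
      have 2: "norm (g x - g y) \<le> e / 4"
        using gC[OF Hs(5)[OF xH yH]] small bounded_op_linear(3)[OF H g xH yH] by simp
      obtain N0 where N0: "\<And>N. N \<ge> N0 \<Longrightarrow> norm (f N y - g y) < e / 4"
        using y(1) LIMSEQ_D[of "\<lambda>N. f N y" "g y" "e / 4"] e by auto
      have 3: "norm (f N x - g x) \<le> norm (f N x - f N y) + norm (f N y - g y) + norm (g x - g y)" for N
      proof -
        have eq: "f N x - g x = (f N x - f N y) + (f N y - g y) - (g x - g y)" by simp
        show ?thesis unfolding eq
          by (rule order_trans[OF norm_triangle_ineq4]) (intro add_right_mono norm_triangle_ineq)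
      qed
      have "norm (f N x - g x) < e" if "N \<ge> N0" for N
        using 1[of N] 2 3[of N] N0[OF that] e by linarith
      then show "\<exists>N0. \<forall>N\<ge>N0. norm (f N x - g x) < e" by blast
    qed
    then show ?thesis using xH by simp
  qed
  then have "closed ?L" by (meson closure_subset_eq subsetI)
  then show ?thesis using z a s unfolding closed_csubspace_def by blast
qed

definition multiple_average :: "('a::cstar_algebra \<Rightarrow> 'a) \<Rightarrow> int \<Rightarrow> 'a \<Rightarrow> 'a \<Rightarrow> nat \<Rightarrow> 'a" where
  "multiple_average \<beta> k a b N
    = (1 / real N) *\<^sub>R (\<Sum>n<N. int_iter UNIV \<beta> (k * int n) a * int_iter UNIV \<beta> ((k + 1) * int n) b)"

context ergodic_system
begin

text \<open>The vectors with the claimed limit form a closed subspace. It contains every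
  eigenvector, as each eigenspace is spanned by some \<open>T \<Psi>\<close>; a vector orthogonal to
  it is therefore weakly mixing and belongs to it as well.\<close>

lemma tendsto_of_eigenvectors_of_weakly_mixing:
  assumes f: "\<And>N. bounded_op H (f N)" and g: "bounded_op H g"
    and K: "\<And>N x. x \<in> H \<Longrightarrow> norm (f N x) \<le> K * norm x"
    and eigen: "\<And>v. v \<in> \<sigma> \<Longrightarrow> \<exists>T. twisted_unitary v T \<and> (\<lambda>N. f N (T \<Psi>)) \<longlonglongrightarrow> g (T \<Psi>)"
    and mixing: "\<And>x. W.weakly_mixing x \<Longrightarrow> (\<lambda>N. f N x) \<longlonglongrightarrow> g x"
    and x: "x \<in> H"
  shows "(\<lambda>N. f N x) \<longlonglongrightarrow> g x"
proof -
  define L where "L = {x \<in> H. (\<lambda>N. f N x) \<longlonglongrightarrow> g x}"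
  have L: "closed_csubspace L" unfolding L_def by (rule closed_csubspace_convergence[OF H f g K])
  have "L = H"
  proof (rule closed_csubspace_eqI[OF L H])
    show "L \<subseteq> H" by (auto simp: L_def)
    fix x assume x: "x \<in> H" "\<And>y. y \<in> L \<Longrightarrow> cinner x y = 0"
    have "cinner x z = 0" if z: "z \<in> H" "W 1 z = v *\<^sub>C z" for v z
    proof (cases "z = 0")
      case False
      then have "v \<in> \<sigma>" using z by (auto simp: point_spectrum_def)
      then obtain T where T: "twisted_unitary v T" "(\<lambda>N. f N (T \<Psi>)) \<longlonglongrightarrow> g (T \<Psi>)" using eigen by blast
      have "T \<Psi> \<in> L" using T(2) twisted_unitaryD(4)[OF T(1) Psi_H] by (simp add: L_def)
      then have "cinner z (T \<Psi>) *\<^sub>C T \<Psi> \<in> L" by (rule closed_csubspaceD(4)[OF L])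
      then show ?thesis using x(2) eigenvector_multiple[OF T(1) z] by simp
    qed simp
    then have "W.weakly_mixing x" using x(1) by (auto simp: W.weakly_mixing_def)
    then show "x \<in> L" using mixing x(1) by (simp add: L_def)
  qed
  then show ?thesis using x by (auto simp: L_def)
qed

text \<open>This is what the averages become at \<open>x = eigen_unitary R v \<Psi>\<close>: the
  unitary moves to the front and leaves the factor \<open>(v powi k) ^ n\<close>. At an eigenvector
  \<open>y\<close> a geometric average remains, with limit 1 exactly at resonance; at weakly mixing
  \<open>y\<close> the limit is 0, where \<open>k \<noteq> - 1\<close> keeps the step
  \<open>k + 1\<close> of the subgroup nonzero.\<close>

lemma average_eigenvector:
  assumes k: "k \<noteq> - 1" and v: "v \<in> \<sigma>" and y: "y \<in> H"
  shows "(\<lambda>N. eigen_unitary R v ((1 / real N) *\<^sub>R (\<Sum>n<N. (v powi k) ^ n *\<^sub>C W ((k + 1) * int n) y)))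
    \<longlonglongrightarrow> V_fibre k R (tensor (eigen_unitary R v \<Psi>) y)"
proof -
  note E = eigen_unitary(2)[OF v]
  have nv: "cmod (v powi k) = 1" unfolding norm_power_int twisted_unitary_norm[OF E] by simp
  have op: "bounded_op H (\<lambda>x. (v powi k) ^ n *\<^sub>C W ((k + 1) * int n) x)" for n
    by (rule bounded_op_scaleC[OF H W.W_op])
  have nop: "norm ((v powi k) ^ n *\<^sub>C W ((k + 1) * int n) x) \<le> 1 * norm x" if "x \<in> H" for x n
    using that by (simp add: norm_scaleC_hilbert norm_power nv)
  show ?thesis
  proof (rule tendsto_of_eigenvectors_of_weakly_mixing[OF _ V_fibre_op(2) _ _ _ y, where K = 1])
    show "bounded_op H (\<lambda>y. eigen_unitary R v ((1 / real N) *\<^sub>R (\<Sum>n<N. (v powi k) ^ n *\<^sub>C W ((k + 1) * int n) y)))" for N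
      by (rule bounded_op_comp[OF twisted_unitaryD(1)[OF E] bounded_op_average(1)[OF H op nop]])
    show "norm (eigen_unitary R v ((1 / real N) *\<^sub>R (\<Sum>n<N. (v powi k) ^ n *\<^sub>C W ((k + 1) * int n) x))) \<le> 1 * norm x"
      if "x \<in> H" for N x
      using bounded_op_average(2)[OF H op nop that] bounded_opD(1)[OF bounded_op_average(1)[OF H op nop] that]
      by (simp add: twisted_unitaryD(5)[OF E])
    fix w assume w: "w \<in> \<sigma>"
    note E' = eigen_unitary(4)[OF w]
    define q where "q = v powi k * w powi (k + 1)"
    have "cmod (w powi (k + 1)) = 1" unfolding norm_power_int twisted_unitary_norm[OF E'] by simp
    then have q: "cmod q = 1" by (simp add: q_def norm_mult nv)
    define z where "z = eigen_unitary' R w \<Psi>"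
    have z: "z \<in> H" unfolding z_def by (rule twisted_unitaryD(4)[OF E' Psi_H])
    have Wz: "(v powi k) ^ n *\<^sub>C W ((k + 1) * int n) z = q ^ n *\<^sub>C z" for n
      using twisted_unitary_W_int[OF E' Psi_H, of "(k + 1) * int n"]
      by (simp add: z_def q_def power_mult_distrib power_int_mult)
    have "(\<lambda>N. ((\<Sum>n<N. q ^ n) / of_nat N) *\<^sub>C eigen_unitary R v z)
        \<longlonglongrightarrow> (if q = 1 then 1 else 0) *\<^sub>C eigen_unitary R v z"
      by (intro tendsto_scaleC tendsto_geometric_average q tendsto_const)
    moreover have "eigen_unitary R v ((1 / real N) *\<^sub>R (\<Sum>n<N. (v powi k) ^ n *\<^sub>C W ((k + 1) * int n) z))
        = ((\<Sum>n<N. q ^ n) / of_nat N) *\<^sub>C eigen_unitary R v z" for N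
      unfolding Wz scaleC_sum_left[symmetric] scaleR_scaleC scaleC_scaleC
      using bounded_opD(3)[OF twisted_unitaryD(1)[OF E] z] by (simp add: divide_inverse mult.commute)
    ultimately have "(\<lambda>N. eigen_unitary R v ((1 / real N) *\<^sub>R (\<Sum>n<N. (v powi k) ^ n *\<^sub>C W ((k + 1) * int n) z)))
        \<longlonglongrightarrow> V_fibre k R (tensor (eigen_unitary R v \<Psi>) z)"
      unfolding z_def V_fibre_eigenvectors[OF v w] basis_def q_def by simp
    with E' show "\<exists>T. twisted_unitary w T \<and>
        (\<lambda>N. eigen_unitary R v ((1 / real N) *\<^sub>R (\<Sum>n<N. (v powi k) ^ n *\<^sub>C W ((k + 1) * int n) (T \<Psi>))))
        \<longlonglongrightarrow> V_fibre k R (tensor (eigen_unitary R v \<Psi>) (T \<Psi>))"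
      unfolding z_def by (intro exI conjI)
  next
    fix x assume x: "W.weakly_mixing x"
    interpret T: unitary_group H "\<lambda>n. W ((k + 1) * n)" by (rule W.subgroup)
    have xH: "x \<in> H" using x by (simp add: W.weakly_mixing_def)
    have "T.weakly_mixing x" by (rule W.weakly_mixing_subgroup[OF x]) (use k in simp)
    then have lim: "(\<lambda>N. (1 / real N) *\<^sub>R (\<Sum>n<N. (v powi k) ^ n *\<^sub>C W ((k + 1) * int n) x)) \<longlonglongrightarrow> 0"
      using nv by (rule T.weakly_mixing_avg)
    have "(\<lambda>N. eigen_unitary R v ((1 / real N) *\<^sub>R (\<Sum>n<N. (v powi k) ^ n *\<^sub>C W ((k + 1) * int n) x)))
        \<longlonglongrightarrow> eigen_unitary R v 0"
      by (rule bounded_op_tendsto[OF H twisted_unitaryD(1)[OF E] bounded_opD(1)[OF bounded_op_average(1)[OF H op nop] xH] lim])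
    then show "(\<lambda>N. eigen_unitary R v ((1 / real N) *\<^sub>R (\<Sum>n<N. (v powi k) ^ n *\<^sub>C W ((k + 1) * int n) x)))
        \<longlonglongrightarrow> V_fibre k R (tensor (eigen_unitary R v \<Psi>) x)"
      using V_fibre_weakly_mixing[of "eigen_unitary R v \<Psi>" x k] x bounded_op_linear(1)[OF H twisted_unitaryD(1)[OF E]]
      by simp
  qed
qed

text \<open>With \<open>u\<^sub>n\<close> the \<open>n\<close>-th summand, the averages of \<open>\<langle>u\<^sub>n\<^sub>+\<^sub>h, u\<^sub>n\<^sub>+\<^sub>h\<^sub>'\<rangle>\<close> converge to a product of a
  correlation of \<open>B \<Psi>\<close> and one of \<open>x\<close>; the first is positive definite, the second is small on average.\<close>

lemma average_weakly_mixing: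
  assumes k: "k \<noteq> 0" and B: "B \<in> M'" and x: "W.weakly_mixing x"
  shows "(\<lambda>N. (1 / real N) *\<^sub>R (\<Sum>n<N. W ((k + 1) * int n) (B (W (- int n) x)))) \<longlonglongrightarrow> 0"
proof -
  have xH: "x \<in> H" using x by (simp add: W.weakly_mixing_def)
  define y where "y = B \<Psi>"
  have y: "y \<in> H" unfolding y_def by (rule bounded_opD(1)[OF M'_op[OF B] Psi_H])
  interpret Tk: unitary_group H "\<lambda>n. W (k * n)" by (rule W.subgroup)
  interpret Tk1: unitary_group H "\<lambda>n. W ((k + 1) * n)" by (rule W.subgroup)
  \<comment> \<open>Conjugates of \<open>B\<close> that absorb a shift: \<open>u (n + h)\<close> has
    the shape of \<open>u n\<close>, with \<open>C h\<close> in place of \<open>B\<close> and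
    \<open>W (k * int h) x\<close> in place of \<open>x\<close>.\<close>
  define C where "C = (\<lambda>h. P.rot ((k + 1) * int h) B)"
  have C: "C h \<in> M'" for h unfolding C_def by (rule P.rot_in_X[OF B])
  note Cd = bounded_opD[OF M'_op[OF C]]
  have CPsi: "C h \<Psi> = W ((k + 1) * int h) y" for h by (simp add: C_def P.rot_def y_def)
  define u where "u = (\<lambda>n. W ((k + 1) * int n) (B (W (- int n) x)))"
  obtain K where K: "K \<ge> 0" "\<And>x. x \<in> H \<Longrightarrow> norm (B x) \<le> K * norm x" using bounded_opD(4)[OF M'_op[OF B]] by blast
  have u_shift: "u (n + h) = W ((k + 1) * int n) (C h (W (- int n) (W (k * int h) x)))" for n h
  proof -
    define z where "z = B (W (- int (n + h)) x)"
    have z: "z \<in> H" unfolding z_def by (rule bounded_opD(1)[OF M'_op[OF B] W.W_H[OF xH]])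
    have "W (- ((k + 1) * int h)) (W (- int n) (W (k * int h) x)) = W (- int (n + h)) x"
      using W.W_plus[of "W (k * int h) x" "- ((k + 1) * int h)" "- int n"]
        W.W_plus[of x "- ((k + 1) * int h) + - int n" "k * int h"] xH
      by (simp add: algebra_simps)
    then have "C h (W (- int n) (W (k * int h) x)) = W ((k + 1) * int h) z"
      by (simp add: C_def P.rot_def z_def)
    then show ?thesis
      using W.W_plus[OF z, of "(k + 1) * int n" "(k + 1) * int h"] by (simp add: u_def z_def algebra_simps)
  qed
  show ?thesis
    unfolding u_def[symmetric]
  proof (rule van_der_corput[where K = "K * norm x" and
        \<gamma> = "\<lambda>h h'. cinner (W ((k + 1) * int h) y) (W ((k + 1) * int h') y) * cinner (W (k * int h) x) (W (k * int h') x)"])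
    fix n
    show "norm (u n) \<le> K * norm x"
      using K(2)[OF W.W_H[OF xH]] xH by (simp add: u_def bounded_opD(1)[OF M'_op[OF B]])
  next
    fix h h'
    define a where "a = W (k * int h) x"
    define b where "b = W (k * int h') x"
    have ab: "a \<in> H" "b \<in> H" using xH by (simp_all add: a_def b_def)
    obtain D where D: "D \<in> M'" "adjoint_on H (C h') D"
      using M'_star_closed C[of h'] unfolding star_closed_on_def by blast
    \<comment> \<open>The correlations become conjugates of this single element of the commutant, to
      which \<open>M'_average\<close> applies.\<close>
    define S where "S = (\<lambda>x. D (C h x))"
    have S: "S \<in> M'" unfolding S_def by (rule M'_comp[OF D(1) C])
    note Sd = bounded_opD[OF M'_op[OF S]]
    have inner: "cinner (u (n + h)) (u (n + h')) = cinner (P.rot (int n) S a) b" for n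
    proof -
      have "cinner (u (n + h)) (u (n + h')) = cinner (C h (W (- int n) a)) (C h' (W (- int n) b))"
        unfolding u_shift a_def[symmetric] b_def[symmetric]
        by (rule W.W_cinner) (simp_all add: Cd(1) ab)
      also have "\<dots> = cinner (S (W (- int n) a)) (W (- int n) b)"
        unfolding S_def by (rule adjoint_onD'[OF D(2), symmetric]) (simp_all add: Cd(1) ab)
      also have "\<dots> = cinner (P.rot (int n) S a) b"
        using W.W_adjoint[OF Sd(1)[OF W.W_H[OF ab(1)]] ab(2), of "int n" "- int n"] by (simp add: P.rot_def)
      finally show ?thesis .
    qed
    have "(\<lambda>N. cinner ((1 / real N) *\<^sub>R (\<Sum>n<N. P.rot (int n) S a)) b) \<longlonglongrightarrow> cinner (cinner (S \<Psi>) \<Psi> *\<^sub>C a) b"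
      by (intro tendsto_cinner M'_average S ab tendsto_const)
    moreover have "cinner ((1 / real N) *\<^sub>R (\<Sum>n<N. P.rot (int n) S a)) b
        = (\<Sum>n<N. cinner (u (n + h)) (u (n + h'))) / of_nat N" for N
      by (simp add: cinner_scaleR_left cinner_sum_left inner)
    moreover have "cinner (S \<Psi>) \<Psi> = cinner (W ((k + 1) * int h) y) (W ((k + 1) * int h') y)"
      unfolding S_def using adjoint_onD'[OF D(2) Cd(1)[OF Psi_H, of h] Psi_H] by (simp add: CPsi)
    ultimately show "(\<lambda>N. (\<Sum>n<N. cinner (u (n + h)) (u (n + h'))) / of_nat N)
        \<longlonglongrightarrow> cinner (W ((k + 1) * int h) y) (W ((k + 1) * int h') y) * cinner (W (k * int h) x) (W (k * int h') x)"
      by (simp add: cinner_scaleC_left a_def b_def)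
  next
    fix \<epsilon> :: real assume \<epsilon>: "\<epsilon> > 0"
    \<comment> \<open>Chosen so that \<open>(norm y)\<^sup>2 * e\<^sup>2 \<le> \<epsilon>\<close>;
      the summand 1 covers the case \<open>y = 0\<close>.\<close>
    define e where "e = sqrt (\<epsilon> / ((norm y)\<^sup>2 + 1))"
    have y1: "(norm y)\<^sup>2 + 1 > 0" by (simp add: add_nonneg_pos)
    have e: "e > 0" "(norm y)\<^sup>2 * e\<^sup>2 \<le> \<epsilon>"
      using \<epsilon> y1 by (simp_all add: e_def field_simps)
    have "Tk.weakly_mixing x" by (rule W.weakly_mixing_subgroup[OF x k])
    from Tk.weakly_mixing_avg_uniform[OF this e(1)] obtain N0 where N0:
      "\<And>N v. N \<ge> N0 \<Longrightarrow> cmod v = 1 \<Longrightarrow> norm ((1 / real N) *\<^sub>R (\<Sum>n<N. v ^ n *\<^sub>C W (k * int n) x)) \<le> e" by blast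
    define L where "L = Suc N0"
    have L: "L > 0" "L \<ge> N0" by (simp_all add: L_def)
    have "norm (\<Sum>h<L. v ^ h *\<^sub>C W (k * int h) x) \<le> e * real L" if "cmod v = 1" for v
      using N0[OF L(2) that] L(1) by (simp add: divide_le_eq)
    then have "cmod (\<Sum>h<L. \<Sum>h'<L. cinner (W ((k + 1) * int h) y) (W ((k + 1) * int h') y) *
        cinner (W (k * int h) x) (W (k * int h') x)) \<le> (norm y)\<^sup>2 * (e * real L)\<^sup>2"
      using e(1) by (intro Tk1.herglotz_bound y) auto
    also have "\<dots> = ((norm y)\<^sup>2 * e\<^sup>2) * (real L)\<^sup>2" by (simp add: power_mult_distrib)
    also have "\<dots> \<le> \<epsilon> * (real L)\<^sup>2" by (intro mult_right_mono e) simp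
    finally show "\<exists>L>0. cmod (\<Sum>h<L. \<Sum>h'<L. cinner (W ((k + 1) * int h) y) (W ((k + 1) * int h') y) *
        cinner (W (k * int h) x) (W (k * int h') x)) \<le> \<epsilon> * (real L)\<^sup>2"
      using L(1) by blast
  qed
qed

text \<open>At \<open>x = eigen_unitary R v \<Psi>\<close> the element \<open>B\<close> of the
  commutant passes through the unitary, which lies in the bicommutant, and the averages of
  \<open>average_eigenvector\<close> appear; at weakly mixing \<open>x\<close> the averages tend to
  0 and the fibre operator vanishes.\<close>

lemma average_commutant:
  assumes k: "k \<noteq> 0" "k \<noteq> - 1" and B: "B \<in> M'" and x: "x \<in> H"
  shows "(\<lambda>N. (1 / real N) *\<^sub>R (\<Sum>n<N. W ((k + 1) * int n) (B (W (- int n) x))))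
    \<longlonglongrightarrow> V_fibre k R (tensor x (B \<Psi>))"
proof -
  note Bd = bounded_opD[OF M'_op[OF B]]
  obtain K where K: "K \<ge> 0" "\<And>x. x \<in> H \<Longrightarrow> norm (B x) \<le> K * norm x" using Bd(4) by blast
  have op: "bounded_op H (\<lambda>x. W ((k + 1) * int n) (B (W (- int n) x)))" for n
    by (rule bounded_op_comp[OF W.W_op bounded_op_comp[OF M'_op[OF B] W.W_op]])
  have nop: "norm (W ((k + 1) * int n) (B (W (- int n) x))) \<le> K * norm x" if "x \<in> H" for x n
    using K(2)[OF W.W_H[OF that]] that by (simp add: Bd(1))
  show ?thesis
  proof (rule tendsto_of_eigenvectors_of_weakly_mixing[OF bounded_op_average(1)[OF H op nop] V_fibre_op(1)
        bounded_op_average(2)[OF H op nop] _ _ x])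
    show "(\<lambda>N. (1 / real N) *\<^sub>R (\<Sum>n<N. W ((k + 1) * int n) (B (W (- int n) x)))) \<longlonglongrightarrow> V_fibre k R (tensor x (B \<Psi>))"
      if "W.weakly_mixing x" for x
      using average_weakly_mixing[OF k(1) B that] V_fibre_weakly_mixing[of x "B \<Psi>"] that by simp
    fix v assume v: "v \<in> \<sigma>"
    note E = eigen_unitary(2)[OF v] and Ed = bounded_opD[OF twisted_unitaryD(1)[OF eigen_unitary(2)[OF v]]]
    have v0: "v \<noteq> 0" using twisted_unitary_norm[OF E] by auto
    define y where "y = B \<Psi>"
    have y: "y \<in> H" unfolding y_def by (rule Bd(1)[OF Psi_H])
    have "W ((k + 1) * int n) (B (W (- int n) (eigen_unitary R v \<Psi>)))
        = eigen_unitary R v ((v powi k) ^ n *\<^sub>C W ((k + 1) * int n) y)" for n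
    proof -
      have "B (W (- int n) (eigen_unitary R v \<Psi>)) = (v powi (- int n)) *\<^sub>C B (eigen_unitary R v \<Psi>)"
        using twisted_unitary_W_int[OF E Psi_H, of "- int n"] Bd(3)[OF Ed(1)[OF Psi_H]] by simp
      also have "B (eigen_unitary R v \<Psi>) = eigen_unitary R v y"
        unfolding y_def by (rule Q.X_commute[OF eigen_unitary(1)[OF v] B Psi_H, symmetric])
      finally have "W ((k + 1) * int n) (B (W (- int n) (eigen_unitary R v \<Psi>)))
          = (v powi (- int n) * v powi ((k + 1) * int n)) *\<^sub>C eigen_unitary R v (W ((k + 1) * int n) y)"
        by (simp add: W.W_scaleC Ed(1) y twisted_unitary_W_int[OF E y])
      also have "v powi (- int n) * v powi ((k + 1) * int n) = v powi (k * int n)"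
        using v0 by (simp add: power_int_add[symmetric] algebra_simps del: power_int_minus)
      also have "v powi (k * int n) = (v powi k) ^ n" by (simp add: power_int_mult)
      finally show ?thesis using Ed(3)[OF W.W_H[OF y]] by simp
    qed
    then have "(1 / real N) *\<^sub>R (\<Sum>n<N. W ((k + 1) * int n) (B (W (- int n) (eigen_unitary R v \<Psi>))))
        = eigen_unitary R v ((1 / real N) *\<^sub>R (\<Sum>n<N. (v powi k) ^ n *\<^sub>C W ((k + 1) * int n) y))" for N
      using Ed(3)[OF H_sum, of "{..<N}" "\<lambda>n. (v powi k) ^ n *\<^sub>C W ((k + 1) * int n) y" "of_real (1 / real N)"]
        bounded_op_linear(4)[OF H twisted_unitaryD(1)[OF E], of "{..<N}" "\<lambda>n. (v powi k) ^ n *\<^sub>C W ((k + 1) * int n) y"]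
      by (simp add: y H_scaleC scaleR_scaleC)
    then have "(\<lambda>N. (1 / real N) *\<^sub>R (\<Sum>n<N. W ((k + 1) * int n) (B (W (- int n) (eigen_unitary R v \<Psi>)))))
        \<longlonglongrightarrow> V_fibre k R (tensor (eigen_unitary R v \<Psi>) (B \<Psi>))"
      using average_eigenvector[OF k(2) v y] by (simp add: y_def)
    with E show "\<exists>T. twisted_unitary v T \<and>
        (\<lambda>N. (1 / real N) *\<^sub>R (\<Sum>n<N. W ((k + 1) * int n) (B (W (- int n) (T \<Psi>)))))
        \<longlonglongrightarrow> V_fibre k R (tensor (T \<Psi>) (B \<Psi>))"
      by (intro exI conjI)
  qed
qed

lemma norm_pi_int_iter_le: "x \<in> H \<Longrightarrow> norm (\<pi> (int_iter UNIV \<beta> n a) x) \<le> norm a * norm x"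
  using pi_norm[of "W (- n) x" a] W.norm_W[of "\<pi> a (W (- n) x)" n] by (simp add: W_pi)

text \<open>For \<open>\<xi> = B \<Psi>\<close> with \<open>B\<close> in the commutant, moving
  \<open>W ((k + 1) * int n)\<close> to the front leaves the iterate
  \<open>k * n - (k + 1) * n = - n\<close> of \<open>a\<close>, which commutes with
  \<open>B\<close>; the summand becomes that of \<open>average_commutant\<close> at
  \<open>\<pi> a \<Psi>\<close>. Such \<open>\<xi>\<close> are dense by
  \<open>M'_cyclic\<close>.\<close>

lemma average_algebra:
  assumes k: "k \<noteq> 0" "k \<noteq> - 1" and \<xi>: "\<xi> \<in> H"
  shows "(\<lambda>N. (1 / real N) *\<^sub>R (\<Sum>n<N. \<pi> (int_iter UNIV \<beta> (k * int n) a) (W ((k + 1) * int n) \<xi>)))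
    \<longlonglongrightarrow> V_fibre k R (tensor (\<pi> a \<Psi>) \<xi>)"
proof -
  have op: "bounded_op H (\<lambda>\<xi>. \<pi> (int_iter UNIV \<beta> (k * int n) a) (W ((k + 1) * int n) \<xi>))" for n
    by (rule bounded_op_comp[OF pi_op W.W_op])
  have nop: "norm (\<pi> (int_iter UNIV \<beta> (k * int n) a) (W ((k + 1) * int n) \<xi>)) \<le> norm a * norm \<xi>" if "\<xi> \<in> H" for n \<xi>
    using norm_pi_int_iter_le[OF W.W_H[OF that]] that by simp
  define L where "L = {\<xi> \<in> H. (\<lambda>N. (1 / real N) *\<^sub>R (\<Sum>n<N. \<pi> (int_iter UNIV \<beta> (k * int n) a) (W ((k + 1) * int n) \<xi>)))
    \<longlonglongrightarrow> V_fibre k R (tensor (\<pi> a \<Psi>) \<xi>)}"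
  have L: "closed_csubspace L"
    unfolding L_def
    by (rule closed_csubspace_convergence[OF H bounded_op_average(1)[OF H op nop] V_fibre_op(2)
          bounded_op_average(2)[OF H op nop]])
  have "B \<Psi> \<in> L" if B: "B \<in> M'" for B
  proof -
    have BH: "B \<Psi> \<in> H" by (rule bounded_opD(1)[OF M'_op[OF B] Psi_H])
    have "\<pi> (int_iter UNIV \<beta> (k * int n) a) (W ((k + 1) * int n) (B \<Psi>))
        = W ((k + 1) * int n) (B (W (- int n) (\<pi> a \<Psi>)))" for n
    proof -
      define b where "b = int_iter UNIV \<beta> (- int n) a"
      have "B (W (- int n) (\<pi> a \<Psi>)) = \<pi> b (B \<Psi>)"
        unfolding b_def W_pi'[OF Psi_H] W_Psi by (rule M'_commute[OF B Psi_H])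
      then have "W ((k + 1) * int n) (B (W (- int n) (\<pi> a \<Psi>)))
          = \<pi> (int_iter UNIV \<beta> ((k + 1) * int n) b) (W ((k + 1) * int n) (B \<Psi>))"
        by (simp add: W_pi'[OF BH])
      also have "int_iter UNIV \<beta> ((k + 1) * int n) b = int_iter UNIV \<beta> (k * int n) a"
        unfolding b_def using int_iter_add[OF bij_beta, of a "(k + 1) * int n" "- int n"] by (simp add: algebra_simps)
      finally show ?thesis by simp
    qed
    then show ?thesis using average_commutant[OF k B pi_H[OF Psi_H]] BH by (simp add: L_def)
  qed
  then have "closure M'\<Psi> \<subseteq> L"
    by (intro closure_minimal closed_csubspaceD(1)[OF L]) auto
  then have "\<xi> \<in> L" using \<xi> M'_cyclic by auto
  then show ?thesis by (simp add: L_def)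
qed

theorem multiple_average_tendsto:
  assumes k: "k \<noteq> 0" "k \<noteq> - 1"
  shows "(\<lambda>N. \<pi> (multiple_average \<beta> k a b N) \<Psi>) \<longlonglongrightarrow> V_fibre k R (tensor (\<pi> a \<Psi>) (\<pi> b \<Psi>))"
  using average_algebra[OF k pi_H[OF Psi_H], of a b]
  by (simp add: multiple_average_def pi_scaleR pi_sum pi_mult W_pi')

text \<open>A bound independent of \<open>\<psi>\<close> and \<open>N\<close>, as dominated
  convergence over the fibres requires.\<close>

lemma multiple_average_bound: "norm (\<pi> (multiple_average \<beta> k a b N) \<Psi>) \<le> norm a * norm b"
proof -
  have "norm (\<Sum>n<N. \<pi> (int_iter UNIV \<beta> (k * int n) a) (\<pi> (int_iter UNIV \<beta> ((k + 1) * int n) b) \<Psi>))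
      \<le> (\<Sum>n<N. norm a * norm b)"
  proof (rule sum_norm_le)
    fix n
    have "norm (\<pi> (int_iter UNIV \<beta> (k * int n) a) (\<pi> (int_iter UNIV \<beta> ((k + 1) * int n) b) \<Psi>))
        \<le> norm a * norm (\<pi> (int_iter UNIV \<beta> ((k + 1) * int n) b) \<Psi>)"
      by (rule norm_pi_int_iter_le) simp
    also have "\<dots> \<le> norm a * (norm b * norm \<Psi>)" by (intro mult_left_mono norm_pi_int_iter_le) simp_all
    finally show "norm (\<pi> (int_iter UNIV \<beta> (k * int n) a) (\<pi> (int_iter UNIV \<beta> ((k + 1) * int n) b) \<Psi>))
      \<le> norm a * norm b" by simp
  qed
  then show ?thesis
    by (cases "N = 0") (simp_all add: multiple_average_def pi_scaleR pi_sum pi_mult divide_le_eq mult.commute)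
qed

end

section \<open>The direct integral\<close>

text \<open>Allows the comparison test for series of vectors in a fibre.\<close>

instance chilbert_space \<subseteq> banach ..

lemma borel_measurable_cong_AE_completion:
  fixes f g :: "'b \<Rightarrow> 'c::topological_space"
  assumes f: "f \<in> borel_measurable (completion M)" and eq: "AE x in completion M. f x = g x"
  shows "g \<in> borel_measurable (completion M)"
proof (rule measurableI)
  fix A :: "'c set" assume A: "A \<in> sets borel"
  show "g -` A \<inter> space (completion M) \<in> sets (completion M)"
  proof (rule completion.in_sets_AE)
    show "AE x in completion M. x \<in> f -` A \<inter> space (completion M) \<longleftrightarrow> x \<in> g -` A \<inter> space (completion M)"
      using eq by eventually_elim auto
  qed (use measurable_sets[OF f A] in auto)
qed simp

lemma borel_measurable_LIMSEQ_AE_completion: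
  fixes u :: "nat \<Rightarrow> 'b \<Rightarrow> 'c::real_normed_vector"
  assumes u: "\<And>n. u n \<in> borel_measurable (completion M)"
    and lim: "AE x in completion M. (\<lambda>n. u n x) \<longlonglongrightarrow> v x"
  shows "v \<in> borel_measurable (completion M)"
proof -
  obtain N where N: "N \<in> null_sets (completion M)" "\<And>x. x \<in> space M - N \<Longrightarrow> (\<lambda>n. u n x) \<longlonglongrightarrow> v x"
    using lim unfolding eventually_ae_filter by fastforce
  have NM: "N \<in> sets (completion M)" using N(1) by auto
  define u' where "u' = (\<lambda>n x. if x \<in> N then 0 else u n x)"
  define v' where "v' = (\<lambda>x. if x \<in> N then 0 else v x)"
  have "v' \<in> borel_measurable (completion M)"
  proof (rule borel_measurable_LIMSEQ_metric)
    show "u' n \<in> borel_measurable (completion M)" for n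
      unfolding u'_def using NM by (intro measurable_If_set u measurable_const) auto
    show "(\<lambda>n. u' n x) \<longlonglongrightarrow> v' x" if "x \<in> space (completion M)" for x
      using N(2)[of x] that by (simp add: u'_def v'_def)
  qed
  moreover have "AE x in completion M. v' x = v x"
    by (rule AE_I'[OF N(1)]) (auto simp: v'_def)
  ultimately show ?thesis by (rule borel_measurable_cong_AE_completion)
qed

text \<open>Fatou's lemma, with convergent upper bounds for the integrals.\<close>

lemma nn_integral_le_of_tendsto:
  fixes u :: "nat \<Rightarrow> 'b \<Rightarrow> ennreal"
  assumes u: "\<And>n. u n \<in> borel_measurable M" and lim: "AE x in M. (\<lambda>n. u n x) \<longlonglongrightarrow> v x"
    and bound: "\<And>n. (\<integral>\<^sup>+x. u n x \<partial>M) \<le> c n" "c \<longlonglongrightarrow> C"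
  shows "(\<integral>\<^sup>+x. v x \<partial>M) \<le> C"
proof -
  have "(\<integral>\<^sup>+x. v x \<partial>M) \<le> (\<integral>\<^sup>+x. liminf (\<lambda>n. u n x) \<partial>M)"
    by (rule nn_integral_mono_AE) (use lim in \<open>eventually_elim, simp add: lim_imp_Liminf\<close>)
  also have "\<dots> \<le> liminf (\<lambda>n. \<integral>\<^sup>+x. u n x \<partial>M)" by (rule nn_integral_liminf[OF u])
  also have "\<dots> \<le> liminf c" by (rule Liminf_mono) (simp add: bound)
  also have "\<dots> = C" by (rule lim_imp_Liminf[OF _ bound(2)]) simp
  finally show ?thesis .
qed

lemma norm_power2_le: "(norm (x + y))\<^sup>2 \<le> 2 * (norm x)\<^sup>2 + 2 * (norm (y::'v::real_normed_vector))\<^sup>2"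
proof -
  have "(norm (x + y))\<^sup>2 \<le> (norm x + norm y)\<^sup>2" by (intro power_mono norm_triangle_ineq) simp
  also have "\<dots> \<le> 2 * (norm x)\<^sup>2 + 2 * (norm y)\<^sup>2"
    using zero_le_power2[of "norm x - norm y"] by (simp add: power2_sum power2_diff)
  finally show ?thesis .
qed

text \<open>Measurable evaluations and the barycentre are what makes the map from
  \<open>\<pi> a \<Psi>\<close> to \<open>gns_field a\<close> isometric into the square-integrable
  fields.\<close>

locale direct_integral = covariant_system \<alpha> \<omega> R + prob_space \<nu>
  for \<alpha> :: "'a::cstar_algebra \<Rightarrow> 'a" and \<omega> :: "'a \<Rightarrow> complex"
    and R :: "('a, 'h::chilbert_space) covariant_rep" and \<nu> :: "('a \<Rightarrow> complex) measure" +
  fixes \<beta> :: "'a \<Rightarrow> 'a" and G :: "('a \<Rightarrow> complex) \<Rightarrow> ('a, 'g::chilbert_space) covariant_rep"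
  assumes fibre: "AE \<psi> in \<nu>. covariant_system \<beta> \<psi> (G \<psi>)"
    and evaluation: "(\<lambda>\<psi>. \<psi> a) \<in> borel_measurable \<nu>"
    and barycentre: "(\<integral>\<psi>. \<psi> a \<partial>\<nu>) = \<omega> a"
begin

abbreviation "\<mu> \<equiv> completion \<nu>"

definition gns_field :: "'a \<Rightarrow> ('a \<Rightarrow> complex) \<Rightarrow> 'g" where
  "gns_field a \<psi> = rep (G \<psi>) a (cyc (G \<psi>))"

lemma fibre': "AE \<psi> in \<mu>. covariant_system \<beta> \<psi> (G \<psi>)"
  by (rule AE_completion[OF fibre])

lemma fibre_gns_field:
  assumes "covariant_system \<beta> \<psi> (G \<psi>)"
  shows "cinner (gns_field a \<psi>) (gns_field b \<psi>) = \<psi> (star b * a)" "gns_field (a + b) \<psi> = gns_field a \<psi> + gns_field b \<psi>"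
    "gns_field (a - b) \<psi> = gns_field a \<psi> - gns_field b \<psi>" "gns_field (c *\<^sub>C a) \<psi> = c *\<^sub>C gns_field a \<psi>" "gns_field a \<psi> \<in> hilb (G \<psi>)"
    "norm (gns_field a \<psi>) \<le> norm a" "cmod (\<psi> a) \<le> norm a"
    "(norm (gns_field a \<psi>))\<^sup>2 = Re (\<psi> (star a * a))"
proof -
  interpret F: covariant_system \<beta> \<psi> "G \<psi>" by (rule assms)
  show inner: "cinner (gns_field a \<psi>) (gns_field b \<psi>) = \<psi> (star b * a)" for a b by (simp add: gns_field_def F.psi_star_mult)
  show "gns_field (a + b) \<psi> = gns_field a \<psi> + gns_field b \<psi>" "gns_field (a - b) \<psi> = gns_field a \<psi> - gns_field b \<psi>" "gns_field (c *\<^sub>C a) \<psi> = c *\<^sub>C gns_field a \<psi>"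
    "gns_field a \<psi> \<in> hilb (G \<psi>)"
    by (simp_all add: gns_field_def F.pi_add F.pi_diff F.pi_scaleC)
  show n: "norm (gns_field a \<psi>) \<le> norm a" using F.pi_norm[OF F.Psi_H, of a] by (simp add: gns_field_def)
  have "cmod (\<psi> a) \<le> norm (gns_field a \<psi>) * norm (cyc (G \<psi>))" unfolding F.psi_eq[of a, folded gns_field_def] by (rule cinner_norm_le)
  then show "cmod (\<psi> a) \<le> norm a" using n by simp
  show "(norm (gns_field a \<psi>))\<^sup>2 = Re (\<psi> (star a * a))"
    unfolding inner[of a a, symmetric] by (simp add: cinner_self del: of_real_power)
qed

lemma gns_field_measurable:
  "(\<lambda>\<psi>. cinner (gns_field a \<psi>) (gns_field b \<psi>)) \<in> borel_measurable \<mu>"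
  "(\<lambda>\<psi>. (norm (gns_field a \<psi>))\<^sup>2) \<in> borel_measurable \<mu>"
proof -
  have "AE \<psi> in \<mu>. \<psi> (star b * a) = cinner (gns_field a \<psi>) (gns_field b \<psi>)" for a b
    using fibre' by eventually_elim (simp add: fibre_gns_field)
  then show m: "(\<lambda>\<psi>. cinner (gns_field a \<psi>) (gns_field b \<psi>)) \<in> borel_measurable \<mu>" for a b
    by (rule borel_measurable_cong_AE_completion[OF measurable_completion[OF evaluation]])
  have "(\<lambda>\<psi>. Re (cinner (gns_field a \<psi>) (gns_field a \<psi>))) \<in> borel_measurable \<mu>" using m[of a a] by measurable
  then show "(\<lambda>\<psi>. (norm (gns_field a \<psi>))\<^sup>2) \<in> borel_measurable \<mu>" by (simp add: cinner_self del: of_real_power)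
qed

text \<open>The barycentre formula at \<open>star a * a\<close>.\<close>

lemma nn_integral_gns_field: "(\<integral>\<^sup>+\<psi>. ennreal ((norm (gns_field a \<psi>))\<^sup>2) \<partial>\<mu>) = ennreal ((norm (\<pi> a \<Psi>))\<^sup>2)"
proof -
  define b where "b = star a * a"
  have int: "integrable \<nu> (\<lambda>\<psi>. \<psi> b)"
    by (rule integrable_const_bound[of _ "norm b"]) (use fibre in \<open>eventually_elim, simp add: fibre_gns_field\<close>, rule evaluation)
  have "(\<integral>\<^sup>+\<psi>. ennreal ((norm (gns_field a \<psi>))\<^sup>2) \<partial>\<mu>) = (\<integral>\<^sup>+\<psi>. ennreal (Re (\<psi> b)) \<partial>\<nu>)"
    unfolding nn_integral_completion
    by (rule nn_integral_cong_AE) (use fibre in \<open>eventually_elim, simp add: fibre_gns_field b_def\<close>)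
  also have "\<dots> = ennreal (\<integral>\<psi>. Re (\<psi> b) \<partial>\<nu>)"
  proof (rule nn_integral_eq_integral)
    show "integrable \<nu> (\<lambda>\<psi>. Re (\<psi> b))" using int by simp
    show "AE \<psi> in \<nu>. 0 \<le> Re (\<psi> b)"
      using fibre by eventually_elim (simp add: b_def fibre_gns_field(8)[symmetric])
  qed
  also have "(\<integral>\<psi>. Re (\<psi> b) \<partial>\<nu>) = Re (\<omega> b)" using int by (simp add: integral_Re barycentre)
  also have "\<omega> b = cinner (\<pi> a \<Psi>) (\<pi> a \<Psi>)" unfolding b_def by (rule psi_star_mult)
  finally show ?thesis by (simp add: cinner_self del: of_real_power)
qed

text \<open>Equivalent to \<open>decomposes\<close> by \<open>decomposes_iff\<close>, with almost
  sure convergence in the fibres instead of convergence in mean square; sums, limits and the fibre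
  operators can then be followed pointwise.\<close>

definition represents :: "'h \<Rightarrow> (('a \<Rightarrow> complex) \<Rightarrow> 'g) \<Rightarrow> bool" where
  "represents \<xi> f \<longleftrightarrow> (\<exists>a. (\<lambda>n. \<pi> (a n) \<Psi>) \<longlonglongrightarrow> \<xi> \<and> (AE \<psi> in \<mu>. (\<lambda>n. gns_field (a n) \<psi>) \<longlonglongrightarrow> f \<psi>))"

lemma represents_gns_field: "represents (\<pi> a \<Psi>) (gns_field a)"
  unfolding represents_def by (intro exI[of _ "\<lambda>_. a"]) simp

lemma represents_add:
  assumes "represents \<xi> f" "represents \<eta> g"
  shows "represents (\<xi> + \<eta>) (\<lambda>\<psi>. f \<psi> + g \<psi>)"
proof -
  obtain a where a: "(\<lambda>n. \<pi> (a n) \<Psi>) \<longlonglongrightarrow> \<xi>" "AE \<psi> in \<mu>. (\<lambda>n. gns_field (a n) \<psi>) \<longlonglongrightarrow> f \<psi>"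
    using assms(1) unfolding represents_def by blast
  obtain b where b: "(\<lambda>n. \<pi> (b n) \<Psi>) \<longlonglongrightarrow> \<eta>" "AE \<psi> in \<mu>. (\<lambda>n. gns_field (b n) \<psi>) \<longlonglongrightarrow> g \<psi>"
    using assms(2) unfolding represents_def by blast
  have "(\<lambda>n. \<pi> (a n + b n) \<Psi>) \<longlonglongrightarrow> \<xi> + \<eta>" using tendsto_add[OF a(1) b(1)] by (simp add: pi_add)
  moreover have "AE \<psi> in \<mu>. (\<lambda>n. gns_field (a n + b n) \<psi>) \<longlonglongrightarrow> f \<psi> + g \<psi>"
    using fibre' a(2) b(2) by eventually_elim (simp add: fibre_gns_field(2) tendsto_add)
  ultimately show ?thesis unfolding represents_def by (intro exI conjI)
qed

lemma represents_scaleC: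
  assumes "represents \<xi> f"
  shows "represents (c *\<^sub>C \<xi>) (\<lambda>\<psi>. c *\<^sub>C f \<psi>)"
proof -
  obtain a where a: "(\<lambda>n. \<pi> (a n) \<Psi>) \<longlonglongrightarrow> \<xi>" "AE \<psi> in \<mu>. (\<lambda>n. gns_field (a n) \<psi>) \<longlonglongrightarrow> f \<psi>"
    using assms(1) unfolding represents_def by blast
  have "(\<lambda>n. \<pi> (c *\<^sub>C a n) \<Psi>) \<longlonglongrightarrow> c *\<^sub>C \<xi>"
    using tendsto_scaleC[OF tendsto_const[of c] a(1)] by (simp add: pi_scaleC)
  moreover have "AE \<psi> in \<mu>. (\<lambda>n. gns_field (c *\<^sub>C a n) \<psi>) \<longlonglongrightarrow> c *\<^sub>C f \<psi>"
    using fibre' a(2) by eventually_elim (simp add: fibre_gns_field(4) tendsto_scaleC)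
  ultimately show ?thesis unfolding represents_def by (intro exI conjI)
qed

lemma represents_diff:
  assumes "represents \<xi> f" "represents \<eta> g"
  shows "represents (\<xi> - \<eta>) (\<lambda>\<psi>. f \<psi> - g \<psi>)"
  using represents_add[OF assms(1) represents_scaleC[OF assms(2), of "- 1"]] by simp

lemma represents_cong_AE:
  assumes "represents \<xi> f" "AE \<psi> in \<mu>. f \<psi> = g \<psi>"
  shows "represents \<xi> g"
proof -
  obtain a where a: "(\<lambda>n. \<pi> (a n) \<Psi>) \<longlonglongrightarrow> \<xi>" "AE \<psi> in \<mu>. (\<lambda>n. gns_field (a n) \<psi>) \<longlonglongrightarrow> f \<psi>"
    using assms(1) unfolding represents_def by blast
  have "AE \<psi> in \<mu>. (\<lambda>n. gns_field (a n) \<psi>) \<longlonglongrightarrow> g \<psi>" using a(2) assms(2) by eventually_elim simp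
  then show ?thesis using a(1) unfolding represents_def by blast
qed

context
  fixes \<xi> f
  assumes f: "represents \<xi> f"
begin

lemma represents_vector: "\<xi> \<in> H"
proof -
  obtain a where "(\<lambda>n. \<pi> (a n) \<Psi>) \<longlonglongrightarrow> \<xi>" using f unfolding represents_def by blast
  then show ?thesis by (rule closed_sequentially[OF H_closed, rotated]) simp
qed

lemma represents_field: "AE \<psi> in \<mu>. f \<psi> \<in> hilb (G \<psi>)"
proof -
  obtain a where "AE \<psi> in \<mu>. (\<lambda>n. gns_field (a n) \<psi>) \<longlonglongrightarrow> f \<psi>" using f unfolding represents_def by blast
  then show ?thesis
    using fibre'
  proof eventually_elim
    case (elim \<psi>)
    interpret F: covariant_system \<beta> \<psi> "G \<psi>" by (rule elim)
    show ?case by (rule closed_sequentially[OF F.H_closed _ elim(1)]) (simp add: gns_field_def)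
  qed
qed

lemma represents_measurable:
  "(\<lambda>\<psi>. cinner (f \<psi>) (gns_field b \<psi>)) \<in> borel_measurable \<mu>" "(\<lambda>\<psi>. (norm (f \<psi>))\<^sup>2) \<in> borel_measurable \<mu>"
proof -
  obtain a where a: "AE \<psi> in \<mu>. (\<lambda>n. gns_field (a n) \<psi>) \<longlonglongrightarrow> f \<psi>" using f unfolding represents_def by blast
  have "AE \<psi> in \<mu>. (\<lambda>n. cinner (gns_field (a n) \<psi>) (gns_field b \<psi>)) \<longlonglongrightarrow> cinner (f \<psi>) (gns_field b \<psi>)"
    using a by eventually_elim (intro tendsto_cinner tendsto_const)
  then show "(\<lambda>\<psi>. cinner (f \<psi>) (gns_field b \<psi>)) \<in> borel_measurable \<mu>"
    by (rule borel_measurable_LIMSEQ_AE_completion[OF gns_field_measurable(1)])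
  have "AE \<psi> in \<mu>. (\<lambda>n. (norm (gns_field (a n) \<psi>))\<^sup>2) \<longlonglongrightarrow> (norm (f \<psi>))\<^sup>2"
    using a by eventually_elim (intro tendsto_power tendsto_norm)
  then show "(\<lambda>\<psi>. (norm (f \<psi>))\<^sup>2) \<in> borel_measurable \<mu>"
    by (rule borel_measurable_LIMSEQ_AE_completion[OF gns_field_measurable(2)])
qed

lemma represents_upper: "(\<integral>\<^sup>+\<psi>. ennreal ((norm (f \<psi>))\<^sup>2) \<partial>\<mu>) \<le> ennreal ((norm \<xi>)\<^sup>2)"
proof -
  obtain a where a: "(\<lambda>n. \<pi> (a n) \<Psi>) \<longlonglongrightarrow> \<xi>" "AE \<psi> in \<mu>. (\<lambda>n. gns_field (a n) \<psi>) \<longlonglongrightarrow> f \<psi>"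
    using f unfolding represents_def by blast
  show ?thesis
  proof (rule nn_integral_le_of_tendsto)
    show "(\<lambda>\<psi>. ennreal ((norm (gns_field (a n) \<psi>))\<^sup>2)) \<in> borel_measurable \<mu>" for n
      using gns_field_measurable(2) by measurable
    show "AE \<psi> in \<mu>. (\<lambda>n. ennreal ((norm (gns_field (a n) \<psi>))\<^sup>2)) \<longlonglongrightarrow> ennreal ((norm (f \<psi>))\<^sup>2)"
      using a(2) by eventually_elim (intro tendsto_ennrealI tendsto_power tendsto_norm)
    show "(\<integral>\<^sup>+\<psi>. ennreal ((norm (gns_field (a n) \<psi>))\<^sup>2) \<partial>\<mu>) \<le> ennreal ((norm (\<pi> (a n) \<Psi>))\<^sup>2)" for n
      by (simp add: nn_integral_gns_field)
    show "(\<lambda>n. ennreal ((norm (\<pi> (a n) \<Psi>))\<^sup>2)) \<longlonglongrightarrow> ennreal ((norm \<xi>)\<^sup>2)"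
      by (intro tendsto_ennrealI tendsto_power tendsto_norm a(1))
  qed
qed

end

text \<open>The constant 2 comes from \<open>norm_power2_le\<close>; it is good enough for
  uniqueness of the represented vector and for continuity of the operators below.\<close>

lemma represents_lower:
  assumes f: "represents \<xi> f"
  shows "ennreal ((norm \<xi>)\<^sup>2) \<le> 2 * (\<integral>\<^sup>+\<psi>. ennreal ((norm (f \<psi>))\<^sup>2) \<partial>\<mu>)"
proof -
  obtain a where a: "(\<lambda>n. \<pi> (a n) \<Psi>) \<longlonglongrightarrow> \<xi>" using f unfolding represents_def by blast
  define I where "I = (\<integral>\<^sup>+\<psi>. ennreal ((norm (f \<psi>))\<^sup>2) \<partial>\<mu>)"
  have bd: "ennreal ((norm (\<pi> (a n) \<Psi>))\<^sup>2) \<le> 2 * I + 2 * ennreal ((norm (\<pi> (a n) \<Psi> - \<xi>))\<^sup>2)" for n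
  proof -
    note d = represents_diff[OF represents_gns_field f, of "a n"]
    have [measurable]: "(\<lambda>\<psi>. (norm (f \<psi>))\<^sup>2) \<in> borel_measurable \<mu>" "(\<lambda>\<psi>. (norm (gns_field (a n) \<psi> - f \<psi>))\<^sup>2) \<in> borel_measurable \<mu>"
      by (rule represents_measurable[OF f], rule represents_measurable[OF d])
    have "ennreal ((norm (\<pi> (a n) \<Psi>))\<^sup>2) = (\<integral>\<^sup>+\<psi>. ennreal ((norm (gns_field (a n) \<psi>))\<^sup>2) \<partial>\<mu>)" by (simp add: nn_integral_gns_field)
    also have "\<dots> \<le> (\<integral>\<^sup>+\<psi>. 2 * ennreal ((norm (f \<psi>))\<^sup>2) + 2 * ennreal ((norm (gns_field (a n) \<psi> - f \<psi>))\<^sup>2) \<partial>\<mu>)"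
    proof (rule nn_integral_mono)
      fix \<psi>
      have "ennreal ((norm (gns_field (a n) \<psi>))\<^sup>2) \<le> ennreal (2 * (norm (f \<psi>))\<^sup>2 + 2 * (norm (gns_field (a n) \<psi> - f \<psi>))\<^sup>2)"
        using norm_power2_le[of "f \<psi>" "gns_field (a n) \<psi> - f \<psi>"] by (intro ennreal_leI) simp
      also have "\<dots> = 2 * ennreal ((norm (f \<psi>))\<^sup>2) + 2 * ennreal ((norm (gns_field (a n) \<psi> - f \<psi>))\<^sup>2)"
        by (simp add: ennreal_plus ennreal_mult)
      finally show "ennreal ((norm (gns_field (a n) \<psi>))\<^sup>2)
          \<le> 2 * ennreal ((norm (f \<psi>))\<^sup>2) + 2 * ennreal ((norm (gns_field (a n) \<psi> - f \<psi>))\<^sup>2)" .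
    qed
    also have "\<dots> = 2 * I + 2 * (\<integral>\<^sup>+\<psi>. ennreal ((norm (gns_field (a n) \<psi> - f \<psi>))\<^sup>2) \<partial>\<mu>)"
      unfolding I_def by (simp add: nn_integral_add nn_integral_cmult)
    also have "\<dots> \<le> 2 * I + 2 * ennreal ((norm (\<pi> (a n) \<Psi> - \<xi>))\<^sup>2)"
      by (intro add_left_mono mult_left_mono represents_upper[OF d]) simp
    finally show ?thesis .
  qed
  have lim: "(\<lambda>n. 2 * I + 2 * ennreal ((norm (\<pi> (a n) \<Psi> - \<xi>))\<^sup>2)) \<longlonglongrightarrow> 2 * I + 2 * ennreal ((norm (\<xi> - \<xi>))\<^sup>2)"
    by (intro tendsto_add tendsto_const ennreal_tendsto_cmult tendsto_ennrealI tendsto_power tendsto_norm tendsto_diff a) simp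
  have "(\<lambda>n. ennreal ((norm (\<pi> (a n) \<Psi>))\<^sup>2)) \<longlonglongrightarrow> ennreal ((norm \<xi>)\<^sup>2)"
    by (intro tendsto_ennrealI tendsto_power tendsto_norm a)
  then have "ennreal ((norm \<xi>)\<^sup>2) \<le> 2 * I + 2 * ennreal ((norm (\<xi> - \<xi>))\<^sup>2)"
    by (rule LIMSEQ_le[OF _ lim]) (use bd in blast)
  then show ?thesis by (simp add: I_def)
qed

lemma represents_unique_vector:
  assumes "represents \<xi> f" "represents \<eta> f"
  shows "\<xi> = \<eta>"
  using represents_lower[OF represents_diff[OF assms]] by (simp add: ennreal_eq_0_iff)

lemma represents_unique_field:
  assumes "represents \<xi> f" "represents \<xi> g"
  shows "AE \<psi> in \<mu>. f \<psi> = g \<psi>"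
proof -
  note d = represents_diff[OF assms]
  have [measurable]: "(\<lambda>\<psi>. (norm (f \<psi> - g \<psi>))\<^sup>2) \<in> borel_measurable \<mu>" by (rule represents_measurable[OF d])
  have "(\<integral>\<^sup>+\<psi>. ennreal ((norm (f \<psi> - g \<psi>))\<^sup>2) \<partial>\<mu>) = 0" using represents_upper[OF d] by simp
  then have "AE \<psi> in \<mu>. ennreal ((norm (f \<psi> - g \<psi>))\<^sup>2) = 0" by (subst (asm) nn_integral_0_iff_AE) measurable
  then show ?thesis by eventually_elim (simp add: ennreal_eq_0_iff)
qed

text \<open>A Riesz-Fischer argument: approximants with error \<open>(1 / 4) ^ n\<close> have
  differences \<open>d n\<close> so small in mean square that
  \<open>2 ^ n * (norm (d n \<psi>))\<^sup>2\<close> is almost surely summable. Then so is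
  \<open>norm (d n \<psi>)\<close>, which is at most \<open>(1 / 2) ^ n\<close> plus that
  term.\<close>

lemma represents_exists:
  assumes \<xi>: "\<xi> \<in> H"
  shows "\<exists>f. represents \<xi> f"
proof -
  have "\<exists>a. dist (\<pi> a \<Psi>) \<xi> < (1 / 4) ^ n" for n
    using \<xi> cyclic closure_approachable[of \<xi> "range (\<lambda>a. \<pi> a \<Psi>)"] by auto
  then obtain a where a: "\<And>n. dist (\<pi> (a n) \<Psi>) \<xi> < (1 / 4) ^ n" by metis
  have a_lim: "(\<lambda>n. \<pi> (a n) \<Psi>) \<longlonglongrightarrow> \<xi>"
  proof (rule Lim_transform_bound[where g = "\<lambda>n. (1 / 4 :: real) ^ n", THEN iffD1[OF LIM_zero_iff]])
    show "\<forall>\<^sub>F n in sequentially. norm (\<pi> (a n) \<Psi> - \<xi>) \<le> norm ((1 / 4 :: real) ^ n)"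
      using a by (simp add: dist_norm less_imp_le)
  qed (simp add: LIMSEQ_power_zero)
  define d where "d = (\<lambda>n. gns_field (a (Suc n) - a n))"
  have d_bound: "(norm (\<pi> (a (Suc n) - a n) \<Psi>))\<^sup>2 \<le> 4 * (1 / 16) ^ n" for n
  proof -
    have "norm (\<pi> (a (Suc n) - a n) \<Psi>) = dist (\<pi> (a (Suc n)) \<Psi>) (\<pi> (a n) \<Psi>)" by (simp add: pi_diff dist_norm)
    also have "\<dots> \<le> (1 / 4) ^ Suc n + (1 / 4) ^ n"
      using a[of n] a[of "Suc n"] dist_triangle2[of "\<pi> (a (Suc n)) \<Psi>" "\<pi> (a n) \<Psi>" \<xi>] by linarith
    also have "\<dots> \<le> 2 * (1 / 4) ^ n" by simp
    finally have "(norm (\<pi> (a (Suc n) - a n) \<Psi>))\<^sup>2 \<le> (2 * (1 / 4) ^ n)\<^sup>2" by (intro power_mono) simp_all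
    also have "\<dots> = 4 * (1 / 16) ^ n"
    proof -
      have "((1 / 4 :: real) ^ n)\<^sup>2 = ((1 / 4)\<^sup>2) ^ n" by (simp only: power_mult[symmetric] mult.commute)
      then show ?thesis unfolding power_mult_distrib by (simp add: power2_eq_square)
    qed
    finally show ?thesis .
  qed
  have [measurable]: "(\<lambda>\<psi>. (norm (d n \<psi>))\<^sup>2) \<in> borel_measurable \<mu>" for n unfolding d_def by (rule gns_field_measurable)
  have "(\<integral>\<^sup>+\<psi>. (\<Sum>n. ennreal (2 ^ n * (norm (d n \<psi>))\<^sup>2)) \<partial>\<mu>) = (\<Sum>n. \<integral>\<^sup>+\<psi>. ennreal (2 ^ n * (norm (d n \<psi>))\<^sup>2) \<partial>\<mu>)"
    by (rule nn_integral_suminf) measurable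
  also have "\<dots> = (\<Sum>n. ennreal (2 ^ n * (norm (\<pi> (a (Suc n) - a n) \<Psi>))\<^sup>2))"
    unfolding d_def by (simp add: ennreal_mult nn_integral_cmult gns_field_measurable nn_integral_gns_field)
  also have "\<dots> \<le> (\<Sum>n. ennreal (4 * (1 / 8) ^ n))"
  proof (intro suminf_le ennreal_leI)
    fix n
    have "2 ^ n * (norm (\<pi> (a (Suc n) - a n) \<Psi>))\<^sup>2 \<le> 2 ^ n * (4 * (1 / 16) ^ n)" by (intro mult_left_mono d_bound) simp
    also have "\<dots> = 4 * (2 * (1 / 16)) ^ n" unfolding power_mult_distrib by simp
    finally show "2 ^ n * (norm (\<pi> (a (Suc n) - a n) \<Psi>))\<^sup>2 \<le> 4 * (1 / 8) ^ n" by simp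
  qed auto
  also have "\<dots> < \<infinity>" by (subst suminf_ennreal2) (auto intro!: summable_mult summable_geometric)
  finally have "AE \<psi> in \<mu>. (\<Sum>n. ennreal (2 ^ n * (norm (d n \<psi>))\<^sup>2)) \<noteq> \<infinity>"
    by (intro nn_integral_PInf_AE) auto
  then have "AE \<psi> in \<mu>. convergent (\<lambda>n. gns_field (a n) \<psi>)"
    using fibre'
  proof eventually_elim
    case (elim \<psi>)
    have "summable (\<lambda>n. 2 ^ n * (norm (d n \<psi>))\<^sup>2)"
      using elim(1) by (intro summable_suminf_not_top) auto
    then have "summable (\<lambda>n. (1 / 2) ^ n + 2 ^ n * (norm (d n \<psi>))\<^sup>2)"
      by (intro summable_add summable_geometric) simp_all
    moreover have "norm (d n \<psi>) \<le> (1 / 2) ^ n + 2 ^ n * (norm (d n \<psi>))\<^sup>2" for n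
    proof (cases "norm (d n \<psi>) \<le> (1 / 2) ^ n")
      case False
      then have "1 \<le> 2 ^ n * norm (d n \<psi>)" by (simp add: power_divide field_simps)
      then have "1 * norm (d n \<psi>) \<le> 2 ^ n * norm (d n \<psi>) * norm (d n \<psi>)" by (rule mult_right_mono) simp
      then show ?thesis by (simp add: power2_eq_square mult.assoc add_increasing)
    qed (simp add: add_increasing2)
    ultimately have "summable (\<lambda>n. d n \<psi>)" by (rule summable_comparison_test')
    then have "(\<lambda>n. gns_field (a 0) \<psi> + (\<Sum>i<n. d i \<psi>)) \<longlonglongrightarrow> gns_field (a 0) \<psi> + (\<Sum>i. d i \<psi>)"
      by (intro tendsto_add tendsto_const summable_LIMSEQ)
    moreover have "gns_field (a 0) \<psi> + (\<Sum>i<n. d i \<psi>) = gns_field (a n) \<psi>" for n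
      using sum_lessThan_telescope[of "\<lambda>n. gns_field (a n) \<psi>" n] by (simp add: d_def fibre_gns_field(3)[OF elim(2)])
    ultimately show ?case by (auto simp: convergent_def)
  qed
  then have "AE \<psi> in \<mu>. (\<lambda>n. gns_field (a n) \<psi>) \<longlonglongrightarrow> lim (\<lambda>n. gns_field (a n) \<psi>)"
    by eventually_elim (simp add: convergent_LIMSEQ_iff)
  then have "represents \<xi> (\<lambda>\<psi>. lim (\<lambda>n. gns_field (a n) \<psi>))"
    using a_lim unfolding represents_def by (intro exI conjI)
  then show ?thesis by blast
qed

lemma represents_imp_decomposes:
  assumes f: "represents \<xi> f"
  shows "decomposes R \<nu> G \<xi> f"
proof -
  obtain a where a: "(\<lambda>n. \<pi> (a n) \<Psi>) \<longlonglongrightarrow> \<xi>" using f unfolding represents_def by blast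
  have "integrable \<mu> (\<lambda>\<psi>. (norm (f \<psi>))\<^sup>2)"
    using represents_measurable(2)[OF f] order_le_less_trans[OF represents_upper[OF f] ennreal_less_top]
    by (intro integrableI_bounded) auto
  then have "square_integrable_field \<nu> G f"
    using represents_field[OF f] represents_measurable(1)[OF f]
    by (simp add: square_integrable_field_def gns_field_def AE_completion_iff)
  moreover have "(\<lambda>n. \<integral>\<^sup>+\<psi>. ennreal ((norm (f \<psi> - gns_field (a n) \<psi>))\<^sup>2) \<partial>\<mu>) \<longlonglongrightarrow> 0"
  proof (rule tendsto_sandwich[OF _ _ tendsto_const])
    show "\<forall>\<^sub>F n in sequentially. (\<integral>\<^sup>+\<psi>. ennreal ((norm (f \<psi> - gns_field (a n) \<psi>))\<^sup>2) \<partial>\<mu>) \<le> ennreal ((norm (\<xi> - \<pi> (a n) \<Psi>))\<^sup>2)"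
      by (intro always_eventually allI represents_upper represents_diff f represents_gns_field)
    have "(\<lambda>n. ennreal ((norm (\<xi> - \<pi> (a n) \<Psi>))\<^sup>2)) \<longlonglongrightarrow> ennreal ((norm (\<xi> - \<xi>))\<^sup>2)"
      by (intro tendsto_ennrealI tendsto_power tendsto_norm tendsto_diff tendsto_const a)
    then show "(\<lambda>n. ennreal ((norm (\<xi> - \<pi> (a n) \<Psi>))\<^sup>2)) \<longlonglongrightarrow> 0" by simp
  qed auto
  ultimately show ?thesis
    using represents_vector[OF f] a unfolding decomposes_def gns_field_def by blast
qed

text \<open>Mean square convergence yields an almost surely convergent subsequence. Measurability of
  the squared distance comes from expanding it into squared norms and an inner product with a GNS
  field.\<close>

lemma decomposes_imp_represents:
  assumes f: "decomposes R \<nu> G \<xi> f"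
  shows "represents \<xi> f"
proof -
  obtain a where a: "(\<lambda>n. \<pi> (a n) \<Psi>) \<longlonglongrightarrow> \<xi>"
    and lim: "(\<lambda>n. \<integral>\<^sup>+\<psi>. ennreal ((norm (f \<psi> - gns_field (a n) \<psi>))\<^sup>2) \<partial>\<mu>) \<longlonglongrightarrow> 0"
    using f unfolding decomposes_def gns_field_def by blast
  have sq: "square_integrable_field \<nu> G f" using f unfolding decomposes_def by blast
  have int: "integrable \<mu> (\<lambda>\<psi>. (norm (f \<psi> - gns_field (a n) \<psi>))\<^sup>2)" for n
  proof (rule Bochner_Integration.integrable_bound)
    have i: "integrable \<mu> (\<lambda>\<psi>. (norm (f \<psi>))\<^sup>2)" using sq by (simp add: square_integrable_field_def)
    have "integrable \<mu> (\<lambda>\<psi>. (norm (gns_field (a n) \<psi>))\<^sup>2)"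
      using gns_field_measurable(2) by (intro integrableI_bounded) (auto simp: nn_integral_gns_field)
    then show "integrable \<mu> (\<lambda>\<psi>. 2 * (norm (f \<psi>))\<^sup>2 + 2 * (norm (gns_field (a n) \<psi>))\<^sup>2)"
      by (intro Bochner_Integration.integrable_add integrable_mult_right i)
    have c: "(\<lambda>\<psi>. cinner (f \<psi>) (gns_field (a n) \<psi>)) \<in> borel_measurable \<mu>"
      using sq by (simp add: square_integrable_field_def gns_field_def)
    have "(\<lambda>\<psi>. (norm (f \<psi>))\<^sup>2 - 2 * Re (cinner (f \<psi>) (gns_field (a n) \<psi>)) + (norm (gns_field (a n) \<psi>))\<^sup>2) \<in> borel_measurable \<mu>"
      using borel_measurable_integrable[OF i] c gns_field_measurable(2)[of "a n"] by measurable
    then show "(\<lambda>\<psi>. (norm (f \<psi> - gns_field (a n) \<psi>))\<^sup>2) \<in> borel_measurable \<mu>"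
      by (simp add: power2_norm_eq_inner inner_diff inner_commute algebra_simps flip: inner_eq_Re_cinner)
    show "AE \<psi> in \<mu>. norm ((norm (f \<psi> - gns_field (a n) \<psi>))\<^sup>2) \<le> norm (2 * (norm (f \<psi>))\<^sup>2 + 2 * (norm (gns_field (a n) \<psi>))\<^sup>2)"
      using norm_power2_le[of "f _" "- gns_field (a n) _"] by simp
  qed
  have "(\<lambda>n. \<integral>\<psi>. norm ((norm (f \<psi> - gns_field (a n) \<psi>))\<^sup>2) \<partial>\<mu>) \<longlonglongrightarrow> 0"
  proof -
    have "(\<lambda>n. ennreal (\<integral>\<psi>. (norm (f \<psi> - gns_field (a n) \<psi>))\<^sup>2 \<partial>\<mu>)) \<longlonglongrightarrow> ennreal 0"
      using lim by (simp add: nn_integral_eq_integral[OF int])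
    then show ?thesis by (subst (asm) tendsto_ennreal_iff) (auto intro!: integral_nonneg_AE)
  qed
  then obtain r where r: "strict_mono (r :: nat \<Rightarrow> nat)"
    "AE \<psi> in \<mu>. (\<lambda>n. (norm (f \<psi> - gns_field (a (r n)) \<psi>))\<^sup>2) \<longlonglongrightarrow> 0"
    using tendsto_L1_AE_subseq[of \<mu> "\<lambda>n \<psi>. (norm (f \<psi> - gns_field (a n) \<psi>))\<^sup>2", OF int] by blast
  have "AE \<psi> in \<mu>. (\<lambda>n. gns_field (a (r n)) \<psi>) \<longlonglongrightarrow> f \<psi>"
    using r(2)
  proof eventually_elim
    case (elim \<psi>)
    then have "(\<lambda>n. sqrt ((norm (f \<psi> - gns_field (a (r n)) \<psi>))\<^sup>2)) \<longlonglongrightarrow> sqrt 0" by (intro tendsto_real_sqrt)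
    then have "(\<lambda>n. norm (gns_field (a (r n)) \<psi> - f \<psi>)) \<longlonglongrightarrow> 0" by (simp add: norm_minus_commute)
    then show ?case by (simp add: tendsto_norm_zero_iff LIM_zero_iff)
  qed
  moreover have "(\<lambda>n. \<pi> (a (r n)) \<Psi>) \<longlonglongrightarrow> \<xi>" using LIMSEQ_subseq_LIMSEQ[OF a r(1)] by (simp add: o_def)
  ultimately show ?thesis unfolding represents_def by (intro exI conjI)
qed

lemma decomposes_iff: "decomposes R \<nu> G \<xi> f \<longleftrightarrow> represents \<xi> f"
  using represents_imp_decomposes decomposes_imp_represents by blast

lemma field_of:
  assumes "represents \<xi> f"
  shows "AE \<psi> in \<mu>. field_of R \<nu> G \<xi> \<psi> = f \<psi>"
proof -
  have "represents \<xi> (field_of R \<nu> G \<xi>)"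
    unfolding field_of_def decomposes_iff by (rule someI[of "represents \<xi>", OF assms])
  then show ?thesis using assms by (rule represents_unique_field)
qed

lemma vector_of:
  assumes "represents \<xi> f"
  shows "vector_of R \<nu> G f = \<xi>"
  unfolding vector_of_def decomposes_iff
  using assms represents_unique_vector by blast

end

section \<open>The operators on the direct integral\<close>

locale ergodic_direct_integral = direct_integral \<alpha> \<omega> R \<nu> \<beta> G
  for \<alpha> :: "'a::cstar_algebra \<Rightarrow> 'a" and \<omega> :: "'a \<Rightarrow> complex"
    and R :: "('a, 'h::chilbert_space) covariant_rep" and \<nu> :: "('a \<Rightarrow> complex) measure"
    and \<beta> :: "'a \<Rightarrow> 'a" and G :: "('a \<Rightarrow> complex) \<Rightarrow> ('a, 'g::chilbert_space) covariant_rep" +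
  fixes k :: int
  assumes ergodic: "AE \<psi> in \<nu>. ergodic_system \<beta> \<psi> (G \<psi>)" and k: "k \<noteq> 0" "k \<noteq> - 1"
begin

lemma ergodic': "AE \<psi> in \<mu>. ergodic_system \<beta> \<psi> (G \<psi>)"
  by (rule AE_completion[OF ergodic])

text \<open>Not cut off outside \<open>F\<close>, in contrast to \<open>V_field\<close>; the two
  agree almost everywhere.\<close>

definition V_image :: "'a \<Rightarrow> (('a \<Rightarrow> complex) \<Rightarrow> 'g) \<Rightarrow> ('a \<Rightarrow> complex) \<Rightarrow> 'g" where
  "V_image a f \<psi> = V_fibre k (G \<psi>) (tensor (gns_field a \<psi>) (f \<psi>))"

lemma ergodic_V_image:
  assumes "ergodic_system \<beta> \<psi> (G \<psi>)"
  shows "V_image a (\<lambda>\<psi>. f \<psi> + g \<psi>) \<psi> = V_image a f \<psi> + V_image a g \<psi>"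
    "V_image a (\<lambda>\<psi>. c *\<^sub>C f \<psi>) \<psi> = c *\<^sub>C V_image a f \<psi>"
    "V_image a (\<lambda>\<psi>. f \<psi> - g \<psi>) \<psi> = V_image a f \<psi> - V_image a g \<psi>"
    "norm (V_image a f \<psi>) \<le> norm a * norm (f \<psi>)"
    "(\<lambda>N. gns_field (multiple_average \<beta> k a b N) \<psi>) \<longlonglongrightarrow> V_image a (gns_field b) \<psi>"
    "norm (gns_field (multiple_average \<beta> k a b N) \<psi>) \<le> norm a * norm b"
proof -
  interpret E: ergodic_system \<beta> \<psi> "G \<psi>" by (rule assms)
  show 1: "V_image a (\<lambda>\<psi>. f \<psi> + g \<psi>) \<psi> = V_image a f \<psi> + V_image a g \<psi>" for f g
    by (simp add: V_image_def E.V_fibre_add_right)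
  show 2: "V_image a (\<lambda>\<psi>. c *\<^sub>C f \<psi>) \<psi> = c *\<^sub>C V_image a f \<psi>" for c f
    by (simp add: V_image_def E.V_fibre_scaleC)
  show "V_image a (\<lambda>\<psi>. f \<psi> - g \<psi>) \<psi> = V_image a f \<psi> - V_image a g \<psi>"
    using 1[of f "\<lambda>\<psi>. (- 1) *\<^sub>C g \<psi>"] 2[of "- 1" g] by simp
  show "norm (V_image a f \<psi>) \<le> norm a * norm (f \<psi>)"
    unfolding V_image_def
    by (rule order_trans[OF E.V_fibre_norm mult_right_mono[OF fibre_gns_field(6)[OF E.covariant_system_axioms]]]) simp
  show "(\<lambda>N. gns_field (multiple_average \<beta> k a b N) \<psi>) \<longlonglongrightarrow> V_image a (gns_field b) \<psi>"
    unfolding V_image_def gns_field_def by (rule E.multiple_average_tendsto[OF k])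
  show "norm (gns_field (multiple_average \<beta> k a b N) \<psi>) \<le> norm a * norm b"
    unfolding gns_field_def by (rule E.multiple_average_bound)
qed

text \<open>In almost every fibre the averages are bounded by \<open>norm a * norm b\<close>, so
  dominated convergence applies to the squared distances. The required measurability comes for free:
  the field \<open>V_image a (gns_field b)\<close> is an almost sure limit of GNS fields.\<close>

lemma represents_V_gns_field:
  "\<exists>\<eta>. (\<lambda>N. \<pi> (multiple_average \<beta> k a b N) \<Psi>) \<longlonglongrightarrow> \<eta> \<and> represents \<eta> (V_image a (gns_field b))"
proof -
  define s where "s = multiple_average \<beta> k a b"
  define g where "g = V_image a (gns_field b)"
  define C where "C = norm a * norm b"
  have lim: "AE \<psi> in \<mu>. (\<lambda>N. gns_field (s N) \<psi>) \<longlonglongrightarrow> g \<psi>"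
    unfolding s_def g_def using ergodic' by eventually_elim (rule ergodic_V_image)
  have bound: "AE \<psi> in \<mu>. norm (gns_field (s N) \<psi> - g \<psi>) \<le> 2 * C" for N
    using ergodic' lim
  proof eventually_elim
    case (elim \<psi>)
    have n: "norm (gns_field (s N) \<psi>) \<le> C" for N unfolding s_def C_def by (rule ergodic_V_image(6)[OF elim(1)])
    then have "norm (g \<psi>) \<le> C" by (intro LIMSEQ_le_const2[OF tendsto_norm[OF elim(2)]]) auto
    then show ?case using n[of N] norm_triangle_ineq4[of "gns_field (s N) \<psi>" "g \<psi>"] by linarith
  qed
  have meas: "(\<lambda>\<psi>. (norm (gns_field (s N) \<psi> - g \<psi>))\<^sup>2) \<in> borel_measurable \<mu>" for N
  proof (rule borel_measurable_LIMSEQ_AE_completion)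
    show "(\<lambda>\<psi>. (norm (gns_field (s N - s M) \<psi>))\<^sup>2) \<in> borel_measurable \<mu>" for M by (rule gns_field_measurable)
    show "AE \<psi> in \<mu>. (\<lambda>M. (norm (gns_field (s N - s M) \<psi>))\<^sup>2) \<longlonglongrightarrow> (norm (gns_field (s N) \<psi> - g \<psi>))\<^sup>2"
      using lim fibre' by eventually_elim
        (simp add: fibre_gns_field(3) tendsto_power tendsto_norm tendsto_diff)
  qed
  define I where "I = (\<lambda>N. \<integral>\<^sup>+\<psi>. ennreal ((norm (gns_field (s N) \<psi> - g \<psi>))\<^sup>2) \<partial>\<mu>)"
  have "I \<longlonglongrightarrow> (\<integral>\<^sup>+\<psi>. 0 \<partial>\<mu>)"
    unfolding I_def
  proof (rule nn_integral_dominated_convergence[where w = "\<lambda>_. ennreal ((2 * C)\<^sup>2)"])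
    show "(\<lambda>\<psi>. ennreal ((norm (gns_field (s N) \<psi> - g \<psi>))\<^sup>2)) \<in> borel_measurable \<mu>" for N
      using meas[of N] by measurable
    show "AE \<psi> in \<mu>. ennreal ((norm (gns_field (s N) \<psi> - g \<psi>))\<^sup>2) \<le> ennreal ((2 * C)\<^sup>2)" for N
      using bound[of N] by eventually_elim (intro ennreal_leI power_mono norm_ge_zero)
    show "(\<integral>\<^sup>+\<psi>. ennreal ((2 * C)\<^sup>2) \<partial>\<mu>) < \<infinity>"
      by (simp add: nn_integral_completion ennreal_mult_less_top emeasure_space_1)
    show "AE \<psi> in \<mu>. (\<lambda>N. ennreal ((norm (gns_field (s N) \<psi> - g \<psi>))\<^sup>2)) \<longlonglongrightarrow> 0"
      using lim
    proof eventually_elim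
      case (elim \<psi>)
      have "(\<lambda>N. ennreal ((norm (gns_field (s N) \<psi> - g \<psi>))\<^sup>2)) \<longlonglongrightarrow> ennreal ((norm (g \<psi> - g \<psi>))\<^sup>2)"
        by (intro tendsto_ennrealI tendsto_power tendsto_norm tendsto_diff tendsto_const elim)
      then show ?case by simp
    qed
  qed simp_all
  then have I: "I \<longlonglongrightarrow> 0" by simp
  \<comment> \<open>The left-hand side is the integral of the squared norm of a GNS field, and
    \<open>g\<close> serves as the intermediate point in each fibre.\<close>
  have diff: "ennreal ((norm (\<pi> (s m) \<Psi> - \<pi> (s n) \<Psi>))\<^sup>2) \<le> 2 * I m + 2 * I n" for m n
  proof -
    have "ennreal ((norm (\<pi> (s m) \<Psi> - \<pi> (s n) \<Psi>))\<^sup>2) = (\<integral>\<^sup>+\<psi>. ennreal ((norm (gns_field (s m - s n) \<psi>))\<^sup>2) \<partial>\<mu>)"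
      by (simp add: nn_integral_gns_field pi_diff)
    also have "\<dots> \<le> (\<integral>\<^sup>+\<psi>. 2 * ennreal ((norm (gns_field (s m) \<psi> - g \<psi>))\<^sup>2) + 2 * ennreal ((norm (gns_field (s n) \<psi> - g \<psi>))\<^sup>2) \<partial>\<mu>)"
    proof (rule nn_integral_mono_AE, use fibre' in eventually_elim)
      case (elim \<psi>)
      have "ennreal ((norm (gns_field (s m - s n) \<psi>))\<^sup>2)
          \<le> ennreal (2 * (norm (gns_field (s m) \<psi> - g \<psi>))\<^sup>2 + 2 * (norm (gns_field (s n) \<psi> - g \<psi>))\<^sup>2)"
        using norm_power2_le[of "gns_field (s m) \<psi> - g \<psi>" "g \<psi> - gns_field (s n) \<psi>"]
        by (intro ennreal_leI) (simp add: fibre_gns_field(3)[OF elim] norm_minus_commute)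
      then show ?case by (simp add: ennreal_plus ennreal_mult)
    qed
    also have "\<dots> = 2 * I m + 2 * I n"
      unfolding I_def using meas by (simp add: nn_integral_add nn_integral_cmult)
    finally show ?thesis .
  qed
  have "Cauchy (\<lambda>N. \<pi> (s N) \<Psi>)"
  proof (rule CauchyI)
    fix e :: real assume e: "e > 0"
    have "\<forall>\<^sub>F N in sequentially. I N < ennreal (e\<^sup>2 / 4)"
      by (rule order_tendstoD(2)[OF I]) (use e in simp)
    then obtain M where M: "\<And>N. N \<ge> M \<Longrightarrow> I N < ennreal (e\<^sup>2 / 4)" by (auto simp: eventually_sequentially)
    have "norm (\<pi> (s m) \<Psi> - \<pi> (s n) \<Psi>) < e" if mn: "m \<ge> M" "n \<ge> M" for m n
    proof -
      obtain i j where ij: "I m = ennreal i" "0 \<le> i" "I n = ennreal j" "0 \<le> j"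
        using M[OF mn(1)] M[OF mn(2)] by (cases "I m"; cases "I n") auto
      have "i < e\<^sup>2 / 4" "j < e\<^sup>2 / 4"
        using M[OF mn(1)] M[OF mn(2)] ij by (simp_all add: ennreal_less_iff)
      moreover have "(norm (\<pi> (s m) \<Psi> - \<pi> (s n) \<Psi>))\<^sup>2 \<le> 2 * i + 2 * j"
      proof -
        have "2 * I m + 2 * I n = ennreal (2 * i + 2 * j)" using ij by (simp add: ennreal_plus ennreal_mult)
        then have "ennreal ((norm (\<pi> (s m) \<Psi> - \<pi> (s n) \<Psi>))\<^sup>2) \<le> ennreal (2 * i + 2 * j)"
          using diff[of m n] by (simp only:)
        then show ?thesis by (subst (asm) ennreal_le_iff) (use ij in simp_all)
      qed
      ultimately have "(norm (\<pi> (s m) \<Psi> - \<pi> (s n) \<Psi>))\<^sup>2 < e\<^sup>2" by linarith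
      then show ?thesis by (rule power_less_imp_less_base) (use e in simp)
    qed
    then show "\<exists>M. \<forall>m\<ge>M. \<forall>n\<ge>M. norm (\<pi> (s m) \<Psi> - \<pi> (s n) \<Psi>) < e" by blast
  qed
  then obtain \<eta> where "(\<lambda>N. \<pi> (s N) \<Psi>) \<longlonglongrightarrow> \<eta>" using Cauchy_convergent convergent_def by blast
  moreover from this have "represents \<eta> g" using lim unfolding represents_def by (intro exI conjI)
  ultimately show ?thesis unfolding s_def g_def by blast
qed

text \<open>The fibrewise bound is framed by \<open>represents_upper\<close> for
  \<open>\<xi>\<close> and \<open>represents_lower\<close> for \<open>\<eta>\<close>; the latter
  costs a factor \<open>sqrt 2\<close>, estimated by 2.\<close>

lemma represents_V_norm:
  assumes f: "represents \<xi> f" and g: "represents \<eta> (V_image a f)"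
  shows "norm \<eta> \<le> 2 * norm a * norm \<xi>"
proof -
  have [measurable]: "(\<lambda>\<psi>. (norm (f \<psi>))\<^sup>2) \<in> borel_measurable \<mu>" by (rule represents_measurable[OF f])
  have "ennreal ((norm \<eta>)\<^sup>2) \<le> 2 * (\<integral>\<^sup>+\<psi>. ennreal ((norm (V_image a f \<psi>))\<^sup>2) \<partial>\<mu>)" by (rule represents_lower[OF g])
  also have "\<dots> \<le> 2 * (\<integral>\<^sup>+\<psi>. ennreal ((norm a)\<^sup>2) * ennreal ((norm (f \<psi>))\<^sup>2) \<partial>\<mu>)"
  proof (intro mult_left_mono nn_integral_mono_AE)
    show "AE \<psi> in \<mu>. ennreal ((norm (V_image a f \<psi>))\<^sup>2) \<le> ennreal ((norm a)\<^sup>2) * ennreal ((norm (f \<psi>))\<^sup>2)"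
      using ergodic'
    proof eventually_elim
      case (elim \<psi>)
      have "(norm (V_image a f \<psi>))\<^sup>2 \<le> (norm a * norm (f \<psi>))\<^sup>2"
        by (intro power_mono ergodic_V_image(4)[OF elim]) simp
      then show ?case by (simp add: ennreal_mult[symmetric] power_mult_distrib ennreal_leI)
    qed
  qed simp
  also have "\<dots> = 2 * (ennreal ((norm a)\<^sup>2) * (\<integral>\<^sup>+\<psi>. ennreal ((norm (f \<psi>))\<^sup>2) \<partial>\<mu>))"
    by (simp add: nn_integral_cmult)
  also have "\<dots> \<le> 2 * (ennreal ((norm a)\<^sup>2) * ennreal ((norm \<xi>)\<^sup>2))"
    by (intro mult_left_mono represents_upper[OF f]) simp_all
  also have "\<dots> = ennreal (2 * ((norm a)\<^sup>2 * (norm \<xi>)\<^sup>2))" by (simp add: ennreal_mult)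
  finally have "(norm \<eta>)\<^sup>2 \<le> 2 * ((norm a)\<^sup>2 * (norm \<xi>)\<^sup>2)" by (subst (asm) ennreal_le_iff) simp_all
  also have "\<dots> \<le> (2 * norm a * norm \<xi>)\<^sup>2" by (simp add: power_mult_distrib)
  finally show ?thesis by (rule power2_le_imp_le) simp
qed

lemma represents_V_diff:
  assumes "represents \<eta> (V_image a f)" "represents \<zeta> (V_image a g)"
  shows "represents (\<eta> - \<zeta>) (V_image a (\<lambda>\<psi>. f \<psi> - g \<psi>))"
proof (rule represents_cong_AE[OF represents_diff[OF assms]])
  show "AE \<psi> in \<mu>. V_image a f \<psi> - V_image a g \<psi> = V_image a (\<lambda>\<psi>. f \<psi> - g \<psi>) \<psi>"
    using ergodic' by eventually_elim (rule ergodic_V_image(3)[symmetric])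
qed

text \<open>Extension by continuity from GNS fields. The vectors \<open>h n\<close> of the
  approximating GNS fields are Cauchy by \<open>represents_V_norm\<close>. A field \<open>g\<close>
  of their limit \<open>\<eta>\<close> agrees with \<open>V_image a f\<close> almost everywhere,
  because by Fatou the integral of the squared distance is at most the limit of
  \<open>(norm (\<eta> - h n))\<^sup>2\<close>, which is 0.\<close>

lemma represents_V:
  assumes f: "represents \<xi> f"
  shows "\<exists>\<eta>. represents \<eta> (V_image a f)"
proof -
  obtain b where b: "(\<lambda>n. \<pi> (b n) \<Psi>) \<longlonglongrightarrow> \<xi>" "AE \<psi> in \<mu>. (\<lambda>n. gns_field (b n) \<psi>) \<longlonglongrightarrow> f \<psi>"
    using f unfolding represents_def by blast
  have "\<exists>\<eta>. represents \<eta> (V_image a (gns_field (b n)))" for n using represents_V_gns_field by blast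
  then obtain h where h: "\<And>n. represents (h n) (V_image a (gns_field (b n)))" by metis
  have bd: "norm (h m - h n) \<le> 2 * norm a * norm (\<pi> (b m) \<Psi> - \<pi> (b n) \<Psi>)" for m n
    by (rule represents_V_norm[OF represents_diff[OF represents_gns_field represents_gns_field] represents_V_diff[OF h h]])
  have "Cauchy h"
  proof (rule CauchyI)
    fix e :: real assume e: "e > 0"
    define c where "c = 2 * norm a + 1"
    have c: "c > 0" by (simp add: c_def add_nonneg_pos)
    have "Cauchy (\<lambda>n. \<pi> (b n) \<Psi>)" using b(1) by (intro convergent_Cauchy convergentI)
    then obtain M where M: "\<And>m n. m \<ge> M \<Longrightarrow> n \<ge> M \<Longrightarrow> norm (\<pi> (b m) \<Psi> - \<pi> (b n) \<Psi>) < e / c"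
      using e c unfolding Cauchy_iff by (metis divide_pos_pos)
    have "norm (h m - h n) < e" if "m \<ge> M" "n \<ge> M" for m n
    proof -
      have "norm (h m - h n) \<le> c * norm (\<pi> (b m) \<Psi> - \<pi> (b n) \<Psi>)"
        by (rule order_trans[OF bd]) (simp add: c_def mult_right_mono)
      also have "\<dots> < c * (e / c)" using M[OF that] c by (intro mult_strict_left_mono)
      finally show ?thesis using c by simp
    qed
    then show "\<exists>M. \<forall>m\<ge>M. \<forall>n\<ge>M. norm (h m - h n) < e" by blast
  qed
  then obtain \<eta> where \<eta>: "h \<longlonglongrightarrow> \<eta>" using Cauchy_convergent convergent_def by blast
  have "\<eta> \<in> H" by (rule closed_sequentially[OF H_closed _ \<eta>]) (rule represents_vector[OF h])
  then obtain g where g: "represents \<eta> g" using represents_exists by blast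
  note d = represents_diff[OF g h]
  have V_lim: "AE \<psi> in \<mu>. (\<lambda>n. V_image a (gns_field (b n)) \<psi>) \<longlonglongrightarrow> V_image a f \<psi>"
    using b(2) ergodic'
  proof eventually_elim
    case (elim \<psi>)
    have "(\<lambda>n. V_image a (gns_field (b n)) \<psi> - V_image a f \<psi>) \<longlonglongrightarrow> 0"
    proof (rule Lim_null_comparison)
      show "\<forall>\<^sub>F n in sequentially. norm (V_image a (gns_field (b n)) \<psi> - V_image a f \<psi>) \<le> norm a * norm (gns_field (b n) \<psi> - f \<psi>)"
        unfolding ergodic_V_image(3)[OF elim(2), symmetric] by (intro always_eventually allI ergodic_V_image(4)[OF elim(2)])
      have "(\<lambda>n. norm a * norm (gns_field (b n) \<psi> - f \<psi>)) \<longlonglongrightarrow> norm a * norm (f \<psi> - f \<psi>)"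
        by (intro tendsto_mult tendsto_norm tendsto_diff tendsto_const elim)
      then show "(\<lambda>n. norm a * norm (gns_field (b n) \<psi> - f \<psi>)) \<longlonglongrightarrow> 0" by simp
    qed
    then show ?case by (rule LIM_zero_cancel)
  qed
  have lim: "AE \<psi> in \<mu>. (\<lambda>n. (norm (g \<psi> - V_image a (gns_field (b n)) \<psi>))\<^sup>2) \<longlonglongrightarrow> (norm (g \<psi> - V_image a f \<psi>))\<^sup>2"
    using V_lim by eventually_elim (intro tendsto_power tendsto_norm tendsto_diff tendsto_const)
  have meas [measurable]: "(\<lambda>\<psi>. (norm (g \<psi> - V_image a f \<psi>))\<^sup>2) \<in> borel_measurable \<mu>"
    by (rule borel_measurable_LIMSEQ_AE_completion[OF represents_measurable(2)[OF d] lim])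
  have "(\<integral>\<^sup>+\<psi>. ennreal ((norm (g \<psi> - V_image a f \<psi>))\<^sup>2) \<partial>\<mu>) \<le> 0"
  proof (rule nn_integral_le_of_tendsto)
    show "(\<lambda>\<psi>. ennreal ((norm (g \<psi> - V_image a (gns_field (b n)) \<psi>))\<^sup>2)) \<in> borel_measurable \<mu>" for n
      using represents_measurable(2)[OF d, of n] by measurable
    show "AE \<psi> in \<mu>. (\<lambda>n. ennreal ((norm (g \<psi> - V_image a (gns_field (b n)) \<psi>))\<^sup>2)) \<longlonglongrightarrow> ennreal ((norm (g \<psi> - V_image a f \<psi>))\<^sup>2)"
      using lim by eventually_elim (rule tendsto_ennrealI)
    show "(\<integral>\<^sup>+\<psi>. ennreal ((norm (g \<psi> - V_image a (gns_field (b n)) \<psi>))\<^sup>2) \<partial>\<mu>) \<le> ennreal ((norm (\<eta> - h n))\<^sup>2)" for n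
      by (rule represents_upper[OF d])
    have "(\<lambda>n. ennreal ((norm (\<eta> - h n))\<^sup>2)) \<longlonglongrightarrow> ennreal ((norm (\<eta> - \<eta>))\<^sup>2)"
      by (intro tendsto_ennrealI tendsto_power tendsto_norm tendsto_diff tendsto_const \<eta>)
    then show "(\<lambda>n. ennreal ((norm (\<eta> - h n))\<^sup>2)) \<longlonglongrightarrow> 0" by simp
  qed
  then have "(\<integral>\<^sup>+\<psi>. ennreal ((norm (g \<psi> - V_image a f \<psi>))\<^sup>2) \<partial>\<mu>) = 0" by simp
  then have "AE \<psi> in \<mu>. ennreal ((norm (g \<psi> - V_image a f \<psi>))\<^sup>2) = 0" by (subst (asm) nn_integral_0_iff_AE) measurable
  then have "AE \<psi> in \<mu>. g \<psi> = V_image a f \<psi>" by eventually_elim (simp add: ennreal_eq_0_iff)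
  then show ?thesis using represents_cong_AE[OF g] by blast
qed

context
  fixes F
  assumes F: "AE \<psi> in \<nu>. \<psi> \<in> F"
begin

text \<open>The choices in \<open>field_of\<close> and the value 0 of \<open>V_field\<close> outside
  \<open>F\<close> affect null sets only, which \<open>vector_of\<close> does not see.\<close>

lemma V_op_eq:
  assumes f: "represents \<xi> f" and g: "represents \<eta> (V_image a f)"
  shows "V_op k R \<nu> F G (\<pi> a) \<xi> = \<eta>"
  unfolding V_op_def V_int_def
proof (rule vector_of[OF represents_cong_AE[OF g]])
  show "AE \<psi> in \<mu>. V_image a f \<psi> = V_field k F G \<psi> (tensor (field_of R \<nu> G (\<pi> a \<Psi>) \<psi>) (field_of R \<nu> G \<xi> \<psi>))"
    using AE_completion[OF F] field_of[OF f] field_of[OF represents_gns_field, of a]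
    by eventually_elim (simp add: V_image_def V_field_def)
qed

lemma represents_V_op:
  assumes f: "represents \<xi> f"
  shows "represents (V_op k R \<nu> F G (\<pi> a) \<xi>) (V_image a f)"
proof -
  obtain \<eta> where "represents \<eta> (V_image a f)" using represents_V[OF f] by blast
  then show ?thesis using V_op_eq[OF f] by simp
qed

lemma bounded_op_V_op: "bounded_op H (V_op k R \<nu> F G (\<pi> a))"
  unfolding bounded_op_def
proof (intro conjI ballI allI exI[of _ "2 * norm a"])
  show "V_op k R \<nu> F G (\<pi> a) ` H \<subseteq> H"
    using represents_exists represents_vector[OF represents_V_op] by blast
  show "norm (V_op k R \<nu> F G (\<pi> a) \<xi>) \<le> 2 * norm a * norm \<xi>" if "\<xi> \<in> H" for \<xi>
    using represents_exists[OF that] represents_V_norm[OF _ represents_V_op] by blast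
  fix \<xi> assume "\<xi> \<in> H"
  then obtain f where f: "represents \<xi> f" using represents_exists by blast
  show "V_op k R \<nu> F G (\<pi> a) (c *\<^sub>C \<xi>) = c *\<^sub>C V_op k R \<nu> F G (\<pi> a) \<xi>" for c
  proof (rule V_op_eq[OF represents_scaleC[OF f]])
    show "represents (c *\<^sub>C V_op k R \<nu> F G (\<pi> a) \<xi>) (V_image a (\<lambda>\<psi>. c *\<^sub>C f \<psi>))"
      by (rule represents_cong_AE[OF represents_scaleC[OF represents_V_op[OF f]]])
         (use ergodic' in \<open>eventually_elim, simp add: ergodic_V_image\<close>)
  qed
  fix \<eta> assume "\<eta> \<in> H"
  then obtain g where g: "represents \<eta> g" using represents_exists by blast
  show "V_op k R \<nu> F G (\<pi> a) (\<xi> + \<eta>) = V_op k R \<nu> F G (\<pi> a) \<xi> + V_op k R \<nu> F G (\<pi> a) \<eta>"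
  proof (rule V_op_eq[OF represents_add[OF f g]])
    show "represents (V_op k R \<nu> F G (\<pi> a) \<xi> + V_op k R \<nu> F G (\<pi> a) \<eta>) (V_image a (\<lambda>\<psi>. f \<psi> + g \<psi>))"
      by (rule represents_cong_AE[OF represents_add[OF represents_V_op[OF f] represents_V_op[OF g]]])
         (use ergodic' in \<open>eventually_elim, simp add: ergodic_V_image\<close>)
  qed
qed

theorem multiple_average_V_op:
  "(\<lambda>N. \<pi> (multiple_average \<beta> k a b N) \<Psi>) \<longlonglongrightarrow> V_op k R \<nu> F G (\<pi> a) (\<pi> b \<Psi>)"
proof -
  obtain \<eta> where \<eta>: "(\<lambda>N. \<pi> (multiple_average \<beta> k a b N) \<Psi>) \<longlonglongrightarrow> \<eta>" "represents \<eta> (V_image a (gns_field b))"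
    using represents_V_gns_field by blast
  then show ?thesis using V_op_eq[OF represents_gns_field \<eta>(2)] by simp
qed

end

end

section \<open>Powers of the automorphism and the barycentre of the orthogonal measure\<close>

lemma star_automorphism_id: "star_automorphism (\<lambda>a::'a::cstar_algebra. a)"
  by (simp add: star_automorphism_def bij_def)

lemma star_automorphism_comp:
  "star_automorphism f \<Longrightarrow> star_automorphism g \<Longrightarrow> star_automorphism (\<lambda>a. f (g a))"
  using bij_comp[of g f] by (simp add: star_automorphism_def o_def)

lemma star_automorphism_inv:
  assumes f: "star_automorphism f"
  shows "star_automorphism (inv f)"
proof -
  have b: "bij f" using f by (simp add: star_automorphism_def)
  have eq: "inv f x = y \<longleftrightarrow> x = f y" for x y
    using b by (metis bij_inv_eq_iff)
  have fi: "f (inv f x) = x" for x using b by (simp add: bij_is_surj surj_f_inv_f)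
  show ?thesis
    using f bij_imp_bij_inv[OF b] by (simp add: star_automorphism_def eq fi)
qed

lemma star_automorphism_int_iter:
  assumes "star_automorphism f"
  shows "star_automorphism (int_iter UNIV f n)"
proof -
  have "star_automorphism (g ^^ m)" if "star_automorphism g" for g :: "'a \<Rightarrow> 'a" and m
    by (induction m) (use star_automorphism_id star_automorphism_comp[OF that] in \<open>simp_all add: id_def o_def\<close>)
  then show ?thesis using assms star_automorphism_inv[OF assms] by (simp add: int_iter_def)
qed

context
  fixes l :: int and R :: "('a::cstar_algebra, 'h::chilbert_space) covariant_rep" and \<nu>
  assumes \<nu>: "orthogonal_measure l R \<nu>"
begin

text \<open>Evaluations are coordinate maps, continuous for pointwise convergence.\<close>

lemma orthogonal_measure_evaluation: "(\<lambda>\<psi>. \<psi> a) \<in> borel_measurable \<nu>"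
proof -
  have s: "sets \<nu> = sets (restrict_space borel states)" using \<nu> by (simp add: orthogonal_measure_def)
  have "continuous_on UNIV (\<lambda>\<psi> :: 'a \<Rightarrow> complex. \<psi> a)" by (rule continuous_on_product_coordinates)
  then have "(\<lambda>\<psi> :: 'a \<Rightarrow> complex. \<psi> a) \<in> borel_measurable (restrict_space borel states)"
    by (intro measurable_restrict_space1 borel_measurable_continuous_onI)
  then show ?thesis using measurable_cong_sets[OF s refl] by blast
qed

text \<open>The defining formula for one-element lists; the projection fixes \<open>\<Psi>\<close>
  because the identity lies in the invariant commutant.\<close>

lemma orthogonal_measure_barycentre:
  assumes "covariant_system \<alpha> \<omega> R"
  shows "(\<integral>\<psi>. \<psi> a \<partial>\<nu>) = \<omega> a"
proof -
  interpret covariant_system \<alpha> \<omega> R by (rule assms)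
  define K where "K = closure ((\<lambda>T. T \<Psi>) ` invariant_commutant l R)"
  have "(\<lambda>x. x) \<in> invariant_commutant l R"
    using M'_id by (simp add: invariant_commutant_def commutant_def M'_op)
  then have "\<Psi> \<in> (\<lambda>T. T \<Psi>) ` invariant_commutant l R" by force
  then have K: "\<Psi> \<in> K" unfolding K_def by (rule subsetD[OF closure_subset])
  have "proj_onto K \<Psi> = \<Psi>"
    unfolding proj_onto_def
  proof (rule the_equality)
    fix y assume y: "y \<in> K \<and> (\<forall>z\<in>K. cinner (\<Psi> - y) z = 0)"
    then have "cinner (\<Psi> - y) (\<Psi> - y) = 0" using K by (simp add: cinner_diff_right)
    then show "y = \<Psi>" by simp
  qed (simp add: K)
  moreover have "(\<integral>\<psi>. prod_list (map \<psi> [a]) \<partial>\<nu>)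
      = cinner (foldr (\<lambda>a x. \<pi> a (proj_onto K x)) [a] \<Psi>) \<Psi>"
    using \<nu> unfolding orthogonal_measure_def K_def by blast
  ultimately show ?thesis by (simp add: psi_eq)
qed

end

theorem corollary5p3:
  fixes \<alpha> :: "'a::cstar_algebra \<Rightarrow> 'a"
    and \<omega> :: "'a \<Rightarrow> complex"
    and R :: "('a, 'h::chilbert_space) covariant_rep"
    and G :: "('a \<Rightarrow> complex) \<Rightarrow> ('a, 'k::chilbert_space) covariant_rep"
    and \<nu> :: "('a \<Rightarrow> complex) measure"
    and F :: "('a \<Rightarrow> complex) set"
    and k l :: int
    and A\<^sub>0 A\<^sub>1 A\<^sub>2 :: 'a
  assumes system: "cstar_dynamical_system \<alpha> \<omega>"
    and separable: "separable_space (euclidean :: 'a topology)"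
    and support: "central_support \<omega>"
    and k: "k \<noteq> -1" "k \<noteq> 0"
    and l: "l \<noteq> 0"
    and gns: "covariant_gns \<alpha> \<omega> R"
    and inv_commutant: "invariant_commutant l R \<subseteq> rep_centre R"
    and orth_measure: "orthogonal_measure l R \<nu>"
    and fibres: "\<forall>\<psi>\<in>extreme_invariant_states (int_iter UNIV \<alpha> l).
                   covariant_gns (int_iter UNIV \<alpha> l) \<psi> (G \<psi>)"
    and full_set: "F \<in> sets \<nu>" "F \<subseteq> extreme_invariant_states (int_iter UNIV \<alpha> l)"
                  "measure \<nu> F = 1" "\<forall>\<psi>\<in>F. central_support \<psi>"
  shows "bounded_op (hilb R) (V_op k R \<nu> F G (rep R A\<^sub>1)) \<and>
    (\<lambda>N. (1 / of_nat N) * (\<Sum>n<N. \<omega> (A\<^sub>0 * int_iter UNIV \<alpha> (int n * k * l) A\<^sub>1 *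
                                   int_iter UNIV \<alpha> (int n * (k + 1) * l) A\<^sub>2)))
      \<longlonglongrightarrow> cinner (V_op k R \<nu> F G (rep R A\<^sub>1) (rep R A\<^sub>2 (cyc R))) (rep R (star A\<^sub>0) (cyc R))"
proof -
  define \<beta> where "\<beta> = int_iter UNIV \<alpha> l"
  have \<alpha>: "star_automorphism \<alpha>" and \<omega>: "\<omega> \<in> states"
    using system by (auto simp: cstar_dynamical_system_def invariant_states_def)
  have \<beta>: "star_automorphism \<beta>" unfolding \<beta>_def by (rule star_automorphism_int_iter[OF \<alpha>])
  have sys: "covariant_system \<alpha> \<omega> R" using gns \<omega> by (rule covariant_system.intro)
  have prob: "prob_space \<nu>" using orth_measure by (simp add: orthogonal_measure_def)
  have F: "AE \<psi> in \<nu>. \<psi> \<in> F"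
    using prob_space.AE_in_set_eq_1[OF prob full_set(1)] full_set(3) by simp
  have ergodic: "ergodic_system \<beta> \<psi> (G \<psi>)" if "\<psi> \<in> F" for \<psi>
  proof
    have "\<psi> \<in> extreme_invariant_states \<beta>" using that full_set(2) by (auto simp: \<beta>_def)
    then show "covariant_gns \<beta> \<psi> (G \<psi>)" "\<psi> \<in> states" "\<psi> \<in> extreme_invariant_states \<beta>"
      using fibres by (auto simp: \<beta>_def extreme_invariant_states_def invariant_states_def)
    show "central_support \<psi>" using that full_set(4) by blast
  qed (rule \<beta>)
  have "ergodic_direct_integral \<alpha> \<omega> R \<nu> \<beta> G k"
  proof (intro ergodic_direct_integral.intro direct_integral.intro direct_integral_axioms.intro
      ergodic_direct_integral_axioms.intro sys prob k)
    show "AE \<psi> in \<nu>. ergodic_system \<beta> \<psi> (G \<psi>)" using F by eventually_elim (rule ergodic)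
    then show "AE \<psi> in \<nu>. covariant_system \<beta> \<psi> (G \<psi>)"
      by eventually_elim (simp add: ergodic_system_def covariant_automorphism_def)
    show "(\<lambda>\<psi>. \<psi> a) \<in> borel_measurable \<nu>" for a by (rule orthogonal_measure_evaluation[OF orth_measure])
    show "(\<integral>\<psi>. \<psi> a \<partial>\<nu>) = \<omega> a" for a by (rule orthogonal_measure_barycentre[OF orth_measure sys])
  qed
  then interpret ergodic_direct_integral \<alpha> \<omega> R \<nu> \<beta> G k .
  have "bij_betw \<alpha> UNIV UNIV" using \<alpha> by (simp add: star_automorphism_def)
  \<comment> \<open>The exponent \<open>n k l\<close> is regrouped as \<open>(k n) l\<close>, which
    is an iterate of \<open>\<beta>\<close>.\<close>
  then have iter: "int_iter UNIV \<alpha> (int n * k * l) a = int_iter UNIV \<beta> (k * int n) a"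
    "int_iter UNIV \<alpha> (int n * (k + 1) * l) a = int_iter UNIV \<beta> ((k + 1) * int n) a" for n a
    unfolding \<beta>_def by (subst int_iter_int_iter; simp add: mult_ac)+
  have avg: "(1 / of_nat N) * (\<Sum>n<N. \<omega> (A\<^sub>0 * int_iter UNIV \<alpha> (int n * k * l) A\<^sub>1 * int_iter UNIV \<alpha> (int n * (k + 1) * l) A\<^sub>2))
      = cinner (\<pi> (multiple_average \<beta> k A\<^sub>1 A\<^sub>2 N) \<Psi>) (\<pi> (star A\<^sub>0) \<Psi>)" for N
    unfolding iter
    by (simp add: multiple_average_def pi_scaleR pi_sum cinner_scaleR_left cinner_sum_left
        psi_star_mult[symmetric] star_star mult.assoc)
  show ?thesis
    unfolding avg
    by (intro conjI bounded_op_V_op[OF F] tendsto_cinner multiple_average_V_op[OF F] tendsto_const)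
qed

end
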